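(* Let $\Omega\subset\mathbb{C}^d$ be an irreducible bounded symmetric domain, let $\mu>0$ be a real number, and let $(M_\Omega(\mu),g(\mu))$ be the associated Cartan--Hartogs domain. If the coefficient $a_2$ of the Engliš expansion of the $\varepsilon$-function associated to $g(\mu)$ is a constant function on $M_\Omega(\mu)$, then $(M_\Omega(\mu),g(\mu))$ is Kähler--Einstein.
   Context: Let $\Omega\subset\mathbb{C}^d$ be an irreducible bounded symmetric domain of genus $\gamma$, with total Euclidean volume $V(\Omega)$ and Bergman kernel $K(z,z)$. Its generic norm is $N(z,z)=(V(\Omega)K(z,z))^{-1/\gamma}$; write $N^\mu=N(z,z)^\mu$. For $\mu>0$ the Cartan--Hartogs domain based on $\Omega$ is $$M_\Omega(\mu)=\{(z,w)\in\Omega\times\mathbb{C}:\ |w|^2<N^\mu(z,z)\}\subset\mathbb{C}^{d+1},$$ endowed with the Kähler metric $g(\mu)$ with global Kähler potential $\Phi(z,w)=-\log(N^\mu-|w|^2)$, that is, with $z_{d+1}=w$, $$g(\mu)_{\alpha\bar\beta}=-\frac{\partial^2\log(N^\mu-|w|^2)}{\partial z_\alpha\,\partial\bar z_\beta},\qquad \alpha,\beta=1,\dots,d+1.$$ Curvature conventions. For a Kähler metric $g$ on an $n$-dimensional complex manifold, in local holomorphic coordinates let $(g^{\alpha\bar\beta})$ be the inverse of the metric, normalized by $\sum_\beta g^{\alpha\bar\beta}g_{\tau\bar\beta}=\delta_{\alpha\tau}$. Then $$\mathrm{Ric}_{\alpha\bar\beta}=-\frac{\partial^2\log\det(g)}{\partial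 z_\alpha\partial\bar z_\beta},\quad \kappa_g=\sum_{\alpha,\beta}g^{\alpha\bar\beta}\mathrm{Ric}_{\alpha\bar\beta},\quad \Delta f=\sum_{\alpha,\beta}g^{\alpha\bar\beta}\frac{\partial^2 f}{\partial z_\alpha\partial\bar z_\beta},$$ $$R_{\alpha\bar\beta\eta\bar\tau}=-\frac{\partial^2 g_{\alpha\bar\beta}}{\partial z_\eta\partial\bar z_\tau}+\sum_{\sigma,\rho}g^{\sigma\bar\rho}\frac{\partial g_{\alpha\bar\rho}}{\partial z_\eta}\frac{\partial g_{\sigma\bar\beta}}{\partial\bar z_\tau},$$ $$|\mathrm{Ric}|^2=\sum g^{\alpha\bar\zeta}g^{\nu\bar\beta}\,\mathrm{Ric}_{\alpha\bar\beta}\overline{\mathrm{Ric}_{\zeta\bar\nu}},\qquad |R|^2=\sum g^{\alpha\bar\zeta}g^{\nu\bar\beta}g^{\eta\bar\xi}g^{\theta\bar\tau}R_{\alpha\bar\beta\eta\bar\tau}\overline{R_{\zeta\bar\nu\xi\bar\theta}},$$ the sums running over all repeated indices. The metric $g$ is Kähler--Einstein if $\mathrm{Ric}=\lambda g$ for some real constant $\lambda$. Engliš expansion. If $g$ has a global Kähler potential $\varphi$ with Kähler form $\omega=\frac{i}{2}\partial\bar\partial\varphi$, let $\mathcal{H}_\alpha$ ($\alpha>0$) be the Hilbert space of holomorphic functions $f$ with $\int_M e^{-\alpha\varphi}|f|^2\frac{\omega^n}{n!}<\infty$, with reproducing kernel $K_\alpha$, and set $\varepsilon_{\alpha g}(x)=e^{-\alpha\varphi(x)}K_\alpha(x,x)$.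 The Engliš expansion is the asymptotic expansion $\varepsilon_{\alpha g}(x)\sim\sum_{j\ge0}a_j(x)\alpha^{n-j}$; its coefficient $a_2$ is the smooth function $$a_2=\frac13\Delta\kappa_g+\frac1{24}\left(|R|^2-4|\mathrm{Ric}|^2+3\kappa_g^2\right).$$ In the claim, $a_2$ denotes this function for $g=g(\mu)$, $n=d+1$. *)

theory Defs
  imports "HOL-Analysis.Analysis"
begin

section \<open>Holomorphic maps in several variables\<close>

definition mholomorphic_on :: "(complex^'n \<Rightarrow> complex) \<Rightarrow> (complex^'n) set \<Rightarrow> bool"
  (infix "mholomorphic'_on" 50) where
  "f mholomorphic_on U \<longleftrightarrow>
     (\<forall>z\<in>U. \<exists>D. (f has_derivative D) (at z) \<and> (\<forall>c v. D (c *s v) = c * D v))"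

definition biholomorphism ::
  "(complex^'n) set \<Rightarrow> (complex^'m) set \<Rightarrow> (complex^'n \<Rightarrow> complex^'m) \<Rightarrow> (complex^'m \<Rightarrow> complex^'n) \<Rightarrow> bool" where
  "biholomorphism A B F G \<longleftrightarrow>
     (\<forall>i. (\<lambda>z. F z $ i) mholomorphic_on A) \<and> (\<forall>i. (\<lambda>z. G z $ i) mholomorphic_on B) \<and>
     F ` A \<subseteq> B \<and> G ` B \<subseteq> A \<and> (\<forall>z\<in>A. G (F z) = z) \<and> (\<forall>z\<in>B. F (G z) = z)"

section \<open>Irreducible bounded symmetric domains\<close>

definition bounded_domain :: "(complex^'n) set \<Rightarrow> bool" where
  "bounded_domain \<Omega> \<longleftrightarrow> open \<Omega> \<and> connected \<Omega> \<and> \<Omega> \<noteq> {} \<and> bounded \<Omega>"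

definition bounded_symmetric_domain :: "(complex^'n) set \<Rightarrow> bool" where
  "bounded_symmetric_domain \<Omega> \<longleftrightarrow> bounded_domain \<Omega> \<and>
     (\<forall>p\<in>\<Omega>. \<exists>s. biholomorphism \<Omega> \<Omega> s s \<and> s p = p \<and>
        (\<exists>e>0. \<forall>z\<in>\<Omega> \<inter> ball p e. s z = z \<longrightarrow> z = p))"

text \<open>\<open>coord_product S A B\<close> is the product of the projection of \<open>A\<close> to the coordinates in \<open>S\<close>
  with the projection of \<open>B\<close> to the remaining ones. When \<open>S\<close> is neither empty nor everything, this
  is a general product of two sets in complex spaces of positive dimensions
  \<open>card S\<close> and \<open>CARD('n) - card S\<close>.\<close>

definition coord_product :: "'n set \<Rightarrow> (complex^'n) set \<Rightarrow> (complex^'n) set \<Rightarrow> (complex^'n) set" where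
  "coord_product S A B = {(\<chi> i. if i \<in> S then x $ i else y $ i) | x y. x \<in> A \<and> y \<in> B}"

definition irreducible_bounded_symmetric_domain :: "(complex^'n) set \<Rightarrow> bool" where
  "irreducible_bounded_symmetric_domain \<Omega> \<longleftrightarrow> bounded_symmetric_domain \<Omega> \<and>
     \<not> (\<exists>(S :: 'n set) A B F G. S \<noteq> {} \<and> S \<noteq> UNIV \<and> bounded_domain (coord_product S A B) \<and>
          biholomorphism \<Omega> (coord_product S A B) F G)"

section \<open>Kaehler metrics in coordinates\<close>

definition wirt :: "'n \<Rightarrow> (complex^'n \<Rightarrow> complex) \<Rightarrow> complex^'n \<Rightarrow> complex" where
  "wirt i f p = (frechet_derivative f (at p) (axis i 1)
                  - \<i> * frechet_derivative f (at p) (axis i \<i>)) / 2"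

definition wirt_bar :: "'n \<Rightarrow> (complex^'n \<Rightarrow> complex) \<Rightarrow> complex^'n \<Rightarrow> complex" where
  "wirt_bar i f p = (frechet_derivative f (at p) (axis i 1)
                      + \<i> * frechet_derivative f (at p) (axis i \<i>)) / 2"

text \<open>A metric assigns to each point \<open>p\<close> the matrix whose entry \<open>g p $ \<alpha> $ \<beta>\<close> is
  the component with holomorphic index \<open>\<alpha>\<close> and antiholomorphic index \<open>\<beta>\<close>; the same order of
  indices (unbarred, barred, unbarred, barred) is used for \<open>ric\<close>, \<open>curv\<close> and \<open>ginv\<close>.\<close>

type_synonym 'n metric = "complex^'n \<Rightarrow> complex^'n^'n"

definition metric_of_potential :: "(complex^'n \<Rightarrow> real) \<Rightarrow> 'n metric" where
  "metric_of_potential \<phi> p = (\<chi> \<alpha> \<beta>. wirt \<alpha> (wirt_bar \<beta> (\<lambda>z. complex_of_real (\<phi> z))) p)"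

text \<open>The transpose gives the normalization
  \<open>(\<Sum>\<beta>. ginv g p $ \<alpha> $ \<beta> * g p $ \<tau> $ \<beta>) = (if \<alpha> = \<tau> then 1 else 0)\<close>.\<close>

definition ginv :: "('n::finite) metric \<Rightarrow> 'n metric" where
  "ginv g p = matrix_inv (transpose (g p))"

definition ric :: "('n::finite) metric \<Rightarrow> complex^'n \<Rightarrow> 'n \<Rightarrow> 'n \<Rightarrow> complex" where
  "ric g p \<alpha> \<beta> = - wirt \<alpha> (wirt_bar \<beta> (\<lambda>z. ln (det (g z)))) p"

definition scal :: "('n::finite) metric \<Rightarrow> complex^'n \<Rightarrow> complex" where
  "scal g p = (\<Sum>\<alpha>\<in>UNIV. \<Sum>\<beta>\<in>UNIV. ginv g p $ \<alpha> $ \<beta> * ric g p \<alpha> \<beta>)"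

definition laplacian :: "('n::finite) metric \<Rightarrow> (complex^'n \<Rightarrow> complex) \<Rightarrow> complex^'n \<Rightarrow> complex" where
  "laplacian g f p = (\<Sum>\<alpha>\<in>UNIV. \<Sum>\<beta>\<in>UNIV. ginv g p $ \<alpha> $ \<beta> * wirt \<alpha> (wirt_bar \<beta> f) p)"

definition curv :: "('n::finite) metric \<Rightarrow> complex^'n \<Rightarrow> 'n \<Rightarrow> 'n \<Rightarrow> 'n \<Rightarrow> 'n \<Rightarrow> complex" where
  "curv g p \<alpha> \<beta> \<eta> \<tau> =
     - wirt \<eta> (wirt_bar \<tau> (\<lambda>z. g z $ \<alpha> $ \<beta>)) p
     + (\<Sum>\<sigma>\<in>UNIV. \<Sum>\<rho>\<in>UNIV. ginv g p $ \<sigma> $ \<rho>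
          * wirt \<eta> (\<lambda>z. g z $ \<alpha> $ \<rho>) p * wirt_bar \<tau> (\<lambda>z. g z $ \<sigma> $ \<beta>) p)"

definition ric_norm2 :: "('n::finite) metric \<Rightarrow> complex^'n \<Rightarrow> complex" where
  "ric_norm2 g p =
     (\<Sum>\<alpha>\<in>UNIV. \<Sum>\<beta>\<in>UNIV. \<Sum>\<zeta>\<in>UNIV. \<Sum>\<nu>\<in>UNIV.
        ginv g p $ \<alpha> $ \<zeta> * ginv g p $ \<nu> $ \<beta> * ric g p \<alpha> \<beta> * cnj (ric g p \<zeta> \<nu>))"

definition curv_norm2 :: "('n::finite) metric \<Rightarrow> complex^'n \<Rightarrow> complex" where
  "curv_norm2 g p =
     (\<Sum>\<alpha>\<in>UNIV. \<Sum>\<beta>\<in>UNIV. \<Sum>\<eta>\<in>UNIV. \<Sum>\<tau>\<in>UNIV. \<Sum>\<zeta>\<in>UNIV. \<Sum>\<nu>\<in>UNIV. \<Sum>\<xi>\<in>UNIV. \<Sum>\<theta>\<in>UNIV.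
        ginv g p $ \<alpha> $ \<zeta> * ginv g p $ \<nu> $ \<beta> * ginv g p $ \<eta> $ \<xi> * ginv g p $ \<theta> $ \<tau>
        * curv g p \<alpha> \<beta> \<eta> \<tau> * cnj (curv g p \<zeta> \<nu> \<xi> \<theta>))"

definition englis_a2 :: "('n::finite) metric \<Rightarrow> complex^'n \<Rightarrow> complex" where
  "englis_a2 g p = 1/3 * laplacian g (scal g) p
     + 1/24 * (curv_norm2 g p - 4 * ric_norm2 g p + 3 * (scal g p)^2)"

definition kaehler_einstein_on :: "('n::finite) metric \<Rightarrow> (complex^'n) set \<Rightarrow> bool" where
  "kaehler_einstein_on g M \<longleftrightarrow>
     (\<exists>l::real. \<forall>p\<in>M. \<forall>\<alpha> \<beta>. ric g p \<alpha> \<beta> = complex_of_real l * g p $ \<alpha> $ \<beta>)"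

section \<open>Bergman kernel\<close>

definition bergman_space :: "(complex^'n) set \<Rightarrow> (complex^'n \<Rightarrow> complex) set" where
  "bergman_space \<Omega> =
     {f. f mholomorphic_on \<Omega> \<and> set_integrable lebesgue \<Omega> (\<lambda>z. (cmod (f z))^2)}"

text \<open>The reproducing property determines the kernel uniquely on \<open>\<Omega> \<times> \<Omega>\<close>, the only place where its
  values are used.\<close>

definition bergman_kernel :: "(complex^'n) set \<Rightarrow> complex^'n \<Rightarrow> complex^'n \<Rightarrow> complex" where
  "bergman_kernel \<Omega> = (SOME K. \<forall>w\<in>\<Omega>. (\<lambda>z. K z w) \<in> bergman_space \<Omega> \<and>
     (\<forall>f\<in>bergman_space \<Omega>. f w = (LINT z:\<Omega>|lebesgue. f z * cnj (K z w))))"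

definition bergman_metric :: "(complex^'n) set \<Rightarrow> 'n metric" where
  "bergman_metric \<Omega> = metric_of_potential (\<lambda>z. ln (Re (bergman_kernel \<Omega> z z)))"

section \<open>Genus\<close>

text \<open>The genus of an irreducible bounded symmetric domain is \<open>2 + a (r - 1) + b\<close>, where \<open>r\<close> is the
  rank and \<open>a\<close>, \<open>b\<close> are the dimensions of the Peirce spaces \<open>V\<^sub>i\<^sub>j\<close> (\<open>0 < i < j\<close>) and \<open>V\<^sub>0\<^sub>j\<close> of
  its Hermitian positive Jordan triple system. The triple product on the tangent space at \<open>p\<close> is
  minus the curvature of the Bergman metric \<open>g\<close>,
  that is \<open>g (triple u v w, t) = - R (u, v, w, t)\<close>; at the centre of a circled realization the right
  hand side is the fourth derivative of \<open>log K(z,z)\<close>. On the unit disc at the origin it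
  is \<open>2 * u * cnj v * w\<close>, so tripotents are normalized by \<open>triple e e e = 2 e\<close>. All points
  and frames give the same result since the automorphism group is transitive on \<open>\<Omega>\<close>, with isotropy
  groups transitive on frames.\<close>

definition jtriple ::
  "('n::finite) metric \<Rightarrow> complex^'n \<Rightarrow> complex^'n \<Rightarrow> complex^'n \<Rightarrow> complex^'n \<Rightarrow> complex^'n" where
  "jtriple g p u v w = (\<chi> \<sigma>. - (\<Sum>\<alpha>\<in>UNIV. \<Sum>\<beta>\<in>UNIV. \<Sum>\<eta>\<in>UNIV. \<Sum>\<tau>\<in>UNIV.
     ginv g p $ \<sigma> $ \<tau> * curv g p \<alpha> \<beta> \<eta> \<tau> * u $ \<alpha> * cnj (v $ \<beta>) * w $ \<eta>))"

definition tripotent :: "('n::finite) metric \<Rightarrow> complex^'n \<Rightarrow> complex^'n \<Rightarrow> bool" where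
  "tripotent g p e \<longleftrightarrow> jtriple g p e e e = 2 *s e"

definition jorthogonal :: "('n::finite) metric \<Rightarrow> complex^'n \<Rightarrow> complex^'n \<Rightarrow> complex^'n \<Rightarrow> bool" where
  "jorthogonal g p e f \<longleftrightarrow> (\<forall>v. jtriple g p e f v = 0)"

definition primitive_tripotent :: "('n::finite) metric \<Rightarrow> complex^'n \<Rightarrow> complex^'n \<Rightarrow> bool" where
  "primitive_tripotent g p e \<longleftrightarrow> tripotent g p e \<and> e \<noteq> 0 \<and>
     \<not> (\<exists>e1 e2. tripotent g p e1 \<and> tripotent g p e2 \<and> e1 \<noteq> 0 \<and> e2 \<noteq> 0 \<and>
          jorthogonal g p e1 e2 \<and> e = e1 + e2)"

definition orthogonal_primitive_system :: "('n::finite) metric \<Rightarrow> complex^'n \<Rightarrow> (complex^'n) set \<Rightarrow> bool" where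
  "orthogonal_primitive_system g p E \<longleftrightarrow>
     (\<forall>e\<in>E. primitive_tripotent g p e) \<and> (\<forall>e\<in>E. \<forall>f\<in>E. e \<noteq> f \<longrightarrow> jorthogonal g p e f)"

definition frame :: "('n::finite) metric \<Rightarrow> complex^'n \<Rightarrow> (complex^'n) set \<Rightarrow> bool" where
  "frame g p E \<longleftrightarrow> orthogonal_primitive_system g p E \<and>
     (\<forall>E'. orthogonal_primitive_system g p E' \<and> E \<subseteq> E' \<longrightarrow> E' = E)"

text \<open>For distinct members \<open>e\<close>, \<open>f\<close> of the frame \<open>E\<close>, the spaces with \<open>S = {e, f}\<close>
  and \<open>S = {e}\<close> are the Peirce spaces of types \<open>V\<^sub>i\<^sub>j\<close> and \<open>V\<^sub>0\<^sub>j\<close>.\<close>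

definition peirce_space ::
  "('n::finite) metric \<Rightarrow> complex^'n \<Rightarrow> (complex^'n) set \<Rightarrow> (complex^'n) set \<Rightarrow> (complex^'n) set" where
  "peirce_space g p E S =
     {v. \<forall>c\<in>E. jtriple g p c c v = (if c \<in> S then 1 else 0) *s v}"

definition genus :: "(complex^'n) set \<Rightarrow> nat" where
  "genus \<Omega> =
     (let g = bergman_metric \<Omega>;
          p = (SOME p. p \<in> \<Omega>);
          E = (SOME E. frame g p E);
          r = card E;
          e = (SOME e. e \<in> E);
          f = (SOME f. f \<in> E \<and> f \<noteq> e);
          a = vec.dim (peirce_space g p E {e, f});
          b = vec.dim (peirce_space g p E {e})
      in 2 + a * (r - 1) + b)"

section \<open>Cartan--Hartogs domains\<close>

definition generic_norm :: "(complex^'n) set \<Rightarrow> complex^'n \<Rightarrow> real" where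
  "generic_norm \<Omega> z =
     (measure lebesgue \<Omega> * Re (bergman_kernel \<Omega> z z)) powr (- 1 / real (genus \<Omega>))"

text \<open>Complex \<open>(d+1)\<close>-space has coordinates indexed by \<open>'n option\<close>: those at \<open>Some i\<close> form the
  point \<open>z\<close> of \<open>\<Omega>\<close>, the one at \<open>None\<close> is \<open>w\<close>.\<close>

definition base_pt :: "complex^('n option) \<Rightarrow> complex^'n" where
  "base_pt x = (\<chi> i. x $ Some i)"

definition cartan_hartogs_domain :: "(complex^'n) set \<Rightarrow> real \<Rightarrow> (complex^('n option)) set" where
  "cartan_hartogs_domain \<Omega> \<mu> =
     {x. base_pt x \<in> \<Omega> \<and> (cmod (x $ None))^2 < generic_norm \<Omega> (base_pt x) powr \<mu>}"

definition cartan_hartogs_metric :: "(complex^'n) set \<Rightarrow> real \<Rightarrow> ('n option) metric" where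
  "cartan_hartogs_metric \<Omega> \<mu> = metric_of_potential
     (\<lambda>x. - ln (generic_norm \<Omega> (base_pt x) powr \<mu> - (cmod (x $ None))^2))"

end

theory Submission
  imports Defs "HOL-Complex_Analysis.Complex_Analysis"
begin

text \<open>
  Write \<open>n\<close> for the complex dimension of \<open>\<Omega>\<close>, \<open>\<phi> = c * log (V K)\<close> with \<open>c = \<mu> / genus\<close>, so that the norm
  to the power \<open>\<mu>\<close> is \<open>exp (- \<phi>)\<close> and the metric has the potential \<open>- log (exp (- \<phi>) - |w|\<^sup>2)\<close>.
  Put \<open>t = |w|\<^sup>2 exp \<phi>\<close> and \<open>u = 1 - t\<close>. Up to the term \<open>\<phi>\<close>, the potential is \<open>- log u\<close>.

  The geometry of \<open>\<Omega>\<close> enters in one way only: its Bergman metric is Einstein, in the strong form that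
  \<open>det (dd\<^sup>c \<phi>)\<close> is a constant multiple of \<open>K\<close>, that is of \<open>exp (\<phi> / c)\<close>
  (\<open>det_bmat_proportional\<close>). The quotient of \<open>det (dd\<^sup>c log K)\<close> by \<open>K\<close> is invariant under every
  automorphism; the symmetry at a point \<open>p\<close> has differential \<open>- 1\<close> there, hence the quotient has
  vanishing differential at every \<open>p\<close> and is constant. Behind this are the existence of the
  kernel, its smoothness on the diagonal and the strict positivity of \<open>dd\<^sup>c log K\<close>.

  Given this, the Ricci form of the Cartan--Hartogs metric \<open>g\<close> is
  \<open>- (n + 2) g + \<delta> h\<close>, where \<open>h\<close> is the pullback of \<open>dd\<^sup>c \<phi>\<close> and \<open>\<delta> = n + 1 - 1 / c\<close> (\<open>ric_G\<close>).
  So \<open>g\<close> is Einstein as soon as \<open>\<delta> = 0\<close>, and it is enough to read off \<open>\<delta>\<close> from \<open>a\<^sub>2\<close>.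
  The curvature tensor is that of complex hyperbolic space plus \<open>1 / u\<close> times a tensor pulled back
  from \<open>\<Omega>\<close> (\<open>curv_G\<close>). The inverse metric restricted to pulled back covectors is \<open>u\<close> times the inverse of
  \<open>h\<close>. Hence every contraction in \<open>a\<^sub>2\<close> is, over a fixed point of \<open>\<Omega>\<close>, a quadratic polynomial
  in \<open>u\<close>, and its linear coefficient is \<open>- 6 \<delta> n\<^sup>2 (n + 3) / 24\<close> (\<open>englis_a2_G\<close>); the norm of the
  curvature of \<open>\<Omega>\<close>, which is not explicit, only enters the quadratic coefficient. On a fibre,
  \<open>u\<close> takes all values in the interval from 0 to 1, so a constant \<open>a\<^sub>2\<close> forces \<open>\<delta> = 0\<close>.

  Away from \<open>w = 0\<close> the computation is done in the logarithmic form
  \<open>l = \<partial> (\<phi> + log w)\<close>, for which \<open>\<partial>t = t l\<close> and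
  \<open>g = U h + U (U - 1) l \<otimes> cnj l\<close> with \<open>U = 1 / u\<close>. Points with \<open>w \<noteq> 0\<close> are enough for
  the comparison of coefficients.
\<close>

text \<open>Indexing of vectors uses the same symbol as coefficients of power series; removing the latter makes
  terms with many indices unambiguous.\<close>

no_notation fps_nth (infixl "$" 75)

section \<open>Directional derivatives and smooth functions\<close>

text \<open>The Wirtinger operators are linear combinations of these; keeping the direction as a parameter
  makes the symmetry of second derivatives a statement about two vectors.\<close>

definition ddir :: "'a::real_normed_vector \<Rightarrow> ('a \<Rightarrow> complex) \<Rightarrow> 'a \<Rightarrow> complex" where
  "ddir v f p = frechet_derivative f (at p) v"

text \<open>Differentiability of all iterated directional derivatives up to order \<open>k\<close>. In finite
  dimensions, having this for all \<open>k\<close> is the usual notion of smoothness, as differentiability of one order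
  gives continuity of the previous one.\<close>

primrec Ck :: "nat \<Rightarrow> 'a::real_normed_vector set \<Rightarrow> ('a \<Rightarrow> complex) \<Rightarrow> bool" where
  "Ck 0 U f \<longleftrightarrow> (\<forall>p\<in>U. f differentiable (at p))"
| "Ck (Suc k) U f \<longleftrightarrow> (\<forall>p\<in>U. f differentiable (at p)) \<and> (\<forall>v. Ck k U (ddir v f))"

definition smooth_on :: "'a::real_normed_vector set \<Rightarrow> ('a \<Rightarrow> complex) \<Rightarrow> bool" where
  "smooth_on U f \<longleftrightarrow> (\<forall>k. Ck k U f)"

lemma ddir_has_derivative:
  assumes "(f has_derivative D) (at p)"
  shows "ddir v f p = D v"
  using assms frechet_derivative_at[OF assms] by (simp add: ddir_def)

lemma ddir_cong:
  assumes "open U" "p \<in> U" "\<And>x. x \<in> U \<Longrightarrow> f x = g x"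
  shows "ddir v f p = ddir v g p"
proof -
  have "(f has_derivative D) (at p) \<longleftrightarrow> (g has_derivative D) (at p)" for D
    using assms by (metis has_derivative_transform_within_open)
  then show ?thesis by (simp add: ddir_def frechet_derivative_def)
qed

lemma differentiable_cong_open:
  assumes "open U" "p \<in> U" "\<And>x. x \<in> U \<Longrightarrow> f x = g x" "f differentiable (at p)"
  shows "g differentiable (at p)"
  using assms unfolding differentiable_def by (metis has_derivative_transform_within_open)

lemma Ck_differentiable: "Ck k U f \<Longrightarrow> p \<in> U \<Longrightarrow> f differentiable (at p)"
  by (cases k) auto

lemma Ck_cong:
  assumes "open U" "\<And>x. x \<in> U \<Longrightarrow> f x = g x" "Ck k U f"
  shows "Ck k U g"
  using assms(2,3)
proof (induction k arbitrary: f g)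
  case 0
  have "g differentiable (at p)" if "p \<in> U" for p
    by (rule differentiable_cong_open[OF assms(1) that 0(1)]) (use 0(2) that in simp_all)
  then show ?case by simp
next
  case (Suc k)
  have "Ck k U (ddir v g)" for v
    by (rule Suc.IH[of "ddir v f"]) (use Suc.prems in \<open>auto intro: ddir_cong[OF assms(1)]\<close>)
  moreover have "g differentiable (at p)" if "p \<in> U" for p
    by (rule differentiable_cong_open[OF assms(1) that Suc.prems(1)]) (use Suc.prems(2) that in simp_all)
  ultimately show ?case by simp
qed

lemma Ck_Suc_imp: "Ck (Suc k) U f \<Longrightarrow> Ck k U f"
  by (induction k arbitrary: f) auto

lemma ddir_add:
  assumes "f differentiable (at p)" "g differentiable (at p)"
  shows "ddir v (\<lambda>x. f x + g x) p = ddir v f p + ddir v g p"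
  using assms ddir_has_derivative[OF has_derivative_add] unfolding frechet_derivative_works ddir_def
  by fastforce

lemma ddir_mult:
  assumes "f differentiable (at p)" "g differentiable (at p)"
  shows "ddir v (\<lambda>x. f x * g x) p = f p * ddir v g p + ddir v f p * g p"
  using assms ddir_has_derivative[OF has_derivative_mult] unfolding frechet_derivative_works ddir_def
  by fastforce

lemma ddir_const [simp]: "ddir v (\<lambda>x. c) p = 0"
  by (simp add: ddir_def)

lemma ddir_holomorphic_comp:
  assumes "f differentiable (at p)" "h field_differentiable (at (f p))"
  shows "ddir v (\<lambda>x. h (f x)) p = deriv h (f p) * ddir v f p"
proof -
  have "(h has_derivative (*) (deriv h (f p))) (at (f p))"
    using assms(2) DERIV_deriv_iff_field_differentiable has_field_derivative_def by blast
  moreover have "(f has_derivative frechet_derivative f (at p)) (at p)"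
    using assms(1) frechet_derivative_works by blast
  ultimately have "((\<lambda>x. h (f x)) has_derivative (\<lambda>v. deriv h (f p) * frechet_derivative f (at p) v)) (at p)"
    using has_derivative_compose by blast
  then show ?thesis by (metis ddir_def ddir_has_derivative)
qed

lemma differentiable_holomorphic_comp:
  assumes "f differentiable (at p)" "h field_differentiable (at (f p))"
  shows "(\<lambda>x. h (f x)) differentiable (at p)"
  using assms differentiable_chain_at[of f p h] field_differentiable_imp_differentiable
  by (metis comp_def differentiable_compose)

lemma ddir_linear:
  assumes "bounded_linear L"
  shows "ddir v L p = L v"
  using ddir_has_derivative[OF bounded_linear_imp_has_derivative[OF assms]] .

lemma ddir_linear_comp:
  assumes "bounded_linear L" "f differentiable (at (L p))"
  shows "ddir v (\<lambda>x. f (L x)) p = ddir (L v) f (L p)"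
proof -
  have "(f has_derivative frechet_derivative f (at (L p))) (at (L p))"
    using assms(2) frechet_derivative_works by blast
  from has_derivative_compose[OF bounded_linear_imp_has_derivative[OF assms(1)] this]
  show ?thesis by (metis ddir_def ddir_has_derivative)
qed

lemma ddir_linear_post:
  assumes "bounded_linear L" "f differentiable (at p)"
  shows "ddir v (\<lambda>x. L (f x)) p = L (ddir v f p)"
proof -
  have "(f has_derivative frechet_derivative f (at p)) (at p)"
    using assms(2) frechet_derivative_works by blast
  from bounded_linear.has_derivative[OF assms(1) this]
  show ?thesis by (metis ddir_def ddir_has_derivative)
qed

lemma differentiable_linear_pre:
  assumes "bounded_linear L" "f differentiable (at (L p))"
  shows "(\<lambda>x. f (L x)) differentiable (at p)"
  using assms by (auto intro: differentiable_compose bounded_linear_imp_differentiable)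

lemma differentiable_linear_post:
  assumes "bounded_linear L" "f differentiable (at p)"
  shows "(\<lambda>x. L (f x)) differentiable (at p)"
  using assms bounded_linear.has_derivative unfolding differentiable_def by blast

lemma Ck_const: "Ck k U (\<lambda>x. c)"
proof (induction k arbitrary: c)
  case (Suc k)
  have "ddir v (\<lambda>x::'a. c) = (\<lambda>x. 0)" for v by (simp add: fun_eq_iff)
  then show ?case using Suc by simp
qed auto

lemma Ck_add:
  assumes "open U" "Ck k U f" "Ck k U g"
  shows "Ck k U (\<lambda>x. f x + g x)"
  using assms(2,3)
proof (induction k arbitrary: f g)
  case (Suc k)
  have "Ck k U (ddir v (\<lambda>x. f x + g x))" for v
    by (rule Ck_cong[OF assms(1) _ Suc.IH[of "ddir v f" "ddir v g"]])
      (use Suc.prems in \<open>auto simp: ddir_add\<close>)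
  then show ?case using Suc.prems by auto
qed auto

lemma Ck_mult:
  assumes "open U" "Ck k U f" "Ck k U g"
  shows "Ck k U (\<lambda>x. f x * g x)"
  using assms(2,3)
proof (induction k arbitrary: f g)
  case (Suc k)
  have "Ck k U (ddir v (\<lambda>x. f x * g x))" for v
  proof (rule Ck_cong[OF assms(1)])
    have "Ck k U f" "Ck k U g" using Suc.prems Ck_Suc_imp by blast+
    then show "Ck k U (\<lambda>p. f p * ddir v g p + ddir v f p * g p)"
      using Suc by (intro Ck_add[OF assms(1)] Suc.IH) auto
  qed (use Suc.prems in \<open>auto simp: ddir_mult\<close>)
  then show ?case using Suc.prems by auto
qed auto

lemma Ck_holomorphic_comp:
  assumes "open U" "Ck k U f" "open S" "h holomorphic_on S" "f ` U \<subseteq> S"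
  shows "Ck k U (\<lambda>x. h (f x))"
  using assms(2,4)
proof (induction k arbitrary: h)
  case 0
  have "h field_differentiable (at (f p))" if "p \<in> U" for p
    using that assms(5) 0 assms(3) holomorphic_on_imp_differentiable_at by blast
  then show ?case using 0 differentiable_holomorphic_comp[of f _ h] by simp
next
  case (Suc k)
  have h: "h field_differentiable (at (f p))" if "p \<in> U" for p
    using that assms(5) Suc.prems assms(3) holomorphic_on_imp_differentiable_at by blast
  have f: "Ck k U f" using Suc.prems Ck_Suc_imp by blast
  have "Ck k U (ddir v (\<lambda>x. h (f x)))" for v
  proof (rule Ck_cong[OF assms(1)])
    show "Ck k U (\<lambda>x. deriv h (f x) * ddir v f x)"
      using Suc.prems f Suc.IH[of "deriv h"] assms(3) by (simp add: Ck_mult[OF assms(1)] holomorphic_deriv)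
  qed (use Suc.prems h in \<open>auto simp: ddir_holomorphic_comp\<close>)
  then show ?case using Suc.prems differentiable_holomorphic_comp[of f _ h] h by simp
qed

lemma Ck_linear_comp:
  assumes "open U" "bounded_linear L" "L ` U \<subseteq> V" "Ck k V f"
  shows "Ck k U (\<lambda>x. f (L x))"
  using assms(4)
proof (induction k arbitrary: f)
  case 0
  then show ?case using assms
    by (auto intro!: differentiable_linear_pre[OF assms(2), of f])
next
  case (Suc k)
  have "Ck k U (ddir v (\<lambda>x. f (L x)))" for v
    by (rule Ck_cong[OF assms(1) _ Suc.IH[of "ddir (L v) f"]])
      (use Suc.prems assms in \<open>auto simp: ddir_linear_comp\<close>)
  then show ?case using Suc.prems assms
    by (auto intro!: differentiable_linear_pre[OF assms(2), of f])
qed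

lemma Ck_linear_post:
  assumes "open U" "bounded_linear L" "Ck k U f"
  shows "Ck k U (\<lambda>x. L (f x))"
  using assms(3)
proof (induction k arbitrary: f)
  case 0
  then show ?case using assms
    by (auto intro!: differentiable_linear_post[OF assms(2), of f])
next
  case (Suc k)
  have "Ck k U (ddir v (\<lambda>x. L (f x)))" for v
    by (rule Ck_cong[OF assms(1) _ Suc.IH[of "ddir v f"]])
      (use Suc.prems assms in \<open>auto simp: ddir_linear_post\<close>)
  then show ?case using Suc.prems assms
    by (auto intro!: differentiable_linear_post[OF assms(2), of f])
qed

lemma Ck_linear: "bounded_linear L \<Longrightarrow> Ck k U L"
proof (cases k)
  case (Suc m)
  assume L: "bounded_linear L"
  have "ddir v L = (\<lambda>x. L v)" for v using ddir_linear[OF L] by auto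
  then show ?thesis using Suc L Ck_const bounded_linear_imp_differentiable by auto
qed (auto intro: bounded_linear_imp_differentiable)

lemma smooth_on_differentiable: "smooth_on U f \<Longrightarrow> p \<in> U \<Longrightarrow> f differentiable (at p)"
  unfolding smooth_on_def using Ck_differentiable by blast

lemma smooth_on_ddir: "smooth_on U f \<Longrightarrow> smooth_on U (ddir v f)"
  unfolding smooth_on_def using Ck.simps(2) by blast

lemma smooth_on_cong: "open U \<Longrightarrow> smooth_on U f \<Longrightarrow> (\<And>x. x \<in> U \<Longrightarrow> f x = g x) \<Longrightarrow> smooth_on U g"
  unfolding smooth_on_def using Ck_cong by blast

lemma smooth_on_const: "smooth_on U (\<lambda>x. c)"
  unfolding smooth_on_def using Ck_const by blast

lemma smooth_on_add: "open U \<Longrightarrow> smooth_on U f \<Longrightarrow> smooth_on U g \<Longrightarrow> smooth_on U (\<lambda>x. f x + g x)"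
  unfolding smooth_on_def using Ck_add by blast

lemma smooth_on_mult: "open U \<Longrightarrow> smooth_on U f \<Longrightarrow> smooth_on U g \<Longrightarrow> smooth_on U (\<lambda>x. f x * g x)"
  unfolding smooth_on_def using Ck_mult by blast

lemma smooth_on_minus: "open U \<Longrightarrow> smooth_on U f \<Longrightarrow> smooth_on U (\<lambda>x. - f x)"
  using smooth_on_mult[of U "\<lambda>x. -1" f] smooth_on_const by auto

lemma smooth_on_diff: "open U \<Longrightarrow> smooth_on U f \<Longrightarrow> smooth_on U g \<Longrightarrow> smooth_on U (\<lambda>x. f x - g x)"
  using smooth_on_add[of U f "\<lambda>x. - g x"] smooth_on_minus by auto

lemma smooth_on_sum:
  "open U \<Longrightarrow> (\<And>i. i \<in> I \<Longrightarrow> smooth_on U (f i)) \<Longrightarrow> smooth_on U (\<lambda>x. \<Sum>i\<in>I. f i x)"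
  by (induction I rule: infinite_finite_induct) (auto simp: smooth_on_const intro: smooth_on_add)

lemma smooth_on_prod:
  "open U \<Longrightarrow> (\<And>i. i \<in> I \<Longrightarrow> smooth_on U (f i)) \<Longrightarrow> smooth_on U (\<lambda>x. \<Prod>i\<in>I. f i x)"
  by (induction I rule: infinite_finite_induct) (auto simp: smooth_on_const intro: smooth_on_mult)

lemma smooth_on_holomorphic_comp:
  "open U \<Longrightarrow> smooth_on U f \<Longrightarrow> open S \<Longrightarrow> h holomorphic_on S \<Longrightarrow> f ` U \<subseteq> S \<Longrightarrow> smooth_on U (\<lambda>x. h (f x))"
  unfolding smooth_on_def using Ck_holomorphic_comp by blast

lemma smooth_on_linear_comp:
  "open U \<Longrightarrow> bounded_linear L \<Longrightarrow> L ` U \<subseteq> V \<Longrightarrow> smooth_on V f \<Longrightarrow> smooth_on U (\<lambda>x. f (L x))"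
  unfolding smooth_on_def using Ck_linear_comp by blast

lemma smooth_on_cnj: "open U \<Longrightarrow> smooth_on U f \<Longrightarrow> smooth_on U (\<lambda>x. cnj (f x))"
  unfolding smooth_on_def using Ck_linear_post bounded_linear_cnj by blast

lemma smooth_on_linear: "bounded_linear L \<Longrightarrow> smooth_on U L"
  unfolding smooth_on_def using Ck_linear by blast

lemma smooth_on_subset: "smooth_on U f \<Longrightarrow> V \<subseteq> U \<Longrightarrow> smooth_on V f"
proof -
  have "Ck k U f \<Longrightarrow> V \<subseteq> U \<Longrightarrow> Ck k V f" for k
    by (induction k arbitrary: f) auto
  then show "smooth_on U f \<Longrightarrow> V \<subseteq> U \<Longrightarrow> smooth_on V f" by (auto simp: smooth_on_def)
qed

text \<open>The second difference divided by \<open>h\<^sup>2\<close> converges to the iterated derivative. Differentiability of the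
  first derivative at the one point \<open>p\<close> suffices: the mean value theorem is applied to the first
  difference along a segment.\<close>

lemma second_difference_limit:
  fixes f :: "'a::real_normed_vector \<Rightarrow> complex"
  assumes U: "open U" "p \<in> U" and f: "\<And>x. x \<in> U \<Longrightarrow> f differentiable (at x)"
    and fu: "ddir u f differentiable (at p)" and "e > 0"
  shows "\<exists>d>0. \<forall>h. 0 < h \<and> h < d \<longrightarrow>
    norm (f (p + h *\<^sub>R u + h *\<^sub>R v) - f (p + h *\<^sub>R u) - f (p + h *\<^sub>R v) + f p - h^2 *\<^sub>R ddir v (ddir u f) p) \<le> e * h^2"
proof -
  define L where "L = frechet_derivative (ddir u f) (at p)"
  have hd: "(ddir u f has_derivative L) (at p)" using fu L_def frechet_derivative_works by blast
  then have lin: "linear L" using has_derivative_linear by blast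
  define M where "M = 2 * (norm u + norm v) + norm u + 1"
  have M: "M > 0" unfolding M_def by (simp add: add_nonneg_pos)
  obtain r where r: "r > 0" "ball p r \<subseteq> U" using U open_contains_ball by blast
  have eM: "e / M > 0" using \<open>e > 0\<close> M by simp
  obtain d1 where d1: "d1 > 0" "\<And>y. norm (y - p) < d1 \<Longrightarrow> norm (ddir u f y - ddir u f p - L (y - p)) \<le> e / M * norm (y - p)"
    using hd eM unfolding has_derivative_at_alt by blast
  define d where "d = min r d1 / (norm u + norm v + 1)"
  have nn: "norm u + norm v + 1 > 0" by (simp add: add_nonneg_pos)
  have d: "d > 0" using r d1 nn by (simp add: d_def)
  have "norm (f (p + h *\<^sub>R u + h *\<^sub>R v) - f (p + h *\<^sub>R u) - f (p + h *\<^sub>R v) + f p - h^2 *\<^sub>R L v) \<le> e * h^2"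
    if h: "0 < h" "h < d" for h
  proof -
    have near: "norm (s *\<^sub>R u + t *\<^sub>R v) < min r d1" if "\<bar>s\<bar> \<le> h" "\<bar>t\<bar> \<le> h" for s t
    proof -
      have "norm (s *\<^sub>R u + t *\<^sub>R v) \<le> \<bar>s\<bar> * norm u + \<bar>t\<bar> * norm v"
        using norm_triangle_ineq[of "s *\<^sub>R u" "t *\<^sub>R v"] by simp
      also have "\<dots> \<le> h * norm u + h * norm v" using that by (intro add_mono mult_right_mono) auto
      also have "\<dots> \<le> h * (norm u + norm v + 1)" using h by (simp add: algebra_simps)
      also have "\<dots> < min r d1" using h nn by (simp add: d_def pos_less_divide_eq)
      finally show ?thesis .
    qed
    define psi where "psi s = f (p + s *\<^sub>R u + h *\<^sub>R v) - f (p + s *\<^sub>R u) - (s * h) *\<^sub>R L v" for s :: real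
    define psi' where "psi' s = ddir u f (p + s *\<^sub>R u + h *\<^sub>R v) - ddir u f (p + s *\<^sub>R u) - h *\<^sub>R L v" for s :: real
    have deriv: "(psi has_derivative (\<lambda>x. x *\<^sub>R psi' s)) (at s within {0..h})" if s: "s \<in> {0..h}" for s
    proof -
      have "p + s *\<^sub>R u + h *\<^sub>R v \<in> U" "p + s *\<^sub>R u \<in> U"
      proof -
        have "dist p (p + x) = norm x" for x by (simp add: dist_norm)
        from this[of "s *\<^sub>R u + h *\<^sub>R v"] this[of "s *\<^sub>R u"]
        have "dist p (p + s *\<^sub>R u + h *\<^sub>R v) = norm (s *\<^sub>R u + h *\<^sub>R v)" "dist p (p + s *\<^sub>R u) = norm (s *\<^sub>R u + 0 *\<^sub>R v)"
          by (simp_all only: add.assoc scaleR_zero_left add_0_right)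
        then show "p + s *\<^sub>R u + h *\<^sub>R v \<in> U" "p + s *\<^sub>R u \<in> U"
          using near[of s h] near[of s 0] s h r(2) by (auto intro!: subsetD[OF r(2)] simp: mem_ball)
      qed
      then have *: "(f has_derivative frechet_derivative f (at (p + s *\<^sub>R u + h *\<^sub>R v))) (at (p + s *\<^sub>R u + h *\<^sub>R v))"
         "(f has_derivative frechet_derivative f (at (p + s *\<^sub>R u))) (at (p + s *\<^sub>R u))"
        using f frechet_derivative_works by blast+
      have 1: "((\<lambda>s. f (p + s *\<^sub>R u + h *\<^sub>R v)) has_derivative (\<lambda>x. x *\<^sub>R ddir u f (p + s *\<^sub>R u + h *\<^sub>R v))) (at s within {0..h})"
      proof -
        have "((\<lambda>s. p + s *\<^sub>R u + h *\<^sub>R v) has_derivative (\<lambda>x. x *\<^sub>R u)) (at s within {0..h})"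
          by (auto intro!: derivative_eq_intros)
        from has_derivative_compose[OF this *(1)] show ?thesis
          by (simp add: ddir_def linear_scale[OF has_derivative_linear[OF *(1)]])
      qed
      have 2: "((\<lambda>s. f (p + s *\<^sub>R u)) has_derivative (\<lambda>x. x *\<^sub>R ddir u f (p + s *\<^sub>R u))) (at s within {0..h})"
      proof -
        have "((\<lambda>s. p + s *\<^sub>R u) has_derivative (\<lambda>x. x *\<^sub>R u)) (at s within {0..h})"
          by (auto intro!: derivative_eq_intros)
        from has_derivative_compose[OF this *(2)] show ?thesis
          by (simp add: ddir_def linear_scale[OF has_derivative_linear[OF *(2)]])
      qed
      have 3: "((\<lambda>s. (s * h) *\<^sub>R L v) has_derivative (\<lambda>x. x *\<^sub>R (h *\<^sub>R L v))) (at s within {0..h})"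
        by (auto intro!: derivative_eq_intros)
      show ?thesis unfolding psi_def psi'_def scaleR_diff_right
        by (rule has_derivative_diff[OF has_derivative_diff[OF 1 2] 3])
    qed
    have bound: "norm (psi' s) \<le> e * h" if s: "s \<in> {0..h}" for s
    proof -
      have a: "norm (ddir u f (p + s *\<^sub>R u + h *\<^sub>R v) - ddir u f p - L (s *\<^sub>R u + h *\<^sub>R v)) \<le> e / M * norm (s *\<^sub>R u + h *\<^sub>R v)"
        using d1(2)[of "p + s *\<^sub>R u + h *\<^sub>R v"] near[of s h] s h by (simp add: add.assoc)
      have b: "norm (ddir u f (p + s *\<^sub>R u) - ddir u f p - L (s *\<^sub>R u)) \<le> e / M * norm (s *\<^sub>R u)"
        using d1(2)[of "p + s *\<^sub>R u"] near[of s 0] s h by simp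
      have "psi' s = (ddir u f (p + s *\<^sub>R u + h *\<^sub>R v) - ddir u f p - L (s *\<^sub>R u + h *\<^sub>R v))
          - (ddir u f (p + s *\<^sub>R u) - ddir u f p - L (s *\<^sub>R u))"
        unfolding psi'_def by (simp add: linear_add[OF lin] linear_scale[OF lin])
      then have "norm (psi' s) \<le> e / M * norm (s *\<^sub>R u + h *\<^sub>R v) + e / M * norm (s *\<^sub>R u)"
        using norm_triangle_ineq4 a b by (smt (verit))
      also have "\<dots> = e / M * (norm (s *\<^sub>R u + h *\<^sub>R v) + norm (s *\<^sub>R u))" by (simp add: algebra_simps)
      also have "\<dots> \<le> e / M * (h * M)"
      proof (rule mult_left_mono)
        have "norm (s *\<^sub>R u + h *\<^sub>R v) + norm (s *\<^sub>R u) \<le> \<bar>s\<bar> * norm u + \<bar>h\<bar> * norm v + \<bar>s\<bar> * norm u"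
          using norm_triangle_ineq[of "s *\<^sub>R u" "h *\<^sub>R v"] by simp
        also have "\<dots> \<le> h * norm u + h * norm v + h * norm u"
          using s h by (intro add_mono mult_right_mono) auto
        also have "\<dots> \<le> h * M" using h by (simp add: M_def algebra_simps)
        finally show "norm (s *\<^sub>R u + h *\<^sub>R v) + norm (s *\<^sub>R u) \<le> h * M" .
      qed (use eM in auto)
      also have "\<dots> = e * h" using M by simp
      finally show ?thesis .
    qed
    have "norm (psi h - psi 0) \<le> (e * h) * norm (h - 0)"
    proof (rule differentiable_bound[of "{0..h}" psi "\<lambda>s x. x *\<^sub>R psi' s"])
      fix s assume s: "s \<in> {0..h}"
      show "onorm (\<lambda>x. x *\<^sub>R psi' s) \<le> e * h"
        using bound[OF s] by (intro onorm_le) (simp add: mult.commute mult_left_mono)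
    qed (use deriv h in auto)
    then show ?thesis using h by (simp add: psi_def power2_eq_square algebra_simps)
  qed
  moreover have "L v = ddir v (ddir u f) p" by (simp add: ddir_def L_def)
  ultimately show ?thesis using d by auto
qed

text \<open>The second difference is symmetric in the two directions, hence so is its limit.\<close>

lemma ddir_commute:
  fixes f :: "'a::real_normed_vector \<Rightarrow> complex"
  assumes U: "open U" "p \<in> U" and f: "smooth_on U f"
  shows "ddir u (ddir v f) p = ddir v (ddir u f) p"
proof -
  have diff: "\<And>x. x \<in> U \<Longrightarrow> f differentiable (at x)" "\<And>u. ddir u f differentiable (at p)"
    using f U(2) smooth_on_differentiable smooth_on_ddir by blast+
  have small: "norm (ddir u (ddir v f) p - ddir v (ddir u f) p) \<le> 2 * e" if e: "e > 0" for e
  proof -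
    obtain d1 where d1: "d1 > 0" "\<And>h. 0 < h \<and> h < d1 \<Longrightarrow> norm (f (p + h *\<^sub>R u + h *\<^sub>R v) - f (p + h *\<^sub>R u) - f (p + h *\<^sub>R v) + f p - h^2 *\<^sub>R ddir v (ddir u f) p) \<le> e * h^2"
      using second_difference_limit[OF U diff(1) diff(2) e, of u v] by auto
    obtain d2 where d2: "d2 > 0" "\<And>h. 0 < h \<and> h < d2 \<Longrightarrow> norm (f (p + h *\<^sub>R v + h *\<^sub>R u) - f (p + h *\<^sub>R v) - f (p + h *\<^sub>R u) + f p - h^2 *\<^sub>R ddir u (ddir v f) p) \<le> e * h^2"
      using second_difference_limit[OF U diff(1) diff(2) e, of v u] by auto
    define h where "h = min d1 d2 / 2"
    have h: "0 < h" "h < d1" "h < d2" using d1 d2 by (auto simp: h_def)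
    define E where "E = f (p + h *\<^sub>R u + h *\<^sub>R v) - f (p + h *\<^sub>R u) - f (p + h *\<^sub>R v) + f p"
    have a: "norm (E - h^2 *\<^sub>R ddir v (ddir u f) p) \<le> e * h^2" using d1(2) h by (simp add: E_def)
    have b: "norm (E - h^2 *\<^sub>R ddir u (ddir v f) p) \<le> e * h^2"
      using d2(2)[of h] h by (simp add: E_def algebra_simps)
    have "norm (h^2 *\<^sub>R (ddir u (ddir v f) p - ddir v (ddir u f) p)) =
        norm ((E - h^2 *\<^sub>R ddir v (ddir u f) p) - (E - h^2 *\<^sub>R ddir u (ddir v f) p))"
      by (simp add: scaleR_diff_right)
    also have "\<dots> \<le> e * h^2 + e * h^2" using a b norm_triangle_ineq4 by (smt (verit))
    finally have "h^2 * norm (ddir u (ddir v f) p - ddir v (ddir u f) p) \<le> h^2 * (2 * e)"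
      by (simp add: mult_ac)
    then show ?thesis using h by simp
  qed
  have "norm (ddir u (ddir v f) p - ddir v (ddir u f) p) \<le> 0"
  proof (rule field_le_epsilon)
    fix e :: real assume "e > 0"
    then show "norm (ddir u (ddir v f) p - ddir v (ddir u f) p) \<le> 0 + e" using small[of "e / 2"] by simp
  qed
  then show ?thesis by simp
qed

section \<open>Calculus of Wirtinger derivatives\<close>

lemma wirt_ddir: "wirt i f p = (ddir (axis i 1) f p - \<i> * ddir (axis i \<i>) f p) / 2"
  by (simp add: wirt_def ddir_def)

lemma wirt_bar_ddir: "wirt_bar i f p = (ddir (axis i 1) f p + \<i> * ddir (axis i \<i>) f p) / 2"
  by (simp add: wirt_bar_def ddir_def)

lemma wirt_cong:
  assumes "open U" "p \<in> U" "\<And>x. x \<in> U \<Longrightarrow> f x = g x"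
  shows "wirt i f p = wirt i g p" "wirt_bar i f p = wirt_bar i g p"
  using ddir_cong[OF assms] by (simp_all add: wirt_ddir wirt_bar_ddir)

lemma wirt_const [simp]: "wirt i (\<lambda>x. c) p = 0" "wirt_bar i (\<lambda>x. c) p = 0"
  by (simp_all add: wirt_ddir wirt_bar_ddir)

lemma wirt_add:
  assumes "f differentiable (at p)" "g differentiable (at p)"
  shows "wirt i (\<lambda>x. f x + g x) p = wirt i f p + wirt i g p"
    "wirt_bar i (\<lambda>x. f x + g x) p = wirt_bar i f p + wirt_bar i g p"
  by (simp_all add: wirt_ddir wirt_bar_ddir ddir_add[OF assms] field_simps)

lemma wirt_mult:
  assumes "f differentiable (at p)" "g differentiable (at p)"
  shows "wirt i (\<lambda>x. f x * g x) p = wirt i f p * g p + f p * wirt i g p"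
    "wirt_bar i (\<lambda>x. f x * g x) p = wirt_bar i f p * g p + f p * wirt_bar i g p"
  by (simp_all add: wirt_ddir wirt_bar_ddir ddir_mult[OF assms] field_simps)

lemma wirt_cmult:
  assumes "f differentiable (at p)"
  shows "wirt i (\<lambda>x. c * f x) p = c * wirt i f p" "wirt_bar i (\<lambda>x. c * f x) p = c * wirt_bar i f p"
  using wirt_mult[of "\<lambda>x. c" p f] assms by auto

lemma wirt_minus:
  assumes "f differentiable (at p)"
  shows "wirt i (\<lambda>x. - f x) p = - wirt i f p" "wirt_bar i (\<lambda>x. - f x) p = - wirt_bar i f p"
  using wirt_cmult[of f p i "-1"] assms by auto

lemma wirt_diff:
  assumes "f differentiable (at p)" "g differentiable (at p)"
  shows "wirt i (\<lambda>x. f x - g x) p = wirt i f p - wirt i g p"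
    "wirt_bar i (\<lambda>x. f x - g x) p = wirt_bar i f p - wirt_bar i g p"
  using wirt_add[of f p "\<lambda>x. - g x" i] wirt_minus[of g p i] assms by auto

lemma differentiable_sum':
  "(\<And>j. j \<in> I \<Longrightarrow> f j differentiable (at p)) \<Longrightarrow> (\<lambda>x. \<Sum>j\<in>I. f j x) differentiable (at p)"
  by (induction I rule: infinite_finite_induct) auto

lemma wirt_sum:
  assumes "\<And>j. j \<in> I \<Longrightarrow> f j differentiable (at p)"
  shows "wirt i (\<lambda>x. \<Sum>j\<in>I. f j x) p = (\<Sum>j\<in>I. wirt i (f j) p)"
    "wirt_bar i (\<lambda>x. \<Sum>j\<in>I. f j x) p = (\<Sum>j\<in>I. wirt_bar i (f j) p)"
  using assms
  by (induction I rule: infinite_finite_induct) (simp_all add: wirt_add differentiable_sum')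

lemma wirt_holomorphic_comp:
  assumes "f differentiable (at p)" "h field_differentiable (at (f p))"
  shows "wirt i (\<lambda>x. h (f x)) p = deriv h (f p) * wirt i f p"
    "wirt_bar i (\<lambda>x. h (f x)) p = deriv h (f p) * wirt_bar i f p"
  by (simp_all add: wirt_ddir wirt_bar_ddir ddir_holomorphic_comp[OF assms] field_simps)

lemma ddir_cnj: "f differentiable (at p) \<Longrightarrow> ddir v (\<lambda>x. cnj (f x)) p = cnj (ddir v f p)"
  using ddir_linear_post[OF bounded_linear_cnj] by blast

lemma wirt_cnj:
  assumes "f differentiable (at p)"
  shows "wirt i (\<lambda>x. cnj (f x)) p = cnj (wirt_bar i f p)"
    "wirt_bar i (\<lambda>x. cnj (f x)) p = cnj (wirt i f p)"
  by (simp_all add: wirt_ddir wirt_bar_ddir ddir_cnj[OF assms])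

lemma smooth_on_wirt: "open U \<Longrightarrow> smooth_on U f \<Longrightarrow> smooth_on U (wirt i f)"
  "open U \<Longrightarrow> smooth_on U f \<Longrightarrow> smooth_on U (wirt_bar i f)"
proof -
  assume "open U" "smooth_on U f"
  then have "smooth_on U (\<lambda>p. (1/2) * (ddir (axis i 1) f p - \<i> * ddir (axis i \<i>) f p))"
     "smooth_on U (\<lambda>p. (1/2) * (ddir (axis i 1) f p + \<i> * ddir (axis i \<i>) f p))"
    by (intro smooth_on_mult smooth_on_add smooth_on_diff smooth_on_const smooth_on_ddir; simp)+
  moreover have "wirt i f = (\<lambda>p. (1/2) * (ddir (axis i 1) f p - \<i> * ddir (axis i \<i>) f p))"
    "wirt_bar i f = (\<lambda>p. (1/2) * (ddir (axis i 1) f p + \<i> * ddir (axis i \<i>) f p))"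
    by (auto simp: wirt_ddir wirt_bar_ddir)
  ultimately show "smooth_on U (wirt i f)" "smooth_on U (wirt_bar i f)" by simp_all
qed

lemma wirt_commute:
  assumes "open U" "p \<in> U" "smooth_on U f"
  shows "wirt i (wirt j f) p = wirt j (wirt i f) p"
    "wirt i (wirt_bar j f) p = wirt_bar j (wirt i f) p"
    "wirt_bar i (wirt_bar j f) p = wirt_bar j (wirt_bar i f) p"
proof -
  have d: "ddir v f differentiable (at p)" for v
    using assms smooth_on_ddir smooth_on_differentiable by blast
  have e: "wirt j f = (\<lambda>x. (1/2) * ddir (axis j 1) f x + (-\<i>/2) * ddir (axis j \<i>) f x)"
    "wirt_bar j f = (\<lambda>x. (1/2) * ddir (axis j 1) f x + (\<i>/2) * ddir (axis j \<i>) f x)" for j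
    by (auto simp: wirt_ddir wirt_bar_ddir field_simps)
  have dc: "ddir v (\<lambda>x. a * ddir u f x + b * ddir w f x) p = a * ddir v (ddir u f) p + b * ddir v (ddir w f) p" for a b u v w
    using d by (subst ddir_add) (auto simp: ddir_mult)
  note c = ddir_commute[OF assms, of "axis i _" "axis j _"]
  show "wirt i (wirt j f) p = wirt j (wirt i f) p"
    "wirt i (wirt_bar j f) p = wirt_bar j (wirt i f) p"
    "wirt_bar i (wirt_bar j f) p = wirt_bar j (wirt_bar i f) p"
    unfolding e wirt_ddir wirt_bar_ddir dc
    by (simp_all add: c algebra_simps)
qed

lemma vec_axis_sum: "(v::complex^'n) = (\<Sum>i\<in>UNIV. Re (v $ i) *\<^sub>R axis i 1 + Im (v $ i) *\<^sub>R axis i \<i>)"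
proof -
  have "(\<Sum>i\<in>UNIV. (Re (v $ i) *\<^sub>R axis i 1 + Im (v $ i) *\<^sub>R axis i \<i>) $ j) = v $ j" for j
  proof -
    have "(\<Sum>i\<in>UNIV. (Re (v $ i) *\<^sub>R axis i 1 + Im (v $ i) *\<^sub>R axis i \<i>) $ j)
      = (\<Sum>i\<in>UNIV. if i = j then v $ j else 0)"
      by (rule sum.cong) (auto simp: axis_def complex_eq_iff)
    then show ?thesis by simp
  qed
  then show ?thesis by (simp add: vec_eq_iff sum_component)
qed

text \<open>The real differential is recovered from the Wirtinger derivatives, so that identities may be
  proved for real directions and used for complex ones.\<close>

lemma ddir_wirt:
  assumes "f differentiable (at p)"
  shows "ddir v f p = (\<Sum>i\<in>UNIV. v $ i * wirt i f p + cnj (v $ i) * wirt_bar i f p)"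
proof -
  have lin: "linear (frechet_derivative f (at p))"
    using assms linear_frechet_derivative by blast
  have "ddir v f p = frechet_derivative f (at p) (\<Sum>i\<in>UNIV. Re (v $ i) *\<^sub>R axis i 1 + Im (v $ i) *\<^sub>R axis i \<i>)"
    using vec_axis_sum[of v] by (simp add: ddir_def)
  also have "\<dots> = (\<Sum>i\<in>UNIV. Re (v $ i) *\<^sub>R ddir (axis i 1) f p + Im (v $ i) *\<^sub>R ddir (axis i \<i>) f p)"
    by (simp add: linear_sum[OF lin] linear_add[OF lin] linear_scale[OF lin] ddir_def)
  also have "\<dots> = (\<Sum>i\<in>UNIV. v $ i * wirt i f p + cnj (v $ i) * wirt_bar i f p)"
    by (rule sum.cong) (auto simp: wirt_ddir wirt_bar_ddir complex_eq_iff field_simps)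
  finally show ?thesis .
qed

section \<open>Separate and joint holomorphy\<close>

definition polydisc :: "complex^'n \<Rightarrow> real \<Rightarrow> (complex^'n) set" where
  "polydisc p r = {x. \<forall>i. cmod (x $ i - p $ i) < r}"

text \<open>The complex derivative along a coordinate axis, meaningful without any differentiability in the
  other variables. For holomorphic functions it is \<open>wirt i f\<close>.\<close>

definition pd :: "'n \<Rightarrow> (complex^'n \<Rightarrow> complex) \<Rightarrow> complex^'n \<Rightarrow> complex" where
  "pd i f z = deriv (\<lambda>t. f (z + axis i t)) 0"

definition sep_hol :: "(complex^'n) set \<Rightarrow> (complex^'n \<Rightarrow> complex) \<Rightarrow> bool" where
  "sep_hol U f \<longleftrightarrow> (\<forall>z\<in>U. \<forall>i. (\<lambda>t. f (z + axis i t)) field_differentiable (at 0))"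

definition loc_bdd :: "(complex^'n) set \<Rightarrow> (complex^'n \<Rightarrow> complex) \<Rightarrow> bool" where
  "loc_bdd U f \<longleftrightarrow> (\<forall>p\<in>U. \<exists>r>0. \<exists>M. \<forall>x\<in>polydisc p r. cmod (f x) \<le> M)"

lemma norm_le_sum_cmod: "norm (x::complex^'n) \<le> (\<Sum>i\<in>UNIV. cmod (x $ i))"
  by (simp add: norm_vec_def L2_set_le_sum)

lemma polydisc_subset_open:
  assumes "open U" "p \<in> (U::(complex^'n) set)"
  obtains r where "r > 0" "polydisc p r \<subseteq> U"
proof -
  obtain e where e: "e > 0" "ball p e \<subseteq> U" using assms open_contains_ball by blast
  have "polydisc p (e / CARD('n)) \<subseteq> ball p e"
  proof
    fix x assume x: "x \<in> polydisc p (e / CARD('n))"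
    have "norm (x - p) \<le> (\<Sum>i\<in>UNIV. cmod ((x - p) $ i))" by (rule norm_le_sum_cmod)
    also have "\<dots> < (\<Sum>i\<in>(UNIV::'n set). e / CARD('n))"
      using x by (intro sum_strict_mono) (auto simp: polydisc_def)
    also have "\<dots> = e" by simp
    finally show "x \<in> ball p e" by (simp add: dist_norm norm_minus_commute)
  qed
  then show thesis using that[of "e / CARD('n)"] e by auto
qed

lemma ball_subset_polydisc: "ball p r \<subseteq> polydisc p r"
proof
  fix x assume "x \<in> ball p r"
  then have "norm (x - p) < r" by (simp add: dist_norm norm_minus_commute)
  then show "x \<in> polydisc p r"
    unfolding polydisc_def using Finite_Cartesian_Product.norm_nth_le[of "x - p"] by (auto intro: le_less_trans)
qed

lemma polydisc_mono: "r \<le> s \<Longrightarrow> polydisc p r \<subseteq> polydisc p s"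
  unfolding polydisc_def by (auto intro: less_le_trans)

lemma polydisc_add_axis: "z \<in> polydisc p r \<Longrightarrow> cmod t < s \<Longrightarrow> z + axis i t \<in> polydisc p (r + s)"
proof -
  assume a: "z \<in> polydisc p r" "cmod t < s"
  have "cmod ((z + axis i t) $ j - p $ j) < r + s" for j
  proof -
    have "cmod ((z + axis i t) $ j - p $ j) \<le> cmod (z $ j - p $ j) + cmod (axis i t $ j)"
      by (metis (no_types, lifting) add_diff_eq add.commute norm_triangle_ineq vector_add_component)
    moreover have "cmod (axis i t $ j) < s" using a(2) le_less_trans[OF norm_ge_zero a(2)] by (auto simp: axis_def)
    moreover have "cmod (z $ j - p $ j) < r" using a(1) by (auto simp: polydisc_def)
    ultimately show ?thesis by linarith
  qed
  then show ?thesis by (auto simp: polydisc_def)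
qed

text \<open>Quantitative form of holomorphy in the single coordinate \<open>i\<close>: all constants in the estimates below
  depend on the radius \<open>r\<close> and the bound \<open>M\<close> only.\<close>

definition hol_dir :: "'n \<Rightarrow> complex^'n \<Rightarrow> real \<Rightarrow> real \<Rightarrow> (complex^'n \<Rightarrow> complex) \<Rightarrow> bool" where
  "hol_dir i p r M f \<longleftrightarrow> r > 0 \<and>
     (\<forall>z\<in>polydisc p r. (\<lambda>t. f (z + axis i t)) field_differentiable (at 0) \<and> cmod (f z) \<le> M)"

lemma hol_dir_nonneg: "hol_dir i p r M f \<Longrightarrow> M \<ge> 0"
proof -
  assume a: "hol_dir i p r M f"
  then have "p \<in> polydisc p r" by (simp add: polydisc_def hol_dir_def)
  then have "cmod (f p) \<le> M" using a by (auto simp: hol_dir_def)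
  then show ?thesis using norm_ge_zero order_trans by blast
qed

lemma axis_zero [simp]: "axis i (0::complex) = 0"
  by (simp add: axis_eq_0_iff)

lemma axis_add: "axis i (s + t) = axis i s + axis i (t :: complex)"
  by (auto simp: axis_def vec_eq_iff)

lemma hol_dir_at:
  assumes "hol_dir i p r M f" "z + axis i t \<in> polydisc p r"
  shows "((\<lambda>t. f (z + axis i t)) has_field_derivative pd i f (z + axis i t)) (at t)"
proof -
  have "((\<lambda>s. f (z + axis i t + axis i s)) has_field_derivative pd i f (z + axis i t)) (at 0)"
    unfolding pd_def using assms DERIV_deriv_iff_field_differentiable unfolding hol_dir_def by blast
  then have "((\<lambda>s. f (z + axis i (t + s))) has_field_derivative pd i f (z + axis i t)) (at 0)"
    by (simp add: axis_add add.assoc)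
  then have "((\<lambda>s. f (z + axis i (s + t))) has_field_derivative pd i f (z + axis i t)) (at 0)"
    by (simp add: add.commute)
  then show ?thesis using DERIV_shift[of "\<lambda>t. f (z + axis i t)" "pd i f (z + axis i t)" 0 t] by simp
qed

lemma hol_dir_holomorphic:
  assumes "hol_dir i p r M f" "z \<in> polydisc p (r - s)"
  shows "(\<lambda>t. f (z + axis i t)) holomorphic_on ball 0 s"
    and "t \<in> ball 0 s \<Longrightarrow> deriv (\<lambda>t. f (z + axis i t)) t = pd i f (z + axis i t)"
proof -
  have *: "z + axis i t \<in> polydisc p r" if "t \<in> ball 0 s" for t
    using polydisc_add_axis[OF assms(2), of t s] that by simp
  show "(\<lambda>t. f (z + axis i t)) holomorphic_on ball 0 s"
    unfolding holomorphic_on_open[OF open_ball] using hol_dir_at[OF assms(1) *] by blast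
  show "t \<in> ball 0 s \<Longrightarrow> deriv (\<lambda>t. f (z + axis i t)) t = pd i f (z + axis i t)"
    using hol_dir_at[OF assms(1) *] DERIV_imp_deriv by blast
qed

text \<open>Cauchy estimate on discs of radius \<open>r / 2\<close>.\<close>

lemma hol_dir_pd:
  assumes "hol_dir i p r M f"
  shows "hol_dir i p (r/2) (4 * M / r) (pd i f)"
  unfolding hol_dir_def
proof (intro conjI ballI)
  have r: "r > 0" using assms by (auto simp: hol_dir_def)
  then show "0 < r / 2" by simp
  fix z assume z: "z \<in> polydisc p (r/2)"
  have z': "z \<in> polydisc p (r - r/2)" using z by simp
  note h = hol_dir_holomorphic[OF assms z']
  have "(deriv (\<lambda>t. f (z + axis i t))) holomorphic_on ball 0 (r/2)"
    using h(1) holomorphic_deriv by blast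
  then have "(\<lambda>t. pd i f (z + axis i t)) holomorphic_on ball 0 (r/2)"
    using h(2) holomorphic_cong by (metis (no_types, lifting))
  then show "(\<lambda>t. pd i f (z + axis i t)) field_differentiable at 0"
    using r holomorphic_on_imp_differentiable_at[of _ "ball 0 (r/2)"] by simp
  have "norm ((deriv ^^ 1) (\<lambda>t. f (z + axis i t)) 0) \<le> fact 1 * M / (r/4)^1"
  proof (rule Cauchy_inequality)
    show "(\<lambda>t. f (z + axis i t)) holomorphic_on ball 0 (r/4)"
      using h(1) r by (auto elim!: holomorphic_on_subset)
    show "continuous_on (cball 0 (r/4)) (\<lambda>t. f (z + axis i t))"
      by (rule holomorphic_on_imp_continuous_on, rule holomorphic_on_subset[OF h(1)]) (use r in auto)
    fix t :: complex assume "cmod (0 - t) = r/4"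
    then have "z + axis i t \<in> polydisc p r" using polydisc_add_axis[OF z', of t "r/2"] r by simp
    then show "cmod (f (z + axis i t)) \<le> M" using assms by (auto simp: hol_dir_def)
  qed (use r in auto)
  then show "cmod (pd i f z) \<le> 4 * M / r" by (simp add: pd_def field_simps)
qed

lemma polydisc_segment:
  assumes "z \<in> polydisc p r" "z + axis i t \<in> polydisc p r" "s \<in> closed_segment 0 t"
  shows "z + axis i s \<in> polydisc p r"
proof -
  obtain u where u: "0 \<le> u" "u \<le> 1" "s = u *\<^sub>R t" using assms(3) by (auto simp: in_segment)
  have "cmod ((z + axis i s) $ j - p $ j) < r" for j
  proof -
    have a: "z $ j - p $ j \<in> ball 0 r" "(z + axis i t) $ j - p $ j \<in> ball 0 r"
      using assms by (auto simp: polydisc_def)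
    have "(1 - u) *\<^sub>R (z $ j - p $ j) + u *\<^sub>R ((z + axis i t) $ j - p $ j) \<in> ball 0 r"
      using convexD[OF convex_ball a, of "1 - u" u] u by simp
    moreover have "(1 - u) *\<^sub>R (z $ j - p $ j) + u *\<^sub>R ((z + axis i t) $ j - p $ j) = (z + axis i s) $ j - p $ j"
      by (auto simp: u(3) axis_def algebra_simps)
    ultimately show ?thesis by simp
  qed
  then show ?thesis by (auto simp: polydisc_def)
qed

lemma hol_dir_lipschitz:
  assumes "hol_dir i p r M f" "z \<in> polydisc p (r/2)" "z + axis i t \<in> polydisc p (r/2)"
  shows "cmod (f (z + axis i t) - f z) \<le> 4 * M / r * cmod t"
proof -
  have r: "r > 0" using assms by (auto simp: hol_dir_def)
  have "norm ((\<lambda>t. f (z + axis i t)) t - (\<lambda>t. f (z + axis i t)) 0) \<le> 4 * M / r * norm (t - 0)"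
  proof (rule field_differentiable_bound[of "closed_segment 0 t" _ "\<lambda>s. pd i f (z + axis i s)"])
    fix s assume s: "s \<in> closed_segment 0 t"
    have c: "z + axis i s \<in> polydisc p (r/2)" using polydisc_segment[OF assms(2,3) s] .
    then have "z + axis i s \<in> polydisc p r" using polydisc_mono[of "r/2" r p] r by auto
    then show "((\<lambda>t. f (z + axis i t)) has_field_derivative pd i f (z + axis i s)) (at s within closed_segment 0 t)"
      using hol_dir_at[OF assms(1)] has_field_derivative_at_within by blast
    show "norm (pd i f (z + axis i s)) \<le> 4 * M / r"
      using hol_dir_pd[OF assms(1)] c by (auto simp: hol_dir_def)
  qed auto
  then show ?thesis by (simp add: axis_eq_0_iff)
qed

lemma hol_dir_taylor:
  assumes "hol_dir i p r M f" "z \<in> polydisc p (r/4)" "z + axis i t \<in> polydisc p (r/4)"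
  shows "cmod (f (z + axis i t) - f z - t * pd i f z) \<le> 32 * M / r^2 * cmod t ^ 2"
proof -
  have r: "r > 0" using assms by (auto simp: hol_dir_def)
  have "norm ((\<lambda>t. f (z + axis i t) - t * pd i f z) t - (\<lambda>t. f (z + axis i t) - t * pd i f z) 0)
     \<le> (32 * M / r^2 * cmod t) * norm (t - 0)"
  proof (rule field_differentiable_bound[of "closed_segment 0 t" _ "\<lambda>s. pd i f (z + axis i s) - pd i f z"])
    fix s assume s: "s \<in> closed_segment 0 t"
    have c: "z + axis i s \<in> polydisc p (r/4)" using polydisc_segment[OF assms(2,3) s] .
    then have "z + axis i s \<in> polydisc p r" using polydisc_mono[of "r/4" r p] r by auto
    then show "((\<lambda>t. f (z + axis i t) - t * pd i f z) has_field_derivative pd i f (z + axis i s) - pd i f z) (at s within closed_segment 0 t)"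
      using has_field_derivative_at_within[OF hol_dir_at[OF assms(1)]] by (auto intro!: derivative_eq_intros)
    have M: "M \<ge> 0" using hol_dir_nonneg[OF assms(1)] .
    have "norm (pd i f (z + axis i s) - pd i f z) \<le> 4 * (4 * M / r) / (r/2) * cmod s"
      using hol_dir_lipschitz[OF hol_dir_pd[OF assms(1)], of z s] c assms(2) by simp
    also have "\<dots> = 32 * M / r^2 * cmod s" using r by (simp add: power2_eq_square)
    also have "\<dots> \<le> 32 * M / r^2 * cmod t"
    proof (rule mult_left_mono)
      show "cmod s \<le> cmod t" using segment_bound(1)[OF s] by simp
    qed (use M in auto)
    finally show "norm (pd i f (z + axis i s) - pd i f z) \<le> 32 * M / r^2 * cmod t" .
  qed auto
  then show ?thesis by (simp add: axis_eq_0_iff power2_eq_square algebra_simps)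
qed

text \<open>Difference quotients in direction \<open>i\<close> are holomorphic in direction \<open>j\<close>, and by
  \<open>hol_dir_taylor\<close> they converge uniformly; so the derivative in direction \<open>i\<close> is holomorphic in
  direction \<open>j\<close>.\<close>

lemma pd_hol_dir_other:
  assumes i: "hol_dir i p r M f" and j: "hol_dir j p r M f"
  shows "hol_dir j p (r/8) (4 * M / r) (pd i f)"
  unfolding hol_dir_def
proof (intro conjI ballI)
  have r: "r > 0" using assms by (auto simp: hol_dir_def)
  then show "0 < r / 8" by simp
  fix z assume z: "z \<in> polydisc p (r/8)"
  have "z \<in> polydisc p (r/2)" using z polydisc_mono[of "r/8" "r/2" p] r by auto
  then show "cmod (pd i f z) \<le> 4 * M / r" using hol_dir_pd[OF i] by (auto simp: hol_dir_def)
  have M: "M \<ge> 0" using hol_dir_nonneg[OF i] .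
  define S where "S = ball (0::complex) (r/16)"
  obtain N where N: "N > 0" "1 / real N < r/16" using r
    by (metis divide_pos_pos real_arch_inverse inverse_eq_divide zero_less_numeral gr0I)
  define q where "q n t = of_nat (n + N) * (f (z + axis j t + axis i (1 / of_nat (n + N))) - f (z + axis j t))" for n :: nat and t
  have small: "cmod (1 / of_nat (n + N)) < r/16" for n :: nat
  proof -
    have "1 / real (n + N) \<le> 1 / real N" using N by (intro divide_left_mono) auto
    moreover have "cmod (1 / of_nat (n + N)) = 1 / real (n + N)" by (simp add: norm_divide del: of_nat_add)
    ultimately show ?thesis using N by linarith
  qed
  have in1: "z + axis j t \<in> polydisc p (r/8 + r/16)" if "t \<in> S" for t
    using polydisc_add_axis[OF z, of t "r/16" j] that by (simp add: S_def)
  have in2: "z + axis j t + axis i (1 / of_nat (n + N)) \<in> polydisc p (r/4)" if "t \<in> S" for t and n :: nat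
    using polydisc_add_axis[OF in1[OF that] small[of n], of i] by simp
  have sub: "polydisc p (r/8 + r/16) \<subseteq> polydisc p (r/4)" "polydisc p (r/4) \<subseteq> polydisc p r"
    using r by (auto intro!: polydisc_mono)
  have hq: "q n holomorphic_on S" for n
  proof -
    have 1: "(\<lambda>t. f (z + axis j t)) holomorphic_on S"
      unfolding S_def holomorphic_on_open[OF open_ball]
      using hol_dir_at[OF j] in1 sub unfolding S_def by blast
    have 2: "(\<lambda>t. f (z + axis i (1 / of_nat (n + N)) + axis j t)) holomorphic_on S"
    proof -
      have "z + axis i (1 / of_nat (n + N)) + axis j t \<in> polydisc p r" if "t \<in> S" for t
      proof -
        have "z + axis i (1 / of_nat (n + N)) + axis j t = z + axis j t + axis i (1 / of_nat (n + N))"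
          by (simp only: add_ac)
        then show ?thesis using in2[OF that, of n] sub(2) by (metis subsetD)
      qed
      then show ?thesis unfolding S_def holomorphic_on_open[OF open_ball] using hol_dir_at[OF j] by blast
    qed
    have "(\<lambda>t. of_nat (n + N) * (f (z + axis i (1 / of_nat (n + N)) + axis j t) - f (z + axis j t))) holomorphic_on S"
      by (intro holomorphic_intros 1 2)
    moreover have "q n = (\<lambda>t. of_nat (n + N) * (f (z + axis i (1 / of_nat (n + N)) + axis j t) - f (z + axis j t)))"
      unfolding q_def by (simp add: add.assoc add.commute[of "axis j _"])
    ultimately show ?thesis by simp
  qed
  have est: "cmod (q n t - pd i f (z + axis j t)) \<le> 32 * M / r^2 / real (n + N)" if "t \<in> S" for n t
  proof -
    define e where "e = 1 / (of_nat (n + N) :: complex)"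
    have "of_nat (n + N) \<noteq> (0 :: complex)" using N by (simp only: of_nat_eq_0_iff)
    then have e: "e \<noteq> 0" "of_nat (n + N) = 1 / e" "cmod e = 1 / real (n + N)"
      by (simp_all add: e_def norm_divide del: of_nat_add)
    have "q n t - pd i f (z + axis j t) = (f (z + axis j t + axis i e) - f (z + axis j t) - e * pd i f (z + axis j t)) / e"
      unfolding q_def e(2) e_def[symmetric] using e(1) by (simp add: field_simps)
    then have "cmod (q n t - pd i f (z + axis j t)) = cmod (f (z + axis j t + axis i e) - f (z + axis j t) - e * pd i f (z + axis j t)) / cmod e"
      by (simp add: norm_divide)
    also have "\<dots> \<le> (32 * M / r^2 * cmod e ^ 2) / cmod e"
      using hol_dir_taylor[OF i, of "z + axis j t" e] in1[OF that] sub in2[OF that, of n] e_def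
      by (intro divide_right_mono) auto
    also have "\<dots> = 32 * M / r^2 / real (n + N)" using e by (simp add: power2_eq_square)
    finally show ?thesis .
  qed
  have "uniform_limit S q (\<lambda>t. pd i f (z + axis j t)) sequentially"
  proof (rule uniform_limitI)
    fix e :: real assume "e > 0"
    have "(\<lambda>n. 32 * M / r^2 / real (n + N)) \<longlonglongrightarrow> 0"
      using LIMSEQ_ignore_initial_segment[OF lim_const_over_n[of "32 * M / r^2"], of N] by simp
    then have "\<forall>\<^sub>F n in sequentially. 32 * M / r^2 / real (n + N) < e"
      using \<open>e > 0\<close> order_tendstoD(2) by blast
    then show "\<forall>\<^sub>F n in sequentially. \<forall>x\<in>S. dist (q n x) (pd i f (z + axis j x)) < e"
    proof (rule eventually_mono)
      fix n assume n: "32 * M / r^2 / real (n + N) < e"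
      show "\<forall>x\<in>S. dist (q n x) (pd i f (z + axis j x)) < e"
      proof
        fix x assume "x \<in> S"
        from est[OF this, of n] n show "dist (q n x) (pd i f (z + axis j x)) < e"
          unfolding dist_norm by linarith
      qed
    qed
  qed
  note ul = this
  have oS: "open S" by (simp add: S_def)
  have "(\<lambda>t. pd i f (z + axis j t)) holomorphic_on S"
  proof (rule holomorphic_uniform_sequence[OF oS hq])
    fix x assume "x \<in> S"
    then obtain d where "d > 0" "cball x d \<subseteq> S" using oS open_contains_cball by blast
    then show "\<exists>d>0. cball x d \<subseteq> S \<and> uniform_limit (cball x d) q (\<lambda>t. pd i f (z + axis j t)) sequentially"
      using uniform_limit_on_subset[OF ul] by blast
  qed
  then show "(\<lambda>t. pd i f (z + axis j t)) field_differentiable at 0"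
    using r holomorphic_on_imp_differentiable_at[of _ S 0] by (simp add: S_def)
qed

lemma sep_hol_hol_dir:
  assumes "sep_hol U f" "polydisc p r \<subseteq> U" "r > 0" "\<And>x. x \<in> polydisc p r \<Longrightarrow> cmod (f x) \<le> M"
  shows "hol_dir i p r M f"
  using assms unfolding sep_hol_def hol_dir_def by blast

lemma sep_hol_local:
  assumes "open U" "sep_hol U f" "loc_bdd U f" "p \<in> U"
  shows "\<exists>r M. polydisc p r \<subseteq> U \<and> (\<forall>i. hol_dir i p r M f)"
proof -
  obtain r1 where r1: "r1 > 0" "polydisc p r1 \<subseteq> U" using polydisc_subset_open[OF assms(1,4)] .
  obtain r2 M where r2: "r2 > 0" "\<And>x. x \<in> polydisc p r2 \<Longrightarrow> cmod (f x) \<le> M"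
    using bspec[OF assms(3)[unfolded loc_bdd_def] assms(4)] by auto
  define r where "r = min r1 r2"
  have "polydisc p r \<subseteq> U" using r1 polydisc_mono[of r r1 p] r_def by auto
  moreover have "hol_dir i p r M f" for i
    by (rule sep_hol_hol_dir[OF assms(2) calculation])
      (use r1 r2 polydisc_mono[of r r2 p] r_def in auto)
  ultimately show ?thesis by blast
qed

lemma sep_hol_pd:
  assumes "open U" "sep_hol U f" "loc_bdd U f"
  shows "sep_hol U (pd i f)" "loc_bdd U (pd i f)"
proof -
  show "sep_hol U (pd i f)"
    unfolding sep_hol_def
  proof (intro ballI allI)
    fix z j assume z: "z \<in> U"
    obtain r M where "\<forall>i. hol_dir i z r M f"
      using sep_hol_local[OF assms z] by blast
    then have r: "hol_dir i z r M f" for i by blast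
    have "hol_dir j z (r/8) (4 * M / r) (pd i f)" by (rule pd_hol_dir_other[OF r r])
    then show "(\<lambda>t. pd i f (z + axis j t)) field_differentiable at 0"
      by (auto simp: hol_dir_def polydisc_def)
  qed
  show "loc_bdd U (pd i f)"
    unfolding loc_bdd_def
  proof
    fix z assume z: "z \<in> U"
    obtain r M where "\<forall>i. hol_dir i z r M f"
      using sep_hol_local[OF assms z] by blast
    then have r: "hol_dir i z r M f" for i by blast
    have "hol_dir i z (r/2) (4 * M / r) (pd i f)" by (rule hol_dir_pd[OF r])
    then show "\<exists>r>0. \<exists>M. \<forall>x\<in>polydisc z r. cmod (pd i f x) \<le> M"
      unfolding hol_dir_def by blast
  qed
qed

text \<open>Passing from \<open>p\<close> to \<open>x\<close> one coordinate at a time.\<close>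

definition mix :: "complex^'n \<Rightarrow> complex^'n \<Rightarrow> 'n set \<Rightarrow> complex^'n" where
  "mix p x S = (\<chi> i. if i \<in> S then x $ i else p $ i)"

lemma mix_insert: "j \<notin> S \<Longrightarrow> mix p x (insert j S) = mix p x S + axis j (x $ j - p $ j)"
  by (auto simp: mix_def vec_eq_iff axis_def)

lemma mix_in_polydisc: "x \<in> polydisc p r \<Longrightarrow> r > 0 \<Longrightarrow> mix p x S \<in> polydisc p r"
  by (auto simp: polydisc_def mix_def)

lemma sep_hol_mix_lipschitz:
  assumes h: "\<And>i. hol_dir i p r M f" and x: "x \<in> polydisc p (r/2)"
  shows "cmod (f (mix p x S) - f p) \<le> 4 * M / r * (\<Sum>i\<in>UNIV. cmod (x $ i - p $ i))"
proof -
  have r: "r > 0" using h hol_dir_def by blast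
  have M: "M \<ge> 0" using hol_dir_nonneg[OF h] .
  have "cmod (f (mix p x S) - f p) \<le> 4 * M / r * (\<Sum>i\<in>S. cmod (x $ i - p $ i))"
  proof (induction S rule: finite_induct[OF finite])
    case 1
    then show ?case by (simp add: mix_def)
  next
    case (2 j S)
    have "cmod (f (mix p x S + axis j (x $ j - p $ j)) - f (mix p x S)) \<le> 4 * M / r * cmod (x $ j - p $ j)"
      using mix_in_polydisc[OF x, of S] mix_in_polydisc[OF x, of "insert j S"] r 2
      by (intro hol_dir_lipschitz[OF h]) (auto simp: mix_insert)
    moreover have "cmod (f (mix p x (insert j S)) - f p) \<le>
       cmod (f (mix p x S + axis j (x $ j - p $ j)) - f (mix p x S)) + cmod (f (mix p x S) - f p)"
      using norm_triangle_ineq[of "f (mix p x S + axis j (x $ j - p $ j)) - f (mix p x S)" "f (mix p x S) - f p"] 2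
      by (simp add: mix_insert)
    ultimately have "cmod (f (mix p x (insert j S)) - f p) \<le> 4 * M / r * cmod (x $ j - p $ j) + 4 * M / r * (\<Sum>i\<in>S. cmod (x $ i - p $ i))"
      using 2 by linarith
    then show ?case using 2 by (simp add: distrib_left)
  qed
  also have "\<dots> \<le> 4 * M / r * (\<Sum>i\<in>UNIV. cmod (x $ i - p $ i))"
    using r M by (intro mult_left_mono sum_mono2) auto
  finally show ?thesis .
qed

text \<open>Telescoping along the path that changes one coordinate at a time. Each step is a Taylor formula in
  one variable, with the derivative taken at an intermediate point; moving it back to \<open>p\<close> costs
  a Lipschitz constant of the derivative.\<close>

lemma sep_hol_taylor:
  assumes U: "open U" "sep_hol U f" "loc_bdd U f" "p \<in> U"
  shows "\<exists>r C. r > 0 \<and>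
    (\<forall>x\<in>polydisc p r. cmod (f x - f p - (\<Sum>i\<in>UNIV. pd i f p * (x $ i - p $ i))) \<le> C * (\<Sum>i\<in>UNIV. cmod (x $ i - p $ i))^2)"
proof -
  obtain r M where rU: "polydisc p r \<subseteq> U" and "\<forall>i. hol_dir i p r M f"
    using sep_hol_local[OF U] by blast
  then have h: "hol_dir i p r M f" for i by blast
  have r: "r > 0" using h hol_dir_def by blast
  have M: "M \<ge> 0" using hol_dir_nonneg[OF h] .
  have hp: "hol_dir j p (r/8) (4 * M / r) (pd i f)" for i j by (rule pd_hol_dir_other[OF h h])
  define C where "C = 32 * M / r^2 + 4 * (4 * M / r) / (r/8)"
  have C: "C \<ge> 0" using r M by (simp add: C_def)
  have "cmod (f x - f p - (\<Sum>i\<in>UNIV. pd i f p * (x $ i - p $ i))) \<le> C * (\<Sum>i\<in>UNIV. cmod (x $ i - p $ i))^2"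
    if x: "x \<in> polydisc p (r/16)" for x
  proof -
    define N where "N = (\<Sum>i\<in>UNIV. cmod (x $ i - p $ i))"
    have Ni: "cmod (x $ i - p $ i) \<le> N" for i
      unfolding N_def by (rule member_le_sum) auto
    have "cmod (f (mix p x S) - f p - (\<Sum>i\<in>S. pd i f p * (x $ i - p $ i))) \<le> (\<Sum>i\<in>S. C * N * cmod (x $ i - p $ i))" for S
    proof (induction S rule: finite_induct[OF finite])
      case 1
      then show ?case by (simp add: mix_def)
    next
      case (2 j S)
      define y where "y = mix p x S"
      define t where "t = x $ j - p $ j"
      have sub: "polydisc p (r/16) \<subseteq> polydisc p (r/4)" using r by (intro polydisc_mono) simp
      have y: "y \<in> polydisc p (r/4)" "y + axis j t \<in> polydisc p (r/4)"
        using mix_in_polydisc[OF x, of S] mix_in_polydisc[OF x, of "insert j S"] r 2 sub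
        by (auto simp: mix_insert y_def t_def)
      have a: "cmod (f (y + axis j t) - f y - t * pd j f y) \<le> 32 * M / r^2 * N * cmod t"
      proof -
        have "cmod (f (y + axis j t) - f y - t * pd j f y) \<le> 32 * M / r^2 * cmod t ^ 2"
          by (rule hol_dir_taylor[OF h y])
        also have "\<dots> \<le> 32 * M / r^2 * (N * cmod t)"
          using M Ni[of j] by (intro mult_left_mono) (auto simp: t_def power2_eq_square intro: mult_right_mono)
        finally show ?thesis by simp
      qed
      have "cmod (pd j f y - pd j f p) \<le> 4 * (4 * M / r) / (r/8) * N"
        using sep_hol_mix_lipschitz[OF hp, of x j S] x by (simp add: y_def N_def)
      then have b: "cmod (t * (pd j f y - pd j f p)) \<le> 4 * (4 * M / r) / (r/8) * N * cmod t"
        unfolding norm_mult mult.commute[of "cmod t"] by (rule mult_right_mono) simp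
      have eq: "f (mix p x (insert j S)) - f p - (\<Sum>i\<in>insert j S. pd i f p * (x $ i - p $ i)) =
         (f (y + axis j t) - f y - t * pd j f y) + t * (pd j f y - pd j f p) + (f y - f p - (\<Sum>i\<in>S. pd i f p * (x $ i - p $ i)))"
        using 2 by (simp add: mix_insert y_def t_def algebra_simps)
      have "cmod (f (mix p x (insert j S)) - f p - (\<Sum>i\<in>insert j S. pd i f p * (x $ i - p $ i))) \<le>
         32 * M / r^2 * N * cmod t + 4 * (4 * M / r) / (r/8) * N * cmod t + (\<Sum>i\<in>S. C * N * cmod (x $ i - p $ i))"
        unfolding eq by (rule norm_triangle_mono[OF norm_triangle_mono[OF a b] 2(3)[folded y_def]])
      also have "\<dots> = C * N * cmod t + (\<Sum>i\<in>S. C * N * cmod (x $ i - p $ i))"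
        by (simp add: C_def algebra_simps)
      finally show ?case using 2 by (simp add: t_def)
    qed
    from this[of UNIV] have "cmod (f x - f p - (\<Sum>i\<in>UNIV. pd i f p * (x $ i - p $ i))) \<le> (\<Sum>i\<in>UNIV. C * N * cmod (x $ i - p $ i))"
      by (simp add: mix_def)
    also have "\<dots> = C * N^2" by (simp add: N_def power2_eq_square flip: sum_distrib_left)
    finally show ?thesis by (simp add: N_def)
  qed
  then show ?thesis using r by (intro exI[of _ "r/16"] exI[of _ C]) auto
qed

lemma sep_hol_has_derivative:
  assumes U: "open U" "sep_hol U f" "loc_bdd U f" "p \<in> U"
  shows "(f has_derivative (\<lambda>v. \<Sum>i\<in>UNIV. pd i f p * v $ i)) (at p)"
proof -
  obtain r C where r: "r > 0"
    and C: "\<forall>x\<in>polydisc p r. cmod (f x - f p - (\<Sum>i\<in>UNIV. pd i f p * (x $ i - p $ i))) \<le> C * (\<Sum>i\<in>UNIV. cmod (x $ i - p $ i))^2"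
    using sep_hol_taylor[OF U] by blast
  define n where "n = real CARD('a)"
  define D where "D = (\<bar>C\<bar> + 1) * n^2"
  have n: "n > 0" by (simp add: n_def)
  have D: "D > 0" using n by (simp add: D_def)
  show ?thesis
    unfolding has_derivative_at_alt
  proof (intro conjI allI impI)
    show "bounded_linear (\<lambda>v. \<Sum>i\<in>UNIV. pd i f p * v $ i)"
      by (intro bounded_linear_sum bounded_linear_const_mult bounded_linear_vec_nth)
    fix e :: real assume e: "e > 0"
    have "norm (f y - f p - (\<Sum>i\<in>UNIV. pd i f p * (y - p) $ i)) \<le> e * norm (y - p)"
      if y: "norm (y - p) < min r (e / D)" for y
    proof -
      have "y \<in> ball p r" using y by (simp add: dist_norm norm_minus_commute)
      then have "y \<in> polydisc p r" using ball_subset_polydisc by blast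
      then have "norm (f y - f p - (\<Sum>i\<in>UNIV. pd i f p * (y $ i - p $ i))) \<le> C * (\<Sum>i\<in>UNIV. cmod (y $ i - p $ i))^2"
        using C by blast
      also have "\<dots> \<le> (\<bar>C\<bar> + 1) * (n * norm (y - p))^2"
      proof (rule mult_mono)
        have "(\<Sum>i\<in>UNIV. cmod (y $ i - p $ i)) \<le> (\<Sum>i\<in>(UNIV::'a set). norm (y - p))"
          by (rule sum_mono) (metis Finite_Cartesian_Product.norm_nth_le vector_minus_component)
        also have "\<dots> = n * norm (y - p)" by (simp add: n_def)
        finally show "(\<Sum>i\<in>UNIV. cmod (y $ i - p $ i))^2 \<le> (n * norm (y - p))^2"
          by (intro power_mono sum_nonneg) auto
      qed auto
      also have "\<dots> = D * norm (y - p) * norm (y - p)" by (simp add: D_def power2_eq_square)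
      also have "\<dots> \<le> e * norm (y - p)"
        using y D by (intro mult_right_mono) (auto simp: field_simps)
      finally show ?thesis by simp
    qed
    then show "\<exists>d>0. \<forall>y. norm (y - p) < d \<longrightarrow> norm (f y - f p - (\<Sum>i\<in>UNIV. pd i f p * (y - p) $ i)) \<le> e * norm (y - p)"
      using r e D by (intro exI[of _ "min r (e / D)"]) auto
  qed
qed

text \<open>For locally bounded functions, holomorphy in each variable separately gives total complex
  differentiability. It is applied to the Bergman kernel in both variables and to uniform limits.\<close>

theorem osgood:
  assumes "open U" "sep_hol U f" "loc_bdd U f"
  shows "f mholomorphic_on U"
  unfolding mholomorphic_on_def
proof
  fix p assume "p \<in> U"
  from sep_hol_has_derivative[OF assms this]
  show "\<exists>D. (f has_derivative D) (at p) \<and> (\<forall>c v. D (c *s v) = c * D v)"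
    by (rule exI[where x = "\<lambda>v. \<Sum>i\<in>UNIV. pd i f p * v $ i", OF conjI])
      (simp add: sum_distrib_left mult_ac)
qed

lemma mholomorphic_sep_hol:
  assumes "open U" "f mholomorphic_on U"
  shows "sep_hol U f" "loc_bdd U f"
proof -
  show "sep_hol U f"
    unfolding sep_hol_def
  proof (intro ballI allI)
    fix z i assume "z \<in> U"
    then obtain D where D: "(f has_derivative D) (at z)" "\<And>c v. D (c *s v) = c * D v"
      using assms unfolding mholomorphic_on_def by blast
    have "bounded_linear (\<lambda>t. axis i t :: complex^'a)"
      by (simp add: axis_add axis_def linear_conv_bounded_linear[symmetric])
        (rule linearI; auto simp: vec_eq_iff)
    then have "((\<lambda>t. z + axis i t) has_derivative (\<lambda>t. axis i t)) (at 0)"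
      by (auto intro!: derivative_eq_intros bounded_linear_imp_has_derivative)
    then have "((\<lambda>t. f (z + axis i t)) has_derivative (\<lambda>t. D (axis i t))) (at 0)"
      by (rule has_derivative_compose) (use D in simp)
    moreover have "D (axis i t) = D (axis i 1) * t" for t
    proof -
      have "axis i t = t *s (axis i 1 :: complex^'a)" by (auto simp: axis_def vec_eq_iff)
      then show ?thesis using D(2) by simp
    qed
    ultimately show "(\<lambda>t. f (z + axis i t)) field_differentiable at 0"
      unfolding field_differentiable_def has_field_derivative_def by (metis (no_types, lifting) ext)
  qed
  show "loc_bdd U f"
    unfolding loc_bdd_def
  proof
    fix p assume p: "p \<in> U"
    then have "isCont f p" using assms unfolding mholomorphic_on_def by (meson has_derivative_continuous)
    then obtain V where V: "open V" "p \<in> V" "\<And>x. x \<in> V \<Longrightarrow> dist (f x) (f p) < 1"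
      unfolding continuous_at_open by (metis mem_ball open_ball zero_less_one centre_in_ball dist_commute)
    obtain r where r: "r > 0" "polydisc p r \<subseteq> V" using polydisc_subset_open[OF V(1,2)] .
    have "cmod (f x) \<le> cmod (f p) + 1" if "x \<in> polydisc p r" for x
      using V(3)[of x] r that norm_triangle_ineq2[of "f x" "f p"] by (auto simp: dist_norm)
    then show "\<exists>r>0. \<exists>M. \<forall>x\<in>polydisc p r. cmod (f x) \<le> M" using r by blast
  qed
qed

section \<open>Holomorphic functions of several variables\<close>

lemma mholomorphic_differentiable: "f mholomorphic_on U \<Longrightarrow> p \<in> U \<Longrightarrow> f differentiable (at p)"
  unfolding mholomorphic_on_def differentiable_def by blast

lemma mholomorphic_wirt:
  assumes "f mholomorphic_on U" "p \<in> U"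
  shows "wirt_bar i f p = 0" "(f has_derivative (\<lambda>v. \<Sum>i\<in>UNIV. wirt i f p * v $ i)) (at p)"
     "ddir v f p = (\<Sum>i\<in>UNIV. wirt i f p * v $ i)"
proof -
  obtain D where D: "(f has_derivative D) (at p)" "\<And>c v. D (c *s v) = c * D v"
    using assms unfolding mholomorphic_on_def by blast
  have diff: "f differentiable (at p)" using D(1) unfolding differentiable_def by blast
  have dd: "ddir v f p = D v" for v using D ddir_has_derivative by blast
  have "axis i \<i> = \<i> *s (axis i 1 :: complex^'a)" for i by (auto simp: axis_def vec_eq_iff)
  then have ii: "D (axis i \<i>) = \<i> * D (axis i 1)" for i using D(2) by simp
  show wb: "wirt_bar i f p = 0" for i by (simp add: wirt_bar_ddir dd ii flip: mult.assoc)
  have "D v = (\<Sum>i\<in>UNIV. wirt i f p * v $ i)" for v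
    using ddir_wirt[OF diff, of v] wb by (simp add: dd mult.commute)
  then have De: "D = (\<lambda>v. \<Sum>i\<in>UNIV. wirt i f p * v $ i)" by (rule ext)
  show "(f has_derivative (\<lambda>v. \<Sum>i\<in>UNIV. wirt i f p * v $ i)) (at p)"
    using D(1) by (simp only: De)
  show "ddir v f p = (\<Sum>i\<in>UNIV. wirt i f p * v $ i)"
    using dd[of v] by (simp only: De)
qed

lemma mholomorphic_wirt_mholomorphic:
  assumes "open U" "f mholomorphic_on U"
  shows "wirt i f mholomorphic_on U"
proof -
  note s = mholomorphic_sep_hol[OF assms]
  have "pd i f mholomorphic_on U" using osgood[OF assms(1)] sep_hol_pd[OF assms(1) s] by blast
  moreover have "wirt i f p = pd i f p" if p: "p \<in> U" for p
  proof -
    have "axis i 1 = (axis i 1 :: complex^'a)" ..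
    have "ddir (axis i 1) f p = pd i f p"
      using ddir_has_derivative[OF sep_hol_has_derivative[OF assms(1) s p], of "axis i 1"]
      by (simp add: axis_def if_distrib cong: if_cong)
    moreover have "ddir (axis i 1) f p = wirt i f p"
      using mholomorphic_wirt(3)[OF assms(2) p, of "axis i 1"] by (simp add: axis_def if_distrib cong: if_cong)
    ultimately show ?thesis by simp
  qed
  ultimately show ?thesis
    unfolding mholomorphic_on_def using assms(1) has_derivative_transform_within_open by (metis (no_types, lifting))
qed

lemma mholomorphic_const: "(\<lambda>x. c) mholomorphic_on U"
  unfolding mholomorphic_on_def by (auto intro!: exI[of _ "\<lambda>x. 0"])

lemma mholomorphic_add: "f mholomorphic_on U \<Longrightarrow> g mholomorphic_on U \<Longrightarrow> (\<lambda>x. f x + g x) mholomorphic_on U"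
  unfolding mholomorphic_on_def
proof
  fix z assume a: "\<forall>z\<in>U. \<exists>D. (f has_derivative D) (at z) \<and> (\<forall>c v. D (c *s v) = c * D v)"
    "\<forall>z\<in>U. \<exists>D. (g has_derivative D) (at z) \<and> (\<forall>c v. D (c *s v) = c * D v)" "z \<in> U"
  then obtain D E where "(f has_derivative D) (at z)" "\<forall>c v. D (c *s v) = c * D v"
    "(g has_derivative E) (at z)" "\<forall>c v. E (c *s v) = c * E v" by blast
  then show "\<exists>D. ((\<lambda>x. f x + g x) has_derivative D) (at z) \<and> (\<forall>c v. D (c *s v) = c * D v)"
    by (intro exI[of _ "\<lambda>v. D v + E v"]) (auto intro: has_derivative_add simp: distrib_left)
qed

lemma mholomorphic_mult: "f mholomorphic_on U \<Longrightarrow> g mholomorphic_on U \<Longrightarrow> (\<lambda>x. f x * g x) mholomorphic_on U"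
  unfolding mholomorphic_on_def
proof
  fix z assume a: "\<forall>z\<in>U. \<exists>D. (f has_derivative D) (at z) \<and> (\<forall>c v. D (c *s v) = c * D v)"
    "\<forall>z\<in>U. \<exists>D. (g has_derivative D) (at z) \<and> (\<forall>c v. D (c *s v) = c * D v)" "z \<in> U"
  then obtain D E where "(f has_derivative D) (at z)" "\<forall>c v. D (c *s v) = c * D v"
    "(g has_derivative E) (at z)" "\<forall>c v. E (c *s v) = c * E v" by blast
  then show "\<exists>D. ((\<lambda>x. f x * g x) has_derivative D) (at z) \<and> (\<forall>c v. D (c *s v) = c * D v)"
    by (intro exI[of _ "\<lambda>v. f z * E v + D v * g z"] conjI has_derivative_mult) (auto simp: algebra_simps)
qed

lemma mholomorphic_sum: "(\<And>i. i \<in> I \<Longrightarrow> f i mholomorphic_on U) \<Longrightarrow> (\<lambda>x. \<Sum>i\<in>I. f i x) mholomorphic_on U"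
  by (induction I rule: infinite_finite_induct) (auto simp: mholomorphic_const intro: mholomorphic_add)

lemma mholomorphic_prod: "(\<And>i. i \<in> I \<Longrightarrow> f i mholomorphic_on U) \<Longrightarrow> (\<lambda>x. \<Prod>i\<in>I. f i x) mholomorphic_on U"
  by (induction I rule: infinite_finite_induct) (auto simp: mholomorphic_const intro: mholomorphic_mult)

lemma mholomorphic_cong:
  assumes "open U" "f mholomorphic_on U" "\<And>x. x \<in> U \<Longrightarrow> f x = g x"
  shows "g mholomorphic_on U"
  using assms has_derivative_transform_within_open[of f _ _ UNIV U g] unfolding mholomorphic_on_def by metis

text \<open>Derivatives of holomorphic functions are holomorphic, and they determine all directional
  derivatives.\<close>

theorem mholomorphic_smooth:
  assumes "open U" "f mholomorphic_on U"
  shows "smooth_on U f"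
  unfolding smooth_on_def
proof
  fix k show "Ck k U f" using assms(2)
  proof (induction k arbitrary: f)
    case 0
    then show ?case using mholomorphic_differentiable by auto
  next
    case (Suc k)
    have "Ck k U (ddir v f)" for v
    proof -
      have "(\<lambda>x. \<Sum>i\<in>UNIV. wirt i f x * v $ i) mholomorphic_on U"
        by (intro mholomorphic_sum mholomorphic_mult mholomorphic_const mholomorphic_wirt_mholomorphic assms Suc.prems)
      then have "ddir v f mholomorphic_on U"
        by (rule mholomorphic_cong[OF assms(1)]) (simp add: mholomorphic_wirt(3)[OF Suc.prems])
      then show ?thesis by (rule Suc.IH)
    qed
    then show ?case using Suc.prems mholomorphic_differentiable by auto
  qed
qed

section \<open>Change of variables by holomorphic maps\<close>

text \<open>Orthonormal bases of two Euclidean spaces of equal dimension are matched; this preserves the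
  product description of Lebesgue measure.\<close>

lemma exists_lborel_transport:
  assumes dim: "DIM('a::euclidean_space) = DIM('b::euclidean_space)"
  shows "\<exists>(T::'a \<Rightarrow> 'b) S. linear T \<and> linear S \<and> (\<forall>x. S (T x) = x) \<and> (\<forall>y. T (S y) = y) \<and>
     distr lborel borel T = lborel \<and> distr lborel borel S = lborel"
proof -
  obtain b :: "'a \<Rightarrow> 'b" where b: "bij_betw b Basis Basis"
    using dim finite_same_card_bij[of "Basis :: 'a set" "Basis :: 'b set"] by auto
  have bB: "b e \<in> Basis" if "e \<in> Basis" for e using b that bij_betwE by blast
  define T where "T x = (\<Sum>e\<in>Basis. (x \<bullet> e) *\<^sub>R b e)" for x
  define S where "S y = (\<Sum>e\<in>Basis. (y \<bullet> b e) *\<^sub>R e)" for y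
  have T: "linear T" unfolding T_def
    by (rule linearI) (simp_all add: inner_add_left sum.distrib scaleR_left_distrib scaleR_sum_right)
  have S: "linear S" unfolding S_def
    by (rule linearI) (simp_all add: inner_add_left sum.distrib scaleR_left_distrib scaleR_sum_right)
  have Te: "T x \<bullet> b e = x \<bullet> e" if e: "e \<in> Basis" for x e
  proof -
    have "T x \<bullet> b e = (\<Sum>e'\<in>Basis. if e' = e then x \<bullet> e' else 0)"
      unfolding T_def inner_sum_left
    proof (rule sum.cong[OF refl])
      fix e' :: 'a assume e': "e' \<in> Basis"
      have "b e' = b e \<longleftrightarrow> e' = e" using b e e' unfolding bij_betw_def by (metis inj_on_contraD)
      then show "(x \<bullet> e') *\<^sub>R b e' \<bullet> b e = (if e' = e then x \<bullet> e' else 0)"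
        using bB[OF e] bB[OF e'] by (simp add: inner_Basis)
    qed
    then show ?thesis using e by simp
  qed
  have Se: "S y \<bullet> e = y \<bullet> b e" if e: "e \<in> Basis" for y e
    using e by (simp add: S_def inner_sum_left inner_Basis sum.delta' if_distrib cong: if_cong)
  have ST: "S (T x) = x" for x
    by (rule euclidean_eqI) (simp add: Se Te)
  have TS: "T (S y) = y" for y
  proof (rule euclidean_eqI)
    fix c :: 'b assume "c \<in> Basis"
    then obtain e where "e \<in> Basis" "c = b e" using b unfolding bij_betw_def by blast
    then show "T (S y) \<bullet> c = y \<bullet> c" by (simp add: Te Se)
  qed
  have mT: "T \<in> borel_measurable borel" and mS: "S \<in> borel_measurable borel"
    using T S linear_continuous_on linear_conv_bounded_linear borel_measurable_continuous_onI by blast+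
  have dS: "distr lborel borel S = lborel"
  proof (rule lborel_eqI[symmetric])
    fix l u :: 'a assume lu: "\<And>e. e \<in> Basis \<Longrightarrow> l \<bullet> e \<le> u \<bullet> e"
    have img: "b ` Basis = Basis" using b by (simp add: bij_betw_def)
    have eq: "S -` box l u = box (T l) (T u)"
    proof -
      have "(S y \<in> box l u) = (y \<in> box (T l) (T u))" for y
      proof -
        have "(y \<in> box (T l) (T u)) = (\<forall>c\<in>b ` Basis. T l \<bullet> c < y \<bullet> c \<and> y \<bullet> c < T u \<bullet> c)"
          unfolding img by (simp add: mem_box)
        also have "\<dots> = (S y \<in> box l u)" by (simp add: mem_box Te Se)
        finally show ?thesis by simp
      qed
      then show ?thesis by auto
    qed
    have "emeasure (distr lborel borel S) (box l u) = emeasure lborel (box (T l) (T u))"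
      using mS by (simp add: emeasure_distr eq)
    also have "\<dots> = (\<Prod>c\<in>Basis. (T u - T l) \<bullet> c)"
    proof (rule emeasure_lborel_box)
      fix c :: 'b assume "c \<in> Basis"
      then obtain e where "e \<in> Basis" "c = b e" using b unfolding bij_betw_def by blast
      then show "T l \<bullet> c \<le> T u \<bullet> c" using lu by (simp add: Te)
    qed
    also have "(\<Prod>c\<in>Basis. (T u - T l) \<bullet> c) = (\<Prod>e\<in>Basis. (T u - T l) \<bullet> b e)"
      using prod.reindex_bij_betw[OF b] by metis
    also have "\<dots> = (\<Prod>e\<in>Basis. (u - l) \<bullet> e)"
      by (rule prod.cong) (simp_all add: inner_diff_left Te)
    finally show "emeasure (distr lborel borel S) (box l u) = (\<Prod>e\<in>Basis. (u - l) \<bullet> e)" .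
  qed simp
  have "distr lborel borel T = distr (distr lborel borel S) borel T" by (simp add: dS)
  also have "\<dots> = distr lborel borel (T \<circ> S)" using mT mS by (intro distr_distr) simp_all
  also have "T \<circ> S = (\<lambda>y. y)" by (auto simp: TS)
  also have "distr lborel borel (\<lambda>y. y) = lborel" by (simp add: distr_id2)
  finally have dT: "distr lborel borel T = lborel" .
  show ?thesis using T S ST TS dT dS by blast
qed

lemma set_integrable_lebesgue_lborel:
  fixes F :: "'a::euclidean_space \<Rightarrow> 'b::euclidean_space"
  assumes "open A" "continuous_on A F"
  shows "(\<lambda>x. indicator A x *\<^sub>R F x) \<in> borel_measurable borel"
    "set_integrable lebesgue A F \<longleftrightarrow> integrable lborel (\<lambda>x. indicator A x *\<^sub>R F x)"
    "(LINT x:A|lebesgue. F x) = (LINT x|lborel. indicator A x *\<^sub>R F x)"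
proof -
  show m: "(\<lambda>x. indicator A x *\<^sub>R F x) \<in> borel_measurable borel"
    using assms by (intro borel_measurable_continuous_on_indicator) auto
  then show "set_integrable lebesgue A F \<longleftrightarrow> integrable lborel (\<lambda>x. indicator A x *\<^sub>R F x)"
    unfolding set_integrable_def by (subst integrable_completion) auto
  show "(LINT x:A|lebesgue. F x) = (LINT x|lborel. indicator A x *\<^sub>R F x)"
    unfolding set_lebesgue_integral_def using m by (subst integral_completion) auto
qed

lemma transport_set_integral:
  fixes T :: "'a::euclidean_space \<Rightarrow> 'b::euclidean_space" and F :: "'a \<Rightarrow> 'c::euclidean_space"
  assumes T: "linear T" "linear S" "\<And>x. S (T x) = x" "\<And>y. T (S y) = y"
    and d: "distr lborel borel S = lborel"
    and A: "open A" "continuous_on A F"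
  shows "set_integrable lebesgue A F \<longleftrightarrow> set_integrable lebesgue (T ` A) (\<lambda>y. F (S y))"
    "(LINT x:A|lebesgue. F x) = (LINT y:T ` A|lebesgue. F (S y))"
proof -
  have cS: "continuous_on B S" for B using T(2) linear_continuous_on linear_conv_bounded_linear by blast
  have img: "T ` A = S -` A" using T(3,4) by (auto simp: image_iff) (metis)
  have oT: "open (T ` A)" unfolding img using A(1) cS open_vimage by blast
  have cF: "continuous_on (T ` A) (\<lambda>y. F (S y))"
    by (rule continuous_on_compose2[OF A(2) cS]) (auto simp: T(3))
  have mS: "S \<in> borel_measurable borel" using cS borel_measurable_continuous_onI by blast
  note a = set_integrable_lebesgue_lborel[OF A] and b = set_integrable_lebesgue_lborel[OF oT cF]
  have eq: "indicator A (S y) *\<^sub>R F (S y) = indicator (T ` A) y *\<^sub>R F (S y)" for y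
    by (simp add: img indicator_def)
  show "set_integrable lebesgue A F \<longleftrightarrow> set_integrable lebesgue (T ` A) (\<lambda>y. F (S y))"
    unfolding a(2) b(2)
    using integrable_distr_eq[of S lborel borel "\<lambda>x. indicator A x *\<^sub>R F x"] mS a(1) d eq by simp
  show "(LINT x:A|lebesgue. F x) = (LINT y:T ` A|lebesgue. F (S y))"
    unfolding a(3) b(3)
    using integral_distr[of S lborel borel "\<lambda>x. indicator A x *\<^sub>R F x"] mS a(1) d eq by simp
qed

lemma change_of_variables_real_valued:
  fixes g :: "real^'m::{finite,wellorder} \<Rightarrow> real^'m::_" and f :: "real^'m::_ \<Rightarrow> real"
  assumes S: "S \<in> sets lebesgue"
    and der: "\<And>x. x \<in> S \<Longrightarrow> (g has_derivative g' x) (at x within S)" and inj: "inj_on g S"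
    and f: "set_integrable lebesgue (g ` S) f"
  shows "set_integrable lebesgue S (\<lambda>x. \<bar>det (matrix (g' x))\<bar> * f (g x)) \<and>
    (LINT x:S|lebesgue. \<bar>det (matrix (g' x))\<bar> * f (g x)) = (LINT x:g ` S|lebesgue. f x)"
proof -
  have v: "vec r = r *\<^sub>R (1 :: real^1)" for r by (simp add: vec_eq_iff)
  have bl: "bounded_linear (\<lambda>r. vec r :: real^1)" unfolding v by (rule bounded_linear_scaleR_left)
  have f1: "(\<lambda>x. vec (f x) :: real^1) absolutely_integrable_on (g ` S)"
    using absolutely_integrable_linear[OF f bl] by (simp add: o_def)
  have "(\<lambda>x. \<bar>det (matrix (g' x))\<bar> *\<^sub>R (vec (f (g x)) :: real^1)) absolutely_integrable_on S \<and>
      integral S (\<lambda>x. \<bar>det (matrix (g' x))\<bar> *\<^sub>R (vec (f (g x)) :: real^1)) = integral (g ` S) (\<lambda>x. vec (f x))"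
    using has_absolute_integral_change_of_variables[OF S der inj, of "\<lambda>x. vec (f x) :: real^1"] f1 by blast
  then have 1: "(\<lambda>x. vec (\<bar>det (matrix (g' x))\<bar> * f (g x)) :: real^1) absolutely_integrable_on S"
    and 2: "integral S (\<lambda>x. vec (\<bar>det (matrix (g' x))\<bar> * f (g x)) :: real^1) = integral (g ` S) (\<lambda>x. vec (f x))"
    by (simp_all add: v)
  have nb: "bounded_linear (\<lambda>y::real^1. y $ 1)" by (rule bounded_linear_vec_nth)
  have 3: "(\<lambda>x. \<bar>det (matrix (g' x))\<bar> * f (g x)) absolutely_integrable_on S"
    using absolutely_integrable_linear[OF 1 nb] by (simp add: o_def)
  have "integral S (\<lambda>x. \<bar>det (matrix (g' x))\<bar> * f (g x)) = integral S (\<lambda>x. vec (\<bar>det (matrix (g' x))\<bar> * f (g x)) :: real^1) $ 1"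
    using integral_linear[OF set_lebesgue_integral_eq_integral(1)[OF 1] nb] by (simp add: o_def)
  also have "\<dots> = integral (g ` S) f"
    unfolding 2 using integral_linear[OF set_lebesgue_integral_eq_integral(1)[OF f1] nb] by (simp add: o_def)
  finally show ?thesis using 3 f by (simp add: set_lebesgue_integral_eq_integral(2))
qed

text \<open>The change of variables formula is a statement about spaces of real vectors with a well-ordered index
  type. It is transported to \<open>complex^'n\<close> by an isometry. Only the properties that matter later are
  exported: multiplicativity, the value on homotheties, and the formula for integrals.\<close>

lemma exists_real_jacobian:
  "\<exists>J :: (complex^'n \<Rightarrow> complex^'n) \<Rightarrow> real.
     (\<forall>D E. linear D \<longrightarrow> linear E \<longrightarrow> J (\<lambda>x. D (E x)) = J D * J E) \<and> (\<forall>D. J D \<ge> 0) \<and>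
     (\<forall>r. J (\<lambda>v. r *\<^sub>R v) = \<bar>r\<bar> ^ (2 * CARD('n))) \<and>
     (\<forall>U s s' F. open U \<longrightarrow> open (s ` U) \<longrightarrow> (\<forall>x\<in>U. (s has_derivative s' x) (at x)) \<longrightarrow> inj_on s U \<longrightarrow>
        continuous_on (s ` U) F \<longrightarrow> continuous_on U (\<lambda>x. J (s' x)) \<longrightarrow>
        set_integrable lebesgue (s ` U) F \<longrightarrow>
        set_integrable lebesgue U (\<lambda>x. J (s' x) * F (s x)) \<and>
        (LINT x:U|lebesgue. J (s' x) * F (s x)) = (LINT x:s ` U|lebesgue. F x))"
proof -
  have "DIM(complex^'n) = DIM(real^('n bit0))" by simp
  from exists_lborel_transport[OF this]
  obtain T :: "complex^'n \<Rightarrow> real^('n bit0)" and S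
    where T: "linear T" "linear S" "\<And>x. S (T x) = x" "\<And>y. T (S y) = y"
      "distr lborel borel T = lborel" "distr lborel borel S = lborel" by blast
  define M where "M D = (\<lambda>y. T (D (S y)))" for D
  have linM: "linear (M D)" if "linear D" for D
    unfolding M_def using linear_compose[OF linear_compose[OF T(2) that] T(1)] by (simp add: o_def)
  define J where "J D = \<bar>det (matrix (M D))\<bar>" for D
  have 1: "J (\<lambda>x. D (E x)) = J D * J E" if "linear D" "linear E" for D E
  proof -
    have "M (\<lambda>x. D (E x)) = M D \<circ> M E" by (auto simp: M_def T)
    then show ?thesis using matrix_compose[OF linM[OF that(2)] linM[OF that(1)]]
      by (simp add: J_def det_mul abs_mult)
  qed
  have 2: "J (\<lambda>v. r *\<^sub>R v) = \<bar>r\<bar> ^ (2 * CARD('n))" for r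
  proof -
    have "M (\<lambda>v. r *\<^sub>R v) = (\<lambda>y. r *\<^sub>R y)" by (simp add: M_def linear_scale[OF T(1)] T)
    moreover have "matrix (\<lambda>y::real^('n bit0). r *\<^sub>R y) = r *\<^sub>R mat 1"
      by (simp add: matrix_def vec_eq_iff axis_def mat_def)
    moreover have "det (r *\<^sub>R mat 1 :: real^('n bit0)^('n bit0)) = r ^ (2 * CARD('n))"
      by (subst det_diagonal) (auto simp: mat_def)
    ultimately show ?thesis by (simp add: J_def power_abs)
  qed
  have bT: "bounded_linear T" "bounded_linear S" using T linear_conv_bounded_linear by blast+
  have 3: "set_integrable lebesgue U (\<lambda>x. J (s' x) * F (s x)) \<and>
        (LINT x:U|lebesgue. J (s' x) * F (s x)) = (LINT x:s ` U|lebesgue. F x)"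
    if a: "open U" "open (s ` U)" "\<forall>x\<in>U. (s has_derivative s' x) (at x)" "inj_on s U"
      "continuous_on (s ` U) F" "continuous_on U (\<lambda>x. J (s' x))" "set_integrable lebesgue (s ` U) F" for U s s' F
  proof -
    define g where "g y = T (s (S y))" for y
    define g' where "g' y = M (s' (S y))" for y
    have img: "T ` U = S -` U" using T(3,4) by (auto simp: image_iff) (metis)
    have cS: "continuous_on B S" for B using T(2) linear_continuous_on linear_conv_bounded_linear by blast
    have oT: "open (T ` U)" unfolding img using a(1) cS open_vimage by blast
    have gi: "g ` (T ` U) = T ` (s ` U)" by (simp add: image_image g_def T)
    have der: "(g has_derivative g' y) (at y within T ` U)" if y: "y \<in> T ` U" for y
    proof -
      have "S y \<in> U" using y img by auto
      then have "(s has_derivative s' (S y)) (at (S y))" using a(3) by blast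
      from has_derivative_compose[OF bounded_linear_imp_has_derivative[OF bT(2)] this]
      have "((\<lambda>y. s (S y)) has_derivative (\<lambda>v. s' (S y) (S v))) (at y)" .
      from bounded_linear.has_derivative[OF bT(1) this]
      show ?thesis unfolding g_def g'_def M_def using has_derivative_at_withinI by blast
    qed
    have inj: "inj_on g (T ` U)"
    proof (rule inj_onI)
      fix x y assume "x \<in> T ` U" "y \<in> T ` U" "g x = g y"
      then have "S x \<in> U" "S y \<in> U" "s (S x) = s (S y)" unfolding g_def img by (auto, metis T(3))
      then have "S x = S y" using a(4) by (meson inj_onD)
      then show "x = y" by (metis T(4))
    qed
    have f: "set_integrable lebesgue (g ` (T ` U)) (\<lambda>y. F (S y))"
      unfolding gi using transport_set_integral(1)[OF T(1-4) T(6) a(2,5)] a(7) by blast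
    have "T ` U \<in> sets lebesgue" using oT by auto
    from change_of_variables_real_valued[OF this der inj f]
    have c: "set_integrable lebesgue (T ` U) (\<lambda>y. J (s' (S y)) * F (s (S y)))"
      "(LINT y:T ` U|lebesgue. J (s' (S y)) * F (s (S y))) = (LINT y:T ` (s ` U)|lebesgue. F (S y))"
      unfolding gi by (simp_all add: g_def g'_def J_def T)
    have cs: "continuous_on U s"
      using a(3) has_derivative_continuous continuous_at_imp_continuous_on by blast
    have cF: "continuous_on U (\<lambda>x. J (s' x) * F (s x))"
      by (intro continuous_on_mult a(6) continuous_on_compose2[OF a(5) cs]) auto
    show ?thesis
      using transport_set_integral[OF T(1-4) T(6) a(1) cF] transport_set_integral(2)[OF T(1-4) T(6) a(2,5)] c by simp
  qed
  show ?thesis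
    by (rule exI[of _ J]) (use 1 2 3 J_def in auto)
qed

text \<open>The absolute value of the real determinant of a real linear endomorphism of \<open>complex^'n\<close>.\<close>

definition rjac :: "(complex^'n \<Rightarrow> complex^'n) \<Rightarrow> real" where
  "rjac = (SOME J.
     (\<forall>D E. linear D \<longrightarrow> linear E \<longrightarrow> J (\<lambda>x. D (E x)) = J D * J E) \<and> (\<forall>D. J D \<ge> 0) \<and>
     (\<forall>r. J (\<lambda>v. r *\<^sub>R v) = \<bar>r\<bar> ^ (2 * CARD('n))) \<and>
     (\<forall>U s s' F. open U \<longrightarrow> open (s ` U) \<longrightarrow> (\<forall>x\<in>U. (s has_derivative s' x) (at x)) \<longrightarrow> inj_on s U \<longrightarrow>
        continuous_on (s ` U) F \<longrightarrow> continuous_on U (\<lambda>x. J (s' x)) \<longrightarrow>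
        set_integrable lebesgue (s ` U) F \<longrightarrow>
        set_integrable lebesgue U (\<lambda>x. J (s' x) * F (s x)) \<and>
        (LINT x:U|lebesgue. J (s' x) * F (s x)) = (LINT x:s ` U|lebesgue. F x)))"

lemmas rjac_spec = someI_ex[OF exists_real_jacobian, folded rjac_def]

lemma rjac_mult: "linear D \<Longrightarrow> linear E \<Longrightarrow> rjac (\<lambda>x. D (E x)) = rjac D * rjac E"
  using rjac_spec by blast

lemma rjac_nonneg: "rjac D \<ge> 0"
  using rjac_spec by blast

lemma rjac_scale: "rjac (\<lambda>v::complex^'n. r *\<^sub>R v) = \<bar>r\<bar> ^ (2 * CARD('n))"
  using rjac_spec by blast

lemma rjac_id: "rjac (\<lambda>v. v) = 1"
  using rjac_scale[of 1] by simp

lemma rjac_change_of_variables: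
  fixes F :: "complex^'n \<Rightarrow> real"
  assumes "open U" "open (s ` U)" "\<And>x. x \<in> U \<Longrightarrow> (s has_derivative s' x) (at x)" "inj_on s U"
    "continuous_on (s ` U) F" "continuous_on U (\<lambda>x. rjac (s' x))" "set_integrable lebesgue (s ` U) F"
  shows "set_integrable lebesgue U (\<lambda>x. rjac (s' x) * F (s x))"
    "(LINT x:U|lebesgue. rjac (s' x) * F (s x)) = (LINT x:s ` U|lebesgue. F x)"
  using rjac_spec assms by blast+

definition diagk :: "'n \<Rightarrow> complex \<Rightarrow> complex^'n^'n" where
  "diagk k a = (\<chi> i j. if i = j then if i = k then a else 1 else 0)"

text \<open>Elementary matrices that add multiples of row \<open>k\<close> to the other rows when multiplied from the left.
  Together with their transposes \<open>rowop\<close> and the diagonal matrices \<open>diagk\<close> they generate the general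
  linear group.\<close>

definition colop :: "'n \<Rightarrow> ('n \<Rightarrow> complex) \<Rightarrow> complex^'n^'n" where
  "colop k c = (\<chi> i j. if i = j then 1 else if j = k then c i else 0)"

definition rowop :: "'n \<Rightarrow> ('n \<Rightarrow> complex) \<Rightarrow> complex^'n^'n" where
  "rowop k c = (\<chi> i j. if i = j then 1 else if i = k then c j else 0)"

lemma diagk_left: "(diagk k a ** X) $ i $ j = (if i = k then a else 1) * X $ i $ j"
proof -
  have "(diagk k a ** X) $ i $ j = (\<Sum>l\<in>UNIV. if l = i then (if i = k then a else 1) * X $ l $ j else 0)"
    unfolding matrix_matrix_mult_def diagk_def vec_lambda_beta by (rule sum.cong) auto
  then show ?thesis by simp
qed

lemma diagk_right: "(X ** diagk k a) $ i $ j = X $ i $ j * (if j = k then a else 1)"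
proof -
  have "(X ** diagk k a) $ i $ j = (\<Sum>l\<in>UNIV. if l = j then X $ i $ l * (if j = k then a else 1) else 0)"
    unfolding matrix_matrix_mult_def diagk_def vec_lambda_beta by (rule sum.cong) auto
  then show ?thesis by simp
qed

lemma colop_left: "(colop k c ** X) $ i $ j = X $ i $ j + (if i = k then 0 else c i * X $ k $ j)"
proof -
  have "(colop k c ** X) $ i $ j = (\<Sum>l\<in>UNIV. (if l = i then X $ l $ j else 0) + (if l = k then if i = k then 0 else c i * X $ l $ j else 0))"
    unfolding matrix_matrix_mult_def colop_def vec_lambda_beta by (rule sum.cong) auto
  then show ?thesis by (simp add: sum.distrib)
qed

lemma rowop_right: "(X ** rowop k c) $ i $ j = X $ i $ j + (if j = k then 0 else X $ i $ k * c j)"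
proof -
  have "(X ** rowop k c) $ i $ j = (\<Sum>l\<in>UNIV. (if l = j then X $ i $ l else 0) + (if l = k then if j = k then 0 else X $ i $ l * c j else 0))"
    unfolding matrix_matrix_mult_def rowop_def vec_lambda_beta by (rule sum.cong) auto
  then show ?thesis by (simp add: sum.distrib)
qed

lemma invertible_diagk: "a \<noteq> 0 \<Longrightarrow> invertible (diagk k a)"
  unfolding invertible_def
  by (rule exI[of _ "diagk k (1/a)"]) (auto simp: vec_eq_iff diagk_left, auto simp: diagk_def mat_def)

lemma invertible_colop: "invertible (colop k c)"
  unfolding invertible_def
  by (rule exI[of _ "colop k (\<lambda>i. - c i)"]) (auto simp: vec_eq_iff colop_left, auto simp: colop_def mat_def)

lemma invertible_rowop: "invertible (rowop k c)"
  unfolding invertible_def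
  by (rule exI[of _ "rowop k (\<lambda>i. - c i)"]) (auto simp: vec_eq_iff rowop_right, auto simp: rowop_def mat_def)

lemma invertible_mult_iff: "invertible ((A :: complex^'n^'n) ** (B :: complex^'n^'n)) \<longleftrightarrow> invertible A \<and> invertible B"
  by (simp add: invertible_det_nz det_mul)

lemma det_diagk: "det (diagk k a) = a"
proof -
  have "det (diagk k a) = (\<Prod>i\<in>UNIV. if i = k then a else 1)"
    by (subst det_diagonal) (auto simp: diagk_def)
  then show ?thesis by simp
qed

text \<open>Conjugation by a diagonal matrix turns a unipotent \<open>e\<close> into \<open>e\<^sup>2\<close>, therefore \<open>Q e = (Q e)\<^sup>2\<close>.\<close>

lemma multiplicative_unipotent:
  fixes Q :: "complex^'n^'n \<Rightarrow> 'b::field"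
  assumes mult: "\<And>A B. invertible A \<Longrightarrow> invertible B \<Longrightarrow> Q (A ** B) = Q A * Q B"
    and nz: "\<And>A. invertible A \<Longrightarrow> Q A \<noteq> 0"
  shows "Q (colop k c) = 1" "Q (rowop k c) = 1"
proof -
  have e1: "colop k c ** colop k c = colop k (\<lambda>i. 2 * c i)"
    by (auto simp: vec_eq_iff colop_left, auto simp: colop_def)
  have e2: "diagk k (1/2) ** colop k c = colop k (\<lambda>i. 2 * c i) ** diagk k (1/2)"
    by (auto simp: vec_eq_iff diagk_left diagk_right colop_def)
  have "Q (colop k c) = Q (colop k (\<lambda>i. 2 * c i))"
    using arg_cong[OF e2, of Q] by (simp add: mult nz invertible_colop invertible_diagk)
  then have "Q (colop k c) * Q (colop k c) = Q (colop k c)"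
    using arg_cong[OF e1, of Q] by (simp add: mult invertible_colop)
  then show "Q (colop k c) = 1" using nz[OF invertible_colop] by simp
  have e1: "rowop k c ** rowop k c = rowop k (\<lambda>i. 2 * c i)"
    by (auto simp: vec_eq_iff rowop_right, auto simp: rowop_def)
  have e2: "diagk k 2 ** rowop k c = rowop k (\<lambda>i. 2 * c i) ** diagk k 2"
    by (auto simp: vec_eq_iff diagk_left diagk_right rowop_def)
  have "Q (rowop k c) = Q (rowop k (\<lambda>i. 2 * c i))"
    using arg_cong[OF e2, of Q] by (simp add: mult nz invertible_rowop invertible_diagk)
  then have "Q (rowop k c) * Q (rowop k c) = Q (rowop k c)"
    using arg_cong[OF e1, of Q] by (simp add: mult invertible_rowop)
  then show "Q (rowop k c) = 1" using nz[OF invertible_rowop] by simp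
qed

text \<open>Gaussian elimination: a multiplicative function is determined by its values on diagonal matrices.
  The induction is over the set of indices outside of which the matrix agrees with the identity.
  It gives determinant identities without expanding determinants.\<close>

lemma multiplicative_GL_trivial:
  fixes Q :: "complex^'n^'n \<Rightarrow> 'b::field"
  assumes mult: "\<And>A B. invertible A \<Longrightarrow> invertible B \<Longrightarrow> Q (A ** B) = Q A * Q B"
    and nz: "\<And>A. invertible A \<Longrightarrow> Q A \<noteq> 0"
    and diag: "\<And>k a. a \<noteq> 0 \<Longrightarrow> Q (diagk k a) = 1"
    and A: "invertible A"
  shows "Q A = 1"
proof -
  note col = multiplicative_unipotent(1)[of Q, OF mult nz]
  note row = multiplicative_unipotent(2)[of Q, OF mult nz]
  define del where "del i j = (if i = j then 1 else 0 :: complex)" for i j :: 'n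
  have "\<forall>A. invertible A \<longrightarrow> (\<forall>i j. i \<notin> S \<or> j \<notin> S \<longrightarrow> A $ i $ j = del i j) \<longrightarrow> Q A = 1" for S :: "'n set"
  proof (induction S rule: finite_induct[OF finite])
    case 1
    have "Q A = 1" if "invertible A" "\<forall>i j. A $ i $ j = del i j" for A
    proof -
      have "A = mat 1" using that(2) by (simp add: vec_eq_iff mat_def del_def)
      then have "A ** A = A" by simp
      then show ?thesis using mult[OF that(1) that(1)] nz[OF that(1)] by simp
    qed
    then show ?case by simp
  next
    case (2 k S)
    have pivot: "Q A = 1" if inv: "invertible A" and out: "\<And>i j. i \<notin> insert k S \<or> j \<notin> insert k S \<Longrightarrow> A $ i $ j = del i j"
      and akk: "A $ k $ k \<noteq> 0" for A
    proof -
      define a where "a = A $ k $ k"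
      define B where "B = (\<chi> i j. if i = k \<or> j = k then del i j else A $ i $ j - A $ i $ k * A $ k $ j / a)"
      have eq: "colop k (\<lambda>i. A $ i $ k / a) ** (diagk k a ** B) ** rowop k (\<lambda>j. A $ k $ j / a) = A"
        using akk by (auto simp: vec_eq_iff rowop_right colop_left diagk_left B_def del_def a_def)
      have inv': "invertible (colop k (\<lambda>i. A $ i $ k / a) ** (diagk k a ** B) ** rowop k (\<lambda>j. A $ k $ j / a))"
        unfolding eq by (rule inv)
      have invs: "invertible (diagk k a ** B)" "invertible B" "invertible (colop k (\<lambda>i. A $ i $ k / a) ** (diagk k a ** B))"
        using inv' by (simp_all only: invertible_mult_iff)
      have "Q B = 1"
      proof (rule "2.IH"[rule_format, OF invs(2)])
        fix i j assume "i \<notin> S \<or> j \<notin> S"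
        then show "B $ i $ j = del i j" using out by (auto simp: B_def del_def)
      qed
      moreover have "Q A = Q (colop k (\<lambda>i. A $ i $ k / a)) * (Q (diagk k a) * Q B) * Q (rowop k (\<lambda>j. A $ k $ j / a))"
      proof -
        have "a \<noteq> 0" using akk a_def by simp
        then show ?thesis
          using arg_cong[OF eq, of Q] mult[OF invs(3) invertible_rowop] mult[OF invertible_colop invs(1)]
            mult[OF invertible_diagk invs(2)] by metis
      qed
      ultimately show ?thesis using col row diag akk a_def by simp
    qed
    have "Q A = 1" if inv: "invertible A" and out: "\<And>i j. i \<notin> insert k S \<or> j \<notin> insert k S \<Longrightarrow> A $ i $ j = del i j" for A
    proof (cases "A $ k $ k = 0")
      case True
      have "column k A \<noteq> 0"
        using inv det_zero_column[of k A] by (auto simp: invertible_det_nz)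
      then obtain i where i: "A $ i $ k \<noteq> 0" by (auto simp: column_def vec_eq_iff)
      have ik: "i \<noteq> k" using True i by auto
      then have iS: "i \<in> S" using out[of i k] i by (auto simp: del_def)
      \<comment> \<open>Adding row \<open>i\<close> to row \<open>k\<close> makes the pivot nonzero.\<close>
      define A' where "A' = colop i (\<lambda>l. if l = k then 1 else 0) ** A"
      have "Q A' = 1"
      proof (rule pivot)
        show "invertible A'" using inv by (simp add: A'_def invertible_mult_iff invertible_colop)
        show "A' $ k $ k \<noteq> 0" using i ik True by (simp add: A'_def colop_left)
        fix i' j assume "i' \<notin> insert k S \<or> j \<notin> insert k S"
        then show "A' $ i' $ j = del i' j"
          using out[of i' j] out[of i j] iS by (auto simp: A'_def colop_left del_def)
      qed
      then show ?thesis using mult[OF invertible_colop inv] col by (simp add: A'_def)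
    next
      case False
      show ?thesis
      proof (rule pivot[OF inv])
        fix i j assume "i \<notin> insert k S \<or> j \<notin> insert k S"
        then show "A $ i $ j = del i j" by (rule out)
      qed (rule False)
    qed
    then show ?case by blast
  qed
  from this[of UNIV] show ?thesis using A by simp
qed

lemma linear_matrix_complex: "linear (\<lambda>v. (A::complex^'n^'n) *v v)"
  by (rule linearI)
    (simp_all add: vec_eq_iff matrix_vector_mult_def scaleR_sum_right distrib_left sum.distrib)

text \<open>Conjugating by the complex conjugation of one coordinate replaces \<open>a\<close> by \<open>cnj a\<close>, so the value is the
  square root of the value at the positive number \<open>cnj a * a\<close>. The \<open>n\<close> coordinates contribute equally by
  permutation, and together they form a homothety.\<close>

lemma rjac_diagk:
  "rjac (\<lambda>v. diagk k a *v v) = (cmod a)\<^sup>2"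
proof -
  \<comment> \<open>\<open>d\<close> scales the coordinates in \<open>S\<close>, \<open>c\<close> conjugates the coordinate \<open>k\<close>, \<open>w\<close> exchanges two coordinates.\<close>
  define d where "d S (r::complex) v = (\<chi> i. if i \<in> S then r * v $ i else v $ i)" for S r and v :: "complex^'a"
  define c where "c v = (\<chi> i. if i = k then cnj (v $ i) else v $ i)" for v :: "complex^'a"
  define w where "w l v = (\<chi> i. v $ (Transposition.transpose k l i))" for l and v :: "complex^'a"
  have lin: "linear (d S r)" "linear c" "linear (w l)" for S r l
    unfolding d_def c_def w_def by (auto intro!: linearI simp: vec_eq_iff distrib_left)
  have diag: "diagk k a *v v = d {k} a v" for a and v :: "complex^'a"
  proof -
    have "(diagk k a *v v) $ i = (\<Sum>j\<in>UNIV. if j = i then (if i = k then a else 1) * v $ j else 0)" for i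
      unfolding matrix_vector_mult_def diagk_def vec_lambda_beta by (rule sum.cong) auto
    then show ?thesis by (simp add: vec_eq_iff d_def)
  qed
  have cc: "rjac c * rjac c = 1"
  proof -
    have "(\<lambda>v. c (c v)) = (\<lambda>v. v)" by (simp add: c_def vec_eq_iff fun_eq_iff)
    then show ?thesis using rjac_mult[OF lin(2,2)] rjac_id by metis
  qed
  have conj: "rjac (d {k} (cnj a)) = rjac (d {k} a)"
  proof -
    have "(\<lambda>v. c (d {k} a (c v))) = d {k} (cnj a)" by (auto simp: c_def d_def vec_eq_iff fun_eq_iff)
    then have "rjac (d {k} (cnj a)) = rjac c * (rjac (d {k} a) * rjac c)"
      using rjac_mult[OF lin(2) linear_compose[OF lin(2) lin(1)[of "{k}" a]]] rjac_mult[OF lin(1)[of "{k}" a] lin(2)]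
      unfolding o_def by metis
    then show ?thesis using cc by (simp add: mult.commute mult.left_commute)
  qed
  define r where "r = (cmod a)\<^sup>2"
  have rr: "a * cnj a = of_real r" unfolding r_def by (rule complex_norm_square[symmetric])
  have "(\<lambda>v. d {k} a (d {k} (cnj a) v)) = d {k} (of_real r)"
    by (auto simp: d_def vec_eq_iff fun_eq_iff mult.assoc[symmetric] rr)
  then have sq: "rjac (d {k} a) * rjac (d {k} a) = rjac (d {k} (of_real r))"
    using rjac_mult[OF lin(1) lin(1), of "{k}" a "{k}" "cnj a"] conj by simp
  have ww: "rjac (w l) * rjac (w l) = 1" for l
  proof -
    have "(\<lambda>v. w l (w l v)) = (\<lambda>v. v)" by (auto simp: w_def vec_eq_iff)
    then show ?thesis using rjac_mult[OF lin(3,3)] rjac_id by metis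
  qed
  have same: "rjac (d {l} (of_real r)) = rjac (d {k} (of_real r))" for l
  proof -
    have "(\<lambda>v. w l (d {k} (of_real r) (w l v))) = d {l} (of_real r)"
      by (auto simp: w_def d_def vec_eq_iff fun_eq_iff Transposition.transpose_def)
    then have "rjac (d {l} (of_real r)) = rjac (w l) * (rjac (d {k} (of_real r)) * rjac (w l))"
      using rjac_mult[OF lin(3)[of l] linear_compose[OF lin(3)[of l] lin(1)[of "{k}" "of_real r"]]]
        rjac_mult[OF lin(1)[of "{k}" "of_real r"] lin(3)[of l]]
      unfolding o_def by metis
    then show ?thesis using ww[of l] by (simp add: mult.commute mult.left_commute)
  qed
  have "rjac (d S (of_real r)) = rjac (d {k} (of_real r)) ^ card S" for S
  proof (induction S rule: finite_induct[OF finite])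
    case 1
    have "d {} (of_real r) = (\<lambda>v. v)" by (auto simp: d_def vec_eq_iff fun_eq_iff)
    then show ?case by (simp add: rjac_id)
  next
    case (2 l S)
    have "(\<lambda>v. d {l} (of_real r) (d S (of_real r) v)) = d (insert l S) (of_real r)"
      using 2 by (auto simp: d_def vec_eq_iff fun_eq_iff)
    then have "rjac (d (insert l S) (of_real r)) = rjac (d {l} (of_real r)) * rjac (d S (of_real r))"
      using rjac_mult[OF lin(1) lin(1)] by metis
    then show ?case using 2 same by simp
  qed
  from this[of UNIV] have "rjac (d UNIV (of_real r)) = rjac (d {k} (of_real r)) ^ CARD('a)" by simp
  moreover have "d UNIV (of_real r) = (\<lambda>v. r *\<^sub>R v)"
    by (simp add: d_def vec_eq_iff fun_eq_iff) (simp add: scaleR_conv_of_real)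
  moreover have "rjac (\<lambda>v::complex^'a. r *\<^sub>R v) = (r^2) ^ CARD('a)"
    using rjac_scale[of r, where 'n = 'a] by (simp only: power_mult power2_abs)
  ultimately have "rjac (d {k} (of_real r)) ^ CARD('a) = (r^2) ^ CARD('a)"
    by metis
  then have "rjac (d {k} (of_real r)) = r^2"
    by (rule power_eq_imp_eq_base) (simp_all add: rjac_nonneg)
  then have "(rjac (d {k} a))^2 = r^2" using sq by (simp add: power2_eq_square)
  then have "rjac (d {k} a) = r"
    by (rule power2_eq_imp_eq) (simp_all add: r_def rjac_nonneg)
  moreover have "(\<lambda>v. diagk k a *v v) = d {k} a" using diag by blast
  ultimately show ?thesis by (simp add: r_def)
qed

text \<open>Both sides are multiplicative and agree on diagonal matrices.\<close>

theorem rjac_matrix: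
  assumes "invertible (A :: complex^'n^'n)"
  shows "rjac (\<lambda>v. A *v v) = (cmod (det A))\<^sup>2"
proof -
  define Q where "Q A = rjac (\<lambda>v. A *v v) / (cmod (det A))\<^sup>2" for A :: "complex^'n^'n"
  have m: "rjac (\<lambda>v. (A ** B) *v v) = rjac (\<lambda>v. A *v v) * rjac (\<lambda>v. B *v v)" for A B :: "complex^'n^'n"
    using rjac_mult[OF linear_matrix_complex linear_matrix_complex, of A B] by (simp add: matrix_vector_mul_assoc)
  have pos: "rjac (\<lambda>v. A *v v) > 0" if inv: "invertible A" for A :: "complex^'n^'n"
  proof -
    obtain B :: "complex^'n^'n" where B: "A ** B = mat 1" using inv unfolding invertible_def by blast
    have "rjac (\<lambda>v. (mat 1 :: complex^'n^'n) *v v) = 1" using rjac_id by simp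
    then have "rjac (\<lambda>v. A *v v) * rjac (\<lambda>v. B *v v) = 1" using m[of A B] B by simp
    then show ?thesis using rjac_nonneg[of "\<lambda>v. A *v v"] by (cases "rjac (\<lambda>v. A *v v) = 0") auto
  qed
  have "Q A = 1"
  proof (rule multiplicative_GL_trivial[OF _ _ _ assms])
    show "Q (A ** B) = Q A * Q B" for A B by (simp add: Q_def m det_mul norm_mult power_mult_distrib)
    show "Q A \<noteq> 0" if "invertible A" for A using pos[OF that] that by (simp add: Q_def invertible_det_nz)
    show "Q (diagk k a) = 1" if "a \<noteq> 0" for k a
      using that by (simp add: Q_def rjac_diagk det_diagk)
  qed
  then show ?thesis using assms by (simp add: Q_def invertible_det_nz)
qed

section \<open>Limits and mean values of holomorphic functions\<close>

lemma mholomorphic_continuous_on: "f mholomorphic_on U \<Longrightarrow> continuous_on U f"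
  by (meson continuous_at_imp_continuous_on differentiable_imp_continuous_within mholomorphic_differentiable)

lemma norm_axis_complex: "norm (axis i t :: complex^'n) = cmod t"
  by (simp add: norm_vec_def L2_set_def axis_def if_distrib[of cmod] if_distrib[of "\<lambda>x. x\<^sup>2"] cong: if_cong)

text \<open>Weierstrass in one variable gives separate holomorphy of the limit, and Osgood does the rest.\<close>

lemma mholomorphic_uniform_limit:
  assumes U: "open U" and F: "\<And>n. F n mholomorphic_on U"
    and lim: "\<And>p. p \<in> U \<Longrightarrow> \<exists>r>0. uniform_limit (ball p r) F f sequentially"
  shows "f mholomorphic_on U"
proof (rule osgood[OF U])
  show "sep_hol U f" unfolding sep_hol_def
  proof (intro ballI allI)
    fix z i assume z: "z \<in> U"
    obtain r where r: "r > 0" "uniform_limit (ball z r) F f sequentially" using lim[OF z] by blast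
    obtain s where s: "s > 0" "ball z s \<subseteq> U" using U z open_contains_ball by blast
    define e where "e = min r s"
    have e: "e > 0" using r s by (simp add: e_def)
    have na: "norm (axis i t :: complex^'a) = cmod t" for t by (rule norm_axis_complex)
    have ul: "uniform_limit (ball 0 e) (\<lambda>n t. F n (z + axis i t)) (\<lambda>t. f (z + axis i t)) sequentially"
    proof (rule uniform_limitI)
      fix d :: real assume "d > 0"
      from uniform_limitD[OF r(2) this]
      show "\<forall>\<^sub>F n in sequentially. \<forall>x\<in>ball 0 e. dist (F n (z + axis i x)) (f (z + axis i x)) < d"
      proof (rule eventually_mono)
        fix n assume a: "\<forall>x\<in>ball z r. dist (F n x) (f x) < d"
        show "\<forall>x\<in>ball 0 e. dist (F n (z + axis i x)) (f (z + axis i x)) < d"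
        proof
          fix x :: complex assume "x \<in> ball 0 e"
          then have "z + axis i x \<in> ball z r" by (simp add: mem_ball dist_norm na e_def)
          then show "dist (F n (z + axis i x)) (f (z + axis i x)) < d" using a by blast
        qed
      qed
    qed
    have hol: "(\<lambda>t. F n (z + axis i t)) holomorphic_on ball 0 e" for n
      unfolding holomorphic_on_open[OF open_ball]
    proof
      fix t :: complex assume "t \<in> ball 0 e"
      then have "z + axis i t \<in> ball z s" by (simp add: mem_ball dist_norm na e_def)
      then have zt: "z + axis i t \<in> U" using s by blast
      have "(\<lambda>h. F n (z + axis i t + axis i h)) field_differentiable (at 0)"
        using mholomorphic_sep_hol(1)[OF U F[of n]] zt unfolding sep_hol_def by blast
      then obtain D where "((\<lambda>h. F n (z + axis i t + axis i h)) has_field_derivative D) (at 0)"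
        unfolding field_differentiable_def by blast
      then have "((\<lambda>h. F n (z + axis i (h + t))) has_field_derivative D) (at 0)"
        by (simp add: axis_add add_ac)
      then show "\<exists>f'. ((\<lambda>t. F n (z + axis i t)) has_field_derivative f') (at t)"
        using DERIV_shift[of "\<lambda>t. F n (z + axis i t)" D 0 t] by auto
    qed
    have "(\<lambda>t. f (z + axis i t)) holomorphic_on ball 0 e"
    proof (rule holomorphic_uniform_sequence[OF open_ball hol])
      fix x :: complex assume "x \<in> ball 0 e"
      then obtain d where "d > 0" "cball x d \<subseteq> ball 0 e" using open_ball open_contains_cball by blast
      then show "\<exists>d>0. cball x d \<subseteq> ball 0 e \<and> uniform_limit (cball x d) (\<lambda>n t. F n (z + axis i t)) (\<lambda>t. f (z + axis i t)) sequentially"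
        using uniform_limit_on_subset[OF ul] by blast
    qed
    then show "(\<lambda>t. f (z + axis i t)) field_differentiable at 0"
      using e holomorphic_on_imp_differentiable_at[of _ "ball 0 e" 0] by simp
  qed
  show "loc_bdd U f" unfolding loc_bdd_def
  proof
    fix p assume p: "p \<in> U"
    obtain r where r: "r > 0" "uniform_limit (ball p r) F f sequentially" using lim[OF p] by blast
    obtain n where n: "\<forall>x\<in>ball p r. dist (F n x) (f x) < 1"
      using eventually_happens'[OF sequentially_bot uniform_limitD[OF r(2) zero_less_one]] by blast
    have "\<exists>r>0. \<exists>M. \<forall>x\<in>polydisc p r. cmod (F n x) \<le> M"
      using mholomorphic_sep_hol(2)[OF U F[of n]] p unfolding loc_bdd_def by blast
    then obtain s M where s: "s > 0" "\<forall>x\<in>polydisc p s. cmod (F n x) \<le> M" by blast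
    obtain q where q: "q > 0" "polydisc p q \<subseteq> ball p r" using polydisc_subset_open[OF open_ball, of p p r] r by auto
    have "cmod (f x) \<le> M + 1" if x: "x \<in> polydisc p (min q s)" for x
    proof -
      have "x \<in> polydisc p q" "x \<in> polydisc p s" using x polydisc_mono[of "min q s" q p] polydisc_mono[of "min q s" s p] by auto
      then have "dist (F n x) (f x) < 1" "cmod (F n x) \<le> M" using n q s by blast+
      then show ?thesis using norm_triangle_ineq2[of "f x" "F n x"] by (simp add: dist_norm norm_minus_commute)
    qed
    then show "\<exists>r>0. \<exists>M. \<forall>x\<in>polydisc p r. cmod (f x) \<le> M" using q s by (intro exI[of _ "min q s"]) auto
  qed
qed

lemma rjac_scalar:
  assumes "cmod u = 1"
  shows "rjac (\<lambda>v::complex^'n. u *s v) = 1"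
proof -
  have u: "u \<noteq> 0" using assms by auto
  have d: "det (mat u :: complex^'n^'n) = u ^ CARD('n)"
    by (subst det_diagonal) (auto simp: mat_def)
  have "invertible (mat u :: complex^'n^'n)" using u d by (simp add: invertible_det_nz)
  from rjac_matrix[OF this]
  have "rjac (\<lambda>v. (mat u :: complex^'n^'n) *v v) = 1" using assms d by (simp add: norm_power)
  moreover have "(mat u :: complex^'n^'n) *v v = u *s v" for v
  proof -
    have "((mat u :: complex^'n^'n) *v v) $ i = (\<Sum>j\<in>UNIV. if j = i then u * v $ j else 0)" for i
      unfolding matrix_vector_mult_def mat_def vec_lambda_beta by (rule sum.cong) auto
    then show ?thesis by (simp add: vec_eq_iff)
  qed
  ultimately show ?thesis by simp
qed

lemma norm_scalar: "norm (u *s (v::complex^'n)) = cmod u * norm v"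
  by (simp add: norm_vec_def norm_mult L2_set_right_distrib)

lemma linear_scalar: "linear (\<lambda>v::complex^'n. u *s v)"
  by (rule linearI) (simp_all add: vec_eq_iff distrib_left)

lemma set_integrable_ball:
  assumes "f mholomorphic_on U" "cball p r \<subseteq> U"
  shows "set_integrable lebesgue (ball p r) (\<lambda>z. (cmod (f z))\<^sup>2)"
proof -
  have c: "continuous_on (cball p r) (\<lambda>z. (cmod (f z))\<^sup>2)"
    by (intro continuous_intros continuous_on_subset[OF mholomorphic_continuous_on[OF assms(1)] assms(2)])
  have "set_integrable lebesgue (cball p r) (\<lambda>z. (cmod (f z))\<^sup>2)"
    using borel_integrable_compact[OF compact_cball c]
    by (simp add: set_integrable_def integrable_completion)
  then show ?thesis by (rule set_integrable_subset) auto
qed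

text \<open>Cauchy integral formula on the unit circle, parametrised by the unit interval.\<close>

lemma circle_mean_value_le:
  assumes g: "g holomorphic_on cball 0 1"
  shows "cmod (g 0) \<le> integral {0..1} (\<lambda>t. cmod (g (exp (2 * of_real pi * \<i> * of_real t))))"
proof -
  define e where "e t = exp (2 * of_real pi * \<i> * of_real t)" for t :: real
  have ce: "circlepath 0 1 t = e t" for t by (simp add: circlepath e_def)
  have ne: "cmod (e t) = 1" for t by (simp add: e_def norm_exp_eq_Re)
  have ce': "continuous_on {0..1} (\<lambda>t. g (e t))"
    by (rule continuous_on_compose2[OF holomorphic_on_imp_continuous_on[OF g]])
      (auto simp: e_def norm_exp_eq_Re intro!: continuous_intros)
  have "((\<lambda>u. g u / (u - 0)) has_contour_integral (2 * of_real pi * \<i> * g 0)) (circlepath 0 1)"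
    by (rule Cauchy_integral_circlepath_simple[OF g]) simp
  then have "((\<lambda>t. g (e t) / e t * vector_derivative (circlepath 0 1) (at t within {0..1})) has_integral (2 * of_real pi * \<i> * g 0)) {0..1}"
    unfolding has_contour_integral_def by (simp add: ce)
  then have "((\<lambda>t. (2 * of_real pi * \<i>) * g (e t)) has_integral (2 * of_real pi * \<i> * g 0)) {0..1}"
    by (rule has_integral_eq[rotated]) (auto simp: vector_derivative_circlepath01 e_def[symmetric], simp add: e_def)
  then have "((\<lambda>t. 1 / (2 * of_real pi * \<i>) * ((2 * of_real pi * \<i>) * g (e t))) has_integral 1 / (2 * of_real pi * \<i>) * (2 * of_real pi * \<i> * g 0)) {0..1}"
    by (rule has_integral_mult_right)
  then have I: "((\<lambda>t. g (e t)) has_integral g 0) {0..1}" by simp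
  have "norm (integral {0..1} (\<lambda>t. g (e t))) \<le> integral {0..1} (\<lambda>t. cmod (g (e t)))"
    by (rule integral_norm_bound_integral) (auto intro!: integrable_continuous_real continuous_intros ce')
  then show ?thesis using I by (simp add: integral_unique e_def)
qed

text \<open>On each complex line through \<open>p\<close> the square of \<open>f\<close> is holomorphic, so \<open>|f p|\<^sup>2\<close> is at most its average over
  a circle. Rotations about \<open>p\<close> preserve the ball and Lebesgue measure, so the average over circles
  and points of the ball is the average over the ball, by Fubini.\<close>

lemma mean_value_L2:
  fixes f :: "complex^'n \<Rightarrow> complex"
  assumes U: "open U" and f: "f mholomorphic_on U" and r: "r > 0" "cball p r \<subseteq> U"
    and int: "set_integrable lebesgue U (\<lambda>z. (cmod (f z))\<^sup>2)"
  shows "measure lebesgue (ball (0::complex^'n) r) * (cmod (f p))\<^sup>2 \<le> (LINT z:U|lebesgue. (cmod (f z))\<^sup>2)"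
proof -
  define e where "e t = exp (2 * of_real pi * \<i> * of_real t)" for t :: real
  have ne: "cmod (e t) = 1" for t by (simp add: e_def norm_exp_eq_Re)
  define B where "B = ball (0::complex^'n) r"
  define I where "I = (LINT z:ball p r|lebesgue. (cmod (f z))\<^sup>2)"
  note ib = set_integrable_ball[OF f r(2)]
  have cf: "continuous_on U f" using f by (rule mholomorphic_continuous_on)
  have inU: "p + c *s v \<in> U" if "cmod c \<le> 1" "v \<in> B" for c v
  proof -
    have "cmod c * norm v \<le> 1 * norm v" using that by (intro mult_right_mono) auto
    then have "p + c *s v \<in> cball p r" using that by (auto simp: dist_norm norm_scalar B_def)
    then show ?thesis using r by blast
  qed
  define F where "F v t = indicator B v * (indicator {0..1} t * (cmod (f (p + e t *s v)))\<^sup>2)" for v and t :: real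
  have Fmeas: "(\<lambda>(v, t). F v t) \<in> borel_measurable (lborel \<Otimes>\<^sub>M lborel)"
  proof -
    have "continuous_on (B \<times> UNIV) (\<lambda>x. (cmod (f (p + e (snd x) *s fst x)))\<^sup>2)"
    proof -
      have "continuous_on (B \<times> (UNIV :: real set)) (\<lambda>x. p + e (snd x) *s fst x)"
        unfolding e_def vector_scalar_mult_def
        by (intro continuous_intros)
      then have "continuous_on (B \<times> (UNIV :: real set)) (\<lambda>x. f (p + e (snd x) *s fst x))"
        by (rule continuous_on_compose2[OF cf]) (use inU ne in auto)
      then show ?thesis by (intro continuous_intros)
    qed
    then have "(\<lambda>x. indicator (B \<times> UNIV) x *\<^sub>R (cmod (f (p + e (snd x) *s fst x)))\<^sup>2) \<in> borel_measurable borel"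
      by (intro borel_measurable_continuous_on_indicator) (auto simp: B_def intro!: borel_open open_Times)
    then have m: "(\<lambda>x. indicator (B \<times> UNIV) x *\<^sub>R (cmod (f (p + e (snd x) *s fst x)))\<^sup>2) \<in> borel_measurable (lborel \<Otimes>\<^sub>M lborel)"
      by (simp add: lborel_prod)
    have m2: "(\<lambda>x. indicator {0..1} (snd x) :: real) \<in> borel_measurable (lborel \<Otimes>\<^sub>M (lborel :: real measure))"
      by measurable
    have "(\<lambda>(v, t). F v t) = (\<lambda>x. (indicator {0..1} (snd x)) * (indicator (B \<times> UNIV) x *\<^sub>R (cmod (f (p + e (snd x) *s fst x)))\<^sup>2))"
      by (auto simp: F_def indicator_def fun_eq_iff)
    then show ?thesis using borel_measurable_times[OF m2 m] by simp
  qed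
  have slice: "ennreal ((cmod (f p))\<^sup>2 * indicator B v) \<le> (\<integral>\<^sup>+t. F v t \<partial>lborel)" for v
  proof (cases "v \<in> B")
    case True
    define g where "g c = (f (p + c *s v))\<^sup>2" for c
    have g: "g holomorphic_on cball 0 1"
      unfolding holomorphic_on_def
    proof
      fix c :: complex assume "c \<in> cball 0 1"
      then have "p + c *s v \<in> U" using inU True by simp
      then obtain D where D: "(f has_derivative D) (at (p + c *s v))" "\<And>c v. D (c *s v) = c * D v"
        using f unfolding mholomorphic_on_def by blast
      have "bounded_linear (\<lambda>c. c *s v)"
        by (intro linear_conv_bounded_linear[THEN iffD1] linearI) (auto simp: vec_eq_iff distrib_right)
      then have "((\<lambda>c. p + c *s v) has_derivative (\<lambda>c. c *s v)) (at c)"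
        using has_derivative_add[OF has_derivative_const[of p] bounded_linear_imp_has_derivative] by fastforce
      from has_derivative_compose[OF this D(1)]
      have "((\<lambda>c. f (p + c *s v)) has_derivative (\<lambda>c. D v * c)) (at c)" by (simp add: D(2) mult.commute)
      then have "((\<lambda>c. f (p + c *s v)) has_field_derivative D v) (at c)"
        by (simp add: has_field_derivative_def)
      then have "(\<lambda>c. f (p + c *s v)) field_differentiable (at c)" unfolding field_differentiable_def by blast
      then have "g field_differentiable (at c)" unfolding g_def by (rule field_differentiable_power)
      then show "g field_differentiable at c within cball 0 1" using field_differentiable_at_within by blast
    qed
    have cg: "continuous_on {0..1} (\<lambda>t. cmod (g (e t)))"
      by (intro continuous_intros continuous_on_compose2[OF holomorphic_on_imp_continuous_on[OF g]])
        (auto simp: e_def norm_exp_eq_Re intro!: continuous_intros)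
    have si: "set_integrable lborel {0..1} (\<lambda>t. cmod (g (e t)))"
      using cg by (rule borel_integrable_atLeastAtMost')
    have "(cmod (f p))\<^sup>2 = cmod (g 0)" by (simp add: g_def norm_power)
    also have "\<dots> \<le> integral {0..1} (\<lambda>t. cmod (g (e t)))"
      using circle_mean_value_le[OF g] by (simp add: e_def)
    also have "\<dots> = (LINT t:{0..1}|lborel. cmod (g (e t)))"
      using set_borel_integral_eq_integral(2)[OF si] by simp
    finally have "ennreal ((cmod (f p))\<^sup>2) \<le> ennreal (LINT t:{0..1}|lborel. cmod (g (e t)))"
      by (rule ennreal_leI)
    also have "\<dots> = (\<integral>\<^sup>+t. ennreal (indicator {0..1} t *\<^sub>R cmod (g (e t))) \<partial>lborel)"
      unfolding set_lebesgue_integral_def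
      by (rule nn_integral_eq_integral[symmetric]) (use si in \<open>auto simp: set_integrable_def\<close>)
    also have "\<dots> = (\<integral>\<^sup>+t. F v t \<partial>lborel)"
      using True by (simp add: F_def g_def norm_power)
    finally show ?thesis using True by simp
  qed simp
  have rot: "(\<integral>\<^sup>+v. F v t \<partial>lborel) = ennreal (indicator {0..1} t * I)" for t
  proof -
    define s where "s v = p + e t *s v" for v :: "complex^'n"
    have u: "cmod (e t) = 1" "e t \<noteq> 0" using ne[of t] by auto
    have img: "s ` B = ball p r"
    proof
      show "s ` B \<subseteq> ball p r" by (auto simp: s_def B_def dist_norm norm_scalar ne)
      show "ball p r \<subseteq> s ` B"
      proof
        fix x assume x: "x \<in> ball p r"
        have "x = s ((1 / e t) *s (x - p))" using u by (simp add: s_def vec_eq_iff)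
        moreover have "(1 / e t) *s (x - p) \<in> B"
          using x u norm_scalar[of "1 / e t" "x - p"]
          by (simp add: B_def norm_divide dist_norm norm_minus_commute del: vector_ssub_ldistrib)
        ultimately show "x \<in> s ` B" by blast
      qed
    qed
    have bl: "bounded_linear (\<lambda>v::complex^'n. e t *s v)"
      using linear_scalar linear_conv_bounded_linear by blast
    have der: "(s has_derivative (\<lambda>v. e t *s v)) (at v)" for v
    proof -
      have "((\<lambda>v. p + e t *s v) has_derivative (\<lambda>v. 0 + e t *s v)) (at v)"
        by (rule has_derivative_add[OF has_derivative_const bounded_linear_imp_has_derivative[OF bl]])
      moreover have "s = (\<lambda>v. p + e t *s v)" by (simp add: fun_eq_iff s_def)
      ultimately show ?thesis by simp
    qed
    have inj: "inj_on s B" by (rule inj_onI) (use u in \<open>auto simp: s_def vec_eq_iff\<close>)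
    have cF: "continuous_on (s ` B) (\<lambda>z. (cmod (f z))\<^sup>2)"
      unfolding img by (intro continuous_intros continuous_on_subset[OF cf]) (use r ball_subset_cball in blast)
    have os: "open B" "open (s ` B)" by (simp_all add: B_def img[unfolded B_def])
    note cv = rjac_change_of_variables[OF os der inj cF]
    have cv1: "set_integrable lebesgue B (\<lambda>v. (cmod (f (s v)))\<^sup>2)"
      and cv2: "(LINT v:B|lebesgue. (cmod (f (s v)))\<^sup>2) = I"
      using cv[unfolded img] ib u by (simp_all add: rjac_scalar I_def)
    have cs: "continuous_on B (\<lambda>v. (cmod (f (s v)))\<^sup>2)"
    proof -
      have "continuous_on B s"
        by (rule continuous_at_imp_continuous_on) (auto intro: has_derivative_continuous[OF der])
      then show ?thesis by (rule continuous_on_compose2[OF cF]) simp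
    qed
    note sl = set_integrable_lebesgue_lborel[OF os(1) cs]
    have "(\<integral>\<^sup>+v. ennreal (indicator B v *\<^sub>R (cmod (f (s v)))\<^sup>2) \<partial>lborel) = ennreal (LINT v|lborel. indicator B v *\<^sub>R (cmod (f (s v)))\<^sup>2)"
      by (rule nn_integral_eq_integral) (use sl(2) cv1 in auto)
    also have "\<dots> = ennreal I" using sl(3) cv2 by simp
    finally have "(\<integral>\<^sup>+v. ennreal (indicator B v * (cmod (f (p + e t *s v)))\<^sup>2) \<partial>lborel) = ennreal I"
      by (simp add: s_def)
    then show ?thesis by (cases "t \<in> {0..1}") (auto simp: F_def)
  qed
  have mB: "emeasure lborel B = ennreal (measure lebesgue B)"
  proof -
    have "emeasure lborel B \<noteq> top"
      using emeasure_lborel_ball_finite[of "0::complex^'n" r] unfolding B_def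
      by (metis infinity_ennreal_def less_irrefl)
    moreover have "measure lebesgue B = measure lborel B"
      by (rule measure_completion) (simp add: B_def)
    ultimately show ?thesis using emeasure_eq_ennreal_measure[of lborel B] by simp
  qed
  have I0: "I \<ge> 0" unfolding I_def set_lebesgue_integral_def by (rule integral_nonneg_AE) (simp add: indicator_def)
  have "ennreal (measure lebesgue B * (cmod (f p))\<^sup>2) = (\<integral>\<^sup>+v. ennreal ((cmod (f p))\<^sup>2 * indicator B v) \<partial>lborel)"
  proof -
    have "(\<integral>\<^sup>+v. ennreal ((cmod (f p))\<^sup>2 * indicator B v) \<partial>lborel) = (\<integral>\<^sup>+v. ennreal ((cmod (f p))\<^sup>2) * indicator B v \<partial>lborel)"
      by (intro nn_integral_cong) (auto simp: indicator_def)
    also have "\<dots> = ennreal ((cmod (f p))\<^sup>2) * emeasure lborel B"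
      by (rule nn_integral_cmult_indicator) (simp add: B_def)
    finally show ?thesis by (simp add: mB ennreal_mult mult.commute)
  qed
  also have "\<dots> \<le> (\<integral>\<^sup>+v. \<integral>\<^sup>+t. F v t \<partial>lborel \<partial>lborel)"
    by (rule nn_integral_mono) (rule slice)
  also have "\<dots> = (\<integral>\<^sup>+t. \<integral>\<^sup>+v. F v t \<partial>lborel \<partial>lborel)"
  proof -
    have "(\<lambda>x. ennreal (case_prod F x)) \<in> borel_measurable (lborel \<Otimes>\<^sub>M lborel)"
      by (rule measurable_compose[OF Fmeas measurable_ennreal])
    from lborel_pair.Fubini[OF this] show ?thesis by (simp only: prod.case)
  qed
  also have "\<dots> = (\<integral>\<^sup>+t. ennreal I * indicator {0..1} t \<partial>(lborel :: real measure))"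
    unfolding rot by (intro nn_integral_cong) (auto simp: indicator_def)
  also have "\<dots> = ennreal I" by (simp add: nn_integral_cmult_indicator)
  finally have "measure lebesgue B * (cmod (f p))\<^sup>2 \<le> I" using I0 by (simp add: ennreal_le_iff)
  also have "I \<le> (LINT z:U|lebesgue. (cmod (f z))\<^sup>2)"
    unfolding I_def set_lebesgue_integral_def
    by (intro integral_mono) (use ib int r ball_subset_cball in \<open>auto simp: set_integrable_def indicator_def subset_iff\<close>)
  finally show ?thesis by (simp add: B_def)
qed

section \<open>The Bergman kernel\<close>

definition bip :: "(complex^'n) set \<Rightarrow> (complex^'n \<Rightarrow> complex) \<Rightarrow> (complex^'n \<Rightarrow> complex) \<Rightarrow> complex" where
  "bip \<Omega> f g = (LINT z:\<Omega>|lebesgue. f z * cnj (g z))"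

definition bn2 :: "(complex^'n) set \<Rightarrow> (complex^'n \<Rightarrow> complex) \<Rightarrow> real" where
  "bn2 \<Omega> f = (LINT z:\<Omega>|lebesgue. (cmod (f z))\<^sup>2)"

lemma set_integrable_dominated:
  fixes F :: "complex^'n \<Rightarrow> 'b::euclidean_space" and G :: "complex^'n \<Rightarrow> real"
  assumes "open \<Omega>" "continuous_on \<Omega> F" "set_integrable lebesgue \<Omega> G" "\<And>z. z \<in> \<Omega> \<Longrightarrow> norm (F z) \<le> G z"
  shows "set_integrable lebesgue \<Omega> F"
proof (rule set_integrable_bound[OF assms(3)])
  show "set_borel_measurable lebesgue \<Omega> F"
    unfolding set_borel_measurable_def
    by (rule measurable_completion) (use set_integrable_lebesgue_lborel(1)[OF assms(1,2)] in simp)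
  show "AE x in lebesgue. x \<in> \<Omega> \<longrightarrow> norm (F x) \<le> norm (G x)"
    using assms(4) by (intro AE_I2) force
qed

locale bounded_open =
  fixes \<Omega> :: "(complex^'n) set"
  assumes open_dom: "open \<Omega>" and bounded_dom: "bounded \<Omega>"
begin

abbreviation "A2 \<equiv> bergman_space \<Omega>"
abbreviation "ip \<equiv> bip \<Omega>"
abbreviation "n2 \<equiv> bn2 \<Omega>"

lemma A2_hol: "f \<in> A2 \<Longrightarrow> f mholomorphic_on \<Omega>"
  and A2_int: "f \<in> A2 \<Longrightarrow> set_integrable lebesgue \<Omega> (\<lambda>z. (cmod (f z))\<^sup>2)"
  by (auto simp: bergman_space_def)

lemma A2_cont: "f \<in> A2 \<Longrightarrow> continuous_on \<Omega> f"
  using A2_hol mholomorphic_continuous_on by blast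

lemma A2_add:
  assumes "f \<in> A2" "g \<in> A2"
  shows "(\<lambda>z. f z + g z) \<in> A2"
proof -
  have "set_integrable lebesgue \<Omega> (\<lambda>z. (cmod (f z + g z))\<^sup>2)"
  proof (rule set_integrable_dominated[OF open_dom, of _ "\<lambda>z. 2 * (cmod (f z))\<^sup>2 + 2 * (cmod (g z))\<^sup>2"])
    show "continuous_on \<Omega> (\<lambda>z. (cmod (f z + g z))\<^sup>2)"
      by (intro continuous_intros A2_cont assms)
    show "set_integrable lebesgue \<Omega> (\<lambda>z. 2 * (cmod (f z))\<^sup>2 + 2 * (cmod (g z))\<^sup>2)"
      by (intro set_integral_add set_integrable_mult_right A2_int assms)
    fix z
    have "(cmod (f z + g z))\<^sup>2 \<le> (cmod (f z) + cmod (g z))\<^sup>2" by (intro power_mono norm_triangle_ineq) auto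
    also have "\<dots> \<le> 2 * (cmod (f z))\<^sup>2 + 2 * (cmod (g z))\<^sup>2"
      using sum_squares_bound[of "cmod (f z)" "cmod (g z)"] by (simp add: power2_sum)
    finally show "norm ((cmod (f z + g z))\<^sup>2) \<le> 2 * (cmod (f z))\<^sup>2 + 2 * (cmod (g z))\<^sup>2" by simp
  qed
  then show ?thesis using mholomorphic_add[OF A2_hol[OF assms(1)] A2_hol[OF assms(2)]]
    by (simp add: bergman_space_def)
qed

lemma A2_cmult:
  assumes "f \<in> A2"
  shows "(\<lambda>z. c * f z) \<in> A2"
proof -
  have "set_integrable lebesgue \<Omega> (\<lambda>z. (cmod c)\<^sup>2 * (cmod (f z))\<^sup>2)"
    by (intro set_integrable_mult_right A2_int assms)
  then have "set_integrable lebesgue \<Omega> (\<lambda>z. (cmod (c * f z))\<^sup>2)"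
    by (simp add: norm_mult power_mult_distrib)
  then show ?thesis using mholomorphic_mult[OF mholomorphic_const A2_hol[OF assms]]
    by (simp add: bergman_space_def)
qed

lemma A2_diff: "f \<in> A2 \<Longrightarrow> g \<in> A2 \<Longrightarrow> (\<lambda>z. f z - g z) \<in> A2"
  using A2_add[of f "\<lambda>z. (-1) * g z"] A2_cmult[of g "-1"] by simp

lemma A2_bounded:
  assumes "f mholomorphic_on \<Omega>" "\<And>z. z \<in> \<Omega> \<Longrightarrow> cmod (f z) \<le> M"
  shows "f \<in> A2"
proof -
  have "set_integrable lebesgue \<Omega> (\<lambda>z. (cmod (f z))\<^sup>2)"
  proof (rule set_integrable_dominated[OF open_dom, of _ "\<lambda>z. M\<^sup>2"])
    show "continuous_on \<Omega> (\<lambda>z. (cmod (f z))\<^sup>2)"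
      by (intro continuous_intros mholomorphic_continuous_on assms)
    have "\<Omega> \<in> lmeasurable" using open_dom bounded_dom by (simp add: lmeasurable_open)
    then show "set_integrable lebesgue \<Omega> (\<lambda>z. M\<^sup>2)"
      by (rule absolutely_integrable_on_const)
    fix z assume "z \<in> \<Omega>"
    then show "norm ((cmod (f z))\<^sup>2) \<le> M\<^sup>2" using assms(2) by (auto intro: power_mono)
  qed
  then show ?thesis using assms(1) by (simp add: bergman_space_def)
qed

lemma A2_const: "(\<lambda>z. c) \<in> A2"
  by (rule A2_bounded[of _ "cmod c"]) (simp_all add: mholomorphic_const)

lemma ip_integrable:
  assumes "f \<in> A2" "g \<in> A2"
  shows "set_integrable lebesgue \<Omega> (\<lambda>z. f z * cnj (g z))"
proof (rule set_integrable_dominated[OF open_dom, of _ "\<lambda>z. (cmod (f z))\<^sup>2 + (cmod (g z))\<^sup>2"])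
  show "continuous_on \<Omega> (\<lambda>z. f z * cnj (g z))"
    by (intro continuous_intros A2_cont assms)
  show "set_integrable lebesgue \<Omega> (\<lambda>z. (cmod (f z))\<^sup>2 + (cmod (g z))\<^sup>2)"
    by (intro set_integral_add A2_int assms)
  fix z
  have "2 * (cmod (f z) * cmod (g z)) \<le> (cmod (f z))\<^sup>2 + (cmod (g z))\<^sup>2"
    using sum_squares_bound[of "cmod (f z)" "cmod (g z)"] by simp
  moreover have "0 \<le> cmod (f z) * cmod (g z)" by simp
  ultimately have "cmod (f z) * cmod (g z) \<le> (cmod (f z))\<^sup>2 + (cmod (g z))\<^sup>2" by linarith
  then show "norm (f z * cnj (g z)) \<le> (cmod (f z))\<^sup>2 + (cmod (g z))\<^sup>2" by (simp add: norm_mult)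
qed

lemma ip_add: "f \<in> A2 \<Longrightarrow> g \<in> A2 \<Longrightarrow> h \<in> A2 \<Longrightarrow> ip (\<lambda>z. f z + g z) h = ip f h + ip g h"
  unfolding bip_def distrib_right by (rule set_integral_add(2)) (simp_all add: ip_integrable)

lemma ip_cmult: "ip (\<lambda>z. c * f z) h = c * ip f h"
  unfolding bip_def mult.assoc by (rule set_integral_mult_right)

lemma ip_cnj: "ip g f = cnj (ip f g)"
proof -
  have "cnj (ip f g) = (LINT z|lebesgue. cnj (indicator \<Omega> z *\<^sub>R (f z * cnj (g z))))"
    unfolding bip_def set_lebesgue_integral_def by (rule Bochner_Integration.integral_cnj[symmetric])
  also have "\<dots> = ip g f" unfolding bip_def set_lebesgue_integral_def
    by (rule Bochner_Integration.integral_cong) (auto simp: indicator_def mult.commute)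
  finally show ?thesis by simp
qed

lemma ip_self: "ip f f = complex_of_real (n2 f)"
proof -
  have "ip f f = (LINT z|lebesgue. complex_of_real (indicator \<Omega> z *\<^sub>R (cmod (f z))\<^sup>2))"
    unfolding bip_def set_lebesgue_integral_def
    by (rule Bochner_Integration.integral_cong)
      (auto simp: indicator_def complex_norm_square[symmetric])
  also have "\<dots> = complex_of_real (n2 f)"
    unfolding bn2_def set_lebesgue_integral_def by (rule integral_complex_of_real)
  finally show ?thesis .
qed

lemma n2_nonneg: "n2 f \<ge> 0"
  unfolding bn2_def set_lebesgue_integral_def by (rule integral_nonneg_AE) (simp add: indicator_def)

lemma n2_add:
  assumes "f \<in> A2" "g \<in> A2"
  shows "n2 (\<lambda>z. f z + g z) = n2 f + n2 g + 2 * Re (ip f g)"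
proof -
  have fg: "(\<lambda>z. f z + g z) \<in> A2" using A2_add assms by blast
  have r: "ip h (\<lambda>z. f z + g z) = ip h f + ip h g" if "h \<in> A2" for h
    using ip_add[OF assms that] ip_cnj[of h] by (metis complex_cnj_add)
  have "complex_of_real (n2 (\<lambda>z. f z + g z)) = ip (\<lambda>z. f z + g z) (\<lambda>z. f z + g z)"
    by (simp add: ip_self)
  also have "\<dots> = ip f f + ip f g + (ip g f + ip g g)"
    using ip_add[OF assms fg] r assms by simp
  also have "ip g f = cnj (ip f g)" by (rule ip_cnj)
  finally have "complex_of_real (n2 (\<lambda>z. f z + g z)) = of_real (n2 f) + ip f g + (cnj (ip f g) + of_real (n2 g))"
    by (simp add: ip_self)
  from arg_cong[OF this, of Re] show ?thesis by simp
qed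

lemma n2_cmult: "n2 (\<lambda>z. c * f z) = (cmod c)\<^sup>2 * n2 f"
  unfolding bn2_def norm_mult power_mult_distrib by (rule set_integral_mult_right)

text \<open>Point evaluations are bounded, locally uniformly in the point.\<close>

lemma A2_loc_bound:
  assumes "p \<in> \<Omega>"
  shows "\<exists>C r. C > 0 \<and> r > 0 \<and> ball p r \<subseteq> \<Omega> \<and> (\<forall>q\<in>ball p r. \<forall>f\<in>A2. (cmod (f q))\<^sup>2 \<le> C * n2 f)"
proof -
  obtain s where s: "s > 0" "cball p s \<subseteq> \<Omega>" using open_dom assms open_contains_cball by blast
  define r where "r = s / 2"
  have r: "r > 0" using s by (simp add: r_def)
  define m where "m = measure lebesgue (ball (0::complex^'n) r)"
  have m: "m > 0" unfolding m_def using r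
    by (simp add: measure_completion content_ball_pos)
  have "(cmod (f q))\<^sup>2 \<le> (1/m) * n2 f" if q: "q \<in> ball p r" and f: "f \<in> A2" for q f
  proof -
    have "cball q r \<subseteq> cball p s"
    proof
      fix x assume "x \<in> cball q r"
      then show "x \<in> cball p s" using q dist_triangle[of p x q] by (simp add: r_def)
    qed
    then have "m * (cmod (f q))\<^sup>2 \<le> n2 f"
      unfolding m_def bn2_def using s
      by (intro mean_value_L2[OF open_dom A2_hol[OF f] r _ A2_int[OF f]]) blast
    then show ?thesis using m by (simp add: field_simps)
  qed
  moreover have "ball p r \<subseteq> \<Omega>" using s r by (auto simp: r_def intro!: subsetD[OF s(2)])
  ultimately show ?thesis using m r by (intro exI[of _ "1/m"] exI[of _ r]) auto
qed

text \<open>By the parallelogram law a minimising sequence is Cauchy in norm, hence locally uniformly convergent.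
  The limit is holomorphic, and by Fatou its norm does not exceed the infimum.\<close>

lemma bergman_minimizer:
  assumes w: "w \<in> \<Omega>"
  shows "\<exists>f\<in>A2. f w = 1 \<and> n2 f > 0 \<and> (\<forall>g\<in>A2. g w = 1 \<longrightarrow> n2 f \<le> n2 g)"
proof -
  define S where "S = {f \<in> A2. f w = 1}"
  define m where "m = Inf (n2 ` S)"
  have S1: "(\<lambda>z. 1) \<in> S" by (simp add: S_def A2_const)
  have bdd: "bdd_below (n2 ` S)" using n2_nonneg by (intro bdd_belowI[of _ 0]) auto
  have mle: "m \<le> n2 g" if "g \<in> S" for g
    unfolding m_def using bdd that by (intro cInf_lower) auto
  have ex: "\<exists>f\<in>S. n2 f < m + 1 / real (Suc k)" for k
  proof (rule ccontr)
    assume "\<not> ?thesis"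
    then have "m + 1 / real (Suc k) \<le> Inf (n2 ` S)"
      using S1 by (intro cInf_greatest) (auto simp: not_less)
    then show False by (simp add: m_def)
  qed
  then have "\<forall>k. \<exists>f. f \<in> S \<and> n2 f < m + 1 / real (Suc k)" by blast
  from choice[OF this] obtain F where F: "\<And>k. F k \<in> S" "\<And>k. n2 (F k) < m + 1 / real (Suc k)" by blast
  have FA: "F k \<in> A2" "F k w = 1" for k using F(1) by (auto simp: S_def)
  \<comment> \<open>The midpoint of two competitors is a competitor, which bounds the norm of the sum from below.\<close>
  have cauchy: "n2 (\<lambda>z. F a z - F b z) \<le> 2 / real (Suc a) + 2 / real (Suc b)" for a b
  proof -
    have "(\<lambda>z. (1/2) * (F a z + F b z)) \<in> S"
      using A2_cmult[OF A2_add[OF FA(1)[of a] FA(1)[of b]], of "1/2"] FA(2) by (simp add: S_def)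
    from mle[OF this, unfolded n2_cmult] have "4 * m \<le> n2 (\<lambda>z. F a z + F b z)"
      by (simp add: power2_eq_square norm_divide)
    also have "\<dots> = n2 (F a) + n2 (F b) + 2 * Re (ip (F a) (F b))" by (rule n2_add[OF FA(1) FA(1)])
    finally have 1: "4 * m \<le> n2 (F a) + n2 (F b) + 2 * Re (ip (F a) (F b))" .
    have "n2 (\<lambda>z. F a z + (-1) * F b z) = n2 (F a) + n2 (\<lambda>z. (-1) * F b z) + 2 * Re (ip (F a) (\<lambda>z. (-1) * F b z))"
      by (intro n2_add FA A2_cmult)
    also have "ip (F a) (\<lambda>z. (-1) * F b z) = - ip (F a) (F b)"
      using ip_cnj[of "F a" "\<lambda>z. (-1) * F b z"] ip_cmult[of "-1" "F b" "F a"] ip_cnj[of "F a" "F b"] by simp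
    also have "n2 (\<lambda>z. (-1) * F b z) = n2 (F b)" by (subst n2_cmult) simp
    finally have 2: "n2 (\<lambda>z. F a z - F b z) = n2 (F a) + n2 (F b) - 2 * Re (ip (F a) (F b))" by simp
    have lin: "x \<le> 2 * u + 2 * v"
      if "x = na + nb - 2 * c" "4 * m \<le> na + nb + 2 * c" "na < m + u" "nb < m + v" for x na nb c u v :: real
      using that by linarith
    have "n2 (\<lambda>z. F a z - F b z) \<le> 2 * (1 / real (Suc a)) + 2 * (1 / real (Suc b))"
      by (rule lin[OF 2 1 F(2) F(2)])
    then show ?thesis by (simp only: times_divide_eq_right mult_1_right)
  qed
  have loc: "\<exists>C r. C > 0 \<and> r > 0 \<and> ball p r \<subseteq> \<Omega> \<and>
      (\<forall>q\<in>ball p r. \<forall>a b. (cmod (F a q - F b q))\<^sup>2 \<le> C * (2 / real (Suc a) + 2 / real (Suc b)))" if "p \<in> \<Omega>" for p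
  proof -
    obtain C r where C: "C > 0" "r > 0" "ball p r \<subseteq> \<Omega>" "\<forall>q\<in>ball p r. \<forall>f\<in>A2. (cmod (f q))\<^sup>2 \<le> C * n2 f"
      using A2_loc_bound[OF \<open>p \<in> \<Omega>\<close>] by blast
    have "(cmod (F a q - F b q))\<^sup>2 \<le> C * (2 / real (Suc a) + 2 / real (Suc b))" if q: "q \<in> ball p r" for q a b
    proof -
      have "(cmod (F a q - F b q))\<^sup>2 \<le> C * n2 (\<lambda>z. F a z - F b z)"
        by (rule C(4)[rule_format, OF q A2_diff[OF FA(1) FA(1)]])
      also have "\<dots> \<le> C * (2 / real (Suc a) + 2 / real (Suc b))"
        using cauchy[of a b] C(1) by (intro mult_left_mono) auto
      finally show ?thesis .
    qed
    then show ?thesis using C(1-3) by (intro exI[of _ C] exI[of _ r]) auto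
  qed
  have lim0: "(\<lambda>n. c / real (Suc n)) \<longlonglongrightarrow> 0" for c :: real
    using LIMSEQ_Suc[OF lim_const_over_n[of c]] by simp
  have conv: "convergent (\<lambda>k. F k p)" if p: "p \<in> \<Omega>" for p
  proof (rule Cauchy_convergent)
    obtain C r where C: "C > 0" "r > 0" "\<forall>q\<in>ball p r. \<forall>a b. (cmod (F a q - F b q))\<^sup>2 \<le> C * (2 / real (Suc a) + 2 / real (Suc b))"
      using loc[OF p] by blast
    have Cb: "(cmod (F a p - F b p))\<^sup>2 \<le> C * (2 / real (Suc a) + 2 / real (Suc b))" for a b
      using C by simp
    show "Cauchy (\<lambda>k. F k p)"
    proof (rule CauchyI)
      fix e :: real assume e: "e > 0"
      have "\<forall>\<^sub>F n in sequentially. (2 * C) / real (Suc n) < e\<^sup>2 / 2"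
        using order_tendstoD(2)[OF lim0] e by simp
      then obtain N where N: "\<And>n. n \<ge> N \<Longrightarrow> (2 * C) / real (Suc n) < e\<^sup>2 / 2"
        unfolding eventually_sequentially by blast
      have "cmod (F a p - F b p) < e" if "a \<ge> N" "b \<ge> N" for a b
      proof -
        have "C * (2 / real (Suc a) + 2 / real (Suc b)) = (2 * C) / real (Suc a) + (2 * C) / real (Suc b)"
          by (simp add: algebra_simps)
        then have "(cmod (F a p - F b p))\<^sup>2 < e\<^sup>2" using Cb[of a b] N[OF that(1)] N[OF that(2)] by linarith
        then show ?thesis using e power_less_imp_less_base[of _ 2 e] by simp
      qed
      then show "\<exists>M. \<forall>m\<ge>M. \<forall>n\<ge>M. norm (F m p - F n p) < e" by blast
    qed
  qed
  define f where "f p = lim (\<lambda>k. F k p)" for p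
  have flim: "(\<lambda>k. F k p) \<longlonglongrightarrow> f p" if "p \<in> \<Omega>" for p
    using conv[OF that] by (simp add: f_def convergent_LIMSEQ_iff)
  have f1: "f w = 1" using flim[OF w] FA(2) LIMSEQ_unique[of "\<lambda>k. F k w"] by simp
  have hol: "f mholomorphic_on \<Omega>"
  proof (rule mholomorphic_uniform_limit[OF open_dom])
    show "F n mholomorphic_on \<Omega>" for n using A2_hol FA by blast
    fix p assume p: "p \<in> \<Omega>"
    obtain C r where C: "C > 0" "r > 0" "ball p r \<subseteq> \<Omega>" "\<forall>q\<in>ball p r. \<forall>a b. (cmod (F a q - F b q))\<^sup>2 \<le> C * (2 / real (Suc a) + 2 / real (Suc b))"
      using loc[OF p] by blast
    have est: "(cmod (F a q - f q))\<^sup>2 \<le> (2 * C) / real (Suc a)" if q: "q \<in> ball p r" for a q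
    proof (rule LIMSEQ_le)
      show "(\<lambda>b. (cmod (F a q - F b q))\<^sup>2) \<longlonglongrightarrow> (cmod (F a q - f q))\<^sup>2"
        using q C(3) by (intro tendsto_intros flim) blast
      have "(\<lambda>b. (2 * C) / real (Suc a) + (2 * C) / real (Suc b)) \<longlonglongrightarrow> (2 * C) / real (Suc a) + 0"
        by (intro tendsto_intros lim0)
      then show "(\<lambda>b. (2 * C) / real (Suc a) + (2 * C) / real (Suc b)) \<longlonglongrightarrow> (2 * C) / real (Suc a)" by simp
      show "\<exists>N. \<forall>n\<ge>N. (cmod (F a q - F n q))\<^sup>2 \<le> (2 * C) / real (Suc a) + (2 * C) / real (Suc n)"
      proof (intro exI allI impI)
        fix n :: nat
        have "C * (2 / real (Suc a) + 2 / real (Suc n)) = (2 * C) / real (Suc a) + (2 * C) / real (Suc n)"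
          by (simp only: distrib_left times_divide_eq_right mult.commute)
        then show "(cmod (F a q - F n q))\<^sup>2 \<le> (2 * C) / real (Suc a) + (2 * C) / real (Suc n)"
          using C(4)[rule_format, OF q, of a n] by (simp only:)
      qed
    qed
    have "uniform_limit (ball p r) F f sequentially"
    proof (rule uniform_limitI)
      fix e :: real assume e: "e > 0"
      have "\<forall>\<^sub>F n in sequentially. (2 * C) / real (Suc n) < e\<^sup>2"
        using order_tendstoD(2)[OF lim0] e by simp
      then show "\<forall>\<^sub>F n in sequentially. \<forall>x\<in>ball p r. dist (F n x) (f x) < e"
      proof (rule eventually_mono)
        fix n assume n: "(2 * C) / real (Suc n) < e\<^sup>2"
        show "\<forall>x\<in>ball p r. dist (F n x) (f x) < e"
        proof
          fix x assume "x \<in> ball p r"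
          then have "(cmod (F n x - f x))\<^sup>2 < e\<^sup>2" using est[of x n] n by linarith
          then show "dist (F n x) (f x) < e" using e power_less_imp_less_base[of _ 2 e] by (simp add: dist_norm)
        qed
      qed
    qed
    then show "\<exists>r>0. uniform_limit (ball p r) F f sequentially" using C by blast
  qed
  have cf: "continuous_on \<Omega> (\<lambda>z. (cmod (f z))\<^sup>2)"
    by (intro continuous_intros mholomorphic_continuous_on hol)
  have cF: "continuous_on \<Omega> (\<lambda>z. (cmod (F k z))\<^sup>2)" for k
    by (intro continuous_intros A2_cont FA)
  note sf = set_integrable_lebesgue_lborel[OF open_dom cf]
  note sF = set_integrable_lebesgue_lborel[OF open_dom cF]
  define G where "G k z = ennreal (indicator \<Omega> z *\<^sub>R (cmod (F k z))\<^sup>2)" for k z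
  have Gint: "(\<integral>\<^sup>+z. G k z \<partial>lborel) = ennreal (n2 (F k))" for k
    unfolding G_def bn2_def sF(3)
    by (rule nn_integral_eq_integral) (use sF(2) A2_int[OF FA(1)] in auto)
  have "(\<integral>\<^sup>+z. ennreal (indicator \<Omega> z *\<^sub>R (cmod (f z))\<^sup>2) \<partial>lborel) = (\<integral>\<^sup>+z. liminf (\<lambda>k. G k z) \<partial>lborel)"
  proof (rule nn_integral_cong)
    fix z
    have "(\<lambda>k. indicator \<Omega> z *\<^sub>R (cmod (F k z))\<^sup>2 :: real) \<longlonglongrightarrow> indicator \<Omega> z *\<^sub>R (cmod (f z))\<^sup>2"
    proof (cases "z \<in> \<Omega>")
      case True
      then show ?thesis by (intro tendsto_intros flim)
    qed simp
    then have "(\<lambda>k. G k z) \<longlonglongrightarrow> ennreal (indicator \<Omega> z *\<^sub>R (cmod (f z))\<^sup>2)"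
      unfolding G_def by (rule tendsto_ennrealI)
    then show "ennreal (indicator \<Omega> z *\<^sub>R (cmod (f z))\<^sup>2) = liminf (\<lambda>k. G k z)"
      using lim_imp_Liminf[OF sequentially_bot] by metis
  qed
  also have "\<dots> \<le> liminf (\<lambda>k. \<integral>\<^sup>+z. G k z \<partial>lborel)"
  proof (rule nn_integral_liminf)
    show "G k \<in> borel_measurable lborel" for k
      unfolding G_def using measurable_compose[OF sF(1)[of k] measurable_ennreal] by simp
  qed
  also have "\<dots> = ennreal m"
  proof -
    have "(\<lambda>k. n2 (F k)) \<longlonglongrightarrow> m"
    proof (rule real_tendsto_sandwich)
      show "\<forall>\<^sub>F n in sequentially. m \<le> n2 (F n)" using mle F(1) by simp
      show "\<forall>\<^sub>F n in sequentially. n2 (F n) \<le> m + 1 / real (Suc n)" using F(2) by (simp add: less_imp_le)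
      show "(\<lambda>n. m) \<longlonglongrightarrow> m" by simp
      have "(\<lambda>n. m + 1 / real (Suc n)) \<longlonglongrightarrow> m + 0" by (intro tendsto_intros lim0)
      then show "(\<lambda>n. m + 1 / real (Suc n)) \<longlonglongrightarrow> m" by simp
    qed
    then have "(\<lambda>k. ennreal (n2 (F k))) \<longlonglongrightarrow> ennreal m" by (rule tendsto_ennrealI)
    then show ?thesis unfolding Gint using lim_imp_Liminf[OF sequentially_bot] by metis
  qed
  finally have le: "(\<integral>\<^sup>+z. ennreal (indicator \<Omega> z *\<^sub>R (cmod (f z))\<^sup>2) \<partial>lborel) \<le> ennreal m" .
  have "integrable lborel (\<lambda>z. indicator \<Omega> z *\<^sub>R (cmod (f z))\<^sup>2 :: real)"
  proof (rule integrableI_nonneg)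
    show "(\<lambda>z. indicator \<Omega> z *\<^sub>R (cmod (f z))\<^sup>2 :: real) \<in> borel_measurable lborel" using sf(1) by simp
    show "AE x in lborel. 0 \<le> (indicator \<Omega> x *\<^sub>R (cmod (f x))\<^sup>2 :: real)" by (simp add: indicator_def)
    show "(\<integral>\<^sup>+z. ennreal (indicator \<Omega> z *\<^sub>R (cmod (f z))\<^sup>2) \<partial>lborel) < \<infinity>"
      using le by (metis ennreal_less_top infinity_ennreal_def le_less_trans)
  qed
  note fint = this
  have fA: "f \<in> A2" using hol sf(2) fint by (simp add: bergman_space_def)
  have m0: "m \<ge> 0" unfolding m_def using S1 n2_nonneg by (intro cInf_greatest) auto
  have "ennreal (n2 f) = (\<integral>\<^sup>+z. ennreal (indicator \<Omega> z *\<^sub>R (cmod (f z))\<^sup>2) \<partial>lborel)"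
    unfolding bn2_def sf(3)
    by (rule nn_integral_eq_integral[symmetric]) (use fint in \<open>auto simp: indicator_def\<close>)
  then have "ennreal (n2 f) \<le> ennreal m" using le by (simp only:)
  then have "n2 f \<le> m" using m0 ennreal_le_iff by blast
  then have min: "\<forall>g\<in>A2. g w = 1 \<longrightarrow> n2 f \<le> n2 g" using mle by (auto simp: S_def intro: order_trans)
  obtain C r where "C > 0" and r: "r > 0" "\<forall>q\<in>ball w r. \<forall>f\<in>A2. (cmod (f q))\<^sup>2 \<le> C * n2 f"
    using A2_loc_bound[OF w] by blast
  have "1 \<le> C * n2 f" using r(2)[rule_format, of w f] r(1) fA f1 by simp
  then have "n2 f \<noteq> 0" by auto
  then have "n2 f > 0" using n2_nonneg[of f] by simp
  then show ?thesis using fA f1 min by blast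
qed

text \<open>The minimiser \<open>f\<close> with \<open>f w = 1\<close> is orthogonal to all functions that vanish at \<open>w\<close>, so evaluation at \<open>w\<close> is
  the scalar product with a multiple of \<open>f\<close>.\<close>

lemma bergman_kernel_exists:
  "\<exists>K. \<forall>w\<in>\<Omega>. (\<lambda>z. K z w) \<in> A2 \<and> (\<forall>f\<in>A2. f w = (LINT z:\<Omega>|lebesgue. f z * cnj (K z w)))"
proof -
  have "\<exists>k. k \<in> A2 \<and> (\<forall>f\<in>A2. f w = ip f k)" if w: "w \<in> \<Omega>" for w
  proof -
    obtain f where f: "f \<in> A2" "f w = 1" "n2 f > 0" "\<forall>g\<in>A2. g w = 1 \<longrightarrow> n2 f \<le> n2 g"
      using bergman_minimizer[OF w] by blast
    have orth: "ip h f = 0" if h: "h \<in> A2" "h w = 0" for h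
    proof -
      define a where "a = ip h f"
      \<comment> \<open>Any positive \<open>t\<close> with \<open>t * n2 h \<le> 1\<close> would do for the variation of the minimiser along \<open>h\<close>.\<close>
      define t where "t = 1 / (n2 h + 1)"
      have t: "t > 0" "t * n2 h \<le> 1" using n2_nonneg[of h] by (auto simp: t_def field_simps)
      define c where "c = - complex_of_real t * cnj a"
      have "n2 f \<le> n2 (\<lambda>z. f z + c * h z)"
        using f(4) A2_add[OF f(1) A2_cmult[OF h(1)]] f(2) h(2) by simp
      also have "\<dots> = n2 f + n2 (\<lambda>z. c * h z) + 2 * Re (ip f (\<lambda>z. c * h z))"
        by (rule n2_add[OF f(1) A2_cmult[OF h(1)]])
      also have "ip f (\<lambda>z. c * h z) = cnj (c * a)"
        using ip_cnj[of f "\<lambda>z. c * h z"] by (simp add: ip_cmult a_def)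
      also have "c * a = - complex_of_real (t * (cmod a)\<^sup>2)"
        using complex_norm_square[of a] by (simp add: c_def mult_ac)
      also have "n2 (\<lambda>z. c * h z) = t\<^sup>2 * (cmod a)\<^sup>2 * n2 h"
        unfolding n2_cmult by (simp add: c_def norm_mult power_mult_distrib)
      finally have "2 * t * (cmod a)\<^sup>2 \<le> t * (cmod a)\<^sup>2 * (t * n2 h)"
        by (simp add: power2_eq_square mult_ac)
      also have "\<dots> \<le> t * (cmod a)\<^sup>2 * 1" using t by (intro mult_left_mono) auto
      finally have "t * (cmod a)\<^sup>2 \<le> 0" by simp
      then show ?thesis using t by (simp add: a_def mult_le_0_iff)
    qed
    have "g w = ip g (\<lambda>z. complex_of_real (1 / n2 f) * f z)" if g: "g \<in> A2" for g
    proof -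
      have h: "(\<lambda>z. g z - g w * f z) \<in> A2" using A2_diff[OF g A2_cmult[OF f(1)]] .
      have "ip (\<lambda>z. g z - g w * f z) f = 0" by (rule orth[OF h]) (simp add: f)
      moreover have "ip (\<lambda>z. (g z - g w * f z) + g w * f z) f = ip (\<lambda>z. g z - g w * f z) f + ip (\<lambda>z. g w * f z) f"
        by (rule ip_add[OF h A2_cmult[OF f(1)] f(1)])
      ultimately have "ip g f = g w * complex_of_real (n2 f)" by (simp add: ip_cmult ip_self)
      moreover have "ip g (\<lambda>z. complex_of_real (1 / n2 f) * f z) = complex_of_real (1 / n2 f) * ip g f"
        using ip_cnj[of g "\<lambda>z. complex_of_real (1 / n2 f) * f z"] ip_cmult[of "complex_of_real (1 / n2 f)" f g] ip_cnj[of g f]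
        by simp
      ultimately show ?thesis using f(3) by simp
    qed
    then show ?thesis using A2_cmult[OF f(1)] by blast
  qed
  then have "\<forall>w. \<exists>k. w \<in> \<Omega> \<longrightarrow> k \<in> A2 \<and> (\<forall>f\<in>A2. f w = ip f k)" by blast
  from choice[OF this] obtain k where "\<forall>w. w \<in> \<Omega> \<longrightarrow> k w \<in> A2 \<and> (\<forall>f\<in>A2. f w = ip f (k w))" by blast
  then show ?thesis unfolding bip_def by (intro exI[of _ "\<lambda>z w. k w z"]) auto
qed

abbreviation "K \<equiv> bergman_kernel \<Omega>"

lemma K_A2: "w \<in> \<Omega> \<Longrightarrow> (\<lambda>z. K z w) \<in> A2"
  and K_reproducing: "w \<in> \<Omega> \<Longrightarrow> f \<in> A2 \<Longrightarrow> f w = ip f (\<lambda>z. K z w)"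
  using someI_ex[OF bergman_kernel_exists] unfolding bergman_kernel_def[symmetric] bip_def by blast+

lemma K_unique:
  assumes "\<And>w. w \<in> \<Omega> \<Longrightarrow> (\<lambda>z. L z w) \<in> A2" "\<And>w f. w \<in> \<Omega> \<Longrightarrow> f \<in> A2 \<Longrightarrow> f w = ip f (\<lambda>z. L z w)"
    and "z \<in> \<Omega>" "w \<in> \<Omega>"
  shows "L z w = K z w"
proof -
  have "L z w = ip (\<lambda>u. L u w) (\<lambda>u. K u z)" using K_reproducing[OF assms(3) assms(1)[OF assms(4)]] .
  also have "\<dots> = cnj (ip (\<lambda>u. K u z) (\<lambda>u. L u w))" by (rule ip_cnj)
  also have "ip (\<lambda>u. K u z) (\<lambda>u. L u w) = K w z" using assms(2)[OF assms(4) K_A2[OF assms(3)]] by simp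
  also have "K w z = ip (\<lambda>u. K u z) (\<lambda>u. K u w)" using K_reproducing[OF assms(4) K_A2[OF assms(3)]] .
  also have "cnj \<dots> = ip (\<lambda>u. K u w) (\<lambda>u. K u z)" by (rule ip_cnj[symmetric])
  also have "\<dots> = K z w" using K_reproducing[OF assms(3) K_A2[OF assms(4)]] by simp
  finally show ?thesis .
qed

lemma K_hermitian:
  assumes "z \<in> \<Omega>" "w \<in> \<Omega>"
  shows "K w z = cnj (K z w)"
proof -
  have "K w z = ip (\<lambda>u. K u z) (\<lambda>u. K u w)" using K_reproducing[OF assms(2) K_A2[OF assms(1)]] .
  also have "\<dots> = cnj (ip (\<lambda>u. K u w) (\<lambda>u. K u z))" by (rule ip_cnj)
  also have "ip (\<lambda>u. K u w) (\<lambda>u. K u z) = K z w" using K_reproducing[OF assms(1) K_A2[OF assms(2)]] by simp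
  finally show ?thesis .
qed

lemma K_diag: "z \<in> \<Omega> \<Longrightarrow> K z z = complex_of_real (n2 (\<lambda>u. K u z))"
  using K_reproducing[OF _ K_A2] ip_self by metis

lemma K_diag_pos:
  assumes z: "z \<in> \<Omega>"
  shows "Re (K z z) > 0"
proof -
  obtain C r where C: "C > 0" "r > 0" "\<forall>q\<in>ball z r. \<forall>f\<in>A2. (cmod (f q))\<^sup>2 \<le> C * n2 f"
    using A2_loc_bound[OF z] by blast
  have "n2 (\<lambda>u. K u z) \<noteq> 0"
  proof
    assume 0: "n2 (\<lambda>u. K u z) = 0"
    define k where "k = (\<lambda>u. K u z)"
    have k: "k \<in> A2" "n2 k = 0" using K_A2[OF z] 0 by (simp_all add: k_def)
    have "Re (ip (\<lambda>u. 1) k) = 1" using K_reproducing[OF z A2_const[of 1]] by (simp add: k_def)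
    have "0 \<le> n2 (\<lambda>u. 1 + of_real (- n2 (\<lambda>u. 1) - 1) * k u)" by (rule n2_nonneg)
    also have "\<dots> = n2 (\<lambda>u. 1) + n2 (\<lambda>u. of_real (- n2 (\<lambda>u. 1) - 1) * k u) + 2 * Re (ip (\<lambda>u. 1) (\<lambda>u. of_real (- n2 (\<lambda>u. 1) - 1) * k u))"
      by (rule n2_add[OF A2_const A2_cmult[OF k(1)]])
    also have "n2 (\<lambda>u. of_real (- n2 (\<lambda>u. 1) - 1) * k u) = 0" by (subst n2_cmult) (simp add: k)
    also have "ip (\<lambda>u. 1) (\<lambda>u. of_real (- n2 (\<lambda>u. 1) - 1) * k u) = of_real (- n2 (\<lambda>u. 1) - 1) * ip (\<lambda>u. 1) k"
      using ip_cnj[of "\<lambda>u. 1" "\<lambda>u. of_real (- n2 (\<lambda>u. 1) - 1) * k u"] ip_cmult[of "of_real (- n2 (\<lambda>u. 1) - 1)" k "\<lambda>u. 1"] ip_cnj[of "\<lambda>u. 1" k]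
      by simp
    finally show False using \<open>Re (ip (\<lambda>u. 1) k) = 1\<close> n2_nonneg[of "\<lambda>u. 1"] by simp
  qed
  then show ?thesis using K_diag[OF z] n2_nonneg[of "\<lambda>u. K u z"] by simp
qed

lemma K_cauchy_schwarz:
  assumes z: "z \<in> \<Omega>" and f: "f \<in> A2"
  shows "(cmod (f z))\<^sup>2 \<le> n2 f * Re (K z z)"
proof -
  define k where "k = (\<lambda>u. K u z)"
  define N where "N = Re (K z z)"
  have k: "k \<in> A2" "n2 k = N" "N > 0" "ip f k = f z"
    using K_A2[OF z] K_diag[OF z] K_diag_pos[OF z] K_reproducing[OF z f] by (simp_all add: k_def N_def)
  define c where "c = - f z / of_real N"
  have "0 \<le> n2 (\<lambda>u. f u + c * k u)" by (rule n2_nonneg)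
  also have "\<dots> = n2 f + n2 (\<lambda>u. c * k u) + 2 * Re (ip f (\<lambda>u. c * k u))"
    by (rule n2_add[OF f A2_cmult[OF k(1)]])
  also have "n2 (\<lambda>u. c * k u) = (cmod (f z))\<^sup>2 / N"
    unfolding n2_cmult using k by (simp add: c_def norm_divide power_divide power2_eq_square)
  also have "ip f (\<lambda>u. c * k u) = cnj c * f z"
    using ip_cnj[of f "\<lambda>u. c * k u"] ip_cmult[of c k f] ip_cnj[of f k] k by simp
  also have "cnj c * f z = - complex_of_real ((cmod (f z))\<^sup>2 / N)"
    using complex_norm_square[of "f z"] by (simp add: c_def mult.commute)
  finally have "(cmod (f z))\<^sup>2 / N \<le> n2 f" by simp
  then show ?thesis using k by (simp add: N_def field_simps)
qed

end

section \<open>Levi forms\<close>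

text \<open>The value of \<open>dd\<^sup>c f\<close> on the vector \<open>v\<close>.\<close>

definition levi :: "(complex^'n \<Rightarrow> complex) \<Rightarrow> complex^'n \<Rightarrow> complex^'n \<Rightarrow> complex" where
  "levi f p v = (\<Sum>i\<in>UNIV. \<Sum>j\<in>UNIV. v $ i * cnj (v $ j) * wirt i (wirt_bar j f) p)"

lemma ddir_rotate:
  assumes "f differentiable (at p)"
  shows "(\<Sum>i\<in>UNIV. v $ i * wirt i f p) = (ddir v f p - \<i> * ddir (\<i> *s v) f p) / 2"
    "(\<Sum>i\<in>UNIV. cnj (v $ i) * wirt_bar i f p) = (ddir v f p + \<i> * ddir (\<i> *s v) f p) / 2"
proof -
  have 1: "ddir v f p = (\<Sum>i\<in>UNIV. v $ i * wirt i f p) + (\<Sum>i\<in>UNIV. cnj (v $ i) * wirt_bar i f p)"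
    by (simp add: ddir_wirt[OF assms] sum.distrib)
  have "ddir (\<i> *s v) f p = (\<Sum>i\<in>UNIV. \<i> * (v $ i * wirt i f p)) + (\<Sum>i\<in>UNIV. (- \<i>) * (cnj (v $ i) * wirt_bar i f p))"
    by (simp add: ddir_wirt[OF assms] sum.distrib sum_negf mult.assoc sum_subtractf)
  then have 2: "ddir (\<i> *s v) f p = \<i> * (\<Sum>i\<in>UNIV. v $ i * wirt i f p) - \<i> * (\<Sum>i\<in>UNIV. cnj (v $ i) * wirt_bar i f p)"
    by (simp add: sum_distrib_left sum_negf)
  show "(\<Sum>i\<in>UNIV. v $ i * wirt i f p) = (ddir v f p - \<i> * ddir (\<i> *s v) f p) / 2"
    "(\<Sum>i\<in>UNIV. cnj (v $ i) * wirt_bar i f p) = (ddir v f p + \<i> * ddir (\<i> *s v) f p) / 2"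
    unfolding 2 unfolding 1 by (simp_all add: algebra_simps)
qed

text \<open>One quarter of the Laplacian of the restriction of \<open>f\<close> to the complex line through \<open>p\<close> in direction \<open>v\<close>.\<close>

lemma levi_ddir:
  assumes U: "open U" "p \<in> U" and f: "smooth_on U f"
  shows "levi f p v = (ddir v (ddir v f) p + ddir (\<i> *s v) (ddir (\<i> *s v) f) p) / 4"
proof -
  have d: "ddir u f differentiable (at p)" for u
    using f U smooth_on_ddir smooth_on_differentiable by blast
  have w: "wirt_bar j f differentiable (at p)" for j
    using smooth_on_wirt(2)[OF U(1) f] U(2) smooth_on_differentiable by blast
  define g where "g x = (\<Sum>j\<in>UNIV. cnj (v $ j) * wirt_bar j f x)" for x
  have gd: "g differentiable (at p)"
    unfolding g_def by (intro differentiable_sum' differentiable_mult differentiable_const w)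
  have g_eq: "ddir u g p = (1/2) * ddir u (ddir v f) p + (\<i>/2) * ddir u (ddir (\<i> *s v) f) p" for u
  proof -
    have "ddir u g p = ddir u (\<lambda>x. (1/2) * ddir v f x + (\<i>/2) * ddir (\<i> *s v) f x) p"
    proof (rule ddir_cong[OF U])
      fix x assume "x \<in> U"
      then have "f differentiable (at x)" using f smooth_on_differentiable by blast
      from ddir_rotate(2)[OF this, of v]
      show "g x = (1/2) * ddir v f x + (\<i>/2) * ddir (\<i> *s v) f x" by (simp add: g_def field_simps)
    qed
    also have "\<dots> = ddir u (\<lambda>x. (1/2) * ddir v f x) p + ddir u (\<lambda>x. (\<i>/2) * ddir (\<i> *s v) f x) p"
      by (rule ddir_add) (intro differentiable_mult differentiable_const d)+
    also have "ddir u (\<lambda>x. (1/2) * ddir v f x) p = (1/2) * ddir u (ddir v f) p"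
      using ddir_mult[OF differentiable_const d, of u "1/2" v] by simp
    also have "ddir u (\<lambda>x. (\<i>/2) * ddir (\<i> *s v) f x) p = (\<i>/2) * ddir u (ddir (\<i> *s v) f) p"
      using ddir_mult[OF differentiable_const d, of u "\<i>/2" "\<i> *s v"] by simp
    finally show ?thesis .
  qed
  have "levi f p v = (\<Sum>i\<in>UNIV. v $ i * wirt i g p)"
    unfolding levi_def g_def by (simp add: wirt_sum wirt_cmult w sum_distrib_left mult.assoc)
  also have "\<dots> = (ddir v g p - \<i> * ddir (\<i> *s v) g p) / 2" by (rule ddir_rotate(1)[OF gd])
  also have "(ddir v g p - \<i> * ddir (\<i> *s v) g p) / 2 = (ddir v (ddir v f) p + ddir (\<i> *s v) (ddir (\<i> *s v) f) p) / 4"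
    unfolding g_eq using ddir_commute[OF U f, of v "\<i> *s v"] by (simp add: field_simps)
  finally show ?thesis .
qed

lemma wirt_real:
  assumes U: "open U" "p \<in> U" and f: "f differentiable (at p)" and real: "\<And>x. x \<in> U \<Longrightarrow> cnj (f x) = f x"
  shows "wirt_bar i f p = cnj (wirt i f p)"
proof -
  have "wirt_bar i f p = wirt_bar i (\<lambda>x. cnj (f x)) p"
    using real by (intro wirt_cong[OF U]) simp
  then show ?thesis using wirt_cnj(2)[OF f] by simp
qed

lemma wirt_hermitian:
  assumes U: "open U" "p \<in> U" and f: "smooth_on U f" and real: "\<And>x. x \<in> U \<Longrightarrow> cnj (f x) = f x"
  shows "wirt i (wirt_bar j f) p = cnj (wirt j (wirt_bar i f) p)"
proof -
  have "wirt j (wirt_bar i f) p = wirt j (\<lambda>x. cnj (wirt i f x)) p"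
    by (rule wirt_cong[OF U]) (rule wirt_real[OF U(1)], use f real smooth_on_differentiable in auto)
  also have "\<dots> = cnj (wirt_bar j (wirt i f) p)"
    using smooth_on_wirt(1)[OF U(1) f] U(2) smooth_on_differentiable by (intro wirt_cnj) blast
  also have "\<dots> = cnj (wirt i (wirt_bar j f) p)" using wirt_commute(2)[OF U f, of i j] by simp
  finally show ?thesis by simp
qed

lemma line_min_second_derivative:
  fixes g g' :: "real \<Rightarrow> real"
  assumes d: "d > 0" and g: "\<And>t. \<bar>t\<bar> < d \<Longrightarrow> (g has_real_derivative g' t) (at t)"
    and g2: "(g' has_real_derivative l) (at 0)" and min: "\<And>t. \<bar>t\<bar> < d \<Longrightarrow> g 0 \<le> g t"
  shows "g' 0 = 0" "l \<ge> 0"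
proof -
  show g0: "g' 0 = 0"
    by (rule DERIV_local_min[OF g[of 0] d]) (use min d in auto)
  show "l \<ge> 0"
  proof (rule ccontr)
    assume "\<not> l \<ge> 0"
    then obtain e where e: "e > 0" "\<And>h. 0 < h \<Longrightarrow> h < e \<Longrightarrow> g' h < g' 0"
      using DERIV_neg_dec_right[OF g2] by auto
    define h where "h = min e d / 2"
    have h: "h > 0" "h < e" "h < d" using e d by (auto simp: h_def)
    obtain z where z: "0 < z" "z < h" "g h - g 0 = (h - 0) * g' z"
      using MVT2[of 0 h g g'] g h by auto
    then have "g h - g 0 < 0" using e(2)[of z] h g0 by (simp add: mult_pos_neg)
    then show False using min[of h] h by simp
  qed
qed

text \<open>Second derivative test along the real lines in directions \<open>v\<close> and \<open>\<i> v\<close>.\<close>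

lemma levi_at_minimum:
  assumes U: "open U" "p \<in> U" and f: "smooth_on U f" and real: "\<And>x. x \<in> U \<Longrightarrow> cnj (f x) = f x"
    and nonneg: "\<And>x. x \<in> U \<Longrightarrow> Re (f x) \<ge> 0" and zero: "f p = 0"
  shows "wirt i f p = 0" "Re (levi f p v) \<ge> 0"
proof -
  obtain r where r: "r > 0" "ball p r \<subseteq> U" using U open_contains_ball by blast
  have dir: "Re (ddir u f p) = 0 \<and> Re (ddir u (ddir u f) p) \<ge> 0" for u
  proof -
    define d where "d = r / (norm u + 1)"
    have nu: "norm u + 1 > 0" by (simp add: add_nonneg_pos)
    have d: "d > 0" using r nu by (simp add: d_def)
    have inU: "p + t *\<^sub>R u \<in> U" if "\<bar>t\<bar> < d" for t
    proof -
      have "\<bar>t\<bar> * norm u \<le> \<bar>t\<bar> * (norm u + 1)" by (intro mult_left_mono) auto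
      also have "\<dots> < r" using that nu by (simp add: d_def pos_less_divide_eq)
      finally have "p + t *\<^sub>R u \<in> ball p r" by (simp add: dist_norm)
      then show ?thesis using r by blast
    qed
    have deriv: "((\<lambda>t. Re (F (p + t *\<^sub>R u))) has_real_derivative Re (ddir u F (p + t *\<^sub>R u))) (at t)"
      if t: "\<bar>t\<bar> < d" and F: "smooth_on U F" for F t
    proof -
      have "F differentiable (at (p + t *\<^sub>R u))" using inU[OF t] F smooth_on_differentiable by blast
      then have D: "(F has_derivative frechet_derivative F (at (p + t *\<^sub>R u))) (at (p + t *\<^sub>R u))"
        using frechet_derivative_works by blast
      have "((\<lambda>t. p + t *\<^sub>R u) has_derivative (\<lambda>x. x *\<^sub>R u)) (at t)"
        by (auto intro!: derivative_eq_intros)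
      from has_derivative_compose[OF this D]
      have "((\<lambda>t. F (p + t *\<^sub>R u)) has_derivative (\<lambda>x. x *\<^sub>R ddir u F (p + t *\<^sub>R u))) (at t)"
        by (simp add: ddir_def linear_scale[OF has_derivative_linear[OF D]])
      from bounded_linear.has_derivative[OF bounded_linear_Re this]
      show ?thesis by (simp add: has_field_derivative_def mult.commute[of _ "Re _"])
    qed
    have "Re (ddir u f (p + 0 *\<^sub>R u)) = 0 \<and> Re (ddir u (ddir u f) (p + 0 *\<^sub>R u)) \<ge> 0"
    proof (intro conjI)
      have m: "Re (f (p + 0 *\<^sub>R u)) \<le> Re (f (p + t *\<^sub>R u))" if "\<bar>t\<bar> < d" for t
        using nonneg[OF inU[OF that]] zero by simp
      have d0: "\<bar>0\<bar> < d" using d by simp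
      have g1: "((\<lambda>t. Re (f (p + t *\<^sub>R u))) has_real_derivative Re (ddir u f (p + t *\<^sub>R u))) (at t)" if "\<bar>t\<bar> < d" for t
        by (rule deriv[OF that f])
      note a = line_min_second_derivative[where g = "\<lambda>t. Re (f (p + t *\<^sub>R u))" and g' = "\<lambda>t. Re (ddir u f (p + t *\<^sub>R u))",
          OF d g1 deriv[OF d0 smooth_on_ddir[OF f]] m]
      show "Re (ddir u f (p + 0 *\<^sub>R u)) = 0" by (rule a(1))
      show "Re (ddir u (ddir u f) (p + 0 *\<^sub>R u)) \<ge> 0" by (rule a(2))
    qed
    then show ?thesis by simp
  qed
  have df: "f differentiable (at p)" using f U smooth_on_differentiable by blast
  have im: "Im (ddir u f p) = 0" for u
  proof -
    have "ddir u f p = ddir u (\<lambda>x. cnj (f x)) p" using real by (intro ddir_cong[OF U]) simp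
    also have "\<dots> = cnj (ddir u f p)" by (rule ddir_cnj[OF df])
    finally show ?thesis by (simp add: complex_eq_iff)
  qed
  have "ddir u f p = 0" for u using dir[of u] im[of u] by (simp add: complex_eq_iff)
  then show "wirt i f p = 0" by (simp add: wirt_ddir)
  show "Re (levi f p v) \<ge> 0"
    unfolding levi_ddir[OF U f] using dir by simp
qed

lemma levi_add_cmult:
  assumes U: "open U" "p \<in> U" and f: "smooth_on U f" and g: "smooth_on U g"
  shows "levi (\<lambda>x. f x + c * g x) p v = levi f p v + c * levi g p v"
proof -
  have d: "wirt_bar j f differentiable (at p)" "wirt_bar j g differentiable (at p)" for j
    using smooth_on_wirt(2)[OF U(1) f] smooth_on_wirt(2)[OF U(1) g] U(2) smooth_on_differentiable by blast+
  have "wirt i (wirt_bar j (\<lambda>x. f x + c * g x)) p = wirt i (wirt_bar j f) p + c * wirt i (wirt_bar j g) p" for i j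
  proof -
    have "wirt i (wirt_bar j (\<lambda>x. f x + c * g x)) p = wirt i (\<lambda>x. wirt_bar j f x + c * wirt_bar j g x) p"
    proof (rule wirt_cong[OF U])
      fix x assume "x \<in> U"
      then have "f differentiable (at x)" "g differentiable (at x)" using f g smooth_on_differentiable by blast+
      then show "wirt_bar j (\<lambda>x. f x + c * g x) x = wirt_bar j f x + c * wirt_bar j g x"
        by (simp add: wirt_add wirt_cmult differentiable_mult)
    qed
    then show ?thesis using d by (simp add: wirt_add wirt_cmult differentiable_mult)
  qed
  then show ?thesis
    by (simp add: levi_def sum.distrib sum_distrib_left algebra_simps)
qed

lemma wirt_norm2_holomorphic:
  assumes U: "open U" "p \<in> U" and k: "k mholomorphic_on U"
  shows "wirt i (\<lambda>x. k x * cnj (k x)) p = wirt i k p * cnj (k p)"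
    "levi (\<lambda>x. k x * cnj (k x)) p v = complex_of_real ((cmod (\<Sum>i\<in>UNIV. v $ i * wirt i k p))\<^sup>2)"
proof -
  have d: "k differentiable (at x)" "(\<lambda>x. cnj (k x)) differentiable (at x)" if "x \<in> U" for x
    using mholomorphic_differentiable[OF k that] differentiable_linear_post[OF bounded_linear_cnj] by blast+
  have wk: "wirt j k mholomorphic_on U" for j by (rule mholomorphic_wirt_mholomorphic[OF U(1) k])
  have dw: "(\<lambda>x. cnj (wirt j k x)) differentiable (at p)" "wirt j k differentiable (at p)" for j
    using mholomorphic_differentiable[OF wk U(2)] differentiable_linear_post[OF bounded_linear_cnj] by blast+
  show "wirt i (\<lambda>x. k x * cnj (k x)) p = wirt i k p * cnj (k p)"
    using d[OF U(2)] by (simp add: wirt_mult wirt_cnj mholomorphic_wirt(1)[OF k U(2)])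
  have "wirt i (wirt_bar j (\<lambda>x. k x * cnj (k x))) p = wirt i k p * cnj (wirt j k p)" for i j
  proof -
    have "wirt i (wirt_bar j (\<lambda>x. k x * cnj (k x))) p = wirt i (\<lambda>x. k x * cnj (wirt j k x)) p"
      by (rule wirt_cong[OF U]) (simp add: wirt_mult wirt_cnj d mholomorphic_wirt(1)[OF k])
    also have "\<dots> = wirt i k p * cnj (wirt j k p)"
      using d[OF U(2)] dw by (simp add: wirt_mult wirt_cnj mholomorphic_wirt(1)[OF wk U(2)])
    finally show ?thesis .
  qed
  then have "levi (\<lambda>x. k x * cnj (k x)) p v = (\<Sum>i\<in>UNIV. \<Sum>j\<in>UNIV. (v $ i * wirt i k p) * cnj (v $ j * wirt j k p))"
    by (simp add: levi_def mult_ac)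
  also have "\<dots> = (\<Sum>i\<in>UNIV. v $ i * wirt i k p) * cnj (\<Sum>i\<in>UNIV. v $ i * wirt i k p)"
    by (simp add: sum_product)
  also have "\<dots> = complex_of_real ((cmod (\<Sum>i\<in>UNIV. v $ i * wirt i k p))\<^sup>2)"
    using complex_norm_square by metis
  finally show "levi (\<lambda>x. k x * cnj (k x)) p v = complex_of_real ((cmod (\<Sum>i\<in>UNIV. v $ i * wirt i k p))\<^sup>2)" .
qed

lemma ln_smooth:
  assumes U: "open U" and f: "smooth_on U f" and pos: "\<And>x. x \<in> U \<Longrightarrow> f x \<in> \<real> \<and> Re (f x) > 0"
  shows "smooth_on U (\<lambda>x. Ln (f x))"
    and "p \<in> U \<Longrightarrow> wirt i (\<lambda>x. Ln (f x)) p = wirt i f p / f p"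
    and "p \<in> U \<Longrightarrow> wirt_bar i (\<lambda>x. Ln (f x)) p = wirt_bar i f p / f p"
    and "p \<in> U \<Longrightarrow> wirt i (wirt_bar j (\<lambda>x. Ln (f x))) p = wirt i (wirt_bar j f) p / f p - wirt_bar j f p * wirt i f p / (f p)\<^sup>2"
proof -
  have in': "f x \<in> - \<real>\<^sub>\<le>\<^sub>0" if "x \<in> U" for x
    using pos[OF that] by (auto elim!: nonpos_Reals_cases simp: Reals_def)
  show sm: "smooth_on U (\<lambda>x. Ln (f x))"
    by (rule smooth_on_holomorphic_comp[OF U f, of "- \<real>\<^sub>\<le>\<^sub>0"])
      (use in' in \<open>auto intro!: holomorphic_intros closed_nonpos_Reals_complex simp: open_Compl\<close>)
  have d: "f differentiable (at x)" if "x \<in> U" for x using f that smooth_on_differentiable by blast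
  have L: "Ln field_differentiable (at (f x))" "deriv Ln (f x) = inverse (f x)" if "x \<in> U" for x
  proof -
    have "(Ln has_field_derivative inverse (f x)) (at (f x))" using in'[OF that] by (intro has_field_derivative_Ln) auto
    then show "Ln field_differentiable (at (f x))" "deriv Ln (f x) = inverse (f x)"
      by (auto simp: field_differentiable_def DERIV_imp_deriv)
  qed
  have w: "wirt i (\<lambda>x. Ln (f x)) p = wirt i f p / f p"
      "wirt_bar i (\<lambda>x. Ln (f x)) p = wirt_bar i f p / f p" if "p \<in> U" for p i
    using that by (simp_all add: wirt_holomorphic_comp d L divide_inverse mult.commute)
  show "p \<in> U \<Longrightarrow> wirt i (\<lambda>x. Ln (f x)) p = wirt i f p / f p"
    "p \<in> U \<Longrightarrow> wirt_bar i (\<lambda>x. Ln (f x)) p = wirt_bar i f p / f p" by (rule w, assumption)+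
  assume p: "p \<in> U"
  have nz: "f x \<noteq> 0" if "x \<in> U" for x using pos[OF that] by auto
  have inv: "inverse field_differentiable (at (f p))" "deriv inverse (f p) = - 1 / (f p)\<^sup>2"
  proof -
    have "(inverse has_field_derivative - (inverse (f p) ^ Suc (Suc 0))) (at (f p))"
      using nz[OF p] by (rule DERIV_inverse)
    then show "inverse field_differentiable (at (f p))" "deriv inverse (f p) = - 1 / (f p)\<^sup>2"
      by (auto simp: field_differentiable_def DERIV_imp_deriv power2_eq_square divide_inverse)
  qed
  have dw: "wirt_bar j f differentiable (at p)" using smooth_on_wirt(2)[OF U f] p smooth_on_differentiable by blast
  have "wirt i (wirt_bar j (\<lambda>x. Ln (f x))) p = wirt i (\<lambda>x. wirt_bar j f x * inverse (f x)) p"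
    by (rule wirt_cong[OF U p]) (simp add: w divide_inverse)
  also have "\<dots> = wirt i (wirt_bar j f) p * inverse (f p) + wirt_bar j f p * (- 1 / (f p)\<^sup>2 * wirt i f p)"
    using wirt_mult(1)[OF dw differentiable_holomorphic_comp[OF d[OF p] inv(1)], of i]
      wirt_holomorphic_comp(1)[OF d[OF p] inv(1), of i] inv(2) by simp
  finally show "wirt i (wirt_bar j (\<lambda>x. Ln (f x))) p = wirt i (wirt_bar j f) p / f p - wirt_bar j f p * wirt i f p / (f p)\<^sup>2"
    by (simp add: divide_inverse mult_ac)
qed

section \<open>Regularity of the kernel on the diagonal\<close>

text \<open>\<open>fstv\<close> and \<open>sndc\<close> split a point of the doubled space into \<open>z\<close> and the conjugate of the remaining
  coordinates; \<open>antidiag\<close> embeds \<open>\<Omega>\<close> as the totally real set on which both agree.\<close>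

definition fstv :: "complex^('n + 'n) \<Rightarrow> complex^'n" where
  "fstv x = (\<chi> i. x $ Inl i)"

definition sndc :: "complex^('n + 'n) \<Rightarrow> complex^'n" where
  "sndc x = (\<chi> i. cnj (x $ Inr i))"

definition antidiag :: "complex^'n \<Rightarrow> complex^('n + 'n)" where
  "antidiag z = (\<chi> s. case s of Inl i \<Rightarrow> z $ i | Inr i \<Rightarrow> cnj (z $ i))"

lemma polar_linear: "bounded_linear fstv" "bounded_linear sndc" "bounded_linear antidiag"
proof -
  show "bounded_linear fstv" "bounded_linear sndc"
    unfolding linear_conv_bounded_linear[symmetric]
    by (auto intro!: linearI simp: fstv_def sndc_def vec_eq_iff)
  show "bounded_linear antidiag"
    unfolding linear_conv_bounded_linear[symmetric]
    by (auto intro!: linearI simp: antidiag_def vec_eq_iff split: sum.split)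
qed

lemma polar_simps [simp]:
  "fstv (antidiag z) = z" "sndc (antidiag z) = z"
  "fstv (x + axis (Inl i) t) = fstv x + axis i t" "fstv (x + axis (Inr i) t) = fstv x"
  "sndc (x + axis (Inl i) t) = sndc x" "sndc (x + axis (Inr i) t) = sndc x + axis i (cnj t)"
  by (auto simp: fstv_def sndc_def antidiag_def axis_def vec_eq_iff)

context bounded_open
begin

lemma K_local_bound:
  assumes "z0 \<in> \<Omega>" "w0 \<in> \<Omega>"
  shows "\<exists>r>0. \<exists>M. \<forall>z\<in>ball z0 r. \<forall>w\<in>ball w0 r. cmod (K z w) \<le> M"
proof -
  obtain C r where C: "C > 0" "r > 0" "ball z0 r \<subseteq> \<Omega>" "\<forall>q\<in>ball z0 r. \<forall>f\<in>A2. (cmod (f q))\<^sup>2 \<le> C * n2 f"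
    using A2_loc_bound[OF assms(1)] by blast
  obtain D s where D: "D > 0" "s > 0" "ball w0 s \<subseteq> \<Omega>" "\<forall>q\<in>ball w0 s. \<forall>f\<in>A2. (cmod (f q))\<^sup>2 \<le> D * n2 f"
    using A2_loc_bound[OF assms(2)] by blast
  have "cmod (K z w) \<le> sqrt (C * D)" if z: "z \<in> ball z0 (min r s)" and w: "w \<in> ball w0 (min r s)" for z w
  proof -
    have w': "w \<in> \<Omega>" "w \<in> ball w0 s" using w D(3) by auto
    have k: "(\<lambda>u. K u w) \<in> A2" using K_A2 w' by blast
    define N where "N = n2 (\<lambda>u. K u w)"
    have kw: "K w w = of_real N" using K_diag[OF w'(1)] by (simp add: N_def)
    then have N: "N > 0" using K_diag_pos[OF w'(1)] by simp
    have "(cmod (K w w))\<^sup>2 \<le> D * N" unfolding N_def by (rule D(4)[rule_format, OF w'(2) k])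
    then have "N * N \<le> D * N" using N by (simp add: kw power2_eq_square)
    then have ND: "N \<le> D" using N by simp
    have "(cmod (K z w))\<^sup>2 \<le> C * N" unfolding N_def using z by (intro C(4)[rule_format, OF _ k]) simp
    also have "\<dots> \<le> C * D" using ND C(1) by (intro mult_left_mono) auto
    finally show ?thesis by (rule real_le_rsqrt)
  qed
  then show ?thesis using C(2) D(2) by (intro exI[of _ "min r s"] exI[of _ "sqrt (C * D)"] conjI ballI) auto
qed

text \<open>\<open>K\<close> is holomorphic in the first and antiholomorphic in the second variable, and locally bounded;
  after conjugating the second variable, Osgood applies in the doubled space.\<close>

lemma K_polarised_holomorphic:
  "(\<lambda>x. K (fstv x) (sndc x)) mholomorphic_on {x. fstv x \<in> \<Omega> \<and> sndc x \<in> \<Omega>}" (is "?G mholomorphic_on ?V")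
  and K_polarised_open: "open {x. fstv x \<in> \<Omega> \<and> sndc x \<in> \<Omega>}"
proof -
  have V: "?V = fstv -` \<Omega> \<inter> sndc -` \<Omega>" by auto
  have "continuous_on UNIV fstv" "continuous_on UNIV sndc"
    using polar_linear linear_continuous_on by blast+
  then show oV: "open ?V" unfolding V using open_dom by (intro open_Int open_vimage)
  show "?G mholomorphic_on ?V"
  proof (rule osgood[OF oV])
    have hol: "(\<lambda>u. K u w) mholomorphic_on \<Omega>" if "w \<in> \<Omega>" for w using A2_hol K_A2 that by blast
    have dir: "(\<lambda>t. K (z + axis i t) w) field_differentiable (at 0)" if "z \<in> \<Omega>" "w \<in> \<Omega>" for z w i
      using mholomorphic_sep_hol(1)[OF open_dom hol[OF that(2)]] that(1) unfolding sep_hol_def by blast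
    show "sep_hol ?V ?G" unfolding sep_hol_def
    proof (intro ballI allI)
      fix x :: "complex^('n + 'n)" and s :: "'n + 'n" assume x: "x \<in> ?V"
      then have zw: "fstv x \<in> \<Omega>" "sndc x \<in> \<Omega>" by auto
      show "(\<lambda>t. K (fstv (x + axis s t)) (sndc (x + axis s t))) field_differentiable (at 0)"
      proof (cases s)
        case (Inl i)
        then show ?thesis using dir[OF zw] by simp
      next
        case (Inr i)
        obtain r where r: "r > 0" "ball (sndc x) r \<subseteq> \<Omega>" using zw(2) open_dom open_contains_ball by blast
        have "(\<lambda>t. K (sndc x + axis i t) (fstv x)) field_differentiable (at (cnj 0))"
          using dir[OF zw(2,1)] by simp
        then have "(cnj \<circ> (\<lambda>t. K (sndc x + axis i t) (fstv x)) \<circ> cnj) field_differentiable (at 0)"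
          by (rule field_differentiable_cnj_cnj)
        then obtain D where D: "((cnj \<circ> (\<lambda>t. K (sndc x + axis i t) (fstv x)) \<circ> cnj) has_field_derivative D) (at 0)"
          unfolding field_differentiable_def by blast
        have "((\<lambda>t. K (fstv x) (sndc x + axis i (cnj t))) has_field_derivative D) (at 0)"
        proof (rule has_field_derivative_transform_within[OF D r(1)])
          fix t :: complex assume "dist t 0 < r"
          then have "sndc x + axis i (cnj t) \<in> ball (sndc x) r"
            by (simp add: dist_norm norm_axis_complex)
          then have "sndc x + axis i (cnj t) \<in> \<Omega>" using r by blast
          from K_hermitian[OF this zw(1)]
          show "(cnj \<circ> (\<lambda>t. K (sndc x + axis i t) (fstv x)) \<circ> cnj) t = K (fstv x) (sndc x + axis i (cnj t))"
            by simp
        qed simp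
        then show ?thesis using Inr by (auto simp: field_differentiable_def)
      qed
    qed
    show "loc_bdd ?V ?G" unfolding loc_bdd_def
    proof
      fix x assume x: "x \<in> ?V"
      then obtain r M where r: "r > 0" "\<forall>z\<in>ball (fstv x) r. \<forall>w\<in>ball (sndc x) r. cmod (K z w) \<le> M"
        using K_local_bound[of "fstv x" "sndc x"] by auto
      define W where "W = fstv -` ball (fstv x) r \<inter> sndc -` ball (sndc x) r"
      have "open W" unfolding W_def using polar_linear linear_continuous_on by (intro open_Int open_vimage) auto
      moreover have "x \<in> W" using r by (simp add: W_def)
      ultimately obtain e where e: "e > 0" "polydisc x e \<subseteq> W" using polydisc_subset_open by metis
      have "\<forall>y\<in>polydisc x e. cmod (K (fstv y) (sndc y)) \<le> M"
      proof
        fix y assume "y \<in> polydisc x e"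
        then have "y \<in> W" using e by blast
        then show "cmod (K (fstv y) (sndc y)) \<le> M" using r(2) by (simp add: W_def)
      qed
      then show "\<exists>r>0. \<exists>M. \<forall>x\<in>polydisc x r. cmod (K (fstv x) (sndc x)) \<le> M" using e(1) by blast
    qed
  qed
qed

text \<open>Restriction of a holomorphic function to a real linear subspace.\<close>

lemma K_smooth: "smooth_on \<Omega> (\<lambda>z. K z z)"
proof -
  have "smooth_on {x. fstv x \<in> \<Omega> \<and> sndc x \<in> \<Omega>} (\<lambda>x. K (fstv x) (sndc x))"
    by (rule mholomorphic_smooth[OF K_polarised_open K_polarised_holomorphic])
  from smooth_on_linear_comp[OF open_dom polar_linear(3) _ this]
  have "smooth_on \<Omega> (\<lambda>z. K (fstv (antidiag z)) (sndc (antidiag z)))" by (auto simp: image_subset_iff)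
  then show ?thesis by simp
qed

lemma K_real: "z \<in> \<Omega> \<Longrightarrow> K z z \<in> \<real> \<and> Re (K z z) > 0"
  using K_diag K_diag_pos by auto

abbreviation "logK \<equiv> \<lambda>z. Ln (K z z)"

lemma logK_smooth: "smooth_on \<Omega> logK"
  by (rule ln_smooth(1)[OF open_dom K_smooth]) (use K_real in auto)

lemma wirt_logK:
  assumes "p \<in> \<Omega>"
  shows "wirt_bar i logK p = wirt_bar i (\<lambda>z. K z z) p / K p p"
    "wirt i (wirt_bar j logK) p =
      wirt i (wirt_bar j (\<lambda>z. K z z)) p / K p p - wirt_bar j (\<lambda>z. K z z) p * wirt i (\<lambda>z. K z z) p / (K p p)\<^sup>2"
  by (rule ln_smooth(3)[OF open_dom K_smooth] ln_smooth(4)[OF open_dom K_smooth]; use K_real assms in auto)+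

section \<open>Positivity of the Bergman metric\<close>

text \<open>By the reproducing property \<open>K z p\<close> is orthogonal to \<open>h\<close>, and this is Bessel's inequality for the
  evaluation at \<open>z\<close> with these two functions.\<close>

lemma K_extremal_bound:
  assumes z: "z \<in> \<Omega>" and p: "p \<in> \<Omega>" and h: "h \<in> A2" "h p = 0" "n2 h > 0"
  shows "(cmod (K z p))\<^sup>2 / Re (K p p) + (cmod (h z))\<^sup>2 / n2 h \<le> Re (K z z)"
proof -
  define N where "N = n2 h"
  define k where "k = (\<lambda>u. K u p)"
  define \<kappa> where "\<kappa> = Re (K p p)"
  have k: "k \<in> A2" "n2 k = \<kappa>" "\<kappa> > 0"
    using K_A2[OF p] K_diag[OF p] K_diag_pos[OF p] by (simp_all add: k_def \<kappa>_def)
  have hk: "ip h k = 0" using K_reproducing[OF p h(1)] h(2) by (simp add: k_def)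
  define X where "X = (cmod (k z))\<^sup>2 / \<kappa> + (cmod (h z))\<^sup>2 / N"
  have X0: "X \<ge> 0" using k h by (simp add: X_def N_def)
  define a where "a = cnj (h z) / of_real N"
  define b where "b = cnj (k z) / of_real \<kappa>"
  define f where "f = (\<lambda>u. a * h u + b * k u)"
  have fA: "f \<in> A2" unfolding f_def using A2_add[OF A2_cmult[OF h(1)] A2_cmult[OF k(1)]] .
  have "f z = of_real X"
    using complex_norm_square[of "h z"] complex_norm_square[of "k z"]
    by (simp add: f_def a_def b_def X_def mult.commute)
  then have fz: "(cmod (f z))\<^sup>2 = X\<^sup>2" by simp
  have "n2 f = n2 (\<lambda>u. a * h u) + n2 (\<lambda>u. b * k u) + 2 * Re (ip (\<lambda>u. a * h u) (\<lambda>u. b * k u))"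
    unfolding f_def by (rule n2_add[OF A2_cmult[OF h(1)] A2_cmult[OF k(1)]])
  also have "ip (\<lambda>u. a * h u) (\<lambda>u. b * k u) = 0"
    using ip_cmult[of a h "\<lambda>u. b * k u"] ip_cnj[of h "\<lambda>u. b * k u"] ip_cmult[of b k h] ip_cnj[of k h] hk by simp
  also have "n2 (\<lambda>u. a * h u) = (cmod (h z))\<^sup>2 / N"
    unfolding n2_cmult using h(3) by (simp add: a_def N_def norm_divide power_divide power2_eq_square)
  also have "n2 (\<lambda>u. b * k u) = (cmod (k z))\<^sup>2 / \<kappa>"
    unfolding n2_cmult using k by (simp add: b_def norm_divide power_divide power2_eq_square)
  finally have nf: "n2 f = X" by (simp add: X_def)
  have "X\<^sup>2 \<le> X * Re (K z z)" using K_cauchy_schwarz[OF z fA] by (simp add: fz nf)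
  then have "X \<le> Re (K z z)"
    using X0 K_diag_pos[OF z] by (cases "X = 0") (auto simp: power2_eq_square)
  then show ?thesis by (simp add: X_def k_def \<kappa>_def N_def)
qed

text \<open>Subtract from \<open>K\<close> on the diagonal the contributions of the kernel function at \<open>p\<close> and of a linear function \<open>h\<close>
  that vanishes at \<open>p\<close> but has nonzero derivative in direction \<open>v\<close>. The difference is nonnegative with
  a zero at \<open>p\<close>, so its Levi form there is nonnegative. The first contribution has the same first
  derivatives as \<open>K\<close> and cancels against the gradient term of the Levi form of the logarithm; the
  second one contributes a positive amount.\<close>

theorem logK_positive:
  assumes p: "p \<in> \<Omega>" and v: "v \<noteq> 0"
  shows "Re (levi logK p v) > 0"
proof -
  define \<kappa> where "\<kappa> = Re (K p p)"
  have \<kappa>: "\<kappa> > 0" "K p p = of_real \<kappa>" using K_diag_pos[OF p] K_diag[OF p] by (auto simp: \<kappa>_def)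
  define h where "h z = (\<Sum>i\<in>UNIV. cnj (v $ i) * (z $ i - p $ i))" for z :: "complex^'n"
  define S where "S = (\<Sum>i\<in>UNIV. (cmod (v $ i))\<^sup>2)"
  have S: "S > 0"
  proof -
    obtain i where "v $ i \<noteq> 0" using v by (auto simp: vec_eq_iff)
    then show ?thesis unfolding S_def by (intro sum_pos2[of _ i]) auto
  qed
  have hd: "(h has_derivative (\<lambda>u. \<Sum>i\<in>UNIV. cnj (v $ i) * u $ i)) (at z)" for z
    unfolding h_def by (auto intro!: derivative_eq_intros bounded_linear.has_derivative[OF bounded_linear_vec_nth])
  have hhol: "h mholomorphic_on \<Omega>"
    unfolding mholomorphic_on_def
    by (intro ballI exI[of _ "\<lambda>u. \<Sum>i\<in>UNIV. cnj (v $ i) * u $ i"] conjI hd) (simp add: sum_distrib_left mult_ac)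
  have wh: "(\<Sum>i\<in>UNIV. v $ i * wirt i h z) = of_real S" if "z \<in> \<Omega>" for z
  proof -
    have "(\<Sum>i\<in>UNIV. v $ i * wirt i h z) = ddir v h z"
      using mholomorphic_wirt(3)[OF hhol that, of v] by (simp add: mult.commute)
    also have "\<dots> = (\<Sum>i\<in>UNIV. cnj (v $ i) * v $ i)" by (rule ddir_has_derivative[OF hd])
    also have "\<dots> = of_real S" unfolding S_def of_real_sum
      by (rule sum.cong) (simp_all add: complex_norm_square[symmetric] mult.commute[of "cnj _"] flip: of_real_power)
    finally show ?thesis .
  qed
  have h0: "h p = 0" by (simp add: h_def)
  have hA: "h \<in> A2"
  proof -
    obtain B where B: "\<And>z. z \<in> \<Omega> \<Longrightarrow> norm z \<le> B" using bounded_dom unfolding bounded_iff by blast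
    show ?thesis
    proof (rule A2_bounded[OF hhol])
      fix z assume z: "z \<in> \<Omega>"
      have "cmod (h z) \<le> (\<Sum>i\<in>UNIV. cmod (cnj (v $ i) * (z $ i - p $ i)))" unfolding h_def by (rule norm_sum)
      also have "\<dots> \<le> (\<Sum>i\<in>UNIV. cmod (v $ i) * (B + B))"
      proof (rule sum_mono)
        fix i
        have "cmod (z $ i - p $ i) \<le> cmod (z $ i) + cmod (p $ i)" by (rule norm_triangle_ineq4)
        also have "\<dots> \<le> B + B"
          using B[OF z] B[OF p] Finite_Cartesian_Product.norm_nth_le[of z i] Finite_Cartesian_Product.norm_nth_le[of p i] by linarith
        finally show "cmod (cnj (v $ i) * (z $ i - p $ i)) \<le> cmod (v $ i) * (B + B)"
          unfolding norm_mult complex_mod_cnj by (rule mult_left_mono) simp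
      qed
      finally show "cmod (h z) \<le> (\<Sum>i\<in>UNIV. cmod (v $ i) * (B + B))" .
    qed
  qed
  define N where "N = n2 h"
  have N: "N > 0"
  proof (rule ccontr)
    assume "\<not> N > 0"
    then have "n2 h = 0" using n2_nonneg[of h] by (simp add: N_def)
    then have "h z = 0" if "z \<in> \<Omega>" for z using K_cauchy_schwarz[OF that hA] by simp
    then have "ddir v h p = ddir v (\<lambda>z. 0) p" by (intro ddir_cong[OF open_dom p]) simp
    then have "(\<Sum>i\<in>UNIV. v $ i * wirt i h p) = 0"
      using mholomorphic_wirt(3)[OF hhol p, of v] by (simp add: mult.commute)
    then show False using wh[OF p] S by simp
  qed
  define k where "k = (\<lambda>u. K u p)"
  have kh: "k mholomorphic_on \<Omega>" using A2_hol[OF K_A2[OF p]] by (simp add: k_def)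
  have sk: "smooth_on \<Omega> (\<lambda>x. k x * cnj (k x))" "smooth_on \<Omega> (\<lambda>x. h x * cnj (h x))"
    using mholomorphic_smooth[OF open_dom kh] mholomorphic_smooth[OF open_dom hhol]
    by (auto intro!: smooth_on_mult smooth_on_cnj open_dom)
  define D1 where "D1 = (\<lambda>x. K x x + (- 1 / of_real \<kappa>) * (k x * cnj (k x)))"
  define D where "D = (\<lambda>x. D1 x + (- 1 / of_real N) * (h x * cnj (h x)))"
  have sD1: "smooth_on \<Omega> D1" unfolding D1_def
    by (intro smooth_on_add smooth_on_mult[OF open_dom smooth_on_const] open_dom K_smooth sk)
  have sD: "smooth_on \<Omega> D" unfolding D_def
    by (intro smooth_on_add smooth_on_mult[OF open_dom smooth_on_const] open_dom sD1 sk)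
  have Dval: "D x = of_real (Re (K x x) - (cmod (k x))\<^sup>2 / \<kappa> - (cmod (h x))\<^sup>2 / N)" if "x \<in> \<Omega>" for x
    using K_real[OF that] complex_norm_square[of "k x"] complex_norm_square[of "h x"]
    by (simp add: D_def D1_def)
  have Dre: "cnj (D x) = D x" if "x \<in> \<Omega>" for x by (simp add: Dval[OF that])
  have Dnn: "Re (D x) \<ge> 0" if "x \<in> \<Omega>" for x
    using K_extremal_bound[OF that p hA h0] N by (simp add: Dval[OF that] k_def \<kappa>_def N_def)
  have D0: "D p = 0" using \<kappa> by (simp add: Dval[OF p] k_def h0 power2_eq_square)
  note m = levi_at_minimum[OF open_dom p sD Dre Dnn D0]
  define a where "a = (\<Sum>i\<in>UNIV. v $ i * wirt i k p)"
  have leviD: "levi D p v = levi (\<lambda>x. K x x) p v - of_real ((cmod a)\<^sup>2) / of_real \<kappa> - of_real (S\<^sup>2) / of_real N"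
    unfolding D_def levi_add_cmult[OF open_dom p sD1 sk(2)]
    unfolding D1_def levi_add_cmult[OF open_dom p K_smooth sk(1)]
    using wirt_norm2_holomorphic(2)[OF open_dom p kh, of v] wirt_norm2_holomorphic(2)[OF open_dom p hhol, of v] wh[OF p]
    by (simp add: a_def)
  have df: "(\<lambda>x. K x x) differentiable (at p)" "(\<lambda>x. k x * cnj (k x)) differentiable (at p)"
    "(\<lambda>x. h x * cnj (h x)) differentiable (at p)" "D1 differentiable (at p)"
    using K_smooth sk sD1 p smooth_on_differentiable by blast+
  have wK: "wirt i (\<lambda>x. K x x) p = wirt i k p" for i
  proof -
    have "wirt i D p = wirt i D1 p + (- 1 / of_real N) * wirt i (\<lambda>x. h x * cnj (h x)) p"
      unfolding D_def wirt_add(1)[OF df(4) differentiable_mult[OF differentiable_const df(3)]] wirt_cmult(1)[OF df(3)] ..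
    also have "wirt i D1 p = wirt i (\<lambda>x. K x x) p + (- 1 / of_real \<kappa>) * wirt i (\<lambda>x. k x * cnj (k x)) p"
      unfolding D1_def wirt_add(1)[OF df(1) differentiable_mult[OF differentiable_const df(2)]] wirt_cmult(1)[OF df(2)] ..
    finally have "wirt i D p = wirt i (\<lambda>x. K x x) p - wirt i k p"
      using wirt_norm2_holomorphic(1)[OF open_dom p kh, of i] wirt_norm2_holomorphic(1)[OF open_dom p hhol, of i] h0 \<kappa>
      by (simp add: k_def)
    then show ?thesis using m(1)[of i] by simp
  qed
  have wbK: "wirt_bar j (\<lambda>x. K x x) p = cnj (wirt j k p)" for j
    using wirt_real[OF open_dom p df(1), of j] K_real wK[of j] by (simp add: Reals_cnj_iff)
  have "levi logK p v = (\<Sum>i\<in>UNIV. \<Sum>j\<in>UNIV. v $ i * cnj (v $ j) * (wirt i (wirt_bar j (\<lambda>x. K x x)) p / K p p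
      - cnj (wirt j k p) * wirt i k p / (K p p)\<^sup>2))"
    unfolding levi_def wirt_logK(2)[OF p] wK wbK ..
  also have "\<dots> = levi (\<lambda>x. K x x) p v / K p p - (\<Sum>i\<in>UNIV. \<Sum>j\<in>UNIV. (v $ i * wirt i k p) * cnj (v $ j * wirt j k p)) / (K p p)\<^sup>2"
    unfolding levi_def sum_divide_distrib sum_subtractf[symmetric]
    by (intro sum.cong refl) (simp add: field_simps)
  also have "(\<Sum>i\<in>UNIV. \<Sum>j\<in>UNIV. (v $ i * wirt i k p) * cnj (v $ j * wirt j k p)) = a * cnj a"
    by (simp add: a_def sum_product)
  also have "a * cnj a = of_real ((cmod a)\<^sup>2)" using complex_norm_square[of a] by simp
  finally have "levi logK p v = levi (\<lambda>x. K x x) p v / of_real \<kappa> - of_real ((cmod a)\<^sup>2) / of_real (\<kappa>\<^sup>2)"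
    by (simp add: \<kappa>(2))
  also have "\<dots> = (levi D p v + of_real (S\<^sup>2 / N)) / of_real \<kappa>"
    unfolding leviD using \<kappa> by (simp add: field_simps power2_eq_square)
  finally have "Re (levi logK p v) = (Re (levi D p v) + S\<^sup>2 / N) / \<kappa>"
    by (simp add: Re_divide_of_real)
  moreover have "S\<^sup>2 / N > 0" using S N by simp
  ultimately show ?thesis using m(2)[of v] \<kappa>(1) by simp
qed

end

section \<open>Holomorphic maps and the transformation law of the kernel\<close>

definition jac :: "(complex^'n \<Rightarrow> complex^'m) \<Rightarrow> complex^'n \<Rightarrow> complex^'n^'m" where
  "jac s p = (\<chi> k i. wirt i (\<lambda>z. s z $ k) p)"

lemma jac_mult: "(jac s p *v v) $ k = (\<Sum>i\<in>UNIV. wirt i (\<lambda>z. s z $ k) p * v $ i)"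
  by (simp add: jac_def matrix_vector_mult_def)

lemma axis_bounded_linear: "bounded_linear (\<lambda>t. axis k t :: complex^'n)"
  unfolding linear_conv_bounded_linear[symmetric]
  by (rule linearI) (auto simp: axis_def vec_eq_iff)

lemma vec_axis_expand: "(x :: complex^'m) = (\<Sum>k\<in>UNIV. axis k (x $ k))"
proof -
  have "(\<Sum>k\<in>UNIV. axis k (x $ k)) $ j = (\<Sum>k\<in>UNIV. if k = j then x $ k else 0)" for j
    unfolding sum_component by (rule sum.cong) (auto simp: axis_def)
  then show ?thesis by (simp add: vec_eq_iff)
qed

lemma holomorphic_map_has_derivative:
  fixes s :: "complex^'n \<Rightarrow> complex^'m"
  assumes "\<And>k. (\<lambda>z. s z $ k) mholomorphic_on U" "p \<in> U"
  shows "(s has_derivative (\<lambda>v. jac s p *v v)) (at p)"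
proof -
  have "((\<lambda>z. \<Sum>k\<in>UNIV. axis k (s z $ k)) has_derivative
      (\<lambda>v. \<Sum>k\<in>UNIV. axis k (\<Sum>i\<in>UNIV. wirt i (\<lambda>z. s z $ k) p * v $ i))) (at p)"
    by (intro has_derivative_sum bounded_linear.has_derivative[OF axis_bounded_linear] mholomorphic_wirt(2)[OF assms])
  moreover have "(\<Sum>k\<in>UNIV. axis k (\<Sum>i\<in>UNIV. wirt i (\<lambda>z. s z $ k) p * v $ i)) = jac s p *v v" for v
    using vec_axis_expand[of "jac s p *v v"] by (simp only: jac_mult)
  ultimately show ?thesis by (simp add: vec_axis_expand[symmetric])
qed

lemma mholomorphic_compose:
  fixes s :: "complex^'n \<Rightarrow> complex^'m"
  assumes s: "\<And>k. (\<lambda>z. s z $ k) mholomorphic_on U" and f: "f mholomorphic_on V" and "s ` U \<subseteq> V"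
  shows "(\<lambda>z. f (s z)) mholomorphic_on U"
  unfolding mholomorphic_on_def
proof
  fix z assume z: "z \<in> U"
  then have "s z \<in> V" using assms(3) by blast
  then obtain D where D: "(f has_derivative D) (at (s z))" "\<And>c v. D (c *s v) = c * D v"
    using f unfolding mholomorphic_on_def by blast
  have "((\<lambda>z. f (s z)) has_derivative (\<lambda>v. D (jac s z *v v))) (at z)"
    by (rule has_derivative_compose[OF holomorphic_map_has_derivative[OF s z] D(1)])
  moreover have "D (jac s z *v (c *s v)) = c * D (jac s z *v v)" for c v
    by (simp add: matrix_vector_mult_scaleR vector_scalar_commute D(2))
  ultimately show "\<exists>D. ((\<lambda>z. f (s z)) has_derivative D) (at z) \<and> (\<forall>c v. D (c *s v) = c * D v)" by blast
qed

lemma wirt_compose_holomorphic: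
  fixes s :: "complex^'n \<Rightarrow> complex^'m"
  assumes s: "\<And>k. (\<lambda>z. s z $ k) mholomorphic_on U" "p \<in> U" and f: "f differentiable (at (s p))"
  shows "wirt i (\<lambda>z. f (s z)) p = (\<Sum>k\<in>UNIV. jac s p $ k $ i * wirt k f (s p))"
    "wirt_bar i (\<lambda>z. f (s z)) p = (\<Sum>k\<in>UNIV. cnj (jac s p $ k $ i) * wirt_bar k f (s p))"
    "ddir v (\<lambda>z. f (s z)) p = ddir (jac s p *v v) f (s p)"
    "(\<lambda>z. f (s z)) differentiable (at p)"
proof -
  have fd: "(f has_derivative frechet_derivative f (at (s p))) (at (s p))"
    using f frechet_derivative_works by blast
  note cd = has_derivative_compose[OF holomorphic_map_has_derivative[OF s] fd]
  show dd: "ddir v (\<lambda>z. f (s z)) p = ddir (jac s p *v v) f (s p)" for v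
    using ddir_has_derivative[OF cd] by (simp add: ddir_def)
  show "(\<lambda>z. f (s z)) differentiable (at p)" using cd unfolding differentiable_def by blast
  define c where "c = (\<chi> k. jac s p $ k $ i)"
  have c1: "jac s p *v axis i a = a *s c" for a
  proof -
    have "(jac s p *v axis i a) $ k = (\<Sum>j\<in>UNIV. if j = i then jac s p $ k $ j * a else 0)" for k
      unfolding matrix_vector_mult_def vec_lambda_beta by (rule sum.cong) (auto simp: axis_def)
    then show ?thesis by (simp add: vec_eq_iff c_def mult.commute)
  qed
  show "wirt i (\<lambda>z. f (s z)) p = (\<Sum>k\<in>UNIV. jac s p $ k $ i * wirt k f (s p))"
    "wirt_bar i (\<lambda>z. f (s z)) p = (\<Sum>k\<in>UNIV. cnj (jac s p $ k $ i) * wirt_bar k f (s p))"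
    using ddir_rotate[OF f, of c] by (simp_all add: wirt_ddir wirt_bar_ddir dd c1) (simp_all add: c_def)
qed

lemma mholomorphic_det_jac:
  fixes s :: "complex^'n \<Rightarrow> complex^'n"
  assumes "open U" "\<And>k. (\<lambda>z. s z $ k) mholomorphic_on U"
  shows "(\<lambda>z. det (jac s z)) mholomorphic_on U"
  unfolding det_def jac_def vec_lambda_beta
  by (intro mholomorphic_sum mholomorphic_mult mholomorphic_const mholomorphic_prod mholomorphic_wirt_mholomorphic assms)

text \<open>The abstract form of a point symmetry: a holomorphic automorphism that is its own inverse.\<close>

locale bounded_involution = bounded_open \<Omega> for \<Omega> :: "(complex^'n) set" +
  fixes s :: "complex^'n \<Rightarrow> complex^'n"
  assumes biholo: "biholomorphism \<Omega> \<Omega> s s"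
begin

lemma s_hol: "(\<lambda>z. s z $ k) mholomorphic_on \<Omega>"
  and s_in: "z \<in> \<Omega> \<Longrightarrow> s z \<in> \<Omega>" and s_s: "z \<in> \<Omega> \<Longrightarrow> s (s z) = z"
  using biholo by (auto simp: biholomorphism_def)

lemma s_der: "z \<in> \<Omega> \<Longrightarrow> (s has_derivative (\<lambda>v. jac s z *v v)) (at z)"
  by (rule holomorphic_map_has_derivative[OF s_hol])

lemma s_image: "s ` \<Omega> = \<Omega>"
proof
  show "s ` \<Omega> \<subseteq> \<Omega>" using s_in by blast
  show "\<Omega> \<subseteq> s ` \<Omega>"
  proof
    fix x assume "x \<in> \<Omega>"
    then show "x \<in> s ` \<Omega>" using s_in s_s by (intro image_eqI[of _ _ "s x"]) auto
  qed
qed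

lemma jac_inverse:
  assumes z: "z \<in> \<Omega>"
  shows "jac s (s z) ** jac s z = mat 1"
proof -
  have "((\<lambda>z. s (s z)) has_derivative (\<lambda>v. jac s (s z) *v (jac s z *v v))) (at z)"
    by (rule has_derivative_compose[OF s_der[OF z] s_der[OF s_in[OF z]]])
  then have "((\<lambda>z. z) has_derivative (\<lambda>v. jac s (s z) *v (jac s z *v v))) (at z)"
    by (rule has_derivative_transform_within_open[OF _ open_dom z]) (simp add: s_s)
  then have "(\<lambda>v. jac s (s z) *v (jac s z *v v)) = (\<lambda>v. v)"
    using has_derivative_unique has_derivative_ident by blast
  then have "(jac s (s z) ** jac s z) *v v = mat 1 *v v" for v
    by (simp add: matrix_vector_mul_assoc[symmetric] fun_eq_iff)
  then show ?thesis using matrix_eq by blast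
qed

definition j :: "complex^'n \<Rightarrow> complex" where "j z = det (jac s z)"

lemma j_hol: "j mholomorphic_on \<Omega>"
  unfolding j_def by (rule mholomorphic_det_jac[OF open_dom s_hol])

lemma j_j: "z \<in> \<Omega> \<Longrightarrow> j (s z) * j z = 1"
  using arg_cong[OF jac_inverse, of z det] by (simp add: det_mul j_def)

lemma j_nz: "z \<in> \<Omega> \<Longrightarrow> j z \<noteq> 0"
  using j_j by fastforce

lemma rjac_s: "z \<in> \<Omega> \<Longrightarrow> rjac (\<lambda>v. jac s z *v v) = (cmod (j z))\<^sup>2"
  unfolding j_def by (rule rjac_matrix) (use j_nz in \<open>simp add: invertible_det_nz j_def\<close>)

text \<open>The induced unitary operator on the Bergman space.\<close>

definition act :: "(complex^'n \<Rightarrow> complex) \<Rightarrow> complex^'n \<Rightarrow> complex" where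
  "act f z = f (s z) * j z"

lemma act_A2:
  assumes f: "f \<in> A2"
  shows "act f \<in> A2" "n2 (act f) = n2 f"
proof -
  have hol: "act f mholomorphic_on \<Omega>"
    unfolding act_def
    by (intro mholomorphic_mult mholomorphic_compose[OF s_hol A2_hol[OF f]] j_hol) (simp add: s_image)
  have inj: "inj_on s \<Omega>" by (rule inj_on_inverseI[of _ s]) (rule s_s)
  have cF: "continuous_on (s ` \<Omega>) (\<lambda>z. (cmod (f z))\<^sup>2)"
    unfolding s_image by (intro continuous_intros A2_cont f)
  have "continuous_on \<Omega> (\<lambda>z. (cmod (j z))\<^sup>2)"
    by (intro continuous_intros mholomorphic_continuous_on j_hol)
  then have cj: "continuous_on \<Omega> (\<lambda>x. rjac (\<lambda>v. jac s x *v v))"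
    by (rule continuous_on_eq) (simp add: rjac_s)
  have iF: "set_integrable lebesgue (s ` \<Omega>) (\<lambda>z. (cmod (f z))\<^sup>2)"
    unfolding s_image by (rule A2_int[OF f])
  have os: "open (s ` \<Omega>)" unfolding s_image by (rule open_dom)
  have eq: "rjac (\<lambda>v. jac s x *v v) * (cmod (f (s x)))\<^sup>2 = (cmod (act f x))\<^sup>2" if "x \<in> \<Omega>" for x
    using rjac_s[OF that] by (simp add: act_def norm_mult power_mult_distrib mult.commute)
  note cv = rjac_change_of_variables[OF open_dom os s_der inj cF cj iF]
  have i1: "set_integrable lebesgue \<Omega> (\<lambda>x. rjac (\<lambda>v. jac s x *v v) * (cmod (f (s x)))\<^sup>2)"
    using cv(1) by simp
  have "set_integrable lebesgue \<Omega> (\<lambda>x. rjac (\<lambda>v. jac s x *v v) * (cmod (f (s x)))\<^sup>2) =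
      set_integrable lebesgue \<Omega> (\<lambda>x. (cmod (act f x))\<^sup>2)"
    by (rule set_integrable_cong) (use eq in auto)
  then have "set_integrable lebesgue \<Omega> (\<lambda>x. (cmod (act f x))\<^sup>2)"
    using i1 by simp
  then show "act f \<in> A2" using hol by (simp add: bergman_space_def)
  have "n2 (act f) = (LINT x:\<Omega>|lebesgue. rjac (\<lambda>v. jac s x *v v) * (cmod (f (s x)))\<^sup>2)"
    unfolding bn2_def by (rule set_lebesgue_integral_cong) (use open_dom eq in auto)
  also have "\<dots> = n2 f" using cv(2) by (simp add: s_image bn2_def)
  finally show "n2 (act f) = n2 f" .
qed

lemma act_ip:
  assumes f: "f \<in> A2" and g: "g \<in> A2"
  shows "ip (act f) (act g) = ip f g"
proof -
  have re: "Re (ip (act f) (act g)) = Re (ip f g)" if f: "f \<in> A2" and g: "g \<in> A2" for f g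
  proof -
    have e: "act (\<lambda>z. f z + g z) = (\<lambda>z. act f z + act g z)" by (auto simp: act_def distrib_right)
    have "n2 (act (\<lambda>z. f z + g z)) = n2 (\<lambda>z. f z + g z)" by (rule act_A2(2)[OF A2_add[OF f g]])
    then show ?thesis
      unfolding e n2_add[OF act_A2(1)[OF f] act_A2(1)[OF g]] n2_add[OF f g] by (simp add: act_A2(2) f g)
  qed
  have e: "act (\<lambda>z. \<i> * f z) = (\<lambda>z. \<i> * act f z)" by (auto simp: act_def)
  have "Im (ip (act f) (act g)) = Im (ip f g)"
    using re[OF A2_cmult[OF f, of \<i>] g] unfolding e ip_cmult by simp
  then show ?thesis using re[OF f g] by (simp add: complex_eq_iff)
qed

lemma ip_cong: "(\<And>z. z \<in> \<Omega> \<Longrightarrow> f z = f' z) \<Longrightarrow> (\<And>z. z \<in> \<Omega> \<Longrightarrow> g z = g' z) \<Longrightarrow> ip f g = ip f' g'"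
  unfolding bip_def by (rule set_lebesgue_integral_cong) (use open_dom in auto)

text \<open>The right hand side has the reproducing property, since \<open>act\<close> is unitary, and the kernel is unique.\<close>

theorem K_transformation:
  assumes "z \<in> \<Omega>" "w \<in> \<Omega>"
  shows "K z w = K (s z) (s w) * j z * cnj (j w)"
proof -
  \<comment> \<open>The candidate kernel; a double application of \<open>act\<close> is the identity.\<close>
  define L where "L z w = cnj (j w) * act (\<lambda>u. K u (s w)) z" for z w
  have aa: "act (act f) z = f z" if "z \<in> \<Omega>" for f z
  proof -
    have "j (s z) * j z = 1" by (rule j_j[OF that])
    then show ?thesis using s_s[OF that] by (simp add: act_def)
  qed
  have "L z w = K z w"
  proof (rule K_unique[OF _ _ assms])
    fix w assume w: "w \<in> \<Omega>"
    then have sw: "s w \<in> \<Omega>" by (rule s_in)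
    have ka: "act (\<lambda>u. K u (s w)) \<in> A2" by (rule act_A2(1)[OF K_A2[OF sw]])
    show "(\<lambda>z. L z w) \<in> A2" unfolding L_def by (rule A2_cmult[OF ka])
    fix f assume f: "f \<in> A2"
    have "ip f (\<lambda>z. L z w) = j w * ip f (act (\<lambda>u. K u (s w)))"
      unfolding L_def
      using ip_cnj[of f "\<lambda>z. cnj (j w) * act (\<lambda>u. K u (s w)) z"] ip_cmult[of "cnj (j w)" "act (\<lambda>u. K u (s w))" f]
        ip_cnj[of f "act (\<lambda>u. K u (s w))"] by simp
    also have "ip f (act (\<lambda>u. K u (s w))) = ip (act f) (act (act (\<lambda>u. K u (s w))))"
      by (rule act_ip[OF f ka, symmetric])
    also have "\<dots> = ip (act f) (\<lambda>u. K u (s w))" by (rule ip_cong) (simp_all add: aa)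
    also have "\<dots> = act f (s w)" by (rule K_reproducing[OF sw act_A2(1)[OF f], symmetric])
    also have "j w * act f (s w) = f w" using s_s[OF w] j_j[OF w] by (simp add: act_def mult_ac)
    finally show "f w = ip f (\<lambda>z. L z w)" by simp
  qed
  then show ?thesis by (simp add: L_def act_def mult_ac)
qed

lemma K_diag_transformation: "z \<in> \<Omega> \<Longrightarrow> K z z = K (s z) (s z) * (j z * cnj (j z))"
  using K_transformation[of z z] by (simp add: mult.assoc)

text \<open>By the transformation law \<open>log K\<close> and its pullback differ by \<open>log |j|\<^sup>2\<close>, which is pluriharmonic.\<close>

lemma logK_levi_transformation:
  assumes z: "z \<in> \<Omega>"
  shows "wirt a (wirt_bar b logK) z = (\<Sum>l\<in>UNIV. \<Sum>k\<in>UNIV. jac s z $ k $ a * wirt k (wirt_bar l logK) (s z) * cnj (jac s z $ l $ b))"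
proof -
  have nz: "K x x \<noteq> 0" if "x \<in> \<Omega>" for x using K_real[OF that] by auto
  have dj: "j differentiable (at x)" "(\<lambda>x. cnj (j x)) differentiable (at x)" if "x \<in> \<Omega>" for x
    using mholomorphic_differentiable[OF j_hol that] differentiable_linear_post[OF bounded_linear_cnj] by blast+
  have dK: "(\<lambda>z. K z z) differentiable (at x)" if "x \<in> \<Omega>" for x
    using K_smooth that smooth_on_differentiable by blast
  have dL: "wirt_bar l logK differentiable (at x)" if "x \<in> \<Omega>" for x l
    using smooth_on_wirt(2)[OF open_dom logK_smooth] that smooth_on_differentiable by blast
  define q where "q x = wirt b j x / j x" for x
  have qhol: "q mholomorphic_on \<Omega>"
  proof -
    have "(\<lambda>x. wirt b j x * j (s x)) mholomorphic_on \<Omega>"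
      by (intro mholomorphic_mult mholomorphic_wirt_mholomorphic[OF open_dom j_hol]
          mholomorphic_compose[OF s_hol j_hol]) (simp add: s_image)
    then show ?thesis
    proof (rule mholomorphic_cong[OF open_dom])
      fix x assume x: "x \<in> \<Omega>"
      show "wirt b j x * j (s x) = q x" using j_j[OF x] j_nz[OF x] by (simp add: q_def field_simps)
    qed
  qed
  have first: "wirt_bar b logK x = (\<Sum>l\<in>UNIV. cnj (jac s x $ l $ b) * wirt_bar l logK (s x)) + cnj (q x)"
    if x: "x \<in> \<Omega>" for x
  proof -
    note sx = s_in[OF x]
    note cd = wirt_compose_holomorphic[OF s_hol x dK[OF sx]]
    have jj: "(\<lambda>x. j x * cnj (j x)) differentiable (at x)" using dj[OF x] by simp
    have "wirt_bar b (\<lambda>z. K z z) x = wirt_bar b (\<lambda>z. K (s z) (s z) * (j z * cnj (j z))) x"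
      by (rule wirt_cong[OF open_dom x]) (rule K_diag_transformation)
    also have "\<dots> = wirt_bar b (\<lambda>z. K (s z) (s z)) x * (j x * cnj (j x)) + K (s x) (s x) * (j x * cnj (wirt b j x))"
      using wirt_mult(2)[OF cd(4) jj] wirt_mult(2)[OF dj[OF x]] wirt_cnj(2)[OF dj(1)[OF x]]
        mholomorphic_wirt(1)[OF j_hol x] by simp
    finally have "wirt_bar b (\<lambda>z. K z z) x / K x x = wirt_bar b (\<lambda>z. K (s z) (s z)) x / K (s x) (s x) + cnj (q x)"
      using nz[OF sx] j_nz[OF x] unfolding K_diag_transformation[OF x] q_def
      by (simp add: field_simps)
    then show ?thesis
      unfolding wirt_logK(1)[OF x] wirt_logK(1)[OF sx] cd(2) by (simp add: sum_divide_distrib)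
  qed
  have dJ: "(\<lambda>x. cnj (jac s x $ l $ b)) differentiable (at z)"
    "wirt i (\<lambda>x. cnj (jac s x $ l $ b)) z = 0" for l i
  proof -
    have h: "(\<lambda>x. jac s x $ l $ b) mholomorphic_on \<Omega>"
      unfolding jac_def vec_lambda_beta by (rule mholomorphic_wirt_mholomorphic[OF open_dom s_hol])
    show "(\<lambda>x. cnj (jac s x $ l $ b)) differentiable (at z)"
      using mholomorphic_differentiable[OF h z] differentiable_linear_post[OF bounded_linear_cnj] by blast
    show "wirt i (\<lambda>x. cnj (jac s x $ l $ b)) z = 0"
      using wirt_cnj(1)[OF mholomorphic_differentiable[OF h z]] mholomorphic_wirt(1)[OF h z] by simp
  qed
  note cL = wirt_compose_holomorphic[OF s_hol z dL[OF s_in[OF z]]]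
  have dq: "q differentiable (at z)" by (rule mholomorphic_differentiable[OF qhol z])
  have "wirt a (wirt_bar b logK) z = wirt a (\<lambda>x. (\<Sum>l\<in>UNIV. cnj (jac s x $ l $ b) * wirt_bar l logK (s x)) + cnj (q x)) z"
    by (rule wirt_cong[OF open_dom z]) (rule first)
  also have "\<dots> = wirt a (\<lambda>x. \<Sum>l\<in>UNIV. cnj (jac s x $ l $ b) * wirt_bar l logK (s x)) z + wirt a (\<lambda>x. cnj (q x)) z"
    by (rule wirt_add(1)) (intro differentiable_sum' differentiable_mult dJ cL(4) differentiable_linear_post[OF bounded_linear_cnj] dq)+
  also have "wirt a (\<lambda>x. cnj (q x)) z = 0"
    using wirt_cnj(1)[OF dq] mholomorphic_wirt(1)[OF qhol z] by simp
  also have "wirt a (\<lambda>x. \<Sum>l\<in>UNIV. cnj (jac s x $ l $ b) * wirt_bar l logK (s x)) z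
      = (\<Sum>l\<in>UNIV. wirt a (\<lambda>x. cnj (jac s x $ l $ b) * wirt_bar l logK (s x)) z)"
    by (rule wirt_sum(1)) (intro differentiable_mult dJ cL(4))
  also have "\<dots> = (\<Sum>l\<in>UNIV. cnj (jac s z $ l $ b) * (\<Sum>k\<in>UNIV. jac s z $ k $ a * wirt k (wirt_bar l logK) (s z)))"
    unfolding wirt_mult(1)[OF dJ(1) cL(4)] dJ(2) cL(1) by simp
  also have "\<dots> = (\<Sum>l\<in>UNIV. \<Sum>k\<in>UNIV. jac s z $ k $ a * wirt k (wirt_bar l logK) (s z) * cnj (jac s z $ l $ b))"
    by (simp add: sum_distrib_left mult_ac)
  finally show ?thesis by simp
qed

section \<open>Symmetries and the Einstein property\<close>

lemma jac_entry_continuous: "continuous_on \<Omega> (\<lambda>z. jac s z $ a $ b)"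
  unfolding jac_def vec_lambda_beta
  by (rule mholomorphic_continuous_on[OF mholomorphic_wirt_mholomorphic[OF open_dom s_hol]])

text \<open>Cartan's linearisation \<open>L z = z + A (s z)\<close> with \<open>A\<close> the differential at \<open>p\<close> intertwines \<open>s\<close> with \<open>A\<close>, and it is a
  local homeomorphism at \<open>p\<close>. A fixed vector of \<open>A\<close> would yield fixed points of \<open>s\<close> arbitrarily close
  to \<open>p\<close>. So the involution \<open>A\<close> has no eigenvalue 1.\<close>

lemma differential_minus_one:
  assumes p: "p \<in> \<Omega>" "s p = p" and e: "e > 0" and iso: "\<And>z. z \<in> \<Omega> \<inter> ball p e \<Longrightarrow> s z = z \<Longrightarrow> z = p"
  shows "jac s p *v u = - u"
proof -
  define A where "A = jac s p"
  have AA: "A *v (A *v u) = u" for u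
    using jac_inverse[OF p(1)] by (simp add: p(2) A_def matrix_vector_mul_assoc)
  have blA: "bounded_linear (\<lambda>v. A *v v)"
    using linear_matrix_complex linear_conv_bounded_linear by blast
  have fix0: "v = 0" if v: "A *v v = v" for v
  proof (rule ccontr)
    assume v0: "v \<noteq> 0"
    \<comment> \<open>As \<open>A\<close> is its own inverse, \<open>A ** jac s z\<close> tends to the identity at \<open>p\<close>; \<open>E\<close> bounds the deviation.\<close>
    define E where "E z = (\<Sum>a\<in>UNIV. \<Sum>b\<in>UNIV. cmod ((A ** jac s z - mat 1) $ a $ b))" for z
    have nE: "norm ((A ** jac s z - mat 1) *v u) \<le> E z * norm u" for z u
    proof -
      have "norm ((A ** jac s z - mat 1) *v u) \<le> (\<Sum>a\<in>UNIV. cmod (((A ** jac s z - mat 1) *v u) $ a))"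
        by (rule norm_le_sum_cmod)
      also have "\<dots> \<le> (\<Sum>a\<in>UNIV. \<Sum>b\<in>UNIV. cmod ((A ** jac s z - mat 1) $ a $ b) * norm u)"
      proof (rule sum_mono)
        fix a
        have "cmod (((A ** jac s z - mat 1) *v u) $ a) \<le> (\<Sum>b\<in>UNIV. cmod ((A ** jac s z - mat 1) $ a $ b * u $ b))"
          unfolding matrix_vector_mult_def vec_lambda_beta by (rule norm_sum)
        also have "\<dots> \<le> (\<Sum>b\<in>UNIV. cmod ((A ** jac s z - mat 1) $ a $ b) * norm u)"
          by (rule sum_mono) (simp add: norm_mult mult_left_mono Finite_Cartesian_Product.norm_nth_le)
        finally show "cmod (((A ** jac s z - mat 1) *v u) $ a) \<le> (\<Sum>b\<in>UNIV. cmod ((A ** jac s z - mat 1) $ a $ b) * norm u)" .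
      qed
      also have "\<dots> = E z * norm u" by (simp add: E_def sum_distrib_right)
      finally show ?thesis .
    qed
    have cE: "continuous_on \<Omega> E"
      unfolding E_def matrix_matrix_mult_def vector_minus_component vec_lambda_beta
      by (intro continuous_intros jac_entry_continuous)
    have "A ** jac s p - mat 1 = 0" using jac_inverse[OF p(1)] by (simp add: A_def p(2))
    then have "E p = 0" by (simp add: E_def)
    obtain d1 where d1: "d1 > 0" "\<And>z. z \<in> \<Omega> \<Longrightarrow> dist z p < d1 \<Longrightarrow> dist (E z) (E p) < 1"
      using cE p(1) unfolding continuous_on_iff by (metis zero_less_one)
    obtain d2 where d2: "d2 > 0" "ball p d2 \<subseteq> \<Omega>" using open_dom p(1) open_contains_ball by blast
    define r where "r = Min {d1, d2, e}"
    have r: "r > 0" "r \<le> d1" "r \<le> d2" "r \<le> e" using d1 d2 e by (auto simp: r_def)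
    have rO: "ball p r \<subseteq> \<Omega>" using d2 r by auto
    \<comment> \<open>\<open>L\<close> is \<open>2 z + m z\<close>, and \<open>m\<close> has Lipschitz constant 1 near \<open>p\<close>; this makes \<open>L\<close> injective there.\<close>
    define m where "m z = A *v s z - z" for z
    have mder: "(m has_derivative (\<lambda>u. (A ** jac s z - mat 1) *v u)) (at z within ball p r)" if "z \<in> ball p r" for z
    proof -
      have z: "z \<in> \<Omega>" using that rO by blast
      have "(m has_derivative (\<lambda>u. A *v (jac s z *v u) - u)) (at z)"
        unfolding m_def by (intro has_derivative_diff bounded_linear.has_derivative[OF blA] s_der[OF z] has_derivative_ident)
      then have "(m has_derivative (\<lambda>u. (A ** jac s z - mat 1) *v u)) (at z)"
        by (simp add: matrix_vector_mult_diff_rdistrib matrix_vector_mul_assoc)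
      then show ?thesis by (rule has_derivative_at_withinI)
    qed
    have mlip: "norm (m x - m y) \<le> 1 * norm (x - y)" if "x \<in> ball p r" "y \<in> ball p r" for x y
    proof (rule differentiable_bound[OF convex_ball mder _ that])
      fix z assume z: "z \<in> ball p r"
      then have "z \<in> \<Omega>" "dist z p < d1" using rO r by (auto simp: dist_commute)
      then have "E z < 1" using d1(2)[of z] \<open>E p = 0\<close> by (simp add: dist_norm)
      have "norm ((A ** jac s z - mat 1) *v u) \<le> 1 * norm u" for u
        using nE[of z u] \<open>E z < 1\<close> mult_right_mono[of "E z" 1 "norm u"] by simp
      then show "onorm ((*v) (A ** jac s z - mat 1)) \<le> 1" by (intro onorm_le)
    qed
    define L where "L z = z + A *v s z" for z
    have Linj: "x = y" if "x \<in> ball p r" "y \<in> ball p r" "L x = L y" for x y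
    proof -
      have "L z = 2 *\<^sub>R z + m z" for z by (simp add: L_def m_def scaleR_2)
      then have "2 *\<^sub>R (x - y) = m y - m x" using that(3) by (simp add: algebra_simps)
      then have "2 * norm (x - y) = norm (m y - m x)" by (metis norm_scaleR abs_numeral)
      also have "\<dots> \<le> norm (x - y)" using mlip[OF that(2,1)] by (simp add: norm_minus_commute)
      finally show ?thesis by simp
    qed
    have Ls: "L (s z) = A *v L z" if "z \<in> \<Omega>" for z
      using s_s[OF that] AA by (simp add: L_def matrix_vector_right_distrib add.commute)
    have cs: "continuous_on \<Omega> s"
      by (rule continuous_at_imp_continuous_on) (use s_der has_derivative_continuous in blast)
    obtain d3 where d3: "d3 > 0" "\<And>z. z \<in> \<Omega> \<Longrightarrow> dist z p < d3 \<Longrightarrow> dist (s z) (s p) < r"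
      using cs p(1) r(1) unfolding continuous_on_iff by metis
    define r' where "r' = min r d3"
    have r': "r' > 0" "r' \<le> r" "r' \<le> d3" using r d3 by (auto simp: r'_def)
    have "L p \<in> interior (L ` ball p r')"
    proof (rule sussmann_open_mapping[OF open_dom _ p(1), where f' = "\<lambda>u. u + A *v (A *v u)" and g' = "\<lambda>u. (1/2) *\<^sub>R u"])
      show "continuous_on \<Omega> L" unfolding L_def
        by (intro continuous_intros continuous_on_compose2[OF linear_continuous_on[OF blA] cs]) auto
      show "(L has_derivative (\<lambda>u. u + A *v (A *v u))) (at p)"
        unfolding L_def using s_der[OF p(1), folded A_def]
        by (intro has_derivative_add has_derivative_ident bounded_linear.has_derivative[OF blA])
      show "bounded_linear (\<lambda>u::complex^'n. (1/2) *\<^sub>R u)" by (rule bounded_linear_scaleR_right)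
      show "(\<lambda>u. u + A *v (A *v u)) \<circ> (\<lambda>u. (1/2) *\<^sub>R u) = id"
        by (auto simp: AA fun_eq_iff scaleR_left_distrib[symmetric])
      show "ball p r' \<subseteq> \<Omega>" using rO r' by auto
      show "p \<in> interior (ball p r')" using r' by (simp add: interior_open)
    qed
    then obtain d where d: "d > 0" "ball (L p) d \<subseteq> L ` ball p r'" using mem_interior by blast
    define t where "t = d / (2 * norm v)"
    have t: "t > 0" "norm (t *\<^sub>R v) = d / 2" using d v0 by (auto simp: t_def)
    have "L p + t *\<^sub>R v \<in> ball (L p) d" using t d by (simp add: dist_norm)
    then obtain z where z: "z \<in> ball p r'" "L z = L p + t *\<^sub>R v" using d(2) by (metis imageE subsetD)
    have zO: "z \<in> \<Omega>" "z \<in> ball p r" "dist z p < d3" using z(1) rO r' by (auto simp: dist_commute)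
    have "L (s z) = A *v (L p + t *\<^sub>R v)" using Ls[OF zO(1)] z(2) by simp
    also have "\<dots> = A *v L p + t *\<^sub>R (A *v v)"
      by (simp add: matrix_vector_right_distrib linear_scale[OF linear_matrix_complex])
    also have "A *v L p = L p" using Ls[OF p(1)] p(2) by simp
    finally have "L (s z) = L z" using v z(2) by simp
    moreover have "s z \<in> ball p r" using d3(2)[OF zO(1,3)] p(2) by (simp add: dist_commute)
    ultimately have "s z = z" using Linj zO(2) by blast
    then have "z = p" using iso[of z] zO r by auto
    then show False using z(2) t v0 by simp
  qed
  have "A *v (u + A *v u) = u + A *v u" by (simp add: matrix_vector_right_distrib AA add.commute)
  then have "u + A *v u = 0" by (rule fix0)
  then show ?thesis by (simp add: A_def eq_neg_iff_add_eq_0 add.commute)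
qed

end

context bounded_open
begin

definition bmat :: "complex^'n \<Rightarrow> complex^'n^'n" where
  "bmat z = (\<chi> i k. wirt i (wirt_bar k logK) z)"

lemma det_bmat_smooth: "smooth_on \<Omega> (\<lambda>z. det (bmat z))"
  unfolding det_def bmat_def vec_lambda_beta
  by (intro smooth_on_sum smooth_on_mult smooth_on_const smooth_on_prod smooth_on_wirt open_dom logK_smooth)

end

lemma det_cnj: "det (\<chi> a b. cnj (A $ a $ b)) = cnj (det (A :: complex^'n^'n))"
  unfolding det_def by simp

context bounded_involution
begin

lemma det_bmat_transformation:
  assumes "z \<in> \<Omega>"
  shows "det (bmat z) = det (bmat (s z)) * (j z * cnj (j z))"
proof -
  have "bmat z = transpose (jac s z) ** bmat (s z) ** (\<chi> a b. cnj (jac s z $ a $ b))"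
    by (simp add: vec_eq_iff bmat_def logK_levi_transformation[OF assms] matrix_matrix_mult_def transpose_def sum_distrib_right)
  then show ?thesis by (simp add: det_mul det_cnj j_def mult_ac)
qed

text \<open>Both \<open>det (dd\<^sup>c log K)\<close> and \<open>K\<close> are multiplied by \<open>|j|\<^sup>2\<close>.\<close>

lemma det_bmat_ratio_invariant:
  assumes "z \<in> \<Omega>"
  shows "det (bmat z) / K z z = det (bmat (s z)) / K (s z) (s z)"
  using det_bmat_transformation[OF assms] K_diag_transformation[OF assms] j_nz[OF assms] by simp

end

locale symmetric_domain = bounded_open \<Omega> for \<Omega> :: "(complex^'n) set" +
  assumes symmetric: "p \<in> \<Omega> \<Longrightarrow> \<exists>s. biholomorphism \<Omega> \<Omega> s s \<and> s p = p \<and>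
        (\<exists>e>0. \<forall>z\<in>\<Omega> \<inter> ball p e. s z = z \<longrightarrow> z = p)"
    and connected_dom: "connected \<Omega>"
begin

text \<open>The quotient \<open>\<psi>\<close> is invariant under the symmetry at \<open>p\<close>, whose differential is \<open>- 1\<close>; so the differential
  of \<open>\<psi>\<close> at \<open>p\<close> equals its negative. Here \<open>p\<close> is arbitrary and \<open>\<Omega>\<close> is connected.\<close>

theorem det_bmat_proportional: "\<exists>c. \<forall>z\<in>\<Omega>. det (bmat z) = c * K z z"
proof -
  define \<psi> where "\<psi> z = det (bmat z) * inverse (K z z)" for z
  have nz: "K z z \<noteq> 0" if "z \<in> \<Omega>" for z using K_real[OF that] by auto
  have "smooth_on \<Omega> (\<lambda>z. inverse (K z z))"
    by (rule smooth_on_holomorphic_comp[OF open_dom K_smooth, of "- {0}"])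
      (use nz in \<open>auto intro!: holomorphic_intros\<close>)
  then have sm: "smooth_on \<Omega> \<psi>"
    unfolding \<psi>_def by (intro smooth_on_mult open_dom det_bmat_smooth)
  have zero: "ddir v \<psi> p = 0" if p: "p \<in> \<Omega>" for p v
  proof -
    obtain s e where s: "biholomorphism \<Omega> \<Omega> s s" "s p = p" "e > 0" "\<forall>z\<in>\<Omega> \<inter> ball p e. s z = z \<longrightarrow> z = p"
      using symmetric[OF p] by blast
    interpret bounded_involution \<Omega> s by unfold_locales (rule s(1))
    have "ddir v \<psi> p = ddir v (\<lambda>z. \<psi> (s z)) p"
      by (rule ddir_cong[OF open_dom p]) (use det_bmat_ratio_invariant in \<open>simp add: \<psi>_def divide_inverse\<close>)
    also have "\<dots> = ddir (jac s p *v v) \<psi> (s p)"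
      by (rule wirt_compose_holomorphic(3)[OF s_hol p]) (use sm s(2) p smooth_on_differentiable in auto)
    also have "\<dots> = ddir (- v) \<psi> p"
      using differential_minus_one[OF p s(2,3)] s(2,4) by simp
    also have "\<dots> = - ddir v \<psi> p"
    proof -
      have "linear (frechet_derivative \<psi> (at p))"
        using sm p smooth_on_differentiable linear_frechet_derivative by blast
      then show ?thesis by (simp add: ddir_def linear_neg)
    qed
    finally show ?thesis by simp
  qed
  have "\<psi> constant_on \<Omega>"
  proof (rule has_derivative_zero_connected_constant_on[OF connected_dom open_dom finite.emptyI])
    show "continuous_on \<Omega> \<psi>"
      using sm smooth_on_differentiable differentiable_imp_continuous_within
      by (intro continuous_at_imp_continuous_on) blast
    show "\<forall>x\<in>\<Omega> - {}. (\<psi> has_derivative (\<lambda>h. 0)) (at x within \<Omega>)"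
    proof
      fix x assume x: "x \<in> \<Omega> - {}"
      then have "(\<psi> has_derivative frechet_derivative \<psi> (at x)) (at x)"
        using sm smooth_on_differentiable frechet_derivative_works by blast
      moreover have "frechet_derivative \<psi> (at x) = (\<lambda>h. 0)"
        using zero x by (auto simp: ddir_def fun_eq_iff)
      ultimately show "(\<psi> has_derivative (\<lambda>h. 0)) (at x within \<Omega>)" by (simp add: has_derivative_at_withinI)
    qed
  qed
  then obtain c where "\<forall>z\<in>\<Omega>. \<psi> z = c" unfolding constant_on_def by blast
  then have "\<forall>z\<in>\<Omega>. det (bmat z) = c * K z z" using nz by (auto simp: \<psi>_def field_simps)
  then show ?thesis by blast
qed

end

section \<open>Inverses and determinants of complex matrices\<close>

lemma matrix_inv_both:
  assumes "invertible (A :: complex^'n^'n)"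
  shows "matrix_inv A ** A = mat 1" "A ** matrix_inv A = mat 1"
proof -
  have "\<exists>B. A ** B = mat 1 \<and> B ** A = mat 1" using assms unfolding invertible_def by blast
  from someI_ex[OF this] show "matrix_inv A ** A = mat 1" "A ** matrix_inv A = mat 1"
    unfolding matrix_inv_def by blast+
qed

text \<open>The transposed inverse, which is the convention of \<open>ginv\<close> for raising indices.\<close>

definition dinv :: "complex^'n^'n \<Rightarrow> complex^'n^'n" where
  "dinv A = matrix_inv (transpose A)"

lemma ginv_dinv: "ginv g p = dinv (g p)"
  by (simp add: ginv_def dinv_def)

lemma invertible_transpose: "invertible (transpose A) \<longleftrightarrow> invertible (A :: complex^'n^'n)"
  by (simp add: invertible_det_nz)

lemma dinv_left:
  assumes "invertible (A :: complex^'n^'n)"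
  shows "(\<Sum>b\<in>UNIV. dinv A $ a $ b * A $ c $ b) = (if a = c then 1 else 0)"
proof -
  have "(dinv A ** transpose A) $ a $ c = (mat 1 :: complex^'n^'n) $ a $ c"
    unfolding dinv_def using matrix_inv_both(1)[of "transpose A"] assms by (simp add: invertible_transpose)
  then show ?thesis by (simp add: matrix_matrix_mult_def transpose_def mat_def)
qed

lemma dinv_right:
  assumes "invertible (A :: complex^'n^'n)"
  shows "(\<Sum>c\<in>UNIV. dinv A $ c $ b * A $ c $ a) = (if a = b then 1 else 0)"
proof -
  have "(transpose A ** dinv A) $ a $ b = (mat 1 :: complex^'n^'n) $ a $ b"
    unfolding dinv_def using matrix_inv_both(2)[of "transpose A"] assms by (simp add: invertible_transpose)
  then show ?thesis by (simp add: matrix_matrix_mult_def transpose_def mat_def mult.commute)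
qed

lemma sum_delta_left: "(\<Sum>c\<in>UNIV. (if a = c then 1 else 0) * f c) = (f a :: complex)" for a :: "'n::finite"
proof -
  have "(\<Sum>c\<in>UNIV. (if a = c then 1 else 0) * f c) = (\<Sum>c\<in>UNIV. if a = c then f c else 0)"
    by (rule sum.cong) auto
  then show ?thesis by simp
qed

lemma sum_delta_right: "(\<Sum>c\<in>UNIV. (if c = a then 1 else 0) * f c) = (f a :: complex)" for a :: "'n::finite"
  using sum_delta_left[of a f] by (simp add: eq_commute)

lemma dinv_solve:
  fixes A :: "complex^'n^'n"
  assumes A: "invertible A" and x: "\<And>c. (\<Sum>b\<in>UNIV. x b * A $ c $ b) = y c"
  shows "x b = (\<Sum>c\<in>UNIV. y c * dinv A $ c $ b)"
proof -
  have "(\<Sum>c\<in>UNIV. y c * dinv A $ c $ b) = (\<Sum>c\<in>UNIV. \<Sum>d\<in>UNIV. x d * A $ c $ d * dinv A $ c $ b)"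
    by (simp add: x[symmetric] sum_distrib_right)
  also have "\<dots> = (\<Sum>d\<in>UNIV. \<Sum>c\<in>UNIV. x d * A $ c $ d * dinv A $ c $ b)" by (rule sum.swap)
  also have "\<dots> = (\<Sum>d\<in>UNIV. (\<Sum>c\<in>UNIV. dinv A $ c $ b * A $ c $ d) * x d)"
    by (simp add: sum_distrib_left mult_ac)
  also have "\<dots> = x b" unfolding dinv_right[OF A] sum_delta_right ..
  finally show ?thesis by simp
qed

lemma dinv_unique:
  fixes A :: "complex^'n^'n"
  assumes A: "invertible A" and x: "\<And>c. (\<Sum>b\<in>UNIV. x b * A $ c $ b) = (if a = c then 1 else 0)"
  shows "x b = dinv A $ a $ b"
proof -
  have "x b = (\<Sum>c\<in>UNIV. (if a = c then 1 else 0) * dinv A $ c $ b)" by (rule dinv_solve[OF A x])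
  also have "\<dots> = dinv A $ a $ b" by (rule sum_delta_left)
  finally show ?thesis .
qed

lemma dinv_hermitian:
  fixes A :: "complex^'n^'n"
  assumes A: "invertible A" and herm: "\<And>a b. cnj (A $ a $ b) = A $ b $ a"
  shows "cnj (dinv A $ a $ b) = dinv A $ b $ a"
proof -
  have "cnj (dinv A $ a $ b) = dinv A $ b $ a"
  proof (rule dinv_unique[OF A, of "\<lambda>a. cnj (dinv A $ a $ b)" b])
    fix c
    have "(\<Sum>a\<in>UNIV. cnj (dinv A $ a $ b) * A $ c $ a) = cnj (\<Sum>a\<in>UNIV. dinv A $ a $ b * A $ a $ c)"
      by (simp add: herm)
    also have "\<dots> = (if b = c then 1 else 0)" unfolding dinv_right[OF A] by simp
    finally show "(\<Sum>a\<in>UNIV. cnj (dinv A $ a $ b) * A $ c $ a) = (if b = c then 1 else 0)" .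
  qed
  then show ?thesis .
qed

lemma hermitian_form_nondegenerate:
  fixes A :: "complex^'n^'n"
  assumes pos: "\<And>v. v \<noteq> 0 \<Longrightarrow> Re (\<Sum>i\<in>UNIV. \<Sum>j\<in>UNIV. v $ i * cnj (v $ j) * A $ i $ j) > 0"
  shows "det A \<noteq> 0"
proof
  assume "det A = 0"
  then have "\<not> invertible A" by (simp add: invertible_det_nz)
  then have "\<not> (\<exists>B. B ** A = mat 1)" using matrix_left_right_inverse invertible_def by metis
  then obtain w where w: "A *v w = 0" "w \<noteq> 0" using matrix_left_invertible_ker[of A] by blast
  define v where "v = (\<chi> i. cnj (w $ i))"
  have "v \<noteq> 0" using w(2) by (auto simp: v_def vec_eq_iff)
  have "(\<Sum>i\<in>UNIV. \<Sum>j\<in>UNIV. v $ i * cnj (v $ j) * A $ i $ j) = (\<Sum>i\<in>UNIV. v $ i * (A *v w) $ i)"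
    by (simp add: v_def matrix_vector_mult_def sum_distrib_left mult_ac)
  also have "\<dots> = 0" by (simp add: w(1))
  finally show False using pos[OF \<open>v \<noteq> 0\<close>] by simp
qed

text \<open>The segment from the identity to \<open>A\<close> consists of positive definite matrices, so the real number
  \<open>det\<close> does not change sign on it.\<close>

lemma hermitian_posdef_det:
  fixes A :: "complex^'n^'n"
  assumes herm: "\<And>a b. cnj (A $ a $ b) = A $ b $ a"
    and pos: "\<And>v. v \<noteq> 0 \<Longrightarrow> Re (\<Sum>i\<in>UNIV. \<Sum>j\<in>UNIV. v $ i * cnj (v $ j) * A $ i $ j) > 0"
  shows "det A \<in> \<real> \<and> Re (det A) > 0"
proof -
  \<comment> \<open>The segment from the identity at \<open>t = 0\<close> to \<open>A\<close> at \<open>t = 1\<close>.\<close>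
  define B where "B t = (\<chi> a b. (1 - complex_of_real t) * (if a = b then 1 else 0) + complex_of_real t * A $ a $ b)" for t
  have real: "det (B t) \<in> \<real>" for t
  proof -
    have "cnj (det (B t)) = det (\<chi> a b. cnj (B t $ a $ b))" by (simp add: det_cnj)
    also have "(\<chi> a b. cnj (B t $ a $ b)) = transpose (B t)"
      by (auto simp: B_def transpose_def vec_eq_iff herm)
    finally have "cnj (det (B t)) = det (B t)" by (simp add: det_transpose)
    then show ?thesis by (simp add: Reals_cnj_iff)
  qed
  have nz: "Re (det (B t)) \<noteq> 0" if t: "0 \<le> t" "t \<le> 1" for t
  proof -
    have "det (B t) \<noteq> 0"
    proof (rule hermitian_form_nondegenerate)
      fix v :: "complex^'n" assume v: "v \<noteq> 0"
      define S where "S = (\<Sum>i\<in>UNIV. (cmod (v $ i))\<^sup>2)"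
      have S: "S > 0"
      proof -
        obtain i where "v $ i \<noteq> 0" using v by (auto simp: vec_eq_iff)
        then show ?thesis unfolding S_def by (intro sum_pos2[of _ i]) auto
      qed
      have "(\<Sum>i\<in>UNIV. \<Sum>j\<in>UNIV. v $ i * cnj (v $ j) * (if i = j then 1 else 0)) = (\<Sum>i\<in>UNIV. v $ i * cnj (v $ i))"
        by (simp add: if_distrib cong: if_cong)
      also have "\<dots> = of_real S" unfolding S_def of_real_sum
        by (rule sum.cong) (simp_all add: complex_norm_square[symmetric] flip: of_real_power)
      finally have id: "(\<Sum>i\<in>UNIV. \<Sum>j\<in>UNIV. v $ i * cnj (v $ j) * (if i = j then 1 else 0)) = of_real S" .
      define P where "P = (\<Sum>i\<in>UNIV. \<Sum>j\<in>UNIV. v $ i * cnj (v $ j) * A $ i $ j)"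
      have "(\<Sum>i\<in>UNIV. \<Sum>j\<in>UNIV. v $ i * cnj (v $ j) * B t $ i $ j) =
         (1 - complex_of_real t) * (\<Sum>i\<in>UNIV. \<Sum>j\<in>UNIV. v $ i * cnj (v $ j) * (if i = j then 1 else 0))
         + complex_of_real t * P"
        unfolding B_def vec_lambda_beta P_def sum_distrib_left sum.distrib[symmetric]
        by (intro sum.cong refl) (simp add: algebra_simps)
      then have e: "Re (\<Sum>i\<in>UNIV. \<Sum>j\<in>UNIV. v $ i * cnj (v $ j) * B t $ i $ j) = (1 - t) * S + t * Re P"
        by (simp add: id)
      have P: "Re P > 0" using pos[OF v] by (simp add: P_def)
      show "Re (\<Sum>i\<in>UNIV. \<Sum>j\<in>UNIV. v $ i * cnj (v $ j) * B t $ i $ j) > 0"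
      proof (cases "t = 0")
        case True
        then show ?thesis unfolding e using S by simp
      next
        case False
        then have "t * Re P > 0" using t P by simp
        moreover have "(1 - t) * S \<ge> 0" using t S by simp
        ultimately show ?thesis unfolding e by linarith
      qed
    qed
    then show ?thesis using real[of t] by (auto simp: complex_is_Real_iff complex_eq_iff)
  qed
  have cont: "continuous_on {0..1} (\<lambda>t. Re (det (B t)))"
    unfolding det_def B_def vec_lambda_beta by (intro continuous_intros)
  have B0: "B 0 = mat 1" by (simp add: B_def mat_def vec_eq_iff)
  have B1: "B 1 = A" by (simp add: B_def vec_eq_iff)
  have "Re (det (B 1)) > 0"
  proof (rule ccontr)
    assume "\<not> ?thesis"
    then obtain t where "0 \<le> t" "t \<le> 1" "Re (det (B t)) = 0"
      using IVT2'[of "\<lambda>t. Re (det (B t))" 1 0 0] cont by (auto simp: B0)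
    then show False using nz by blast
  qed
  then show ?thesis using real[of 1] by (simp add: B1)
qed

lemma dinv_cramer:
  fixes A :: "complex^'n^'n"
  assumes A: "invertible A"
  shows "dinv A $ a $ b = det (\<chi> i j. if j = b then (if i = a then 1 else 0) else A $ i $ j) / det A"
proof -
  have d: "det A \<noteq> 0" using A by (simp add: invertible_det_nz)
  define x where "x = (\<chi> b. dinv A $ a $ b)"
  have "A *v x = axis a 1"
    using dinv_left[OF A, of a] by (simp add: vec_eq_iff matrix_vector_mult_def x_def axis_def mult.commute eq_commute)
  then have "x = (\<chi> k. det (\<chi> i j. if j = k then axis a 1 $ i else A $ i $ j) / det A)"
    using cramer[OF d] by blast
  then have "x $ b = det (\<chi> i j. if j = b then axis a 1 $ i else A $ i $ j) / det A" by simp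
  then show ?thesis unfolding x_def axis_def vec_lambda_beta .
qed

lemma differentiable_prod':
  fixes f :: "'i \<Rightarrow> 'a::real_normed_vector \<Rightarrow> complex"
  shows "(\<And>j. j \<in> I \<Longrightarrow> f j differentiable (at p)) \<Longrightarrow> (\<lambda>x. \<Prod>j\<in>I. f j x) differentiable (at p)"
  by (induction I rule: infinite_finite_induct) auto

lemma wirt_bar_prod:
  assumes "finite I" "\<And>j. j \<in> I \<Longrightarrow> f j differentiable (at p)"
  shows "wirt_bar i (\<lambda>x. \<Prod>j\<in>I. f j x) p = (\<Sum>k\<in>I. wirt_bar i (f k) p * (\<Prod>j\<in>I - {k}. f j p))"
  using assms
proof (induction I rule: finite_induct)
  case (insert a I)
  have d: "f a differentiable (at p)" "(\<lambda>x. \<Prod>j\<in>I. f j x) differentiable (at p)"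
    using insert.prems by (auto intro: differentiable_prod')
  have "wirt_bar i (\<lambda>x. \<Prod>j\<in>insert a I. f j x) p = wirt_bar i (\<lambda>x. f a x * (\<Prod>j\<in>I. f j x)) p"
    using insert by simp
  also have "\<dots> = wirt_bar i (f a) p * (\<Prod>j\<in>I. f j p) + f a p * (\<Sum>k\<in>I. wirt_bar i (f k) p * (\<Prod>j\<in>I - {k}. f j p))"
    using wirt_mult(2)[OF d] insert by simp
  also have "f a p * (\<Sum>k\<in>I. wirt_bar i (f k) p * (\<Prod>j\<in>I - {k}. f j p)) =
      (\<Sum>k\<in>I. wirt_bar i (f k) p * (\<Prod>j\<in>insert a I - {k}. f j p))"
    unfolding sum_distrib_left
  proof (rule sum.cong[OF refl])
    fix k assume "k \<in> I"
    then have "insert a I - {k} = insert a (I - {k})" "a \<notin> I - {k}" using insert by auto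
    then show "f a p * (wirt_bar i (f k) p * (\<Prod>j\<in>I - {k}. f j p)) = wirt_bar i (f k) p * (\<Prod>j\<in>insert a I - {k}. f j p)"
      using insert by simp
  qed
  also have "I = insert a I - {a}" using insert by auto
  finally show ?case using insert by simp
qed simp

text \<open>Jacobi's formula: the determinant is differentiated row by row, and a differentiated row is a combination
  of the rows of \<open>A\<close> whose coefficients are given by the inverse.\<close>

lemma wirt_bar_det:
  fixes A :: "complex^'m \<Rightarrow> complex^'n^'n"
  assumes d: "\<And>a b. (\<lambda>x. A x $ a $ b) differentiable (at p)" and inv: "invertible (A p)"
  shows "wirt_bar l (\<lambda>x. det (A x)) p = det (A p) * (\<Sum>a\<in>UNIV. \<Sum>b\<in>UNIV. dinv (A p) $ a $ b * wirt_bar l (\<lambda>x. A x $ a $ b) p)"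
proof -
  define D where "D a b = wirt_bar l (\<lambda>x. A x $ a $ b) p" for a b
  let ?P = "{q. q permutes (UNIV :: 'n set)}"
  have dp: "(\<lambda>x. \<Prod>i\<in>UNIV. A x $ i $ q i) differentiable (at p)" for q :: "'n \<Rightarrow> 'n"
    by (rule differentiable_prod') (rule d)
  have "wirt_bar l (\<lambda>x. det (A x)) p = (\<Sum>q\<in>?P. of_int (sign q) * wirt_bar l (\<lambda>x. \<Prod>i\<in>UNIV. A x $ i $ q i) p)"
    unfolding det_def by (subst wirt_sum(2)) (auto simp: wirt_cmult(2)[OF dp] intro: differentiable_mult dp)
  also have "\<dots> = (\<Sum>q\<in>?P. \<Sum>k\<in>UNIV. of_int (sign q) * (D k (q k) * (\<Prod>i\<in>UNIV - {k}. A p $ i $ q i)))"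
    by (simp add: wirt_bar_prod[OF finite d] D_def sum_distrib_left)
  also have "\<dots> = (\<Sum>k\<in>UNIV. \<Sum>q\<in>?P. of_int (sign q) * (D k (q k) * (\<Prod>i\<in>UNIV - {k}. A p $ i $ q i)))"
    by (rule sum.swap)
  also have "\<dots> = (\<Sum>k\<in>UNIV. det (\<chi> i j. if i = k then D k j else A p $ i $ j))"
    unfolding det_def
  proof (intro sum.cong refl)
    fix k and q :: "'n \<Rightarrow> 'n"
    have "(\<Prod>i\<in>UNIV. (\<chi> i j. if i = k then D k j else A p $ i $ j) $ i $ q i)
       = (if k = k then D k (q k) else A p $ k $ q k) * (\<Prod>i\<in>UNIV - {k}. if i = k then D k (q i) else A p $ i $ q i)"
      by (subst prod.remove[of UNIV k]) auto
    also have "(\<Prod>i\<in>UNIV - {k}. if i = k then D k (q i) else A p $ i $ q i) = (\<Prod>i\<in>UNIV - {k}. A p $ i $ q i)"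
      by (rule prod.cong) auto
    finally show "of_int (sign q) * (D k (q k) * (\<Prod>i\<in>UNIV - {k}. A p $ i $ q i)) =
        of_int (sign q) * (\<Prod>i\<in>UNIV. (\<chi> i j. if i = k then D k j else A p $ i $ j) $ i $ q i)" by simp
  qed
  also have "\<dots> = (\<Sum>k\<in>UNIV. (\<Sum>b\<in>UNIV. dinv (A p) $ k $ b * D k b) * det (A p))"
  proof (rule sum.cong[OF refl])
    fix k
    define x where "x = (\<chi> a. \<Sum>b\<in>UNIV. D k b * dinv (A p) $ a $ b)"
    have rows: "(\<Sum>i\<in>UNIV. x $ i *s row i (A p)) = (\<chi> j. D k j)"
    proof -
      have "(\<Sum>i\<in>UNIV. x $ i * A p $ i $ j) = D k j" for j
      proof -
        have "(\<Sum>i\<in>UNIV. x $ i * A p $ i $ j) = (\<Sum>i\<in>UNIV. \<Sum>b\<in>UNIV. D k b * dinv (A p) $ i $ b * A p $ i $ j)"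
          by (simp add: x_def sum_distrib_right)
        also have "\<dots> = (\<Sum>b\<in>UNIV. \<Sum>i\<in>UNIV. D k b * dinv (A p) $ i $ b * A p $ i $ j)" by (rule sum.swap)
        also have "\<dots> = (\<Sum>b\<in>UNIV. (\<Sum>i\<in>UNIV. dinv (A p) $ i $ b * A p $ i $ j) * D k b)"
          by (simp add: sum_distrib_left mult_ac)
        also have "\<dots> = D k j" unfolding dinv_right[OF inv] sum_delta_left ..
        finally show ?thesis .
      qed
      then show ?thesis by (simp add: vec_eq_iff row_def sum_component)
    qed
    have "(\<chi> i. if i = k then (\<Sum>i\<in>UNIV. x $ i *s row i (A p)) else row i (A p)) = (\<chi> i j. if i = k then D k j else A p $ i $ j)"
      unfolding rows by (auto simp: vec_eq_iff row_def)
    then show "det (\<chi> i j. if i = k then D k j else A p $ i $ j) = (\<Sum>b\<in>UNIV. dinv (A p) $ k $ b * D k b) * det (A p)"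
      using cramer_lemma_transpose[of k x "A p"] by (simp add: x_def mult.commute)
  qed
  finally show ?thesis by (simp add: D_def sum_distrib_left sum_distrib_right mult_ac)
qed

lemma sum_option:
  fixes f :: "'n::finite option \<Rightarrow> 'a::comm_monoid_add"
  shows "(\<Sum>a\<in>UNIV. f a) = f None + (\<Sum>i\<in>UNIV. f (Some i))"
proof -
  have "(\<Sum>a\<in>UNIV. f a) = f None + (\<Sum>a\<in>range Some. f a)"
    unfolding UNIV_option_conv by (subst sum.insert) auto
  then show ?thesis by (simp add: sum.reindex)
qed

definition blk :: "complex^'n^'n \<Rightarrow> complex^('n option)^('n option)" where
  "blk A = (\<chi> a b. case a of None \<Rightarrow> (case b of None \<Rightarrow> 1 | Some j \<Rightarrow> 0)
     | Some i \<Rightarrow> (case b of None \<Rightarrow> 0 | Some j \<Rightarrow> A $ i $ j))"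

lemma blk_mult: "blk (A ** B) = blk A ** blk B"
  by (simp add: vec_eq_iff blk_def matrix_matrix_mult_def sum_option split: option.split)

lemma blk_one: "blk (mat 1) = mat 1"
  by (auto simp: vec_eq_iff blk_def mat_def split: option.split)

text \<open>The quotient of both sides is multiplicative and equal to 1 on diagonal matrices.\<close>

lemma det_blk:
  assumes "invertible (A :: complex^'n^'n)"
  shows "det (blk A) = det A"
proof -
  define Q where "Q A = det (blk A) / det A" for A :: "complex^'n^'n"
  have inv: "det (blk A) \<noteq> 0" if A: "invertible A" for A :: "complex^'n^'n"
  proof -
    obtain B :: "complex^'n^'n" where "A ** B = mat 1" using A unfolding invertible_def by blast
    then have "blk A ** blk B = mat 1" by (metis blk_mult blk_one)
    then have "det (blk A) * det (blk B) = 1" using det_mul det_I by metis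
    then show ?thesis by auto
  qed
  have "Q A = 1"
  proof (rule multiplicative_GL_trivial[OF _ _ _ assms])
    show "Q (A ** B) = Q A * Q B" for A B by (simp add: Q_def blk_mult det_mul)
    show "Q A \<noteq> 0" if "invertible A" for A using inv[OF that] that by (simp add: Q_def invertible_det_nz)
    fix k :: 'n and a :: complex assume a: "a \<noteq> 0"
    have "blk (diagk k a) = diagk (Some k) a"
      by (auto simp: vec_eq_iff blk_def diagk_def split: option.split)
    then show "Q (diagk k a) = 1" using a by (simp add: Q_def det_diagk)
  qed
  then show ?thesis using assms by (simp add: Q_def invertible_det_nz)
qed

text \<open>The rank one term is removed by a unipotent row and a unipotent column operation, since \<open>x\<close> and \<open>y\<close> are 1
  at the extra index.\<close>

lemma det_bordered:
  assumes A: "invertible (A :: complex^'n^'n)" and e: "e \<noteq> 0"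
    and x: "x None = 1" and y: "y None = 1"
  shows "det (\<chi> a b. (case a of None \<Rightarrow> 0 | Some i \<Rightarrow> (case b of None \<Rightarrow> 0 | Some j \<Rightarrow> A $ i $ j)) + e * x a * y b) = e * det A"
proof -
  have eq: "(\<chi> a b. (case a of None \<Rightarrow> 0 | Some i \<Rightarrow> (case b of None \<Rightarrow> 0 | Some j \<Rightarrow> A $ i $ j)) + e * x a * y b)
     = colop None x ** (diagk None e ** blk A) ** rowop None y"
    by (auto simp: vec_eq_iff rowop_right colop_left diagk_left blk_def x y split: option.split)
  have "det (colop None x) = 1" "det (rowop None y) = 1"
    by (rule multiplicative_unipotent[of det]; simp add: det_mul invertible_det_nz)+
  then show ?thesis unfolding eq by (simp add: det_mul det_diagk det_blk[OF A])
qed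

lemma sum_swap_outer: "(\<Sum>a\<in>A. \<Sum>b\<in>B. \<Sum>c\<in>C. f a b c) = (\<Sum>c\<in>C. \<Sum>b\<in>B. \<Sum>a\<in>A. f a b c)"
proof -
  have "(\<Sum>a\<in>A. \<Sum>b\<in>B. \<Sum>c\<in>C. f a b c) = (\<Sum>a\<in>A. \<Sum>c\<in>C. \<Sum>b\<in>B. f a b c)"
    by (intro sum.cong refl sum.swap)
  also have "\<dots> = (\<Sum>c\<in>C. \<Sum>a\<in>A. \<Sum>b\<in>B. f a b c)" by (rule sum.swap)
  also have "\<dots> = (\<Sum>c\<in>C. \<Sum>b\<in>B. \<Sum>a\<in>A. f a b c)" by (intro sum.cong refl sum.swap)
  finally show ?thesis .
qed

section \<open>Einstein potentials on the base\<close>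

text \<open>What is needed from the base: a real potential \<open>\<phi>\<close> whose Levi form is positive and whose Monge--Ampere
  measure is a multiple of \<open>exp (\<phi> / c)\<close>. For \<open>\<phi> = c log (V K)\<close> this is the Einstein property of the
  Bergman metric.\<close>

locale base_potential =
  fixes \<Omega> :: "(complex^'n) set" and \<phi> :: "complex^'n \<Rightarrow> complex" and c :: real and C :: complex
  assumes open_dom: "open \<Omega>" and \<phi>_smooth: "smooth_on \<Omega> \<phi>"
    and \<phi>_real: "z \<in> \<Omega> \<Longrightarrow> cnj (\<phi> z) = \<phi> z"
    and \<phi>_pos: "z \<in> \<Omega> \<Longrightarrow> v \<noteq> 0 \<Longrightarrow> Re (levi \<phi> z v) > 0"
    and c_pos: "c > 0"
    and einstein: "z \<in> \<Omega> \<Longrightarrow> det (\<chi> i k. wirt i (wirt_bar k \<phi>) z) = C * exp (\<phi> z / of_real c)"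
begin

definition h :: "complex^'n \<Rightarrow> complex^'n^'n" where
  "h z = (\<chi> i k. wirt i (wirt_bar k \<phi>) z)"

abbreviation "hi z \<equiv> dinv (h z)"

lemma h_smooth: "smooth_on \<Omega> (\<lambda>z. h z $ i $ k)"
  unfolding h_def vec_lambda_beta by (intro smooth_on_wirt open_dom \<phi>_smooth)

lemma h_hermitian: "z \<in> \<Omega> \<Longrightarrow> cnj (h z $ i $ k) = h z $ k $ i"
  unfolding h_def vec_lambda_beta
  by (subst wirt_hermitian[OF open_dom _ \<phi>_smooth, of z k i]) (use \<phi>_real in auto)

lemma det_h_pos: "z \<in> \<Omega> \<Longrightarrow> det (h z) \<in> \<real> \<and> Re (det (h z)) > 0"
  by (rule hermitian_posdef_det) (use h_hermitian \<phi>_pos in \<open>auto simp: h_def levi_def\<close>)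

lemma det_h_nz: "z \<in> \<Omega> \<Longrightarrow> det (h z) \<noteq> 0"
proof
  assume "z \<in> \<Omega>" "det (h z) = 0"
  then show False using det_h_pos[of z] by simp
qed

lemma h_invertible: "z \<in> \<Omega> \<Longrightarrow> invertible (h z)"
  using det_h_pos[of z] by (auto simp: invertible_det_nz)

lemma h_differentiable:
  assumes "z \<in> \<Omega>"
  shows "(\<lambda>z. h z $ i $ k) differentiable (at z)" "wirt_bar l (\<lambda>z. h z $ i $ k) differentiable (at z)"
    "wirt l (\<lambda>z. h z $ i $ k) differentiable (at z)"
  using h_smooth smooth_on_wirt[OF open_dom h_smooth] assms smooth_on_differentiable by blast+

lemma hi_smooth: "smooth_on \<Omega> (\<lambda>z. hi z $ a $ b)"
proof -
  have s1: "smooth_on \<Omega> (\<lambda>z. det (\<chi> i k. if k = b then (if i = a then 1 else 0) else h z $ i $ k))"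
  proof -
    have "smooth_on \<Omega> (\<lambda>z. if k = b then (if i = a then 1 else 0) else h z $ i $ k)" for i k
      by (cases "k = b") (simp_all add: smooth_on_const h_smooth)
    then show ?thesis unfolding det_def vec_lambda_beta
      by (intro smooth_on_sum smooth_on_mult smooth_on_const smooth_on_prod open_dom)
  qed
  have "smooth_on \<Omega> (\<lambda>z. det (h z))"
    unfolding det_def by (intro smooth_on_sum smooth_on_mult smooth_on_const smooth_on_prod open_dom h_smooth)
  then have s2: "smooth_on \<Omega> (\<lambda>z. inverse (det (h z)))"
    by (rule smooth_on_holomorphic_comp[OF open_dom, of _ "- {0}"])
      (use det_h_nz in \<open>auto intro!: holomorphic_intros\<close>)
  show ?thesis
    by (rule smooth_on_cong[OF open_dom smooth_on_mult[OF open_dom s1 s2]])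
      (simp add: dinv_cramer h_invertible divide_inverse)
qed

text \<open>Logarithmic derivative of the Monge--Ampere equation.\<close>

lemma trace_dbar_h:
  assumes z: "z \<in> \<Omega>"
  shows "(\<Sum>a\<in>UNIV. \<Sum>b\<in>UNIV. hi z $ a $ b * wirt_bar l (\<lambda>z. h z $ a $ b) z) = wirt_bar l \<phi> z / of_real c"
proof -
  have d\<phi>: "\<phi> differentiable (at z)" using \<phi>_smooth z smooth_on_differentiable by blast
  have der: "((\<lambda>x. C * exp (x / of_real c)) has_field_derivative C * exp (\<phi> z / of_real c) / of_real c) (at (\<phi> z))"
    using c_pos by (auto intro!: derivative_eq_intros)
  have "wirt_bar l (\<lambda>z. det (h z)) z = wirt_bar l (\<lambda>z. C * exp (\<phi> z / of_real c)) z"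
    by (rule wirt_cong[OF open_dom z]) (simp add: h_def einstein)
  also have "\<dots> = C * exp (\<phi> z / of_real c) / of_real c * wirt_bar l \<phi> z"
    using wirt_holomorphic_comp(2)[OF d\<phi>, of "\<lambda>x. C * exp (x / of_real c)"] der
    by (metis DERIV_imp_deriv field_differentiable_def)
  also have "C * exp (\<phi> z / of_real c) = det (h z)" by (simp add: h_def einstein[OF z])
  finally have "det (h z) * (\<Sum>a\<in>UNIV. \<Sum>b\<in>UNIV. hi z $ a $ b * wirt_bar l (\<lambda>z. h z $ a $ b) z)
      = det (h z) * (wirt_bar l \<phi> z / of_real c)"
    using wirt_bar_det[of h z, OF h_differentiable(1)[OF z] h_invertible[OF z]] by simp
  then show ?thesis using det_h_nz[OF z] mult_cancel_left by blast
qed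

lemma wirt_hi:
  assumes z: "z \<in> \<Omega>"
  shows "wirt k (\<lambda>z. hi z $ a $ b) z = - (\<Sum>e\<in>UNIV. \<Sum>d\<in>UNIV. hi z $ a $ d * wirt k (\<lambda>z. h z $ e $ d) z * hi z $ e $ b)"
proof -
  have dh: "(\<lambda>z. hi z $ a $ b) differentiable (at z)" for a b
    using hi_smooth z smooth_on_differentiable by blast
  have "(\<Sum>b\<in>UNIV. wirt k (\<lambda>z. hi z $ a $ b) z * h z $ e $ b) = - (\<Sum>b\<in>UNIV. hi z $ a $ b * wirt k (\<lambda>z. h z $ e $ b) z)" for e
  proof -
    have "wirt k (\<lambda>z. \<Sum>b\<in>UNIV. hi z $ a $ b * h z $ e $ b) z = wirt k (\<lambda>z. if a = e then 1 else 0) z"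
      by (rule wirt_cong[OF open_dom z]) (simp add: dinv_left h_invertible)
    also have "\<dots> = 0" by simp
    finally have "(\<Sum>b\<in>UNIV. wirt k (\<lambda>z. hi z $ a $ b) z * h z $ e $ b + hi z $ a $ b * wirt k (\<lambda>z. h z $ e $ b) z) = 0"
      using dh h_differentiable(1)[OF z] by (simp add: wirt_sum wirt_mult differentiable_mult)
    then show ?thesis by (simp add: sum.distrib eq_neg_iff_add_eq_0)
  qed
  from dinv_solve[OF h_invertible[OF z] this]
  show ?thesis by (simp add: sum_negf sum_distrib_right)
qed

text \<open>The curvature tensor of \<open>h\<close>.\<close>

definition Rh :: "complex^'n \<Rightarrow> 'n \<Rightarrow> 'n \<Rightarrow> 'n \<Rightarrow> 'n \<Rightarrow> complex" where
  "Rh z i j k l = - wirt k (wirt_bar l (\<lambda>z. h z $ i $ j)) z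
     + (\<Sum>a\<in>UNIV. \<Sum>b\<in>UNIV. hi z $ a $ b * wirt k (\<lambda>z. h z $ i $ b) z * wirt_bar l (\<lambda>z. h z $ a $ j) z)"

text \<open>A further derivative of the Monge--Ampere equation: the trace of the curvature is the Ricci tensor,
  which is \<open>- h / c\<close>.\<close>

lemma trace_Rh:
  assumes z: "z \<in> \<Omega>"
  shows "(\<Sum>i\<in>UNIV. \<Sum>j\<in>UNIV. hi z $ i $ j * Rh z i j k l) = - h z $ k $ l / of_real c"
proof -
  have dh: "(\<lambda>z. hi z $ a $ b) differentiable (at z)" for a b
    using hi_smooth z smooth_on_differentiable by blast
  define D where "D e d = wirt k (\<lambda>z. h z $ e $ d) z" for e d
  define B where "B e d = wirt_bar l (\<lambda>z. h z $ e $ d) z" for e d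
  define X where "X e d = wirt k (wirt_bar l (\<lambda>z. h z $ e $ d)) z" for e d
  have d\<phi>: "wirt_bar l \<phi> differentiable (at z)"
    using smooth_on_wirt(2)[OF open_dom \<phi>_smooth] z smooth_on_differentiable by blast
  have "wirt k (\<lambda>z. \<Sum>a\<in>UNIV. \<Sum>b\<in>UNIV. hi z $ a $ b * wirt_bar l (\<lambda>z. h z $ a $ b) z) z
      = wirt k (\<lambda>z. (1 / of_real c) * wirt_bar l \<phi> z) z"
    by (rule wirt_cong[OF open_dom z]) (simp add: trace_dbar_h)
  also have "\<dots> = h z $ k $ l / of_real c" using wirt_cmult(1)[OF d\<phi>, of k "1 / of_real c"] by (simp add: h_def)
  finally have 1: "(\<Sum>a\<in>UNIV. \<Sum>b\<in>UNIV. wirt k (\<lambda>z. hi z $ a $ b) z * B a b + hi z $ a $ b * X a b) = h z $ k $ l / of_real c"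
    using dh h_differentiable[OF z] by (simp add: wirt_sum wirt_mult differentiable_mult differentiable_sum' B_def X_def)
  have "(\<Sum>i\<in>UNIV. \<Sum>j\<in>UNIV. hi z $ i $ j * (\<Sum>a\<in>UNIV. \<Sum>b\<in>UNIV. hi z $ a $ b * D i b * B a j))
     = (\<Sum>i\<in>UNIV. \<Sum>j\<in>UNIV. \<Sum>a\<in>UNIV. \<Sum>b\<in>UNIV. hi z $ a $ b * D i b * hi z $ i $ j * B a j)"
    by (simp add: sum_distrib_left mult_ac)
  also have "\<dots> = (\<Sum>a\<in>UNIV. \<Sum>j\<in>UNIV. \<Sum>i\<in>UNIV. \<Sum>b\<in>UNIV. hi z $ a $ b * D i b * hi z $ i $ j * B a j)"
    by (rule sum_swap_outer)
  also have "\<dots> = - (\<Sum>a\<in>UNIV. \<Sum>j\<in>UNIV. wirt k (\<lambda>z. hi z $ a $ j) z * B a j)"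
    unfolding wirt_hi[OF z] by (simp add: D_def sum_distrib_right sum_negf)
  finally have 2: "(\<Sum>i\<in>UNIV. \<Sum>j\<in>UNIV. hi z $ i $ j * (\<Sum>a\<in>UNIV. \<Sum>b\<in>UNIV. hi z $ a $ b * D i b * B a j))
     = - (\<Sum>a\<in>UNIV. \<Sum>j\<in>UNIV. wirt k (\<lambda>z. hi z $ a $ j) z * B a j)" .
  have "(\<Sum>i\<in>UNIV. \<Sum>j\<in>UNIV. hi z $ i $ j * Rh z i j k l) = - (\<Sum>i\<in>UNIV. \<Sum>j\<in>UNIV. hi z $ i $ j * X i j)
     + (\<Sum>i\<in>UNIV. \<Sum>j\<in>UNIV. hi z $ i $ j * (\<Sum>a\<in>UNIV. \<Sum>b\<in>UNIV. hi z $ a $ b * D i b * B a j))"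
    unfolding Rh_def D_def[symmetric] B_def[symmetric] X_def[symmetric]
    by (simp add: right_diff_distrib sum_subtractf)
  also have "\<dots> = - (h z $ k $ l / of_real c)"
    unfolding 2 1[symmetric] by (simp add: sum.distrib)
  finally show ?thesis by simp
qed

lemma trace_h: "z \<in> \<Omega> \<Longrightarrow> (\<Sum>i\<in>UNIV. \<Sum>j\<in>UNIV. hi z $ i $ j * h z $ i $ j) = of_nat CARD('n)"
  by (simp add: dinv_left[OF h_invertible])

end

section \<open>The Cartan--Hartogs metric and its Ricci form\<close>

text \<open>Pulls back a covector of the base: the component along the fibre coordinate \<open>None\<close> is 0.\<close>

definition lft :: "'n option \<Rightarrow> ('n \<Rightarrow> complex) \<Rightarrow> complex" where
  "lft a f = (case a of None \<Rightarrow> 0 | Some i \<Rightarrow> f i)"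

lemma lft_simps [simp]: "lft None f = 0" "lft (Some i) f = f i"
  by (simp_all add: lft_def)

lemma base_pt_linear: "bounded_linear (base_pt :: complex^('n option) \<Rightarrow> complex^'n)"
  unfolding linear_conv_bounded_linear[symmetric]
  by (rule linearI) (simp_all add: base_pt_def vec_eq_iff)

lemma base_pt_axis [simp]: "base_pt (axis (Some i) a) = axis i a" "base_pt (axis None a) = 0"
  by (auto simp: base_pt_def axis_def vec_eq_iff)

lemma wirt_pullback:
  assumes "F differentiable (at (base_pt x))"
  shows "wirt a (\<lambda>x. F (base_pt x)) x = lft a (\<lambda>i. wirt i F (base_pt x))"
    "wirt_bar a (\<lambda>x. F (base_pt x)) x = lft a (\<lambda>i. wirt_bar i F (base_pt x))"
proof -
  have dd: "ddir v (\<lambda>x. F (base_pt x)) x = ddir (base_pt v) F (base_pt x)" for v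
    by (rule ddir_linear_comp[OF base_pt_linear assms])
  have z: "ddir 0 F (base_pt x) = 0"
    unfolding ddir_def using linear_frechet_derivative[OF assms] by (rule linear_0)
  show "wirt a (\<lambda>x. F (base_pt x)) x = lft a (\<lambda>i. wirt i F (base_pt x))"
    "wirt_bar a (\<lambda>x. F (base_pt x)) x = lft a (\<lambda>i. wirt_bar i F (base_pt x))"
    by (cases a; simp add: wirt_ddir wirt_bar_ddir dd z)+
qed

lemma wirt_coord:
  fixes k :: "'n::finite" and p :: "complex^'n"
  shows "wirt a (\<lambda>x. x $ k) p = (if a = k then 1 else 0)" "wirt_bar a (\<lambda>x. x $ k) p = 0"
  "wirt_bar a (\<lambda>x. cnj (x $ k)) p = (if a = k then 1 else 0)" "wirt a (\<lambda>x. cnj (x $ k)) p = 0"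
proof -
  have l: "bounded_linear (\<lambda>x::complex^'n::finite. vec_nth x k)" by (rule bounded_linear_vec_nth)
  show 1: "wirt a (\<lambda>x. x $ k) p = (if a = k then 1 else 0)" "wirt_bar a (\<lambda>x. x $ k) p = 0" for a
    by (auto simp: wirt_ddir wirt_bar_ddir ddir_linear[OF l] axis_def)
  show "wirt_bar a (\<lambda>x. cnj (x $ k)) p = (if a = k then 1 else 0)" "wirt a (\<lambda>x. cnj (x $ k)) p = 0"
    using wirt_cnj[OF bounded_linear_imp_differentiable[OF l], of a p] 1[of a] by auto
qed

lemma wirt_exp:
  assumes "f differentiable (at p)"
  shows "wirt a (\<lambda>x. exp (f x)) p = exp (f p) * wirt a f p" "wirt_bar a (\<lambda>x. exp (f x)) p = exp (f p) * wirt_bar a f p"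
proof -
  have "exp field_differentiable (at (f p))" "deriv exp (f p) = exp (f p)"
    using DERIV_exp[of "f p"] DERIV_imp_deriv unfolding field_differentiable_def by blast+
  then show "wirt a (\<lambda>x. exp (f x)) p = exp (f p) * wirt a f p"
    "wirt_bar a (\<lambda>x. exp (f x)) p = exp (f p) * wirt_bar a f p"
    using wirt_holomorphic_comp[OF assms, of exp a] by simp_all
qed

lemma wirt_inverse:
  assumes "f differentiable (at p)" "f p \<noteq> 0"
  shows "wirt a (\<lambda>x. inverse (f x)) p = - wirt a f p * inverse (f p) * inverse (f p)"
    "wirt_bar a (\<lambda>x. inverse (f x)) p = - wirt_bar a f p * inverse (f p) * inverse (f p)"
proof -
  have "(inverse has_field_derivative - (inverse (f p) ^ Suc (Suc 0))) (at (f p))"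
    using assms(2) by (rule DERIV_inverse)
  then have "inverse field_differentiable (at (f p))" "deriv inverse (f p) = - (inverse (f p) ^ Suc (Suc 0))"
    by (auto simp: field_differentiable_def DERIV_imp_deriv)
  then show "wirt a (\<lambda>x. inverse (f x)) p = - wirt a f p * inverse (f p) * inverse (f p)"
    "wirt_bar a (\<lambda>x. inverse (f x)) p = - wirt_bar a f p * inverse (f p) * inverse (f p)"
    using wirt_holomorphic_comp[OF assms(1), of inverse a] by simp_all
qed

context base_potential
begin

text \<open>In the names below a final \<open>b\<close> stands for the antiholomorphic counterpart. \<open>M\<close> is the Cartan--Hartogs
  domain and \<open>\<Phi>\<close> its potential \<open>- log (exp (- \<phi>) - |w|\<^sup>2)\<close> rewritten; \<open>p\<close> is \<open>\<partial>\<phi>\<close>, \<open>he\<close> is the pullback of \<open>h\<close>,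
  and \<open>th\<close> is \<open>\<partial>w + w \<partial>\<phi>\<close>, the connection form of the line bundle with weight \<open>\<phi>\<close>.\<close>

definition W :: "complex^('n option) \<Rightarrow> complex" where "W x = x $ None"
definition E :: "complex^('n option) \<Rightarrow> complex" where "E x = exp (\<phi> (base_pt x))"
definition t :: "complex^('n option) \<Rightarrow> complex" where "t x = W x * cnj (W x) * E x"
definition u :: "complex^('n option) \<Rightarrow> complex" where "u x = 1 - t x"
definition M :: "(complex^('n option)) set" where
  "M = {x. base_pt x \<in> \<Omega> \<and> (cmod (W x))\<^sup>2 < exp (- Re (\<phi> (base_pt x)))}"
definition \<Phi> :: "complex^('n option) \<Rightarrow> complex" where "\<Phi> x = \<phi> (base_pt x) - Ln (u x)"

definition p :: "'n option \<Rightarrow> complex^('n option) \<Rightarrow> complex" where "p a x = lft a (\<lambda>i. wirt i \<phi> (base_pt x))"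
definition pb :: "'n option \<Rightarrow> complex^('n option) \<Rightarrow> complex" where "pb a x = lft a (\<lambda>i. wirt_bar i \<phi> (base_pt x))"
definition he :: "'n option \<Rightarrow> 'n option \<Rightarrow> complex^('n option) \<Rightarrow> complex" where
  "he a b x = lft a (\<lambda>i. lft b (\<lambda>k. h (base_pt x) $ i $ k))"
definition th :: "'n option \<Rightarrow> complex^('n option) \<Rightarrow> complex" where
  "th a x = (if a = None then 1 else 0) + W x * p a x"
definition thb :: "'n option \<Rightarrow> complex^('n option) \<Rightarrow> complex" where
  "thb b x = (if b = None then 1 else 0) + cnj (W x) * pb b x"

text \<open>The metric in closed form: a horizontal part along the base and a rank one part along the fibre.\<close>

definition gm :: "complex^('n option) \<Rightarrow> complex^('n option)^('n option)" where
  "gm x = (\<chi> a b. he a b x / u x + E x / (u x)\<^sup>2 * th a x * thb b x)"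

lemma base_pt_M: "x \<in> M \<Longrightarrow> base_pt x \<in> \<Omega>"
  by (simp add: M_def)

lemma \<phi>_of_real: "z \<in> \<Omega> \<Longrightarrow> \<phi> z = of_real (Re (\<phi> z))"
  using \<phi>_real[of z] by (metis Reals_cnj_iff of_real_Re)

lemma open_M: "open M"
proof -
  have cb: "continuous_on UNIV (base_pt :: complex^('n option) \<Rightarrow> complex^'n)"
    using base_pt_linear linear_continuous_on by blast
  define S where "S = (base_pt :: complex^('n option) \<Rightarrow> complex^'n) -` \<Omega>"
  have oS: "open S" unfolding S_def using open_dom cb by (rule open_vimage)
  have c\<phi>: "continuous_on \<Omega> \<phi>"
    using \<phi>_smooth smooth_on_differentiable differentiable_imp_continuous_within
    by (intro continuous_at_imp_continuous_on) blast
  have cp: "continuous_on S (\<lambda>x. \<phi> (base_pt x))"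
    by (rule continuous_on_compose2[OF c\<phi> continuous_on_subset[OF cb]]) (auto simp: S_def)
  have "continuous_on S (\<lambda>x. exp (- Re (\<phi> (base_pt x))) - (cmod (W x))\<^sup>2)"
    unfolding W_def by (intro continuous_intros cp)
  from continuous_open_preimage[OF this oS open_greaterThan[of 0]]
  have "open (S \<inter> (\<lambda>x. exp (- Re (\<phi> (base_pt x))) - (cmod (W x))\<^sup>2) -` {0<..})" .
  also have "S \<inter> (\<lambda>x. exp (- Re (\<phi> (base_pt x))) - (cmod (W x))\<^sup>2) -` {0<..} = M"
    by (auto simp: S_def M_def)
  finally show ?thesis .
qed

lemma E_real: "x \<in> M \<Longrightarrow> E x = of_real (exp (Re (\<phi> (base_pt x))))"
  unfolding E_def by (subst \<phi>_of_real) (auto simp: base_pt_M exp_of_real)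

lemma t_real:
  assumes "x \<in> M"
  shows "t x = of_real ((cmod (W x))\<^sup>2 * exp (Re (\<phi> (base_pt x))))"
    "0 \<le> (cmod (W x))\<^sup>2 * exp (Re (\<phi> (base_pt x)))" "(cmod (W x))\<^sup>2 * exp (Re (\<phi> (base_pt x))) < 1"
proof -
  show "t x = of_real ((cmod (W x))\<^sup>2 * exp (Re (\<phi> (base_pt x))))"
    using complex_norm_square[of "W x"] by (simp add: t_def E_real[OF assms])
  have "(cmod (W x))\<^sup>2 * exp (Re (\<phi> (base_pt x))) < exp (- Re (\<phi> (base_pt x))) * exp (Re (\<phi> (base_pt x)))"
    using assms by (intro mult_strict_right_mono) (auto simp: M_def)
  then show "(cmod (W x))\<^sup>2 * exp (Re (\<phi> (base_pt x))) < 1" by (simp add: exp_minus)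
qed simp

lemma u_real: "x \<in> M \<Longrightarrow> u x \<in> \<real> \<and> Re (u x) > 0"
  using t_real[of x] by (simp add: u_def)

lemma u_nz: "x \<in> M \<Longrightarrow> u x \<noteq> 0"
  using u_real[of x] by auto

lemma E_nz: "E x \<noteq> 0"
  by (simp add: E_def)

lemma smooth_pullback: "smooth_on \<Omega> F \<Longrightarrow> smooth_on M (\<lambda>x. F (base_pt x))"
  by (rule smooth_on_linear_comp[OF open_M base_pt_linear]) (auto simp: base_pt_M)

lemma W_smooth: "smooth_on S W" "smooth_on S (\<lambda>x. cnj (W x))"
proof -
  have "bounded_linear W" "bounded_linear (\<lambda>x. cnj (W x))"
    unfolding W_def using bounded_linear_vec_nth bounded_linear_compose[OF bounded_linear_cnj bounded_linear_vec_nth] by auto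
  then show "smooth_on S W" "smooth_on S (\<lambda>x. cnj (W x))" using smooth_on_linear by blast+
qed

lemma E_smooth: "smooth_on M E"
  unfolding E_def by (rule smooth_on_holomorphic_comp[OF open_M smooth_pullback[OF \<phi>_smooth] open_UNIV holomorphic_on_exp]) auto

lemma t_smooth: "smooth_on M t"
  unfolding t_def by (intro smooth_on_mult open_M W_smooth E_smooth)

lemma u_smooth: "smooth_on M u"
  unfolding u_def by (intro smooth_on_diff smooth_on_const open_M t_smooth)

lemma diffs:
  assumes "x \<in> M"
  shows "W differentiable (at x)" "(\<lambda>x. cnj (W x)) differentiable (at x)" "E differentiable (at x)"
    "t differentiable (at x)" "u differentiable (at x)" "(\<lambda>x. \<phi> (base_pt x)) differentiable (at x)"
  using W_smooth E_smooth t_smooth u_smooth smooth_pullback[OF \<phi>_smooth] assms smooth_on_differentiable by blast+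

lemma wirt_pull:
  assumes "smooth_on \<Omega> F" "x \<in> M"
  shows "wirt a (\<lambda>x. F (base_pt x)) x = lft a (\<lambda>i. wirt i F (base_pt x))"
    "wirt_bar a (\<lambda>x. F (base_pt x)) x = lft a (\<lambda>i. wirt_bar i F (base_pt x))"
  using wirt_pullback[of F x] smooth_on_differentiable[OF assms(1) base_pt_M[OF assms(2)]] by blast+

lemma wirt_W:
  "wirt a W x = (if a = None then 1 else 0)" "wirt_bar a W x = 0"
  "wirt_bar a (\<lambda>x. cnj (W x)) x = (if a = None then 1 else 0)" "wirt a (\<lambda>x. cnj (W x)) x = 0"
  unfolding W_def by (rule wirt_coord)+

lemma wirt_E:
  assumes "x \<in> M"
  shows "wirt a E x = E x * p a x" "wirt_bar a E x = E x * pb a x"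
  using wirt_exp[OF diffs(6)[OF assms], of a] wirt_pull[OF \<phi>_smooth assms, of a]
  by (simp_all add: E_def[abs_def] p_def pb_def)

lemma wirt_t:
  assumes x: "x \<in> M"
  shows "wirt a t x = cnj (W x) * E x * th a x" "wirt_bar a t x = W x * E x * thb a x"
proof -
  note d = diffs[OF x]
  have ww: "(\<lambda>x. W x * cnj (W x)) differentiable (at x)" using d by simp
  show "wirt a t x = cnj (W x) * E x * th a x" "wirt_bar a t x = W x * E x * thb a x"
    unfolding t_def[abs_def] wirt_mult[OF ww d(3)] wirt_mult[OF d(1,2)] wirt_W wirt_E[OF x] th_def thb_def
    by (simp_all add: algebra_simps)
qed

lemma wirt_u:
  assumes x: "x \<in> M"
  shows "wirt a u x = - (cnj (W x) * E x * th a x)" "wirt_bar a u x = - (W x * E x * thb a x)"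
  unfolding u_def[abs_def] wirt_diff[OF differentiable_const diffs(4)[OF x]] wirt_t[OF x] by simp_all

lemma pb_smooth: "smooth_on M (pb b)" "smooth_on M (p b)"
proof -
  have "smooth_on M (\<lambda>x. wirt_bar i \<phi> (base_pt x))" "smooth_on M (\<lambda>x. wirt i \<phi> (base_pt x))" for i
    by (intro smooth_pullback smooth_on_wirt open_dom \<phi>_smooth)+
  then show "smooth_on M (pb b)" "smooth_on M (p b)"
    unfolding pb_def[abs_def] p_def[abs_def] by (cases b; simp add: smooth_on_const)+
qed

lemma wirt_pb:
  assumes x: "x \<in> M"
  shows "wirt a (pb b) x = he a b x" "wirt_bar b (p a) x = he a b x"
proof -
  show "wirt a (pb b) x = he a b x"
  proof (cases b)
    case None
    then show ?thesis by (cases a) (simp_all add: pb_def[abs_def] he_def)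
  next
    case (Some k)
    then show ?thesis
      using wirt_pull(1)[OF smooth_on_wirt(2)[OF open_dom \<phi>_smooth] x, of a k]
      by (simp add: pb_def[abs_def] he_def h_def)
  qed
  show "wirt_bar b (p a) x = he a b x"
  proof (cases a)
    case None
    then show ?thesis by (simp add: p_def[abs_def] he_def)
  next
    case (Some k)
    then show ?thesis
      using wirt_pull(2)[OF smooth_on_wirt(1)[OF open_dom \<phi>_smooth] x, of b k]
        wirt_commute(2)[OF open_dom base_pt_M[OF x] \<phi>_smooth]
      by (cases b) (simp_all add: p_def[abs_def] he_def h_def)
  qed
qed

lemma wirt_bar_\<Phi>:
  assumes x: "x \<in> M"
  shows "wirt_bar b \<Phi> x = pb b x + W x * E x * inverse (u x) * thb b x"
proof -
  have "wirt_bar b (\<lambda>x. Ln (u x)) x = wirt_bar b u x / u x"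
    by (rule ln_smooth(3)[OF open_M u_smooth]) (use u_real x in auto)
  moreover have "(\<lambda>x. Ln (u x)) differentiable (at x)"
    using ln_smooth(1)[OF open_M u_smooth] u_real x smooth_on_differentiable by blast
  ultimately show ?thesis
    unfolding \<Phi>_def[abs_def] using wirt_diff(2)[OF diffs(6)[OF x], of "\<lambda>x. Ln (u x)" b]
    by (simp add: wirt_pull[OF \<phi>_smooth x] pb_def wirt_u[OF x] divide_inverse)
qed

lemma \<Phi>_smooth: "smooth_on M \<Phi>"
proof -
  have "smooth_on M (\<lambda>x. Ln (u x))" by (rule ln_smooth(1)[OF open_M u_smooth]) (use u_real in auto)
  then show ?thesis unfolding \<Phi>_def[abs_def]
    by (intro smooth_on_diff open_M smooth_pullback \<phi>_smooth)
qed

theorem metric_formula: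
  assumes x: "x \<in> M"
  shows "wirt a (wirt_bar b \<Phi>) x = gm x $ a $ b"
proof -
  note d = diffs[OF x]
  have dpb: "pb b differentiable (at x)" using pb_smooth x smooth_on_differentiable by blast
  have u0: "u x \<noteq> 0" by (rule u_nz[OF x])
  have iu: "(\<lambda>x. inverse (u x)) differentiable (at x)"
    using d(5) u0 by (intro differentiable_inverse)
  have we: "(\<lambda>x. W x * E x) differentiable (at x)" using d by simp
  have weu: "(\<lambda>x. W x * E x * inverse (u x)) differentiable (at x)" using we iu by simp
  have cwp: "(\<lambda>x. cnj (W x) * pb b x) differentiable (at x)" using d dpb by simp
  have thd: "thb b differentiable (at x)" unfolding thb_def[abs_def] using cwp by simp
  have wth: "wirt a (thb b) x = cnj (W x) * he a b x"
    unfolding thb_def[abs_def] wirt_add(1)[OF differentiable_const cwp] wirt_mult(1)[OF d(2) dpb] wirt_W wirt_pb[OF x]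
    by simp
  have "wirt a (wirt_bar b \<Phi>) x = wirt a (\<lambda>x. pb b x + W x * E x * inverse (u x) * thb b x) x"
    by (rule wirt_cong[OF open_M x]) (rule wirt_bar_\<Phi>)
  also have "\<dots> = wirt a (pb b) x + wirt a (\<lambda>x. W x * E x * inverse (u x) * thb b x) x"
    by (rule wirt_add(1)[OF dpb differentiable_mult[OF weu thd]])
  also have "\<dots> = he a b x + ((((if a = None then 1 else 0) * E x + W x * (E x * p a x)) * inverse (u x)
       + W x * E x * (cnj (W x) * E x * th a x * inverse (u x) * inverse (u x))) * thb b x
      + W x * E x * inverse (u x) * (cnj (W x) * he a b x))"
    unfolding wirt_mult(1)[OF weu thd] wirt_mult(1)[OF we iu] wirt_mult(1)[OF d(1,3)] wirt_W wirt_E[OF x]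
      wirt_inverse(1)[OF d(5) u0] wirt_u[OF x] wth wirt_pb[OF x] by simp
  also have "(if a = None then 1 else 0) * E x + W x * (E x * p a x) = E x * th a x"
    by (simp add: th_def algebra_simps)
  finally have "wirt a (wirt_bar b \<Phi>) x = he a b x * (1 + t x * inverse (u x))
      + E x * th a x * thb b x * (inverse (u x) + t x * inverse (u x) * inverse (u x))"
    by (simp add: t_def algebra_simps)
  moreover have "1 + t x * inverse (u x) = inverse (u x)"
    using u0 by (simp add: u_def field_simps)
  moreover have "inverse (u x) + t x * inverse (u x) * inverse (u x) = inverse (u x) * inverse (u x)"
  proof -
    have "inverse (u x) + t x * inverse (u x) * inverse (u x) = (1 + t x * inverse (u x)) * inverse (u x)"
      by (simp add: algebra_simps)
    then show ?thesis using \<open>1 + t x * inverse (u x) = inverse (u x)\<close> by simp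
  qed
  ultimately show ?thesis by (simp add: gm_def divide_inverse power2_eq_square mult_ac)
qed

text \<open>A bordered determinant, since the rank one part is the only one with components along the fibre.\<close>

lemma det_gm:
  assumes x: "x \<in> M"
  shows "det (gm x) = E x / (u x) ^ (CARD('n) + 2) * det (h (base_pt x))"
proof -
  have u0: "u x \<noteq> 0" by (rule u_nz[OF x])
  define A where "A = (\<chi> i. (1 / u x) *s h (base_pt x) $ i)"
  have dA: "det A = (1 / u x) ^ CARD('n) * det (h (base_pt x))"
    unfolding A_def by (subst det_rows_mul) simp
  have iA: "invertible A"
    using dA u0 det_h_nz[OF base_pt_M[OF x]] by (simp add: invertible_det_nz)
  have e0: "E x / (u x)\<^sup>2 \<noteq> 0" using u0 E_nz by simp
  have "gm x = (\<chi> a b. (case a of None \<Rightarrow> 0 | Some i \<Rightarrow> (case b of None \<Rightarrow> 0 | Some j \<Rightarrow> A $ i $ j)) + E x / (u x)\<^sup>2 * th a x * thb b x)"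
    by (simp add: vec_eq_iff gm_def he_def A_def lft_def split: option.split)
  also have "det \<dots> = E x / (u x)\<^sup>2 * det A"
    by (rule det_bordered[OF iA e0]) (simp_all add: th_def thb_def p_def pb_def)
  finally show ?thesis using u0 by (simp add: dA power_add power_divide power2_eq_square field_simps)
qed

lemma gm_invertible: "x \<in> M \<Longrightarrow> invertible (gm x)"
  using det_gm[of x] u_nz[of x] E_nz[of x] det_h_nz[OF base_pt_M, of x] by (simp add: invertible_det_nz)

text \<open>The defect of the Einstein condition: it vanishes exactly if the Ricci form is a multiple of the metric.\<close>

definition \<delta> :: complex where "\<delta> = of_nat CARD('n) + 1 - 1 / of_real c"

lemma C_real:
  assumes "z \<in> \<Omega>"
  shows "C \<in> \<real> \<and> Re C > 0"
proof -
  have e: "exp (\<phi> z / of_real c) = of_real (exp (Re (\<phi> z) / c))"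
    by (subst \<phi>_of_real[OF assms]) (simp add: exp_of_real[symmetric])
  have "det (h z) = C * exp (\<phi> z / of_real c)" by (simp add: h_def einstein[OF assms])
  then have "C = det (h z) / of_real (exp (Re (\<phi> z) / c))" by (simp add: e)
  then show ?thesis using det_h_pos[OF assms] by (auto simp: Re_divide_of_real)
qed

text \<open>The determinant is \<open>u\<close> to the power \<open>- (n + 2)\<close> times a function of the base, and the Monge--Ampere equation
  expresses the latter through \<open>\<phi>\<close>. Hence the Ricci potential is a combination of \<open>\<Phi>\<close> and \<open>\<phi>\<close>.\<close>

lemma Ln_det_gm:
  assumes x: "x \<in> M"
  shows "Ln (det (gm x)) = of_nat (CARD('n) + 2) * \<Phi> x - \<delta> * \<phi> (base_pt x) + Ln C"
proof -
  note z = base_pt_M[OF x]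
  define f where "f = Re (\<phi> (base_pt x))"
  have f: "\<phi> (base_pt x) = of_real f" unfolding f_def by (rule \<phi>_of_real[OF z])
  obtain v where v: "u x = of_real v" "v > 0" using u_real[OF x] by (metis Reals_cases Re_complex_of_real)
  obtain k where k: "C = of_real k" "k > 0" using C_real[OF z] by (metis Reals_cases Re_complex_of_real)
  have dh: "det (h (base_pt x)) = of_real (k * exp (f / c))"
    using einstein[OF z] by (simp add: h_def f k exp_of_real[symmetric])
  have "det (gm x) = of_real (exp f / v ^ (CARD('n) + 2) * (k * exp (f / c)))"
    unfolding det_gm[OF x] dh E_def f v(1) by (simp add: exp_of_real[symmetric])
  moreover have pos: "exp f / v ^ (CARD('n) + 2) * (k * exp (f / c)) > 0" using v k by simp
  ultimately have "Ln (det (gm x)) = of_real (ln (exp f / v ^ (CARD('n) + 2) * (k * exp (f / c))))"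
    using Ln_of_real[OF pos] by simp
  also have "ln (exp f / v ^ (CARD('n) + 2) * (k * exp (f / c))) = f - real (CARD('n) + 2) * ln v + (ln k + f / c)"
    using v k by (simp add: ln_mult ln_div ln_realpow algebra_simps)
  finally have "Ln (det (gm x)) = of_real (f - real (CARD('n) + 2) * ln v + (ln k + f / c))" .
  moreover have "Ln (u x) = of_real (ln v)" "Ln C = of_real (ln k)" using v k by (simp_all add: Ln_of_real)
  ultimately show ?thesis by (simp add: \<Phi>_def f \<delta>_def algebra_simps)
qed

end

text \<open>The metric is prescribed on the domain, where it arises by differentiating a potential.\<close>

locale ch_metric = base_potential \<Omega> \<phi> c C for \<Omega> :: "(complex^'n) set" and \<phi> c C +
  fixes G :: "('n option) metric"
  assumes G: "x \<in> M \<Longrightarrow> G x = gm x"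
begin

lemma ginv_G: "x \<in> M \<Longrightarrow> ginv G x = dinv (gm x)"
  by (simp add: ginv_dinv G)

theorem ric_G:
  assumes x: "x \<in> M"
  shows "ric G x a b = - of_nat (CARD('n) + 2) * gm x $ a $ b + \<delta> * he a b x"
proof -
  define N where "N = (of_nat (CARD('n) + 2) :: complex)"
  have s\<phi>: "smooth_on M (\<lambda>x. \<phi> (base_pt x))" by (rule smooth_pullback[OF \<phi>_smooth])
  have d: "\<Phi> differentiable (at y)" "(\<lambda>x. \<phi> (base_pt x)) differentiable (at y)" if "y \<in> M" for y
    using \<Phi>_smooth s\<phi> that smooth_on_differentiable by blast+
  have db: "wirt_bar b \<Phi> differentiable (at x)" "wirt_bar b (\<lambda>x. \<phi> (base_pt x)) differentiable (at x)"
    using smooth_on_wirt(2)[OF open_M \<Phi>_smooth] smooth_on_wirt(2)[OF open_M s\<phi>] x smooth_on_differentiable by blast+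
  have "wirt_bar b (\<lambda>z. Ln (det (G z))) y = N * wirt_bar b \<Phi> y - \<delta> * wirt_bar b (\<lambda>x. \<phi> (base_pt x)) y" if y: "y \<in> M" for y
  proof -
    have "wirt_bar b (\<lambda>z. Ln (det (G z))) y = wirt_bar b (\<lambda>z. (N * \<Phi> z - \<delta> * \<phi> (base_pt z)) + Ln C) y"
      by (rule wirt_cong[OF open_M y]) (simp add: G Ln_det_gm N_def)
    also have "\<dots> = N * wirt_bar b \<Phi> y - \<delta> * wirt_bar b (\<lambda>x. \<phi> (base_pt x)) y"
      using d[OF y] by (simp add: wirt_add wirt_diff wirt_cmult differentiable_mult)
    finally show ?thesis .
  qed
  then have "wirt a (wirt_bar b (\<lambda>z. Ln (det (G z)))) x
      = wirt a (\<lambda>y. N * wirt_bar b \<Phi> y - \<delta> * wirt_bar b (\<lambda>x. \<phi> (base_pt x)) y) x"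
    by (rule wirt_cong[OF open_M x])
  also have "\<dots> = N * wirt a (wirt_bar b \<Phi>) x - \<delta> * wirt a (wirt_bar b (\<lambda>x. \<phi> (base_pt x))) x"
    using db by (simp add: wirt_diff wirt_cmult differentiable_mult)
  also have "wirt a (wirt_bar b (\<lambda>x. \<phi> (base_pt x))) x = wirt a (pb b) x"
    by (rule wirt_cong[OF open_M x]) (simp add: wirt_pull[OF \<phi>_smooth] pb_def)
  finally show ?thesis by (simp add: ric_def metric_formula[OF x] wirt_pb[OF x] N_def algebra_simps)
qed

end

section \<open>Logarithmic frame and scalar invariants\<close>

context base_potential
begin

text \<open>Where \<open>w\<close> does not vanish, \<open>l = \<partial> (\<phi> + log w)\<close> is defined, \<open>\<partial>t = t l\<close>, and the derivatives of \<open>l\<close>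
  in the antiholomorphic directions are the components of \<open>h\<close>. The coefficients of the metric become
  functions of \<open>U = 1 / u\<close> alone.\<close>

definition Mw :: "(complex^('n option)) set" where "Mw = {x \<in> M. W x \<noteq> 0}"
definition U :: "complex^('n option) \<Rightarrow> complex" where "U x = inverse (u x)"
definition l :: "'n option \<Rightarrow> complex^('n option) \<Rightarrow> complex" where
  "l a x = p a x + (if a = None then 1 else 0) * inverse (W x)"
definition lb :: "'n option \<Rightarrow> complex^('n option) \<Rightarrow> complex" where
  "lb b x = pb b x + (if b = None then 1 else 0) * inverse (cnj (W x))"

lemma Mw_M: "x \<in> Mw \<Longrightarrow> x \<in> M" and Mw_W: "x \<in> Mw \<Longrightarrow> W x \<noteq> 0"
  by (auto simp: Mw_def)

lemma open_Mw: "open Mw"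
proof -
  have "continuous_on M W" using W_smooth(1)[of M] smooth_on_differentiable differentiable_imp_continuous_within
    by (intro continuous_at_imp_continuous_on) blast
  then have "open (M \<inter> W -` (- {0}))"
    by (rule continuous_open_preimage[OF _ open_M]) (simp add: open_Compl)
  also have "M \<inter> W -` (- {0}) = Mw" by (auto simp: Mw_def)
  finally show ?thesis .
qed

lemma th_l: "x \<in> Mw \<Longrightarrow> th a x = W x * l a x" "x \<in> Mw \<Longrightarrow> thb a x = cnj (W x) * lb a x"
  using Mw_W[of x] by (auto simp: th_def l_def thb_def lb_def p_def pb_def algebra_simps)

lemma t_U:
  assumes "x \<in> M"
  shows "t x * U x * U x = U x * (U x - 1)" "u x * U x = 1" "t x = 1 - u x"
  using u_nz[OF assms] by (simp_all add: U_def u_def field_simps)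

lemma t_nz: "x \<in> Mw \<Longrightarrow> t x \<noteq> 0"
  using Mw_W[of x] by (simp add: t_def E_nz)

lemma UU_nz:
  assumes "x \<in> Mw"
  shows "U x * (U x - 1) \<noteq> 0"
proof -
  have "t x * U x * U x \<noteq> 0" using t_nz[OF assms] u_nz[OF Mw_M[OF assms]] by (simp add: U_def)
  then show ?thesis unfolding t_U(1)[OF Mw_M[OF assms]] .
qed

lemma gm_l:
  assumes x: "x \<in> Mw"
  shows "gm x $ a $ b = U x * he a b x + U x * (U x - 1) * l a x * lb b x"
proof -
  have "gm x $ a $ b = U x * he a b x + (t x * U x * U x) * l a x * lb b x"
    by (simp add: gm_def th_l[OF x] t_def U_def divide_inverse power2_eq_square mult_ac)
  then show ?thesis unfolding t_U(1)[OF Mw_M[OF x]] .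
qed

lemma he_hermitian: "x \<in> M \<Longrightarrow> cnj (he a b x) = he b a x"
  using h_hermitian[OF base_pt_M] by (cases a; cases b) (simp_all add: he_def)

lemma lb_cnj: "x \<in> M \<Longrightarrow> lb a x = cnj (l a x)"
proof -
  assume x: "x \<in> M"
  have "wirt_bar i \<phi> (base_pt x) = cnj (wirt i \<phi> (base_pt x))" for i
    by (rule wirt_real[OF open_dom base_pt_M[OF x]])
      (use \<phi>_smooth base_pt_M[OF x] \<phi>_real smooth_on_differentiable in auto)
  then show ?thesis by (cases a) (simp_all add: l_def lb_def p_def pb_def)
qed

lemma U_cnj: "x \<in> M \<Longrightarrow> cnj (U x) = U x" "x \<in> M \<Longrightarrow> cnj (u x) = u x"
  using u_real[of x] by (auto simp: U_def Reals_cnj_iff)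

lemma gm_hermitian:
  assumes x: "x \<in> Mw"
  shows "cnj (gm x $ a $ b) = gm x $ b $ a"
  using Mw_M[OF x]
  by (simp add: gm_l[OF x] he_hermitian U_cnj lb_cnj mult_ac)

lemma \<delta>_real: "cnj \<delta> = \<delta>"
  by (simp add: \<delta>_def)

lemma lb_pow: "x \<in> Mw \<Longrightarrow> lb None x \<noteq> 0" "x \<in> Mw \<Longrightarrow> l None x = inverse (W x)"
  using Mw_W[of x] by (auto simp: lb_def pb_def l_def p_def)

abbreviation "gi x \<equiv> dinv (gm x)"

text \<open>A row of the inverse metric at a base index annihilates \<open>lb\<close>, because it is orthogonal to the fibre row
  of \<open>g\<close>, which is a multiple of \<open>lb\<close>. So on base indices only the term \<open>U h\<close> is inverted.\<close>

lemma gi_block: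
  assumes x: "x \<in> Mw"
  shows "gi x $ Some i $ Some k = u x * hi (base_pt x) $ i $ k"
proof -
  have M: "x \<in> M" by (rule Mw_M[OF x])
  note inv = gm_invertible[OF M]
  have he0: "he None b x = 0" "he b None x = 0" for b by (cases b; simp add: he_def)+
  have "(\<Sum>b\<in>UNIV. gi x $ Some i $ b * gm x $ None $ b) = 0"
    using dinv_left[OF inv, of "Some i" None] by simp
  then have "U x * (U x - 1) * l None x * (\<Sum>b\<in>UNIV. gi x $ Some i $ b * lb b x) = 0"
    by (simp add: gm_l[OF x] he0 sum_distrib_left mult_ac)
  then have perp: "(\<Sum>b\<in>UNIV. gi x $ Some i $ b * lb b x) = 0"
    using UU_nz[OF x] lb_pow(2)[OF x] Mw_W[OF x] by simp
  have "U x * gi x $ Some i $ Some k = hi (base_pt x) $ i $ k"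
  proof (rule dinv_unique[OF h_invertible[OF base_pt_M[OF M]], of "\<lambda>k. U x * gi x $ Some i $ Some k" i])
    fix e
    have "(if i = e then 1 else 0) = (\<Sum>b\<in>UNIV. gi x $ Some i $ b * gm x $ Some e $ b)"
      using dinv_left[OF inv, of "Some i" "Some e"] by simp
    also have "\<dots> = U x * (\<Sum>b\<in>UNIV. gi x $ Some i $ b * he (Some e) b x)
        + U x * (U x - 1) * l (Some e) x * (\<Sum>b\<in>UNIV. gi x $ Some i $ b * lb b x)"
      by (simp add: gm_l[OF x] distrib_left sum.distrib sum_distrib_left mult_ac)
    also have "\<dots> = (\<Sum>k\<in>UNIV. U x * gi x $ Some i $ Some k * h (base_pt x) $ e $ k)"
      unfolding perp by (simp add: sum_option he0 he_def sum_distrib_left mult_ac)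
    finally show "(\<Sum>k\<in>UNIV. U x * gi x $ Some i $ Some k * h (base_pt x) $ e $ k) = (if i = e then 1 else 0)" by simp
  qed
  then have "u x * (U x * gi x $ Some i $ Some k) = u x * hi (base_pt x) $ i $ k" by simp
  then show ?thesis using t_U(2)[OF M] by (simp flip: mult.assoc)
qed

lemma he_None: "he None b x = 0" "he b None x = 0"
  by (cases b; simp add: he_def)+

lemma trace_he:
  assumes x: "x \<in> Mw"
  shows "(\<Sum>a\<in>UNIV. \<Sum>b\<in>UNIV. gi x $ a $ b * he a b x) = of_nat CARD('n) * u x"
proof -
  have "(\<Sum>a\<in>UNIV. \<Sum>b\<in>UNIV. gi x $ a $ b * he a b x) = (\<Sum>i\<in>UNIV. \<Sum>k\<in>UNIV. u x * (hi (base_pt x) $ i $ k * h (base_pt x) $ i $ k))"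
    by (simp add: sum_option he_None) (simp add: he_def gi_block[OF x] mult_ac)
  also have "\<dots> = u x * of_nat CARD('n)" by (simp add: trace_h[OF base_pt_M[OF Mw_M[OF x]]] flip: sum_distrib_left)
  finally show ?thesis by simp
qed

lemma trace_gm:
  assumes x: "x \<in> M"
  shows "(\<Sum>a\<in>UNIV. \<Sum>b\<in>UNIV. gi x $ a $ b * gm x $ a $ b) = of_nat CARD('n) + 1"
proof -
  have "(\<Sum>a\<in>UNIV. \<Sum>b\<in>UNIV. gi x $ a $ b * gm x $ a $ b) = of_nat CARD('n option)"
    by (simp add: dinv_left[OF gm_invertible[OF x]])
  also have "CARD('n option) = Suc CARD('n)" by simp
  finally show ?thesis by simp
qed

text \<open>The trace of \<open>g\<close> minus that of \<open>U h\<close> is the trace of the rank one term.\<close>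

lemma trace_l:
  assumes x: "x \<in> Mw"
  shows "(\<Sum>a\<in>UNIV. \<Sum>b\<in>UNIV. gi x $ a $ b * (l a x * lb b x)) * (U x * (U x - 1)) = 1"
proof -
  have "of_nat CARD('n) + 1 = (\<Sum>a\<in>UNIV. \<Sum>b\<in>UNIV. U x * (gi x $ a $ b * he a b x) + U x * (U x - 1) * (gi x $ a $ b * (l a x * lb b x)))"
    unfolding trace_gm[OF Mw_M[OF x], symmetric] gm_l[OF x] by (simp add: algebra_simps)
  also have "\<dots> = U x * (of_nat CARD('n) * u x) + U x * (U x - 1) * (\<Sum>a\<in>UNIV. \<Sum>b\<in>UNIV. gi x $ a $ b * (l a x * lb b x))"
    unfolding sum.distrib sum_distrib_left[symmetric] trace_he[OF x] ..
  finally show ?thesis using t_U(2)[OF Mw_M[OF x]] by (simp add: algebra_simps)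
qed

text \<open>These rules form a closed calculus: the derivatives of \<open>t\<close> and \<open>U\<close>, and those of \<open>l\<close> and \<open>lb\<close> in the
  directions of opposite type, are again expressed by \<open>t\<close>, \<open>U\<close>, \<open>l\<close>, \<open>lb\<close> and \<open>h\<close>.\<close>

lemma wirt_l:
  assumes x: "x \<in> Mw"
  shows "wirt a t x = t x * l a x" "wirt_bar a t x = t x * lb a x"
    "wirt_bar b (l a) x = he a b x" "wirt a (lb b) x = he a b x"
    "wirt a U x = U x * (U x - 1) * l a x" "wirt_bar a U x = U x * (U x - 1) * lb a x"
proof -
  have M: "x \<in> M" by (rule Mw_M[OF x])
  note d = diffs[OF M]
  show t: "wirt a t x = t x * l a x" "wirt_bar a t x = t x * lb a x" for a
    by (simp_all add: wirt_t[OF M] th_l[OF x] t_def mult_ac)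
  have dp: "p a differentiable (at x)" "pb a differentiable (at x)" for a
    using pb_smooth M smooth_on_differentiable by blast+
  have iW: "(\<lambda>x. inverse (W x)) differentiable (at x)" "(\<lambda>x. inverse (cnj (W x))) differentiable (at x)"
    using d Mw_W[OF x] by (auto intro!: differentiable_inverse)
  have iW': "(\<lambda>x. c * inverse (W x)) differentiable (at x)" "(\<lambda>x. c * inverse (cnj (W x))) differentiable (at x)" for c
    using iW by auto
  have z: "wirt_bar b (\<lambda>x. inverse (W x)) x = 0" "wirt b (\<lambda>x. inverse (cnj (W x))) x = 0" for b
    using wirt_inverse(2)[OF d(1)] wirt_inverse(1)[OF d(2)] Mw_W[OF x] by (simp_all add: wirt_W)
  show "wirt_bar b (l a) x = he a b x"
    unfolding l_def[abs_def] wirt_add(2)[OF dp(1) iW'(1)] wirt_cmult(2)[OF iW(1)] z wirt_pb[OF M] by simp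
  show "wirt a (lb b) x = he a b x"
    unfolding lb_def[abs_def] wirt_add(1)[OF dp(2) iW'(2)] wirt_cmult(1)[OF iW(2)] z wirt_pb[OF M] by simp
  have u: "wirt a u x = - (t x * l a x)" "wirt_bar a u x = - (t x * lb a x)" for a
    unfolding u_def[abs_def] wirt_diff[OF differentiable_const d(4)] t by simp_all
  have iU: "U = (\<lambda>x. inverse (u x))" by (simp add: fun_eq_iff U_def)
  have "wirt a U x = - wirt a u x * U x * U x" "wirt_bar a U x = - wirt_bar a u x * U x * U x"
    using wirt_inverse[OF d(5) u_nz[OF M], of a] by (simp_all add: iU)
  then have "wirt a U x = t x * U x * U x * l a x" "wirt_bar a U x = t x * U x * U x * lb a x"
    unfolding u by simp_all
  then show "wirt a U x = U x * (U x - 1) * l a x" "wirt_bar a U x = U x * (U x - 1) * lb a x"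
    unfolding t_U(1)[OF M] by simp_all
qed

lemma smooth_Mw:
  "smooth_on Mw t" "smooth_on Mw u" "smooth_on Mw U" "smooth_on Mw (l a)" "smooth_on Mw (lb a)"
proof -
  have sub: "smooth_on M f \<Longrightarrow> smooth_on Mw f" for f using smooth_on_subset Mw_M by blast
  show "smooth_on Mw t" "smooth_on Mw u" using sub t_smooth u_smooth by blast+
  then show "smooth_on Mw U" unfolding U_def[abs_def]
    by (intro smooth_on_holomorphic_comp[OF open_Mw, of _ "- {0}" inverse])
      (use u_nz Mw_M in \<open>auto intro!: holomorphic_intros\<close>)
  have iW: "smooth_on Mw (\<lambda>x. inverse (W x))" "smooth_on Mw (\<lambda>x. inverse (cnj (W x)))"
    by (rule smooth_on_holomorphic_comp[OF open_Mw W_smooth(1), of "- {0}" inverse]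
        smooth_on_holomorphic_comp[OF open_Mw W_smooth(2), of "- {0}" inverse];
      use Mw_W in \<open>auto intro!: holomorphic_intros\<close>)+
  show "smooth_on Mw (l a)" "smooth_on Mw (lb a)"
    unfolding l_def[abs_def] lb_def[abs_def]
    by (intro smooth_on_add smooth_on_mult smooth_on_const open_Mw sub pb_smooth iW)+
qed

lemma diffs_Mw:
  assumes "x \<in> Mw"
  shows "t differentiable (at x)" "u differentiable (at x)" "U differentiable (at x)"
    "l a differentiable (at x)" "lb a differentiable (at x)"
  using smooth_Mw assms smooth_on_differentiable by blast+

end

context ch_metric
begin

lemma scal_G:
  assumes x: "x \<in> Mw"
  shows "scal G x = - (of_nat CARD('n) + 2) * (of_nat CARD('n) + 1) + \<delta> * of_nat CARD('n) * u x"
proof -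
  have M: "x \<in> M" by (rule Mw_M[OF x])
  have "scal G x = (\<Sum>a\<in>UNIV. \<Sum>b\<in>UNIV. - (of_nat CARD('n) + 2) * (gi x $ a $ b * gm x $ a $ b) + \<delta> * (gi x $ a $ b * he a b x))"
    unfolding scal_def ginv_G[OF M] ric_G[OF M] by (simp add: algebra_simps)
  also have "\<dots> = - (of_nat CARD('n) + 2) * (of_nat CARD('n) + 1) + \<delta> * (of_nat CARD('n) * u x)"
    unfolding sum.distrib sum_distrib_left[symmetric] trace_gm[OF M] trace_he[OF x] ..
  finally show ?thesis by simp
qed

text \<open>\<open>\<partial>\<close> and then its conjugate applied to \<open>u = 1 - t\<close> give \<open>- t (l \<otimes> lb + h)\<close>.\<close>

lemma laplacian_scal_G:
  assumes x: "x \<in> Mw"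
  shows "laplacian G (scal G) x = - \<delta> * of_nat CARD('n) * ((u x)\<^sup>2 + of_nat CARD('n) * (1 - u x) * u x)"
proof -
  have M: "x \<in> M" by (rule Mw_M[OF x])
  have wb: "wirt_bar b (scal G) y = (- \<delta> * of_nat CARD('n)) * (t y * lb b y)" if y: "y \<in> Mw" for b y
  proof -
    note d = diffs[OF Mw_M[OF y]]
    have "wirt_bar b (scal G) y = wirt_bar b (\<lambda>x. (- (of_nat CARD('n) + 2) * (of_nat CARD('n) + 1) + \<delta> * of_nat CARD('n)) + (- \<delta> * of_nat CARD('n)) * t x) y"
      by (rule wirt_cong[OF open_Mw y]) (simp add: scal_G u_def algebra_simps)
    also have "\<dots> = (- \<delta> * of_nat CARD('n)) * wirt_bar b t y"
      unfolding wirt_add(2)[OF differentiable_const differentiable_mult[OF differentiable_const d(4)]] wirt_cmult(2)[OF d(4)]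
      by simp
    finally show ?thesis by (simp add: wirt_l[OF y])
  qed
  have w: "wirt a (wirt_bar b (scal G)) x = (- \<delta> * of_nat CARD('n) * t x) * (l a x * lb b x) + (- \<delta> * of_nat CARD('n) * t x) * he a b x" for a b
  proof -
    note d = diffs_Mw[OF x]
    have "wirt a (wirt_bar b (scal G)) x = wirt a (\<lambda>y. (- \<delta> * of_nat CARD('n)) * (t y * lb b y)) x"
      by (rule wirt_cong[OF open_Mw x]) (rule wb)
    also have "\<dots> = (- \<delta> * of_nat CARD('n)) * (t x * l a x * lb b x + t x * he a b x)"
      unfolding wirt_cmult(1)[OF differentiable_mult[OF d(1,5)]] wirt_mult(1)[OF d(1,5)] wirt_l[OF x] ..
    finally show ?thesis by (simp add: algebra_simps)
  qed
  have "laplacian G (scal G) x = (\<Sum>a\<in>UNIV. \<Sum>b\<in>UNIV. (- \<delta> * of_nat CARD('n) * t x) * (gi x $ a $ b * (l a x * lb b x)) + (- \<delta> * of_nat CARD('n) * t x) * (gi x $ a $ b * he a b x))"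
    unfolding laplacian_def ginv_G[OF M] w by (simp add: algebra_simps)
  also have "\<dots> = (- \<delta> * of_nat CARD('n) * t x) * (\<Sum>a\<in>UNIV. \<Sum>b\<in>UNIV. gi x $ a $ b * (l a x * lb b x)) + (- \<delta> * of_nat CARD('n) * t x) * (of_nat CARD('n) * u x)"
    unfolding sum.distrib sum_distrib_left[symmetric] trace_he[OF x] ..
  also have "t x * (\<Sum>a\<in>UNIV. \<Sum>b\<in>UNIV. gi x $ a $ b * (l a x * lb b x)) = (u x)\<^sup>2"
  proof -
    define S where "S = (\<Sum>a\<in>UNIV. \<Sum>b\<in>UNIV. gi x $ a $ b * (l a x * lb b x))"
    have "S * (t x * U x * U x) = 1" using trace_l[OF x] by (simp add: S_def t_U(1)[OF M])
    then have "(u x * u x) * (S * (t x * U x * U x)) = u x * u x" by simp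
    moreover have "(u x * u x) * (S * (t x * U x * U x)) = t x * S * ((u x * U x) * (u x * U x))" by (simp add: mult_ac)
    ultimately show ?thesis unfolding S_def[symmetric] t_U(2)[OF M] by (simp add: power2_eq_square)
  qed
  then have "(- \<delta> * of_nat CARD('n) * t x) * (\<Sum>a\<in>UNIV. \<Sum>b\<in>UNIV. gi x $ a $ b * (l a x * lb b x)) = - \<delta> * of_nat CARD('n) * (u x)\<^sup>2"
    by (simp add: mult.assoc)
  finally show ?thesis by (simp add: t_U(3)[OF M] algebra_simps)
qed

lemma ric_norm2_G:
  assumes x: "x \<in> Mw"
  shows "ric_norm2 G x = (of_nat CARD('n) + 2)\<^sup>2 * (of_nat CARD('n) + 1) - 2 * (of_nat CARD('n) + 2) * \<delta> * of_nat CARD('n) * u x + \<delta>\<^sup>2 * of_nat CARD('n) * (u x)\<^sup>2"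
proof -
  have M: "x \<in> M" by (rule Mw_M[OF x])
  note inv = gm_invertible[OF M]
  define a0 :: complex where "a0 = - (of_nat CARD('n) + 2)"
  have ric: "ric G x a b = a0 * gm x $ a $ b + \<delta> * he a b x" for a b
    unfolding ric_G[OF M] a0_def by simp
  have cric: "cnj (ric G x a b) = a0 * gm x $ b $ a + \<delta> * he b a x" for a b
    unfolding ric by (simp add: gm_hermitian[OF x] he_hermitian[OF M] \<delta>_real a0_def)
  define H where "H a b = (\<Sum>z\<in>UNIV. \<Sum>v\<in>UNIV. gi x $ a $ z * gi x $ v $ b * he v z x)" for a b
  have raise_g: "(\<Sum>z\<in>UNIV. \<Sum>v\<in>UNIV. gi x $ a $ z * gi x $ v $ b * gm x $ v $ z) = gi x $ a $ b" for a b
  proof -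
    have "(\<Sum>z\<in>UNIV. \<Sum>v\<in>UNIV. gi x $ a $ z * gi x $ v $ b * gm x $ v $ z)
       = (\<Sum>v\<in>UNIV. \<Sum>z\<in>UNIV. gi x $ a $ z * gi x $ v $ b * gm x $ v $ z)" by (rule sum.swap)
    also have "\<dots> = (\<Sum>v\<in>UNIV. (\<Sum>z\<in>UNIV. gi x $ a $ z * gm x $ v $ z) * gi x $ v $ b)"
      by (simp add: sum_distrib_left sum_distrib_right mult_ac)
    also have "\<dots> = gi x $ a $ b" unfolding dinv_left[OF inv] sum_delta_left ..
    finally show ?thesis .
  qed
  have raise: "(\<Sum>z\<in>UNIV. \<Sum>v\<in>UNIV. gi x $ a $ z * gi x $ v $ b * ric G x a b * cnj (ric G x z v))
      = ric G x a b * (a0 * gi x $ a $ b + \<delta> * H a b)" for a b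
  proof -
    have "(\<Sum>z\<in>UNIV. \<Sum>v\<in>UNIV. gi x $ a $ z * gi x $ v $ b * ric G x a b * cnj (ric G x z v))
      = (\<Sum>z\<in>UNIV. \<Sum>v\<in>UNIV. (ric G x a b * a0) * (gi x $ a $ z * gi x $ v $ b * gm x $ v $ z)
          + (ric G x a b * \<delta>) * (gi x $ a $ z * gi x $ v $ b * he v z x))"
      unfolding cric by (simp add: algebra_simps)
    also have "\<dots> = (ric G x a b * a0) * gi x $ a $ b + (ric G x a b * \<delta>) * H a b"
      unfolding sum.distrib sum_distrib_left[symmetric] raise_g H_def ..
    finally show ?thesis by (simp add: algebra_simps)
  qed
  have gH: "(\<Sum>a\<in>UNIV. \<Sum>b\<in>UNIV. gm x $ a $ b * H a b) = of_nat CARD('n) * u x"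
  proof -
    have "(\<Sum>b\<in>UNIV. gm x $ a $ b * H a b) = (\<Sum>z\<in>UNIV. gi x $ a $ z * he a z x)" for a
    proof -
      have "(\<Sum>b\<in>UNIV. gm x $ a $ b * H a b) = (\<Sum>b\<in>UNIV. \<Sum>z\<in>UNIV. \<Sum>v\<in>UNIV. (gi x $ v $ b * gm x $ a $ b) * (gi x $ a $ z * he v z x))"
        by (simp add: H_def sum_distrib_left mult_ac)
      also have "\<dots> = (\<Sum>v\<in>UNIV. \<Sum>z\<in>UNIV. \<Sum>b\<in>UNIV. (gi x $ v $ b * gm x $ a $ b) * (gi x $ a $ z * he v z x))"
        by (rule sum_swap_outer)
      also have "\<dots> = (\<Sum>v\<in>UNIV. (if v = a then 1 else 0) * (\<Sum>z\<in>UNIV. gi x $ a $ z * he v z x))"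
        unfolding sum_distrib_right[symmetric] dinv_left[OF inv] by (simp add: sum_distrib_left)
      also have "\<dots> = (\<Sum>z\<in>UNIV. gi x $ a $ z * he a z x)" by (rule sum_delta_right)
      finally show ?thesis .
    qed
    then show ?thesis using trace_he[OF x] by simp
  qed
  have HS: "H (Some i) (Some k) = (u x)\<^sup>2 * hi (base_pt x) $ i $ k" for i k
  proof -
    have "H (Some i) (Some k) = (\<Sum>z\<in>UNIV. \<Sum>v\<in>UNIV. (u x)\<^sup>2 * (hi (base_pt x) $ i $ z * h (base_pt x) $ v $ z * hi (base_pt x) $ v $ k))"
      unfolding H_def by (simp add: sum_option he_None gi_block[OF x]) (simp add: he_def power2_eq_square mult_ac)
    also have "\<dots> = (\<Sum>v\<in>UNIV. \<Sum>z\<in>UNIV. (u x)\<^sup>2 * (hi (base_pt x) $ i $ z * h (base_pt x) $ v $ z * hi (base_pt x) $ v $ k))"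
      by (rule sum.swap)
    also have "\<dots> = (\<Sum>v\<in>UNIV. (\<Sum>z\<in>UNIV. hi (base_pt x) $ i $ z * h (base_pt x) $ v $ z) * ((u x)\<^sup>2 * hi (base_pt x) $ v $ k))"
      by (simp add: sum_distrib_right sum_distrib_left mult_ac)
    also have "\<dots> = (u x)\<^sup>2 * hi (base_pt x) $ i $ k"
      unfolding dinv_left[OF h_invertible[OF base_pt_M[OF M]]] sum_delta_left ..
    finally show ?thesis .
  qed
  have hH: "(\<Sum>a\<in>UNIV. \<Sum>b\<in>UNIV. he a b x * H a b) = (u x)\<^sup>2 * of_nat CARD('n)"
  proof -
    have "(\<Sum>a\<in>UNIV. \<Sum>b\<in>UNIV. he a b x * H a b) = (\<Sum>i\<in>UNIV. \<Sum>k\<in>UNIV. (u x)\<^sup>2 * (hi (base_pt x) $ i $ k * h (base_pt x) $ i $ k))"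
      by (simp add: sum_option he_None HS) (simp add: he_def mult_ac)
    also have "\<dots> = (u x)\<^sup>2 * of_nat CARD('n)" by (simp add: trace_h[OF base_pt_M[OF M]] flip: sum_distrib_left)
    finally show ?thesis .
  qed
  have "ric_norm2 G x = (\<Sum>a\<in>UNIV. \<Sum>b\<in>UNIV. ric G x a b * (a0 * gi x $ a $ b + \<delta> * H a b))"
    unfolding ric_norm2_def ginv_G[OF M] raise ..
  also have "\<dots> = (\<Sum>a\<in>UNIV. \<Sum>b\<in>UNIV. a0\<^sup>2 * (gi x $ a $ b * gm x $ a $ b) + (a0 * \<delta>) * (gi x $ a $ b * he a b x)
      + ((a0 * \<delta>) * (gm x $ a $ b * H a b) + \<delta>\<^sup>2 * (he a b x * H a b)))"
    unfolding ric by (intro sum.cong refl) (simp add: power2_eq_square algebra_simps)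
  also have "\<dots> = a0\<^sup>2 * (of_nat CARD('n) + 1) + (a0 * \<delta>) * (of_nat CARD('n) * u x) + ((a0 * \<delta>) * (of_nat CARD('n) * u x) + \<delta>\<^sup>2 * ((u x)\<^sup>2 * of_nat CARD('n)))"
    unfolding sum.distrib sum_distrib_left[symmetric] trace_gm[OF M] trace_he[OF x] gH hH ..
  finally show ?thesis by (simp add: a0_def power2_eq_square algebra_simps)
qed

end

section \<open>The curvature tensor\<close>

text \<open>The curvature tensor after all derivatives are replaced by symbols. In the names, \<open>a\<close>, \<open>b\<close>, \<open>e\<close>, \<open>t\<close> are the four
  indices, \<open>D\<close> and \<open>Db\<close> are first derivatives of \<open>h\<close>, \<open>V\<close> and \<open>Vb\<close> those of \<open>l\<close> and \<open>lb\<close>, \<open>DD\<close> is the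
  second derivative of \<open>h\<close> and \<open>R2\<close> the quadratic term of the curvature of \<open>h\<close>.
  All terms with derivatives of \<open>l\<close> cancel.\<close>

lemma curvature_identity:
  fixes U la le lb lt hab het hat heb Dab Dat Dbab Dbeb V Vb DD R2 gl :: complex
  shows "- (((2 * U - 1) * (U * (U - 1) * le) * lt * hab + U * (U - 1) * het * hab + U * (U - 1) * lt * Dab)
        + (U * (U - 1) * le * Dbab + U * DD)
        + ((6 * U * U - 6 * U + 1) * (U * (U - 1) * le) * lt * la * lb
           + (2 * U - 1) * U * (U - 1) * (het * la * lb + lt * V * lb + lt * la * heb))
        + ((2 * U - 1) * (U * (U - 1) * le) * (hat * lb + la * Vb)
           + U * (U - 1) * (Dat * lb + hat * heb + V * Vb + la * Dbeb)))
      + ((U - 1) * (le * (U * (U - 1) * lt * hab + U * Dbab + (2 * U - 1) * U * (U - 1) * lt * la * lb + U * (U - 1) * (hat * lb + la * Vb)) + la * (U * (U - 1) * lt * heb + U * Dbeb + (2 * U - 1) * U * (U - 1) * lt * le * lb + U * (U - 1) * (het * lb + le * Vb)))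
        + (U * (U - 1) * lt * Dab + U * R2 + (2 * U - 1) * U * (U - 1) * lt * gl * lb + U * (U - 1) * (Dat * lb + gl * Vb))
        + (V + la * le - gl) * ((2 * U - 1) * U * (U - 1) * lt * lb + U * (U - 1) * Vb)) = - ((U * hab + U * (U - 1) * la * lb) * (U * het + U * (U - 1) * le * lt)
        + (U * hat + U * (U - 1) * la * lt) * (U * heb + U * (U - 1) * le * lb))
      + U * (- DD + R2 + hab * het + hat * heb)"
  by algebra

context base_potential
begin

lemma wirt_he:
  assumes x: "x \<in> M"
  shows "wirt e (he a b) x = lft a (\<lambda>i. lft b (\<lambda>k. lft e (\<lambda>m. wirt m (\<lambda>z. h z $ i $ k) (base_pt x))))"
    "wirt_bar e (he a b) x = lft a (\<lambda>i. lft b (\<lambda>k. lft e (\<lambda>m. wirt_bar m (\<lambda>z. h z $ i $ k) (base_pt x))))"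
  using wirt_pull[OF h_smooth x, of e]
  by (cases a; cases b; simp add: he_def[abs_def])+

lemma wirt_wirt_bar_he:
  assumes x: "x \<in> M"
  shows "wirt e (wirt_bar d (he a b)) x = lft a (\<lambda>i. lft b (\<lambda>k. lft e (\<lambda>m. lft d (\<lambda>q. wirt m (wirt_bar q (\<lambda>z. h z $ i $ k)) (base_pt x)))))"
proof -
  have "wirt e (wirt_bar d (he a b)) x = wirt e (\<lambda>x. lft a (\<lambda>i. lft b (\<lambda>k. lft d (\<lambda>q. wirt_bar q (\<lambda>z. h z $ i $ k) (base_pt x))))) x"
    by (rule wirt_cong[OF open_M x]) (rule wirt_he)
  then show ?thesis
    using wirt_pull(1)[OF smooth_on_wirt(2)[OF open_dom h_smooth] x, of e]
    by (cases a; cases b; cases d) (simp_all add: lft_def split: option.split)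
qed

lemma he_smooth: "smooth_on M (he a b)"
  using smooth_pullback[OF h_smooth]
  by (cases a; cases b) (simp_all add: he_def[abs_def] smooth_on_const)

lemma he_smooth_Mw: "smooth_on Mw (he a b)"
  using smooth_on_subset[OF he_smooth] Mw_M by blast

lemma h_derivative_symmetry:
  assumes z: "z \<in> \<Omega>"
  shows "wirt m (\<lambda>z. h z $ i $ k) z = wirt i (\<lambda>z. h z $ m $ k) z"
    "wirt_bar m (\<lambda>z. h z $ i $ k) z = wirt_bar k (\<lambda>z. h z $ i $ m) z"
proof -
  show "wirt m (\<lambda>z. h z $ i $ k) z = wirt i (\<lambda>z. h z $ m $ k) z"
    unfolding h_def vec_lambda_beta
    by (rule wirt_commute(1)[OF open_dom z smooth_on_wirt(2)[OF open_dom \<phi>_smooth]])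
  have "wirt_bar m (wirt i (wirt_bar k \<phi>)) z = wirt_bar k (wirt i (wirt_bar m \<phi>)) z"
  proof -
    have s: "smooth_on \<Omega> (wirt_bar k \<phi>)" for k by (rule smooth_on_wirt(2)[OF open_dom \<phi>_smooth])
    have "wirt_bar m (wirt i (wirt_bar k \<phi>)) z = wirt i (wirt_bar m (wirt_bar k \<phi>)) z"
      by (rule wirt_commute(2)[OF open_dom z s, symmetric])
    also have "\<dots> = wirt i (wirt_bar k (wirt_bar m \<phi>)) z"
      by (rule wirt_cong[OF open_dom z]) (rule wirt_commute(3)[OF open_dom _ \<phi>_smooth])
    also have "\<dots> = wirt_bar k (wirt i (wirt_bar m \<phi>)) z"
      by (rule wirt_commute(2)[OF open_dom z s])
    finally show ?thesis .
  qed
  then show "wirt_bar m (\<lambda>z. h z $ i $ k) z = wirt_bar k (\<lambda>z. h z $ i $ m) z"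
    unfolding h_def vec_lambda_beta .
qed

text \<open>The deviation of the curvature of the base from constant holomorphic sectional curvature
  (with the same normalisation as for the total space).\<close>

definition s4 :: "complex^'n \<Rightarrow> 'n \<Rightarrow> 'n \<Rightarrow> 'n \<Rightarrow> 'n \<Rightarrow> complex" where
  "s4 z i k m q = Rh z i k m q + h z $ i $ k * h z $ m $ q + h z $ i $ q * h z $ m $ k"

definition S4 :: "complex^('n option) \<Rightarrow> 'n option \<Rightarrow> 'n option \<Rightarrow> 'n option \<Rightarrow> 'n option \<Rightarrow> complex" where
  "S4 x a b e d = lft a (\<lambda>i. lft b (\<lambda>k. lft e (\<lambda>m. lft d (\<lambda>q. s4 (base_pt x) i k m q))))"

end

context ch_metric
begin

text \<open>The expression \<open>\<Gamma>\<close> is the Christoffel symbol: it is characterised by \<open>\<Gamma> g = \<partial>g\<close>, so contracting \<open>\<partial>g\<close>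
  with the inverse metric gives \<open>\<Gamma>\<close>. The derivatives \<open>V\<close> of \<open>l\<close> in pure holomorphic directions are not
  determined by \<open>h\<close>; they enter \<open>\<Gamma>\<close> along the vector field \<open>w \<partial>/\<partial>w\<close> and cancel in the end.\<close>

theorem curv_G:
  assumes x: "x \<in> Mw"
  shows "curv G x a b e d = - (gm x $ a $ b * gm x $ e $ d + gm x $ a $ d * gm x $ e $ b) + U x * S4 x a b e d"
proof -
  have M: "x \<in> M" by (rule Mw_M[OF x])
  note z = base_pt_M[OF M]
  have sVb: "smooth_on Mw (wirt_bar d (lb b))" for b d by (rule smooth_on_wirt(2)[OF open_Mw smooth_Mw(5)])
  have sDb: "smooth_on Mw (wirt_bar d (he a b))" for a b d by (rule smooth_on_wirt(2)[OF open_Mw he_smooth_Mw])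
  have dall: "U differentiable (at y)" "l a differentiable (at y)" "lb a differentiable (at y)" "he a b differentiable (at y)"
    "wirt_bar d (lb b) differentiable (at y)" "wirt_bar d (he a b) differentiable (at y)" if "y \<in> Mw" for y a b d
    using diffs_Mw[OF that] he_smooth_Mw sVb sDb that smooth_on_differentiable by blast+
  define D where "D a b e = wirt e (he a b) x" for a b e
  define Db where "Db a b d = wirt_bar d (he a b) x" for a b d
  define V where "V a e = wirt e (l a) x" for a e
  define Vb where "Vb b d = wirt_bar d (lb b) x" for b d
  define DD where "DD = wirt e (wirt_bar d (he a b)) x"
  define X where "X a b e = U x * (U x - 1) * l e x * he a b x + U x * D a b e + (2 * U x - 1) * U x * (U x - 1) * l e x * l a x * lb b x
      + U x * (U x - 1) * (V a e * lb b x + l a x * he e b x)" for a b e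
  define Y where "Y a b d y = U y * (U y - 1) * lb d y * he a b y + U y * wirt_bar d (he a b) y
      + (2 * U y - 1) * U y * (U y - 1) * lb d y * l a y * lb b y
      + U y * (U y - 1) * (he a d y * lb b y + l a y * wirt_bar d (lb b) y)" for a b d y
  have wG: "wirt e (\<lambda>z. G z $ a $ b) x = X a b e" for a b e
  proof -
    have "wirt e (\<lambda>z. G z $ a $ b) x = wirt e (\<lambda>z. U z * he a b z + U z * (U z - 1) * l a z * lb b z) x"
      by (rule wirt_cong[OF open_Mw x]) (simp add: G Mw_M gm_l)
    also have "\<dots> = X a b e"
      using dall[OF x] by (simp add: wirt_add wirt_diff wirt_mult wirt_l[OF x] X_def D_def V_def) (simp add: algebra_simps)
    finally show ?thesis .
  qed
  have wbG: "wirt_bar d (\<lambda>z. G z $ a $ b) y = Y a b d y" if y: "y \<in> Mw" for a b d y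
  proof -
    have "wirt_bar d (\<lambda>z. G z $ a $ b) y = wirt_bar d (\<lambda>z. U z * he a b z + U z * (U z - 1) * l a z * lb b z) y"
      by (rule wirt_cong[OF open_Mw y]) (simp add: G Mw_M gm_l)
    also have "\<dots> = Y a b d y"
      using dall[OF y] by (simp add: wirt_add wirt_diff wirt_mult wirt_l[OF y] Y_def) (simp add: algebra_simps)
    finally show ?thesis .
  qed
  have wVb: "wirt e (wirt_bar d (lb b)) x = Db e b d"
  proof -
    have "wirt e (wirt_bar d (lb b)) x = wirt_bar d (wirt e (lb b)) x"
      by (rule wirt_commute(2)[OF open_Mw x smooth_Mw(5)])
    also have "\<dots> = wirt_bar d (he e b) x" by (rule wirt_cong[OF open_Mw x]) (rule wirt_l)
    finally show ?thesis by (simp add: Db_def)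
  qed
  have wY: "wirt e (Y a b d) x = ((2 * U x - 1) * (U x * (U x - 1) * l e x) * lb d x * he a b x + U x * (U x - 1) * he e d x * he a b x + U x * (U x - 1) * lb d x * D a b e)
        + (U x * (U x - 1) * l e x * Db a b d + U x * DD)
        + ((6 * U x * U x - 6 * U x + 1) * (U x * (U x - 1) * l e x) * lb d x * l a x * lb b x
           + (2 * U x - 1) * U x * (U x - 1) * (he e d x * l a x * lb b x + lb d x * V a e * lb b x + lb d x * l a x * he e b x))
        + ((2 * U x - 1) * (U x * (U x - 1) * l e x) * (he a d x * lb b x + l a x * Vb b d)
           + U x * (U x - 1) * (D a d e * lb b x + he a d x * he e b x + V a e * Vb b d + l a x * Db e b d))"
    unfolding Y_def[abs_def]
    using dall[OF x] by (simp add: wirt_add wirt_diff wirt_mult wirt_l[OF x] wVb D_def[symmetric] Db_def[symmetric] V_def[symmetric] Vb_def[symmetric] DD_def[symmetric])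
      (simp add: algebra_simps)
  have first: "wirt e (wirt_bar d (\<lambda>z. G z $ a $ b)) x = wirt e (Y a b d) x"
    by (rule wirt_cong[OF open_Mw x]) (rule wbG)
  define \<gamma> where "\<gamma> k = (\<Sum>r\<in>UNIV. hi (base_pt x) $ k $ r * D a (Some r) e)" for k
  define gl where "gl = (\<Sum>k\<in>UNIV. \<gamma> k * l (Some k) x)"
  \<comment> \<open>The coefficient of \<open>\<Gamma>\<close> along \<open>w \<partial>/\<partial>w\<close>.\<close>
  define Q where "Q = V a e + l a x * l e x - gl"
  have \<gamma>h: "(\<Sum>k\<in>UNIV. \<gamma> k * he (Some k) s x) = D a s e" for s
  proof (cases s)
    case None
    then show ?thesis by (simp add: he_None D_def wirt_he[OF M]) (cases a; simp)
  next
    case (Some q)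
    have "(\<Sum>k\<in>UNIV. \<gamma> k * he (Some k) s x) = (\<Sum>k\<in>UNIV. \<Sum>r\<in>UNIV. hi (base_pt x) $ k $ r * h (base_pt x) $ k $ q * D a (Some r) e)"
      by (simp add: Some \<gamma>_def he_def sum_distrib_left sum_distrib_right mult_ac)
    also have "\<dots> = (\<Sum>r\<in>UNIV. \<Sum>k\<in>UNIV. hi (base_pt x) $ k $ r * h (base_pt x) $ k $ q * D a (Some r) e)" by (rule sum.swap)
    also have "\<dots> = D a (Some q) e"
      unfolding sum_distrib_right[symmetric] dinv_right[OF h_invertible[OF z]] sum_delta_left ..
    finally show ?thesis by (simp add: Some)
  qed
  define \<Gamma> where "\<Gamma> s = (U x - 1) * ((if a = s then 1 else 0) * l e x + (if e = s then 1 else 0) * l a x) + lft s \<gamma> + (if None = s then 1 else 0) * (Q * W x)" for s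
  have \<Gamma>_sum: "(\<Sum>s\<in>UNIV. \<Gamma> s * F s) = (U x - 1) * (l e x * F a + l a x * F e) + (\<Sum>k\<in>UNIV. \<gamma> k * F (Some k)) + Q * W x * F None" for F
  proof -
    have "(\<Sum>s\<in>UNIV. \<Gamma> s * F s) = (\<Sum>s\<in>UNIV. ((U x - 1) * l e x) * ((if a = s then 1 else 0) * F s) + ((U x - 1) * l a x) * ((if e = s then 1 else 0) * F s)
        + (lft s \<gamma> * F s + (Q * W x) * ((if None = s then 1 else 0) * F s)))"
      by (intro sum.cong refl) (simp add: \<Gamma>_def algebra_simps)
    also have "\<dots> = ((U x - 1) * l e x) * F a + ((U x - 1) * l a x) * F e + ((\<Sum>s\<in>UNIV. lft s \<gamma> * F s) + (Q * W x) * F None)"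
      unfolding sum.distrib sum_distrib_left[symmetric] sum_delta_left ..
    also have "(\<Sum>s\<in>UNIV. lft s \<gamma> * F s) = (\<Sum>k\<in>UNIV. \<gamma> k * F (Some k))" by (simp add: sum_option)
    finally show ?thesis by (simp add: algebra_simps)
  qed
  have lN: "W x * l None x = 1" using lb_pow(2)[OF x] Mw_W[OF x] by simp
  have \<Gamma>X: "(\<Sum>s\<in>UNIV. \<Gamma> s * gm x $ s $ r) = X a r e" for r
  proof -
    have "(\<Sum>k\<in>UNIV. \<gamma> k * gm x $ Some k $ r) = U x * (\<Sum>k\<in>UNIV. \<gamma> k * he (Some k) r x) + U x * (U x - 1) * lb r x * gl"
      unfolding gl_def sum_distrib_left sum.distrib[symmetric] gm_l[OF x]
      by (intro sum.cong refl) (simp add: algebra_simps)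
    then have 1: "(\<Sum>k\<in>UNIV. \<gamma> k * gm x $ Some k $ r) = U x * D a r e + U x * (U x - 1) * lb r x * gl"
      unfolding \<gamma>h .
    have 2: "W x * gm x $ None $ r = U x * (U x - 1) * lb r x"
    proof -
      have "W x * gm x $ None $ r = (W x * l None x) * (U x * (U x - 1) * lb r x)"
        unfolding gm_l[OF x] by (simp add: he_None mult_ac)
      then show ?thesis unfolding lN by simp
    qed
    have "(\<Sum>s\<in>UNIV. \<Gamma> s * gm x $ s $ r) = (U x - 1) * (l e x * gm x $ a $ r + l a x * gm x $ e $ r)
        + (U x * D a r e + U x * (U x - 1) * lb r x * gl) + Q * (U x * (U x - 1) * lb r x)"
      unfolding \<Gamma>_sum 1 mult.assoc[of Q "W x"] 2 ..
    then show ?thesis unfolding gm_l[OF x] X_def Q_def by (simp add: algebra_simps)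
  qed
  have lower: "(\<Sum>r\<in>UNIV. gi x $ s $ r * X a r e) = \<Gamma> s" for s
  proof -
    have "(\<Sum>r\<in>UNIV. gi x $ s $ r * X a r e) = (\<Sum>r\<in>UNIV. \<Sum>q\<in>UNIV. gi x $ s $ r * gm x $ q $ r * \<Gamma> q)"
      by (simp add: \<Gamma>X[symmetric] sum_distrib_left mult_ac)
    also have "\<dots> = (\<Sum>q\<in>UNIV. \<Sum>r\<in>UNIV. gi x $ s $ r * gm x $ q $ r * \<Gamma> q)" by (rule sum.swap)
    also have "\<dots> = \<Gamma> s"
      unfolding sum_distrib_right[symmetric] dinv_left[OF gm_invertible[OF M]] sum_delta_left ..
    finally show ?thesis .
  qed
  define R2 where "R2 = (\<Sum>k\<in>UNIV. \<gamma> k * Db (Some k) b d)"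
  have second: "(\<Sum>s\<in>UNIV. \<Sum>r\<in>UNIV. ginv G x $ s $ r * wirt e (\<lambda>z. G z $ a $ r) x * wirt_bar d (\<lambda>z. G z $ s $ b) x)
      = (U x - 1) * (l e x * Y a b d x + l a x * Y e b d x) + (\<Sum>k\<in>UNIV. \<gamma> k * Y (Some k) b d x) + Q * W x * Y None b d x"
    unfolding ginv_G[OF M] wG wbG[OF x] sum_distrib_right[symmetric] lower \<Gamma>_sum ..
  have YS: "(\<Sum>k\<in>UNIV. \<gamma> k * Y (Some k) b d x) = U x * (U x - 1) * lb d x * D a b e + U x * R2
      + (2 * U x - 1) * U x * (U x - 1) * lb d x * gl * lb b x + U x * (U x - 1) * (D a d e * lb b x + gl * Vb b d)"
  proof -
    have "(\<Sum>k\<in>UNIV. \<gamma> k * Y (Some k) b d x) = U x * (U x - 1) * lb d x * (\<Sum>k\<in>UNIV. \<gamma> k * he (Some k) b x) + U x * R2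
      + (2 * U x - 1) * U x * (U x - 1) * lb d x * lb b x * gl
      + (U x * (U x - 1) * lb b x * (\<Sum>k\<in>UNIV. \<gamma> k * he (Some k) d x) + U x * (U x - 1) * Vb b d * gl)"
      unfolding R2_def gl_def sum_distrib_left sum.distrib[symmetric]
      by (intro sum.cong refl) (simp add: Y_def Vb_def Db_def algebra_simps)
    then show ?thesis unfolding \<gamma>h by (simp add: algebra_simps)
  qed
  have YN: "W x * Y None b d x = (2 * U x - 1) * U x * (U x - 1) * lb d x * lb b x + U x * (U x - 1) * Vb b d"
  proof -
    have "wirt_bar d (he None b) x = 0" by (simp add: wirt_he[OF M])
    then have "W x * Y None b d x = (W x * l None x) * ((2 * U x - 1) * U x * (U x - 1) * lb d x * lb b x + U x * (U x - 1) * Vb b d)"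
      unfolding Y_def by (simp add: he_None Vb_def algebra_simps)
    then show ?thesis unfolding lN by simp
  qed
  have "curv G x a b e d = - wirt e (Y a b d) x
      + ((U x - 1) * (l e x * Y a b d x + l a x * Y e b d x)
        + (U x * (U x - 1) * lb d x * D a b e + U x * R2 + (2 * U x - 1) * U x * (U x - 1) * lb d x * gl * lb b x + U x * (U x - 1) * (D a d e * lb b x + gl * Vb b d))
        + (V a e + l a x * l e x - gl) * ((2 * U x - 1) * U x * (U x - 1) * lb d x * lb b x + U x * (U x - 1) * Vb b d))"
    unfolding curv_def first second YS mult.assoc[of Q "W x"] YN unfolding Q_def ..
  also have "\<dots> = - (gm x $ a $ b * gm x $ e $ d + gm x $ a $ d * gm x $ e $ b)
      + U x * (- DD + R2 + he a b x * he e d x + he a d x * he e b x)"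
    unfolding wY Y_def[of _ _ _ x] Db_def[symmetric] Vb_def[symmetric] gm_l[OF x]
    by (rule curvature_identity)
  also have "- DD + R2 + he a b x * he e d x + he a d x * he e b x = S4 x a b e d"
  proof (cases "a = None \<or> b = None \<or> e = None \<or> d = None")
    case True
    have "DD = 0" unfolding DD_def wirt_wirt_bar_he[OF M] using True by (cases a; cases b; cases e; simp)
    moreover have "R2 = 0"
    proof (cases "a = None \<or> e = None")
      case True
      then have "D a (Some r) e = 0" for r unfolding D_def wirt_he[OF M] by (cases a; simp)
      then show ?thesis by (simp add: R2_def \<gamma>_def)
    next
      case False
      then have "Db (Some k) b d = 0" for k unfolding Db_def wirt_he[OF M] using True False by (cases a; cases e; cases b; cases d; simp)
      then show ?thesis by (simp add: R2_def)
    qed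
    moreover have "S4 x a b e d = 0" unfolding S4_def using True by (cases a; cases b; cases e; simp)
    moreover have "he a b x * he e d x + he a d x * he e b x = 0" using True by (auto simp: he_None)
    ultimately show ?thesis by simp
  next
    case False
    then obtain i k m q where s: "a = Some i" "b = Some k" "e = Some m" "d = Some q" by auto
    have "R2 = (\<Sum>a\<in>UNIV. \<Sum>b\<in>UNIV. hi (base_pt x) $ a $ b * wirt m (\<lambda>z. h z $ i $ b) (base_pt x) * wirt_bar q (\<lambda>z. h z $ a $ k) (base_pt x))"
      unfolding R2_def \<gamma>_def D_def Db_def wirt_he[OF M] s by (simp add: sum_distrib_right)
    moreover have "DD = wirt m (wirt_bar q (\<lambda>z. h z $ i $ k)) (base_pt x)"
      unfolding DD_def wirt_wirt_bar_he[OF M] s by simp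
    ultimately show ?thesis by (simp add: S4_def s s4_def Rh_def he_def)
  qed
  finally show ?thesis .
qed

end

section \<open>Contractions of the curvature tensor\<close>

definition sum4 :: "('m::finite \<Rightarrow> 'm \<Rightarrow> 'm \<Rightarrow> 'm \<Rightarrow> complex) \<Rightarrow> complex" where
  "sum4 f = (\<Sum>a\<in>UNIV. \<Sum>b\<in>UNIV. \<Sum>c\<in>UNIV. \<Sum>d\<in>UNIV. f a b c d)"

text \<open>Raises all four indices, in the pattern of \<open>curv_norm2\<close>.\<close>

definition raise :: "complex^('m::finite)^'m \<Rightarrow> ('m \<Rightarrow> 'm \<Rightarrow> 'm \<Rightarrow> 'm \<Rightarrow> complex) \<Rightarrow> 'm \<Rightarrow> 'm \<Rightarrow> 'm \<Rightarrow> 'm \<Rightarrow> complex" where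
  "raise A B a b c d = sum4 (\<lambda>z v y w. A $ a $ z * A $ v $ b * A $ c $ y * A $ w $ d * B z v y w)"

lemma sum4_add: "sum4 (\<lambda>a b c d. f a b c d + g a b c d) = sum4 f + sum4 g"
  by (simp add: sum4_def sum.distrib)

lemma sum4_cmult: "sum4 (\<lambda>a b c d. k * f a b c d) = k * sum4 f"
  by (simp add: sum4_def sum_distrib_left)

lemma sum4_swap: "sum4 (\<lambda>a b c d. f a d c b) = sum4 f"
  unfolding sum4_def by (rule sum.cong[OF refl]) (rule sum_swap_outer)

lemma sum4_prod: "sum4 (\<lambda>a b c d. f a b * g c d) = (\<Sum>a\<in>UNIV. \<Sum>b\<in>UNIV. f a b) * (\<Sum>c\<in>UNIV. \<Sum>d\<in>UNIV. g c d)"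
  unfolding sum4_def sum_distrib_left[symmetric] sum_distrib_right[symmetric] ..

lemma sum4_tuple: "sum4 f = (\<Sum>p\<in>UNIV. f (fst p) (fst (snd p)) (fst (snd (snd p))) (snd (snd (snd p))))"
  unfolding sum4_def by (simp add: sum.cartesian_product split_def)

lemma sum4_exchange: "sum4 (\<lambda>a b c d. sum4 (F a b c d)) = sum4 (\<lambda>z v y w. sum4 (\<lambda>a b c d. F a b c d z v y w))"
  unfolding sum4_tuple by (rule sum.swap)

lemma raise_add: "raise A (\<lambda>a b c d. f a b c d + g a b c d) a b c d = raise A f a b c d + raise A g a b c d"
  by (simp add: raise_def distrib_left sum4_add)

lemma raise_cmult: "raise A (\<lambda>a b c d. k * f a b c d) a b c d = k * raise A f a b c d"
  unfolding raise_def sum4_cmult[symmetric] by (simp add: mult_ac)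

lemma raise_swap: "raise A (\<lambda>a b c d. f a d c b) a b c d = raise A f a d c b"
  unfolding raise_def by (subst sum4_swap[symmetric]) (simp add: mult_ac)

lemma raise_metric2:
  assumes "invertible A"
  shows "(\<Sum>z\<in>UNIV. \<Sum>v\<in>UNIV. dinv A $ a $ z * dinv A $ v $ b * A $ v $ z) = dinv A $ a $ b"
proof -
  have "(\<Sum>z\<in>UNIV. \<Sum>v\<in>UNIV. dinv A $ a $ z * dinv A $ v $ b * A $ v $ z)
     = (\<Sum>v\<in>UNIV. \<Sum>z\<in>UNIV. dinv A $ a $ z * dinv A $ v $ b * A $ v $ z)" by (rule sum.swap)
  also have "\<dots> = (\<Sum>v\<in>UNIV. (\<Sum>z\<in>UNIV. dinv A $ a $ z * A $ v $ z) * dinv A $ v $ b)"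
    by (simp add: sum_distrib_left sum_distrib_right mult_ac)
  also have "\<dots> = dinv A $ a $ b" unfolding dinv_left[OF assms] sum_delta_left ..
  finally show ?thesis .
qed

lemma raise_metric:
  assumes A: "invertible A"
  shows "raise (dinv A) (\<lambda>z v y w. A $ v $ z * A $ w $ y) a b c d = dinv A $ a $ b * dinv A $ c $ d"
proof -
  have "raise (dinv A) (\<lambda>z v y w. A $ v $ z * A $ w $ y) a b c d
      = sum4 (\<lambda>z v y w. (dinv A $ a $ z * dinv A $ v $ b * A $ v $ z) * (dinv A $ c $ y * dinv A $ w $ d * A $ w $ y))"
    unfolding raise_def by (simp add: mult_ac)
  then show ?thesis unfolding sum4_prod raise_metric2[OF A] .
qed

text \<open>Contracting raised indices with the metric lowers them in pairs.\<close>

lemma sum4_metric_raise: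
  assumes A: "invertible A"
  shows "sum4 (\<lambda>a b c d. (A $ a $ b * A $ c $ d) * raise (dinv A) B a b c d)
    = sum4 (\<lambda>z v y w. dinv A $ v $ z * dinv A $ w $ y * B z v y w)"
proof -
  have low: "(\<Sum>a\<in>UNIV. \<Sum>b\<in>UNIV. dinv A $ v $ b * dinv A $ a $ z * A $ a $ b) = dinv A $ v $ z" for v z
    using raise_metric2[OF A, of v z] by (subst sum.swap)
  have "sum4 (\<lambda>a b c d. (A $ a $ b * A $ c $ d) * raise (dinv A) B a b c d)
      = sum4 (\<lambda>a b c d. sum4 (\<lambda>z v y w. B z v y w * ((dinv A $ v $ b * dinv A $ a $ z * A $ a $ b) * (dinv A $ w $ d * dinv A $ c $ y * A $ c $ d))))"
    unfolding raise_def sum4_cmult[symmetric] by (simp add: mult_ac)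
  also have "\<dots> = sum4 (\<lambda>z v y w. B z v y w * (dinv A $ v $ z * dinv A $ w $ y))"
    by (subst sum4_exchange) (simp add: sum4_cmult sum4_prod low)
  finally show ?thesis by (simp add: mult_ac)
qed

lemma sum4_metric_inverse:
  fixes A :: "complex^'m^'m"
  assumes A: "invertible A"
  shows "sum4 (\<lambda>a b c d. (A $ a $ b * A $ c $ d) * (dinv A $ a $ b * dinv A $ c $ d)) = (of_nat CARD('m))\<^sup>2"
    "sum4 (\<lambda>a b c d. (A $ a $ b * A $ c $ d) * (dinv A $ a $ d * dinv A $ c $ b)) = of_nat CARD('m)"
proof -
  have tr: "(\<Sum>a\<in>UNIV. \<Sum>b\<in>UNIV. dinv A $ a $ b * A $ a $ b) = of_nat CARD('m)"
    by (simp add: dinv_left[OF A])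
  have "sum4 (\<lambda>a b c d. (A $ a $ b * A $ c $ d) * (dinv A $ a $ b * dinv A $ c $ d))
      = sum4 (\<lambda>a b c d. (dinv A $ a $ b * A $ a $ b) * (dinv A $ c $ d * A $ c $ d))" by (simp add: mult_ac)
  then show "sum4 (\<lambda>a b c d. (A $ a $ b * A $ c $ d) * (dinv A $ a $ b * dinv A $ c $ d)) = (of_nat CARD('m))\<^sup>2"
    unfolding sum4_prod tr by (simp add: power2_eq_square)
  have row: "(\<Sum>d\<in>UNIV. (A $ a $ b * A $ c $ d) * (dinv A $ a $ d * dinv A $ c $ b))
      = (if a = c then 1 else 0) * (A $ a $ b * dinv A $ c $ b)" for a b c
    unfolding dinv_left[OF A, symmetric] by (simp add: sum_distrib_left mult_ac)
  have "sum4 (\<lambda>a b c d. (A $ a $ b * A $ c $ d) * (dinv A $ a $ d * dinv A $ c $ b))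
      = (\<Sum>a\<in>UNIV. \<Sum>b\<in>UNIV. dinv A $ a $ b * A $ a $ b)"
    unfolding sum4_def row sum_delta_left by (simp add: mult.commute)
  then show "sum4 (\<lambda>a b c d. (A $ a $ b * A $ c $ d) * (dinv A $ a $ d * dinv A $ c $ b)) = of_nat CARD('m)"
    unfolding tr .
qed

text \<open>The eightfold sum as a pairing of the curvature with its raised conjugate.\<close>

lemma curv_norm2_raise:
  "curv_norm2 g x = sum4 (\<lambda>a b c d. curv g x a b c d * raise (ginv g x) (\<lambda>z v y w. cnj (curv g x z v y w)) a b c d)"
  unfolding curv_norm2_def raise_def sum4_def by (simp add: sum_distrib_left mult_ac)

context base_potential
begin

lemma s4_symmetric:
  assumes z: "z \<in> \<Omega>"
  shows "s4 z i k m q = s4 z i q m k"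
proof -
  have "wirt m (wirt_bar q (\<lambda>z. h z $ i $ k)) z = wirt m (wirt_bar k (\<lambda>z. h z $ i $ q)) z"
    by (rule wirt_cong[OF open_dom z]) (rule h_derivative_symmetry(2))
  then show ?thesis unfolding s4_def Rh_def h_derivative_symmetry(2)[OF z, of q _ k] by simp
qed

lemma S4_symmetric: "x \<in> M \<Longrightarrow> S4 x a b e d = S4 x a d e b"
  using s4_symmetric[OF base_pt_M] by (cases a; cases b; cases e; cases d) (simp_all add: S4_def)

text \<open>The double trace of the curvature is the scalar curvature \<open>- n / c\<close> of the base, and the metric terms
  contribute \<open>n\<^sup>2 + n\<close>.\<close>

lemma s4_trace:
  assumes z: "z \<in> \<Omega>"
  shows "sum4 (\<lambda>i k m q. (hi z $ i $ k * hi z $ m $ q) * s4 z i k m q) = of_nat CARD('n) * \<delta>"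
proof -
  have "sum4 (\<lambda>i k m q. (hi z $ i $ k * hi z $ m $ q) * s4 z i k m q)
      = sum4 (\<lambda>i k m q. (hi z $ i $ k * hi z $ m $ q) * Rh z i k m q)
        + sum4 (\<lambda>i k m q. (h z $ i $ k * h z $ m $ q) * (hi z $ i $ k * hi z $ m $ q))
        + sum4 (\<lambda>i k m q. (h z $ i $ q * h z $ m $ k) * (hi z $ i $ k * hi z $ m $ q))"
    unfolding sum4_add[symmetric] by (simp add: s4_def algebra_simps)
  also have "sum4 (\<lambda>i k m q. (h z $ i $ q * h z $ m $ k) * (hi z $ i $ k * hi z $ m $ q)) = of_nat CARD('n)"
    unfolding sum4_metric_inverse(2)[OF h_invertible[OF z], symmetric] by (rule sum4_swap)
  also have "sum4 (\<lambda>i k m q. (hi z $ i $ k * hi z $ m $ q) * Rh z i k m q) = - of_nat CARD('n) / of_real c"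
  proof -
    have "sum4 (\<lambda>i k m q. (hi z $ i $ k * hi z $ m $ q) * Rh z i k m q)
        = (\<Sum>i\<in>UNIV. \<Sum>k\<in>UNIV. \<Sum>p\<in>UNIV. (hi z $ i $ k * hi z $ fst p $ snd p) * Rh z i k (fst p) (snd p))"
      unfolding sum4_def by (simp add: sum.cartesian_product split_def)
    also have "\<dots> = (\<Sum>p\<in>UNIV. \<Sum>k\<in>UNIV. \<Sum>i\<in>UNIV. (hi z $ i $ k * hi z $ fst p $ snd p) * Rh z i k (fst p) (snd p))"
      by (rule sum_swap_outer)
    also have "\<dots> = (\<Sum>p\<in>UNIV. \<Sum>i\<in>UNIV. \<Sum>k\<in>UNIV. (hi z $ i $ k * hi z $ fst p $ snd p) * Rh z i k (fst p) (snd p))"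
      by (intro sum.cong refl sum.swap)
    also have "\<dots> = (\<Sum>p\<in>UNIV. hi z $ fst p $ snd p * (\<Sum>i\<in>UNIV. \<Sum>k\<in>UNIV. hi z $ i $ k * Rh z i k (fst p) (snd p)))"
      by (simp add: sum_distrib_left mult_ac)
    also have "\<dots> = (\<Sum>p\<in>UNIV. (- 1 / of_real c) * (hi z $ fst p $ snd p * h z $ fst p $ snd p))"
      unfolding trace_Rh[OF z] by simp
    also have "\<dots> = (- 1 / of_real c) * (\<Sum>m\<in>UNIV. \<Sum>q\<in>UNIV. hi z $ m $ q * h z $ m $ q)"
      by (simp add: sum_distrib_left sum.cartesian_product split_def)
    finally show ?thesis unfolding trace_h[OF z] by simp
  qed
  finally show ?thesis
    unfolding sum4_metric_inverse(1)[OF h_invertible[OF z]] by (simp add: \<delta>_def power2_eq_square algebra_simps)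
qed

text \<open>The squared norm of the tensor \<open>s4\<close> with respect to \<open>h\<close>.\<close>

definition \<sigma> :: "complex^'n \<Rightarrow> complex" where
  "\<sigma> z = sum4 (\<lambda>i k m q. s4 z i k m q * raise (hi z) (\<lambda>i k m q. cnj (s4 z i k m q)) i k m q)"

lemma S4_trace:
  assumes x: "x \<in> Mw"
  shows "sum4 (\<lambda>a b e d. (gi x $ a $ b * gi x $ e $ d) * S4 x a b e d) = (u x)\<^sup>2 * (of_nat CARD('n) * \<delta>)"
proof -
  have "sum4 (\<lambda>a b e d. (gi x $ a $ b * gi x $ e $ d) * S4 x a b e d)
      = sum4 (\<lambda>i k m q. (u x)\<^sup>2 * ((hi (base_pt x) $ i $ k * hi (base_pt x) $ m $ q) * s4 (base_pt x) i k m q))"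
    unfolding sum4_def by (simp add: sum_option S4_def gi_block[OF x] power2_eq_square mult_ac)
  then show ?thesis unfolding sum4_cmult s4_trace[OF base_pt_M[OF Mw_M[OF x]]] .
qed

lemma S4_norm:
  assumes x: "x \<in> Mw"
  shows "sum4 (\<lambda>a b e d. S4 x a b e d * raise (gi x) (\<lambda>a b e d. cnj (S4 x a b e d)) a b e d) = (u x) ^ 4 * \<sigma> (base_pt x)"
proof -
  have "raise (gi x) (\<lambda>a b e d. cnj (S4 x a b e d)) (Some i) (Some k) (Some m) (Some q)
      = (u x) ^ 4 * raise (hi (base_pt x)) (\<lambda>i k m q. cnj (s4 (base_pt x) i k m q)) i k m q" for i k m q
    unfolding raise_def sum4_cmult[symmetric] unfolding sum4_def
    by (simp add: sum_option S4_def gi_block[OF x] power4_eq_xxxx mult_ac)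
  then have "sum4 (\<lambda>a b e d. S4 x a b e d * raise (gi x) (\<lambda>a b e d. cnj (S4 x a b e d)) a b e d)
    = sum4 (\<lambda>i k m q. (u x) ^ 4 * (s4 (base_pt x) i k m q * raise (hi (base_pt x)) (\<lambda>i k m q. cnj (s4 (base_pt x) i k m q)) i k m q))"
    unfolding sum4_def[where 'm = "'n option"] by (simp add: sum_option S4_def) (simp add: sum4_def mult_ac)
  then show ?thesis unfolding sum4_cmult \<sigma>_def .
qed

end

context ch_metric
begin

text \<open>Three kinds of terms: the norm of the hyperbolic part, its pairing with the part \<open>S\<close> from the base,
  which is a double trace, and the norm of \<open>S\<close>. Each pulled back tensor brings a factor \<open>u\<close> for each
  pair of contracted indices, against the factors \<open>U\<close> in front of \<open>S\<close>.\<close>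

theorem curv_norm2_G:
  assumes x: "x \<in> Mw"
  shows "curv_norm2 G x = 2 * (of_nat CARD('n) + 1) * (of_nat CARD('n) + 2)
     - 4 * of_nat CARD('n) * \<delta> * u x + (u x)\<^sup>2 * \<sigma> (base_pt x)"
proof -
  have M: "x \<in> M" by (rule Mw_M[OF x])
  note inv = gm_invertible[OF M]
  define P where "P a b e d = gm x $ a $ b * gm x $ e $ d" for a b e d
  define Q where "Q a b e d = gi x $ a $ b * gi x $ e $ d" for a b e d
  define S where "S = S4 x"
  define K where "K = raise (gi x) (\<lambda>a b e d. cnj (S a b e d))"
  have c: "curv G x a b e d = (- 1) * (P a b e d + P a d e b) + U x * S a b e d" for a b e d
    by (simp add: curv_G[OF x] P_def S_def)
  have cc: "(\<lambda>a b e d. cnj (curv G x a b e d)) = (\<lambda>a b e d. (- 1) * (gm x $ b $ a * gm x $ d $ e + gm x $ d $ a * gm x $ b $ e) + U x * cnj (S a b e d))"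
    unfolding c P_def by (simp add: gm_hermitian[OF x] U_cnj[OF M])
  have r1: "raise (gi x) (\<lambda>a b e d. gm x $ b $ a * gm x $ d $ e) a b e d = Q a b e d" for a b e d
    unfolding Q_def by (rule raise_metric[OF inv])
  have r2: "raise (gi x) (\<lambda>a b e d. gm x $ d $ a * gm x $ b $ e) a b e d = Q a d e b" for a b e d
    unfolding r1[symmetric] by (rule raise_swap)
  have rc: "raise (gi x) (\<lambda>a b e d. cnj (curv G x a b e d)) a b e d = (- 1) * (Q a b e d + Q a d e b) + U x * K a b e d" for a b e d
    unfolding cc K_def raise_add raise_cmult r1 r2 ..
  have Ss: "S a b e d = S a d e b" for a b e d unfolding S_def by (rule S4_symmetric[OF M])
  have Ks: "K a b e d = K a d e b" for a b e d
    unfolding K_def by (subst raise_swap[symmetric]) (simp add: Ss[symmetric])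
  have card: "of_nat CARD('n option) = (of_nat CARD('n) + 1 :: complex)" by simp
  have PQ: "sum4 (\<lambda>a b e d. P a b e d * Q a b e d) = (of_nat CARD('n) + 1)\<^sup>2"
    "sum4 (\<lambda>a b e d. P a b e d * Q a d e b) = of_nat CARD('n) + 1"
    unfolding P_def Q_def sum4_metric_inverse[OF inv] card by (rule refl)+
  have PQ': "sum4 (\<lambda>a b e d. P a d e b * Q a d e b) = (of_nat CARD('n) + 1)\<^sup>2"
    "sum4 (\<lambda>a b e d. P a d e b * Q a b e d) = of_nat CARD('n) + 1"
    using sum4_swap[of "\<lambda>a b e d. P a b e d * Q a b e d"] sum4_swap[of "\<lambda>a b e d. P a b e d * Q a d e b"]
    unfolding PQ by simp_all
  have SQ: "sum4 (\<lambda>a b e d. S a b e d * Q a b e d) = (u x)\<^sup>2 * (of_nat CARD('n) * \<delta>)"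
    unfolding S4_trace[OF x, symmetric] S_def Q_def by (simp add: mult.commute)
  have SQ': "sum4 (\<lambda>a b e d. S a b e d * Q a d e b) = (u x)\<^sup>2 * (of_nat CARD('n) * \<delta>)"
    unfolding SQ[symmetric] by (subst Ss) (rule sum4_swap)
  have gic: "cnj (gi x $ a $ b) = gi x $ b $ a" for a b
    by (rule dinv_hermitian[OF inv gm_hermitian[OF x]])
  have PK: "sum4 (\<lambda>a b e d. P a b e d * K a b e d) = (u x)\<^sup>2 * (of_nat CARD('n) * \<delta>)"
  proof -
    have "sum4 (\<lambda>a b e d. P a b e d * K a b e d) = sum4 (\<lambda>z v y w. gi x $ v $ z * gi x $ w $ y * cnj (S z v y w))"
      unfolding P_def K_def by (rule sum4_metric_raise[OF inv])
    also have "\<dots> = cnj (sum4 (\<lambda>a b e d. (gi x $ a $ b * gi x $ e $ d) * S4 x a b e d))"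
      by (simp add: sum4_def S_def gic)
    finally show ?thesis unfolding S4_trace[OF x] by (simp add: U_cnj[OF M] \<delta>_real)
  qed
  have PK': "sum4 (\<lambda>a b e d. P a d e b * K a b e d) = (u x)\<^sup>2 * (of_nat CARD('n) * \<delta>)"
    unfolding PK[symmetric] by (subst Ks) (rule sum4_swap)
  have SK: "sum4 (\<lambda>a b e d. S a b e d * K a b e d) = (u x) ^ 4 * \<sigma> (base_pt x)"
    unfolding S_def K_def by (rule S4_norm[OF x])
  have "curv_norm2 G x = sum4 (\<lambda>a b e d. (P a b e d * Q a b e d + P a b e d * Q a d e b + P a d e b * Q a b e d + P a d e b * Q a d e b)
      + (- U x) * (P a b e d * K a b e d + P a d e b * K a b e d + S a b e d * Q a b e d + S a b e d * Q a d e b)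
      + (U x)\<^sup>2 * (S a b e d * K a b e d))"
    unfolding curv_norm2_raise ginv_G[OF M] rc unfolding c by (simp add: power2_eq_square algebra_simps)
  also have "\<dots> = 2 * (of_nat CARD('n) + 1) * (of_nat CARD('n) + 2) - 4 * of_nat CARD('n) * \<delta> * (u x * U x) * u x
      + (u x * U x)\<^sup>2 * ((u x)\<^sup>2 * \<sigma> (base_pt x))"
    unfolding sum4_add sum4_cmult PQ PQ' PK PK' SQ SQ' SK by (simp add: power2_eq_square power4_eq_xxxx algebra_simps)
  finally show ?thesis unfolding t_U(2)[OF M] by simp
qed

theorem englis_a2_G:
  assumes x: "x \<in> Mw"
  shows "24 * englis_a2 G x = (of_nat CARD('n) + 1) * (of_nat CARD('n) + 2) * (2 - 4 * (of_nat CARD('n) + 2) + 3 * (of_nat CARD('n) + 1) * (of_nat CARD('n) + 2))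
    + (- 6 * \<delta> * of_nat CARD('n) * (of_nat CARD('n) * (of_nat CARD('n) + 3))) * u x
    + (8 * \<delta> * of_nat CARD('n) * (of_nat CARD('n) - 1) - 4 * \<delta>\<^sup>2 * of_nat CARD('n) + 3 * \<delta>\<^sup>2 * (of_nat CARD('n))\<^sup>2 + \<sigma> (base_pt x)) * (u x)\<^sup>2"
proof -
  have "24 * englis_a2 G x = 8 * laplacian G (scal G) x + (curv_norm2 G x - 4 * ric_norm2 G x + 3 * (scal G x)\<^sup>2)"
    by (simp add: englis_a2_def)
  then show ?thesis unfolding laplacian_scal_G[OF x] scal_G[OF x] ric_norm2_G[OF x] curv_norm2_G[OF x] by algebra
qed

lemma quadratic_constant_three_points:
  fixes A B D k :: complex
  assumes "\<And>s::complex. s \<in> {1/4, 1/2, 3/4} \<Longrightarrow> A + B * s + D * s\<^sup>2 = k"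
  shows "B = 0"
proof -
  have "A + B * (1/4) + D * (1/4)\<^sup>2 = k" "A + B * (1/2) + D * (1/2)\<^sup>2 = k" "A + B * (3/4) + D * (3/4)\<^sup>2 = k"
    using assms by blast+
  then show ?thesis by (simp add: power2_eq_square field_simps) algebra
qed

text \<open>Three points of one fibre determine the coefficients of the quadratic polynomial in \<open>u\<close>; its linear
  coefficient is a nonzero multiple of \<open>\<delta>\<close>.\<close>

theorem kaehler_einstein_G:
  assumes ne: "\<Omega> \<noteq> {}" and const: "englis_a2 G constant_on M"
  shows "kaehler_einstein_on G M"
proof -
  obtain z where z: "z \<in> \<Omega>" using ne by blast
  obtain k where k: "\<And>x. x \<in> M \<Longrightarrow> englis_a2 G x = k" using const by (auto simp: constant_on_def)
  have B: "- 6 * \<delta> * of_nat CARD('n) * (of_nat CARD('n) * (of_nat CARD('n) + 3)) = 0"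
  proof (rule quadratic_constant_three_points)
    fix s :: complex assume "s \<in> {1/4, 1/2, 3/4}"
    then have "s = of_real (1/4) \<or> s = of_real (1/2) \<or> s = of_real (3/4)" by auto
    moreover have "(0::real) < 1/4 \<and> (1/4::real) < 1" "(0::real) < 1/2 \<and> (1/2::real) < 1" "(0::real) < 3/4 \<and> (3/4::real) < 1"
      by auto
    ultimately have "\<exists>r::real. s = of_real r \<and> 0 < r \<and> r < 1" by blast
    then obtain r :: real where r: "s = of_real r" "0 < r" "r < 1" by blast
    \<comment> \<open>The point over \<open>z\<close> with \<open>t = 1 - r\<close>, so that \<open>u = r\<close>.\<close>
    define x where "x = (\<chi> a. case a of None \<Rightarrow> of_real (sqrt ((1 - r) * exp (- Re (\<phi> z)))) | Some i \<Rightarrow> z $ i)"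
    have b: "base_pt x = z" by (simp add: base_pt_def x_def vec_eq_iff)
    have w: "(cmod (W x))\<^sup>2 = (1 - r) * exp (- Re (\<phi> z))" using r by (simp add: W_def x_def)
    then have M: "x \<in> M" using r z b by (simp add: M_def)
    have "(cmod (W x))\<^sup>2 \<noteq> 0" unfolding w using r by simp
    then have x: "x \<in> Mw" using M by (auto simp: Mw_def)
    have e: "exp (- Re (\<phi> z)) * exp (Re (\<phi> z)) = 1" by (simp flip: exp_add)
    have "t x = of_real (1 - r)" unfolding t_real(1)[OF M] w b mult.assoc e by simp
    then have u: "u x = s" unfolding u_def r(1) by simp
    show "(of_nat CARD('n) + 1) * (of_nat CARD('n) + 2) * (2 - 4 * (of_nat CARD('n) + 2) + 3 * (of_nat CARD('n) + 1) * (of_nat CARD('n) + 2))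
    + (- 6 * \<delta> * of_nat CARD('n) * (of_nat CARD('n) * (of_nat CARD('n) + 3))) * s
    + (8 * \<delta> * of_nat CARD('n) * (of_nat CARD('n) - 1) - 4 * \<delta>\<^sup>2 * of_nat CARD('n) + 3 * \<delta>\<^sup>2 * (of_nat CARD('n))\<^sup>2 + \<sigma> z) * s\<^sup>2 = 24 * k"
      using englis_a2_G[OF x] unfolding u b k[OF M] by simp
  qed
  have "of_nat CARD('n) + 3 \<noteq> (0::complex)" by (metis of_nat_add of_nat_numeral of_nat_eq_0_iff add_eq_0_iff_both_eq_0 zero_neq_numeral)
  then have d0: "\<delta> = 0" using B by simp
  have "ric G x a b = of_real (- real (CARD('n) + 2)) * G x $ a $ b" if x: "x \<in> M" for x a b
    using ric_G[OF x, of a b] d0 G[OF x] by simp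
  then show ?thesis unfolding kaehler_einstein_on_def by blast
qed

end

section \<open>Cartan--Hartogs domains over symmetric domains\<close>

context symmetric_domain
begin

text \<open>Strict positivity and the Einstein property of the Bergman metric, rescaled by \<open>c\<close>. Adding \<open>log V\<close> changes
  only the constant in the Monge--Ampere equation.\<close>

lemma base_potential_bergman:
  assumes V: "V > 0" and c: "c > 0"
  shows "\<exists>C. base_potential \<Omega> (\<lambda>z. of_real c * (of_real (ln V) + logK z)) c C"
proof -
  obtain c0 where c0: "\<forall>z\<in>\<Omega>. det (bmat z) = c0 * K z z" using det_bmat_proportional by blast
  define \<phi> where "\<phi> z = of_real c * (of_real (ln V) + logK z)" for z
  have sm: "smooth_on \<Omega> (\<lambda>z. of_real (ln V) + logK z)"
    by (intro smooth_on_add smooth_on_const open_dom logK_smooth)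
  have s\<phi>: "smooth_on \<Omega> \<phi>" unfolding \<phi>_def[abs_def]
    by (intro smooth_on_mult smooth_on_const open_dom sm)
  have dl: "logK differentiable (at z)" if "z \<in> \<Omega>" for z using logK_smooth that smooth_on_differentiable by blast
  have dlb: "wirt_bar k logK differentiable (at z)" if "z \<in> \<Omega>" for z k
    using smooth_on_wirt(2)[OF open_dom logK_smooth] that smooth_on_differentiable by blast
  have wb: "wirt_bar k \<phi> z = of_real c * wirt_bar k logK z" if z: "z \<in> \<Omega>" for z k
    unfolding \<phi>_def[abs_def] wirt_cmult(2)[OF differentiable_add[OF differentiable_const dl[OF z]]]
      wirt_add(2)[OF differentiable_const dl[OF z]] wirt_const by simp
  have w: "wirt i (wirt_bar k \<phi>) z = of_real c * bmat z $ i $ k" if z: "z \<in> \<Omega>" for z i k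
  proof -
    have "wirt i (wirt_bar k \<phi>) z = wirt i (\<lambda>z. of_real c * wirt_bar k logK z) z"
      by (rule wirt_cong[OF open_dom z]) (rule wb)
    then show ?thesis unfolding wirt_cmult(1)[OF dlb[OF z]] by (simp add: bmat_def)
  qed
  have "base_potential \<Omega> \<phi> c (of_real c ^ CARD('n) * c0 / of_real V)"
  proof
    show "open \<Omega>" "smooth_on \<Omega> \<phi>" "c > 0" by (rule open_dom s\<phi> c)+
  next
    fix z assume z: "z \<in> \<Omega>"
    have "Ln (K z z) = of_real (ln (Re (K z z)))"
      using K_real[OF z] Ln_of_real[of "Re (K z z)"] by simp
    then show "cnj (\<phi> z) = \<phi> z" by (simp add: \<phi>_def)
    have "levi \<phi> z v = of_real c * levi logK z v" for v
      by (simp add: levi_def w[OF z] bmat_def sum_distrib_left mult_ac)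
    then show "Re (levi \<phi> z v) > 0" if "v \<noteq> 0" for v
      using logK_positive[OF z that] c by simp
    have "K z z \<noteq> 0" using K_real[OF z] by auto
    then have e: "exp (\<phi> z / of_real c) = of_real V * K z z"
      using c V by (simp add: \<phi>_def exp_add exp_of_real)
    have "(\<chi> i k. wirt i (wirt_bar k \<phi>) z) = (\<chi> i. of_real c *s (bmat z $ i))"
      by (simp add: vec_eq_iff w[OF z])
    then have "det (\<chi> i k. wirt i (wirt_bar k \<phi>) z) = of_real c ^ CARD('n) * det (bmat z)"
      by (simp add: det_rows_mul)
    then show "det (\<chi> i k. wirt i (wirt_bar k \<phi>) z) = of_real c ^ CARD('n) * c0 / of_real V * exp (\<phi> z / of_real c)"
      using c0 z V unfolding e by simp
  qed
  then show ?thesis unfolding \<phi>_def[abs_def] by blast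
qed

end

lemma genus_pos: "genus \<Omega> > 0"
  by (simp add: genus_def Let_def)

lemma generic_norm_powr:
  assumes "V = measure lebesgue \<Omega>" "V > 0" "Re (bergman_kernel \<Omega> z z) > 0"
  shows "generic_norm \<Omega> z powr \<mu> = exp (- (\<mu> / real (genus \<Omega>) * (ln V + ln (Re (bergman_kernel \<Omega> z z)))))"
  using assms by (simp add: generic_norm_def powr_powr powr_def ln_mult)

text \<open>It remains to identify the given domain and metric with \<open>M\<close> and \<open>gm\<close> for the potential
  \<open>\<phi> = c log (V K)\<close> of the base.\<close>

theorem theorem2:
  fixes \<Omega> :: "(complex^'n) set" and \<mu> :: real
  assumes "irreducible_bounded_symmetric_domain \<Omega>"
    and "\<mu> > 0"
    and "englis_a2 (cartan_hartogs_metric \<Omega> \<mu>) constant_on cartan_hartogs_domain \<Omega> \<mu>"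
  shows "kaehler_einstein_on (cartan_hartogs_metric \<Omega> \<mu>) (cartan_hartogs_domain \<Omega> \<mu>)"
proof -
  have bd: "bounded_domain \<Omega>" and sym: "\<forall>p\<in>\<Omega>. \<exists>s. biholomorphism \<Omega> \<Omega> s s \<and> s p = p \<and>
        (\<exists>e>0. \<forall>z\<in>\<Omega> \<inter> ball p e. s z = z \<longrightarrow> z = p)"
    using assms(1) unfolding irreducible_bounded_symmetric_domain_def bounded_symmetric_domain_def by (rule conjunct1[THEN conjunct1], rule conjunct1[THEN conjunct2])
  have dom: "open \<Omega>" "connected \<Omega>" "\<Omega> \<noteq> {}" "bounded \<Omega>" using bd unfolding bounded_domain_def by auto
  interpret symmetric_domain \<Omega>
    by unfold_locales (use dom sym in auto)
  define V where "V = measure lebesgue \<Omega>"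
  have "\<not> negligible \<Omega>" using open_not_negligible dom by blast
  then have "V \<noteq> 0" using negligible_iff_measure[of \<Omega>] lmeasurable_open[OF dom(4,1)] by (auto simp: V_def)
  then have V: "V > 0" by (simp add: V_def zero_less_measure_iff)
  define c where "c = \<mu> / real (genus \<Omega>)"
  have c: "c > 0" using assms(2) genus_pos[of \<Omega>] by (simp add: c_def)
  define \<phi> where "\<phi> z = of_real c * (of_real (ln V) + logK z)" for z
  obtain C where "base_potential \<Omega> \<phi> c C"
    using base_potential_bergman[OF V c] unfolding \<phi>_def[abs_def] by blast
  then interpret B: base_potential \<Omega> \<phi> c C .
  have N: "generic_norm \<Omega> z powr \<mu> = exp (- Re (\<phi> z))" if z: "z \<in> \<Omega>" for z
  proof -
    have "Ln (K z z) = of_real (ln (Re (K z z)))" using K_real[OF z] Ln_of_real[of "Re (K z z)"] by simp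
    then have "Re (\<phi> z) = c * (ln V + ln (Re (K z z)))" by (simp add: \<phi>_def)
    then show ?thesis using generic_norm_powr[OF V_def V] K_real[OF z] by (simp add: c_def)
  qed
  have M: "cartan_hartogs_domain \<Omega> \<mu> = B.M"
    unfolding cartan_hartogs_domain_def B.M_def B.W_def using N by auto
  have pot: "complex_of_real (- ln (generic_norm \<Omega> (base_pt y) powr \<mu> - (cmod (y $ None))\<^sup>2)) = B.\<Phi> y" if y: "y \<in> B.M" for y
  proof -
    define f where "f = Re (\<phi> (base_pt y))"
    define r where "r = 1 - (cmod (y $ None))\<^sup>2 * exp f"
    have f: "\<phi> (base_pt y) = of_real f" unfolding f_def by (rule B.\<phi>_of_real[OF B.base_pt_M[OF y]])
    have u: "B.u y = of_real r" unfolding B.u_def B.t_real(1)[OF y] r_def f_def B.W_def by simp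
    have r: "r > 0" using B.u_real[OF y] u by simp
    have "exp (- f) - (cmod (y $ None))\<^sup>2 = exp (- f) * r"
      by (simp add: r_def algebra_simps flip: exp_add)
    then have "- ln (exp (- f) - (cmod (y $ None))\<^sup>2) = f - ln r" using r by (simp add: ln_mult)
    moreover have "Ln (B.u y) = of_real (ln r)" unfolding u by (rule Ln_of_real[OF r])
    ultimately show ?thesis unfolding N[OF B.base_pt_M[OF y]] f_def[symmetric] B.\<Phi>_def f by simp
  qed
  have G: "cartan_hartogs_metric \<Omega> \<mu> x = B.gm x" if x: "x \<in> B.M" for x
  proof -
    have "wirt a (wirt_bar b (\<lambda>x. complex_of_real (- ln (generic_norm \<Omega> (base_pt x) powr \<mu> - (cmod (x $ None))\<^sup>2)))) x
        = wirt a (wirt_bar b B.\<Phi>) x" for a b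
      by (rule wirt_cong[OF B.open_M x]) (rule wirt_cong[OF B.open_M], assumption, rule pot)
    then show ?thesis
      unfolding cartan_hartogs_metric_def metric_of_potential_def B.metric_formula[OF x] by (simp add: vec_eq_iff)
  qed
  interpret H: ch_metric \<Omega> \<phi> c C "cartan_hartogs_metric \<Omega> \<mu>"
    by unfold_locales (rule G)
  show ?thesis using H.kaehler_einstein_G[OF dom(3)] assms(3) unfolding M by blast
qed

end
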